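(* Let $\Pi_{3,2}\cong\mathbb{C}^{10}$ be the space of all homogeneous polynomials $\mathbb{C}^3\to\mathbb{C}$ of degree $3$, let $\Sigma_{3,2}\subset\Pi_{3,2}$ be the set of such polynomials having a singular point outside the origin, and let $N_{3,2}\subset\mathbb{CP}^{9}$ be the projectivization of $\Pi_{3,2}\setminus\Sigma_{3,2}$ (the space of nonsingular plane cubic curves in $\mathbb{CP}^2$). Then the only nontrivial groups $H^i(\Pi_{3,2}\setminus\Sigma_{3,2},\mathbb{R})$ are $H^0\cong H^1\cong H^3\cong H^4\cong H^5\cong H^6\cong H^8\cong H^9\cong\mathbb{R}$. In particular, the only nontrivial groups $H^i(N_{3,2},\mathbb{R})$ are $H^0\cong H^3\cong H^5\cong H^8\cong\mathbb{R}$.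
   Context: A point $x\ne 0$ is a singular point of a homogeneous polynomial $f$ if all partial derivatives of $f$ vanish at $x$. *)

theory Defs
  imports "HOL-Analysis.Analysis" "HOL-Homology.Homology"
begin

text \<open>Monomials x^a y^b z^c of degree 3 are indexed by exponent triples (a,b,c).
  A polynomial in Pi_{3,2} is its coefficient function, vanishing off these 10 triples.
  The space carries the product (= Euclidean) topology, i.e. it is C^10.\<close>

definition cubic_monomials :: "(nat \<times> nat \<times> nat) set" where
  "cubic_monomials = {(a,b,c). a + b + c = 3}"

definition Pi32 :: "(nat \<times> nat \<times> nat \<Rightarrow> complex) set" where
  "Pi32 = {f. \<forall>m. m \<notin> cubic_monomials \<longrightarrow> f m = 0}"

definition eval_cubic :: "(nat \<times> nat \<times> nat \<Rightarrow> complex) \<Rightarrow> complex \<Rightarrow> complex \<Rightarrow> complex \<Rightarrow> complex" where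
  "eval_cubic f x y z = (\<Sum>(a,b,c)\<in>cubic_monomials. f (a,b,c) * x ^ a * y ^ b * z ^ c)"

definition dx_cubic :: "(nat \<times> nat \<times> nat \<Rightarrow> complex) \<Rightarrow> complex \<Rightarrow> complex \<Rightarrow> complex \<Rightarrow> complex" where
  "dx_cubic f x y z = (\<Sum>(a,b,c)\<in>cubic_monomials. f (a,b,c) * of_nat a * x ^ (a - 1) * y ^ b * z ^ c)"
definition dy_cubic :: "(nat \<times> nat \<times> nat \<Rightarrow> complex) \<Rightarrow> complex \<Rightarrow> complex \<Rightarrow> complex \<Rightarrow> complex" where
  "dy_cubic f x y z = (\<Sum>(a,b,c)\<in>cubic_monomials. f (a,b,c) * x ^ a * of_nat b * y ^ (b - 1) * z ^ c)"
definition dz_cubic :: "(nat \<times> nat \<times> nat \<Rightarrow> complex) \<Rightarrow> complex \<Rightarrow> complex \<Rightarrow> complex \<Rightarrow> complex" where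
  "dz_cubic f x y z = (\<Sum>(a,b,c)\<in>cubic_monomials. f (a,b,c) * x ^ a * y ^ b * of_nat c * z ^ (c - 1))"

definition Sigma32 :: "(nat \<times> nat \<times> nat \<Rightarrow> complex) set" where
  "Sigma32 = {f \<in> Pi32. \<exists>x y z. (x, y, z) \<noteq> (0, 0, 0) \<and>
      dx_cubic f x y z = 0 \<and> dy_cubic f x y z = 0 \<and> dz_cubic f x y z = 0}"

definition U32 :: "(nat \<times> nat \<times> nat \<Rightarrow> complex) topology" where
  "U32 = top_of_set (Pi32 - Sigma32)"

definition quotient_topology :: "'a topology \<Rightarrow> ('a \<Rightarrow> 'b) \<Rightarrow> 'b topology" where
  "quotient_topology X q = topology (\<lambda>V. V \<subseteq> q ` topspace X \<and> openin X {x \<in> topspace X. q x \<in> V})"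

definition proj_class :: "(nat \<times> nat \<times> nat \<Rightarrow> complex) \<Rightarrow> (nat \<times> nat \<times> nat \<Rightarrow> complex) set" where
  "proj_class f = {(\<lambda>m. l * f m) | l. l \<noteq> 0}"

definition N32 :: "(nat \<times> nat \<times> nat \<Rightarrow> complex) set topology" where
  "N32 = quotient_topology U32 proj_class"

text \<open>Real p-cochains: real-valued functions on singular p-simplices (values elsewhere ignored).\<close>
definition coboundary_val :: "nat \<Rightarrow> (((nat \<Rightarrow> real) \<Rightarrow> 'a) \<Rightarrow> real) \<Rightarrow> ((nat \<Rightarrow> real) \<Rightarrow> 'a) \<Rightarrow> real" where
  "coboundary_val p c \<sigma> = (\<Sum>k\<le>p. (-1) ^ k * c (singular_face p k \<sigma>))"

definition real_cocycle :: "nat \<Rightarrow> 'a topology \<Rightarrow> (((nat \<Rightarrow> real) \<Rightarrow> 'a) \<Rightarrow> real) \<Rightarrow> bool" where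
  "real_cocycle p X c \<longleftrightarrow> (\<forall>\<sigma>. singular_simplex (Suc p) X \<sigma> \<longrightarrow> coboundary_val (Suc p) c \<sigma> = 0)"

definition real_coboundary :: "nat \<Rightarrow> 'a topology \<Rightarrow> (((nat \<Rightarrow> real) \<Rightarrow> 'a) \<Rightarrow> real) \<Rightarrow> bool" where
  "real_coboundary p X c \<longleftrightarrow>
     (if p = 0 then (\<forall>\<sigma>. singular_simplex 0 X \<sigma> \<longrightarrow> c \<sigma> = 0)
      else (\<exists>b. \<forall>\<sigma>. singular_simplex p X \<sigma> \<longrightarrow> c \<sigma> = coboundary_val p b \<sigma>))"

definition cohom_trivial :: "nat \<Rightarrow> 'a topology \<Rightarrow> bool" where
  "cohom_trivial p X \<longleftrightarrow> (\<forall>c. real_cocycle p X c \<longrightarrow> real_coboundary p X c)"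

definition cohom_is_R :: "nat \<Rightarrow> 'a topology \<Rightarrow> bool" where
  "cohom_is_R p X \<longleftrightarrow> (\<exists>z. real_cocycle p X z \<and> \<not> real_coboundary p X z \<and>
       (\<forall>c. real_cocycle p X c \<longrightarrow> (\<exists>a::real. real_coboundary p X (\<lambda>\<sigma>. c \<sigma> - a * z \<sigma>))))"

end

theory Submission
  imports Defs "HOL-Computational_Algebra.Fundamental_Theorem_Algebra"
begin

text \<open>
  The group \<open>G = GL\<^sub>3\<close> acts on the nonsingular cubics, and \<open>G = SL\<^sub>3\<close> on the nonsingular plane cubic
  curves; in both cases the orbit map is an isomorphism in rational homology. Indeed, every nonsingular
  cubic is equivalent to a Weierstrass cubic \<open>y\<^sup>2 z - x\<^sup>3 - 3 a x z\<^sup>2 - 2 b z\<^sup>3\<close>, where \<open>(a, b)\<close> is unique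
  up to \<open>(a \<alpha> / \<beta>^4, b / \<beta>^6)\<close> with \<open>\<alpha>^3 = 1\<close>, and all equivalences between Weierstrass cubics are
  compositions of such diagonal ones with involutions exchanging two of the nine flexes. Over each of the
  regions \<open>Re j < 2/3\<close>, \<open>Re j > 1/3\<close> and their intersection, where \<open>j = a\<^sup>3 / (a\<^sup>3 + b\<^sup>2)\<close>, the parameters
  can be taken from a contractible slice \<open>S\<close>, and \<open>G \<times> S\<close> is a finite covering of the region. As \<open>G\<close> is
  connected, all lifts of an orbit map are homotopic, so that by the transfer the orbit map is a rational
  isomorphism onto the region; excision glues the two regions.

  The rational homology of \<open>SL\<^sub>3\<close> is that of the space of 2-frames in \<open>C\<^sup>3\<close>, which is computed by
  trivialising it on the complement of a ray of first vectors and on a neighbourhood of the ray.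
  Everything is done with integral homology modulo torsion, and real cohomology is obtained by evaluating
  cochains on cycles.
\<close>

section \<open>Real cohomology from integral homology\<close>

text \<open>The obstacle is that a curve with \<open>j = 0\<close> or \<open>j = 1\<close> has more
  automorphisms than its neighbours, so the orbits of the group are not all of one type. The slices
  repair this. Near \<open>j = 0\<close> the parameter is not \<open>j\<close> but \<open>a\<close>,
  with \<open>b = 1\<close>, and a fixed finite set of diagonal equivalences rotates it; at
  \<open>a = 0\<close> the rotations become automorphisms, but their number does not change. Near
  \<open>j = 1\<close> the roles of \<open>a\<close> and \<open>b\<close> are exchanged. Hence the
  number of sheets is constant on each region: nine, one for each flex, times the number of diagonal
  equivalences with admissible scalars. The bounds 2/3 and 1/3 are exchanged by \<open>j\<close> to
  \<open>1 - j\<close>. Each half-plane becomes the disc with centre 1/2 and radius 3/2 in the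
  variable \<open>a^3 / b^2\<close> or \<open>b^2 / a^3\<close>; it contains 0 and has the singular
  value -1 on its boundary, so the slices are starlike about 0. The orbit map over the strip is
  taken at \<open>a = b = 1\<close> and slides inside the slice \<open>a = 1\<close> to the one at
  \<open>b = 0\<close>.\<close>

definition cochain_eval :: "('s \<Rightarrow> real) \<Rightarrow> ('s \<Rightarrow>\<^sub>0 int) \<Rightarrow> real" where
  "cochain_eval c z = (\<Sum>s\<in>Poly_Mapping.keys z. of_int (poly_mapping.lookup z s) * c s)"

lemma cochain_eval_superset:
  assumes "finite S" "Poly_Mapping.keys z \<subseteq> S"
  shows "cochain_eval c z = (\<Sum>s\<in>S. of_int (poly_mapping.lookup z s) * c s)"
  unfolding cochain_eval_def
  by (rule sum.mono_neutral_left) (use assms in \<open>auto simp: in_keys_iff\<close>)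

lemma cochain_eval_0 [simp]: "cochain_eval c 0 = 0"
  by (simp add: cochain_eval_def)

lemma cochain_eval_of [simp]: "cochain_eval c (frag_of s) = c s"
  by (simp add: cochain_eval_def)

lemma cochain_eval_add: "cochain_eval c (x + y) = cochain_eval c x + cochain_eval c y"
proof -
  let ?S = "Poly_Mapping.keys x \<union> Poly_Mapping.keys y"
  have "Poly_Mapping.keys (x + y) \<subseteq> ?S" by (rule keys_add)
  then show ?thesis
    using cochain_eval_superset[of ?S x c] cochain_eval_superset[of ?S y c]
      cochain_eval_superset[of ?S "x+y" c]
    by (simp add: lookup_add distrib_right sum.distrib)
qed

lemma cochain_eval_cmul [simp]: "cochain_eval c (frag_cmul k x) = of_int k * cochain_eval c x"
proof -
  have "Poly_Mapping.keys (frag_cmul k x) \<subseteq> Poly_Mapping.keys x" by (rule keys_cmul)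
  then show ?thesis
    using cochain_eval_superset[of "Poly_Mapping.keys x" "frag_cmul k x" c]
    by (simp add: cochain_eval_def sum_distrib_left mult.assoc)
qed

lemma cochain_eval_minus: "cochain_eval c (- x) = - cochain_eval c x"
  using cochain_eval_cmul[of c "-1" x] by simp

lemma cochain_eval_diff: "cochain_eval c (x - y) = cochain_eval c x - cochain_eval c y"
  using cochain_eval_add[of c x "-y"] by (simp add: cochain_eval_minus)

lemma cochain_eval_sum: "cochain_eval c (sum f I) = (\<Sum>i\<in>I. cochain_eval c (f i))"
  by (induction I rule: infinite_finite_induct) (auto simp: cochain_eval_add)

lemma cochain_eval_linear: "cochain_eval (\<lambda>s. c s - a * d s) z = cochain_eval c z - a * cochain_eval d z"
  by (simp add: cochain_eval_def algebra_simps sum_subtractf sum_distrib_left)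

lemma coboundary_val_eval:
  "p > 0 \<Longrightarrow> coboundary_val p c s = cochain_eval c (chain_boundary p (frag_of s))"
  by (simp add: coboundary_val_def chain_boundary_of cochain_eval_sum)

lemma cochain_eval_boundary:
  assumes "p > 0"
  shows "cochain_eval c (chain_boundary p z) = cochain_eval (coboundary_val p c) z"
proof -
  have "Poly_Mapping.keys z \<subseteq> UNIV" by simp
  then show ?thesis
  proof (induction z rule: frag_induction)
    case (one x) then show ?case using assms by (simp add: coboundary_val_eval)
  next
    case (diff a b) then show ?case by (simp add: chain_boundary_diff cochain_eval_diff)
  qed simp
qed

lemma cochain_eval_eq_on:
  assumes "singular_chain p X z" "\<And>s. singular_simplex p X s \<Longrightarrow> c s = d s"
  shows "cochain_eval c z = cochain_eval d z"
  using assms unfolding cochain_eval_def singular_chain_def by (intro sum.cong) auto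

section \<open>Rational chains and the extension of real functionals\<close>

definition rat_scale :: "rat \<Rightarrow> ('s \<Rightarrow>\<^sub>0 rat) \<Rightarrow> ('s \<Rightarrow>\<^sub>0 rat)" where
  "rat_scale q v = Poly_Mapping.map ((*) q) v"

definition rat_chain :: "('s \<Rightarrow>\<^sub>0 int) \<Rightarrow> ('s \<Rightarrow>\<^sub>0 rat)" where
  "rat_chain v = Poly_Mapping.map of_int v"

lemma lookup_rat_scale [simp]: "poly_mapping.lookup (rat_scale q v) s = q * poly_mapping.lookup v s"
  by (simp add: rat_scale_def Poly_Mapping.map.rep_eq when_def)

lemma lookup_rat_chain [simp]: "poly_mapping.lookup (rat_chain v) s = of_int (poly_mapping.lookup v s)"
  by (simp add: rat_chain_def Poly_Mapping.map.rep_eq when_def)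

lemma rat_chain_add: "rat_chain (x + y) = rat_chain x + rat_chain y"
  by (rule poly_mapping_eqI) (simp add: lookup_add)

lemma rat_chain_diff: "rat_chain (x - y) = rat_chain x - rat_chain y"
  by (rule poly_mapping_eqI) (simp add: lookup_minus)

lemma rat_chain_cmul: "rat_chain (frag_cmul k x) = rat_scale (of_int k) (rat_chain x)"
  by (rule poly_mapping_eqI) simp

lemma rat_chain_inj: "rat_chain x = rat_chain y \<Longrightarrow> x = y"
  by (metis lookup_rat_chain of_int_eq_iff poly_mapping_eqI)

interpretation rat_chains: vector_space "rat_scale :: rat \<Rightarrow> ('s \<Rightarrow>\<^sub>0 rat) \<Rightarrow> _"
  by standard (auto intro!: poly_mapping_eqI simp: lookup_add algebra_simps)

text \<open>The real line is regarded as a rational vector space, so that values prescribed on a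
  rational basis of chains extend to all chains.\<close>

interpretation rat_functionals: vector_space_pair "rat_scale :: rat \<Rightarrow> ('s \<Rightarrow>\<^sub>0 rat) \<Rightarrow> _"
    "\<lambda>q (x::real). of_rat q * x"
  by standard (auto simp: algebra_simps of_rat_add of_rat_mult)

text \<open>The rationalization of \<open>d ` M\<close> is a rational vector space, and \<open>f\<close> descends to it; real
  functionals extend from subspaces of rational vector spaces.\<close>

lemma additive_functional_extends:
  fixes M :: "('x \<Rightarrow>\<^sub>0 int) set" and d :: "('x \<Rightarrow>\<^sub>0 int) \<Rightarrow> ('s \<Rightarrow>\<^sub>0 int)"
    and f :: "('x \<Rightarrow>\<^sub>0 int) \<Rightarrow> real"
  assumes M0: "0 \<in> M" and Madd: "\<And>x y. x \<in> M \<Longrightarrow> y \<in> M \<Longrightarrow> x + y \<in> M"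
    and Mcmul: "\<And>x k. x \<in> M \<Longrightarrow> frag_cmul k x \<in> M"
    and dadd: "\<And>x y. x \<in> M \<Longrightarrow> y \<in> M \<Longrightarrow> d (x + y) = d x + d y"
    and dcmul: "\<And>x k. x \<in> M \<Longrightarrow> d (frag_cmul k x) = frag_cmul k (d x)"
    and fadd: "\<And>x y. x \<in> M \<Longrightarrow> y \<in> M \<Longrightarrow> f (x + y) = f x + f y"
    and fcmul: "\<And>x k. x \<in> M \<Longrightarrow> f (frag_cmul k x) = of_int k * f x"
    and ker: "\<And>x. x \<in> M \<Longrightarrow> d x = 0 \<Longrightarrow> f x = 0"
  obtains b where "\<And>x. x \<in> M \<Longrightarrow> f x = cochain_eval b (d x)"
proof -
  have feq: "f x = f y" if "x \<in> M" "y \<in> M" "d x = d y" for x y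
  proof -
    have "d (x + frag_cmul (-1) y) = d x + frag_cmul (-1) (d y)" "x + frag_cmul (-1) y \<in> M"
      using that by (simp_all add: dadd dcmul Mcmul Madd del: frag_cmul_minus_one)
    then have "d (x + frag_cmul (-1) y) = 0" "x + frag_cmul (-1) y \<in> M" using that by simp_all
    then have "f (x + frag_cmul (-1) y) = 0" using ker by blast
    then show ?thesis using that by (simp add: fadd fcmul Mcmul del: frag_cmul_minus_one)
  qed
  let ?T = "(\<lambda>x. rat_chain (d x)) ` M"
  \<comment> \<open>The basis is taken inside the image of \<open>d\<close>, where \<open>f\<close>
    prescribes the values of \<open>g\<close>.\<close>
  obtain B where B: "B \<subseteq> ?T" "rat_chains.independent B" "?T \<subseteq> rat_chains.span B"
    using rat_chains.maximal_independent_subset[of ?T] by blast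
  define f' where "f' t = f (SOME x. x \<in> M \<and> rat_chain (d x) = t)" for t
  have f': "f' (rat_chain (d x)) = f x" if "x \<in> M" for x
  proof -
    have "(SOME y. y \<in> M \<and> rat_chain (d y) = rat_chain (d x)) \<in> M \<and>
        rat_chain (d (SOME y. y \<in> M \<and> rat_chain (d y) = rat_chain (d x))) = rat_chain (d x)"
      by (rule someI[where x = x]) (use that in auto)
    then show ?thesis unfolding f'_def using feq that rat_chain_inj by blast
  qed
  obtain g where g: "Vector_Spaces.linear rat_scale (\<lambda>q (x::real). of_rat q * x) g"
      and gB: "\<And>t. t \<in> B \<Longrightarrow> g t = f' t"
    using rat_functionals.linear_independent_extend[OF B(2), of f'] by blast
  interpret g: Vector_Spaces.linear rat_scale "\<lambda>q (x::real). of_rat q * x" g by (rule g)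
  \<comment> \<open>Clearing denominators: a rational combination of images of \<open>M\<close> need
    not be an image, but a positive multiple of it is. \<open>Good\<close> collects the vectors on
    which \<open>f\<close> and \<open>g\<close> agree in this sense; it is a subspace containing
    \<open>B\<close>, so it contains the span of \<open>B\<close>.\<close>
  define Good where "Good = {v. \<exists>n x. (n::int) > 0 \<and> x \<in> M \<and> rat_scale (of_int n) v = rat_chain (d x) \<and>
      f x = of_int n * g v}"
  have "rat_chains.subspace Good"
    unfolding rat_chains.subspace_def
  proof (intro conjI ballI allI)
    have "d 0 = 0" using dcmul[OF M0, of 0] by simp
    moreover have "f 0 = 0" using fcmul[OF M0, of 0] by simp
    moreover have "rat_scale (of_int 1) 0 = rat_chain 0" by (rule poly_mapping_eqI) simp
    ultimately show "0 \<in> Good" unfolding Good_def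
      by (intro CollectI exI[of _ "1::int"] exI[of _ 0]) (simp add: M0 g.zero)
  next
    fix u v assume "u \<in> Good" "v \<in> Good"
    then obtain n x m y where u: "n > 0" "x \<in> M" "rat_scale (of_int n) u = rat_chain (d x)" "f x = of_int n * g u"
      and v: "m > 0" "y \<in> M" "rat_scale (of_int m) v = rat_chain (d y)" "f y = of_int m * g v"
      unfolding Good_def by blast
    have "rat_scale (of_int (n * m)) (u + v) = rat_scale (of_int m) (rat_scale (of_int n) u) + rat_scale (of_int n) (rat_scale (of_int m) v)"
      by (rule poly_mapping_eqI) (simp add: lookup_add algebra_simps)
    also have "\<dots> = rat_chain (d (frag_cmul m x + frag_cmul n y))"
      using u v by (simp add: dadd dcmul Mcmul rat_chain_add rat_chain_cmul)
    finally have "rat_scale (of_int (n * m)) (u + v) = rat_chain (d (frag_cmul m x + frag_cmul n y))" .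
    moreover have "f (frag_cmul m x + frag_cmul n y) = of_int (n * m) * g (u + v)"
      using u v by (simp add: fadd fcmul Mcmul g.add algebra_simps)
    moreover have "n * m > 0" "frag_cmul m x + frag_cmul n y \<in> M" using u v by (simp_all add: Madd Mcmul)
    ultimately show "u + v \<in> Good" unfolding Good_def by blast
  next
    fix q v assume "v \<in> Good"
    then obtain m y where v: "m > 0" "y \<in> M" "rat_scale (of_int m) v = rat_chain (d y)" "f y = of_int m * g v"
      unfolding Good_def by blast
    obtain a b where ab: "quotient_of q = (a, b)" by fastforce
    have q: "q = of_int a / of_int b" "b > 0"
      using quotient_of_div[OF ab] quotient_of_denom_pos[OF ab] by auto
    have bq: "of_int b * q = (of_int a :: rat)" using q by simp
    have "of_int b * (of_int m * (q * t)) = of_int a * (of_int m * (t::rat))" for t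
      by (simp flip: bq)
    then have "rat_scale (of_int (b * m)) (rat_scale q v) = rat_scale (of_int a) (rat_scale (of_int m) v)"
      by (intro poly_mapping_eqI) (simp add: mult.assoc)
    also have "\<dots> = rat_chain (d (frag_cmul a y))" using v by (simp add: dcmul rat_chain_cmul)
    finally have "rat_scale (of_int (b * m)) (rat_scale q v) = rat_chain (d (frag_cmul a y))" .
    moreover have "f (frag_cmul a y) = of_int (b * m) * g (rat_scale q v)"
    proof -
      have "of_rat q = (of_int a / of_int b :: real)" using q by (simp add: of_rat_divide)
      then show ?thesis using v(4) q(2) by (simp only: fcmul[OF v(2)] g.scale) simp
    qed
    moreover have "b * m > 0" "frag_cmul a y \<in> M" using v q by (simp_all add: Mcmul)
    ultimately show "rat_scale q v \<in> Good" unfolding Good_def by blast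
  qed
  moreover have "B \<subseteq> Good"
  proof
    fix t assume "t \<in> B"
    then obtain x where x: "x \<in> M" "t = rat_chain (d x)" using B by blast
    have "f x = of_int 1 * g t" using gB[OF \<open>t \<in> B\<close>] f'[OF x(1)] x(2) by simp
    moreover have "rat_scale (of_int 1) t = rat_chain (d x)" using x(2) by simp
    moreover have "(1::int) > 0" by simp
    ultimately show "t \<in> Good" using x(1) unfolding Good_def by blast
  qed
  ultimately have span: "rat_chains.span B \<subseteq> Good" by (rule rat_chains.span_minimal[rotated])
  have fg: "f x = g (rat_chain (d x))" if x: "x \<in> M" for x
  proof -
    have "rat_chain (d x) \<in> Good" using B(3) span x by blast
    then obtain n y where y: "n > 0" "y \<in> M" "rat_scale (of_int n) (rat_chain (d x)) = rat_chain (d y)"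
      "f y = of_int n * g (rat_chain (d x))" unfolding Good_def by blast
    then have "d (frag_cmul n x) = d y" by (metis dcmul rat_chain_cmul rat_chain_inj x)
    then have "f y = of_int n * f x" using feq[OF y(2) Mcmul[OF x, of n]] fcmul[OF x, of n] by simp
    then show ?thesis using y by simp
  qed
  have geval: "g (rat_chain w) = cochain_eval (\<lambda>s. g (rat_chain (frag_of s))) w" for w
  proof -
    have "Poly_Mapping.keys w \<subseteq> UNIV" by simp
    then show ?thesis
    proof (induction w rule: frag_induction)
      case zero
      have "rat_chain 0 = (0 :: 's \<Rightarrow>\<^sub>0 rat)" by (rule poly_mapping_eqI) simp
      then show ?case by (simp add: g.zero)
    next
      case (diff a b) then show ?case by (simp add: rat_chain_diff g.diff cochain_eval_diff)
    qed simp
  qed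
  show ?thesis by (rule that[of "\<lambda>s. g (rat_chain (frag_of s))"]) (simp add: fg flip: geval)
qed

section \<open>Groups of rational rank zero and one, and homology classes of cycles\<close>

definition torsion_group :: "('a, 'b) monoid_scheme \<Rightarrow> bool" where
  "torsion_group G \<longleftrightarrow> (\<forall>x\<in>carrier G. \<exists>n>0. x [^]\<^bsub>G\<^esub> (n::nat) = \<one>\<^bsub>G\<^esub>)"

text \<open>For an abelian group this says that its tensor product with the rationals has dimension
  one; \<open>g\<close> spans it.\<close>

definition rank_one_group :: "('a, 'b) monoid_scheme \<Rightarrow> bool" where
  "rank_one_group G \<longleftrightarrow> (\<exists>g\<in>carrier G. (\<forall>n>0. g [^]\<^bsub>G\<^esub> (n::nat) \<noteq> \<one>\<^bsub>G\<^esub>) \<and>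
     (\<forall>x\<in>carrier G. \<exists>n>0. \<exists>m::int. x [^]\<^bsub>G\<^esub> (n::nat) = g [^]\<^bsub>G\<^esub> m))"

lemma homology_class_add:
  assumes "singular_relcycle p X S a" "singular_relcycle p X S b"
  shows "homologous_rel_set p X S a \<otimes>\<^bsub>relative_homology_group (int p) X S\<^esub> homologous_rel_set p X S b
    = homologous_rel_set p X S (a + b)"
proof -
  \<comment> \<open>The group operation is addition of cosets; \<open>c\<close> is split as
    \<open>a\<close> plus \<open>c - a\<close>.\<close>
  have "homologous_rel p X S (a + b) c \<Longrightarrow> \<exists>r. homologous_rel p X S a r \<and> (\<exists>s. homologous_rel p X S b s \<and> c = r + s)" for c
    by (intro exI[of _ "a"] conjI homologous_rel_refl exI[of _ "c - a"])
       (auto simp: homologous_rel_def algebra_simps)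
  then show ?thesis
    by (auto simp: mult_relative_homology_group homologous_rel_add)
qed

lemma homology_class_pow:
  assumes "singular_relcycle p X S a"
  shows "homologous_rel_set p X S a [^]\<^bsub>relative_homology_group (int p) X S\<^esub> (n::nat)
    = homologous_rel_set p X S (frag_cmul (int n) a)"
proof (induction n)
  case 0
  then show ?case by (simp add: nat_pow_def homologous_rel_set_eq_relboundary[symmetric])
      (metis homologous_rel_eq_relboundary singular_relboundary_0)
next
  case (Suc n)
  have "frag_cmul (1 + int n) a = frag_cmul (int n) a + a"
    by (simp add: frag_cmul_distrib)
  then show ?case using Suc assms
    by (simp add: nat_pow_def homology_class_add singular_relcycle_cmul)
qed

lemma homology_class_int_pow:
  assumes "singular_relcycle p X S a"
  shows "homologous_rel_set p X S a [^]\<^bsub>relative_homology_group (int p) X S\<^esub> (m::int)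
    = homologous_rel_set p X S (frag_cmul m a)"
proof -
  interpret group "relative_homology_group (int p) X S" by simp
  have c: "homologous_rel_set p X S a \<in> carrier (relative_homology_group (int p) X S)"
    using assms by (auto simp: carrier_relative_homology_group)
  show ?thesis
  proof (cases "m \<ge> 0")
    case True
    then obtain n where "m = int n" using nonneg_int_cases by blast
    then show ?thesis by (simp add: int_pow_int homology_class_pow assms)
  next
    case False
    define n where "n = nat (- m)"
    have m: "m = - int n" using False by (simp add: n_def)
    have "homologous_rel_set p X S (frag_cmul m a) \<otimes>\<^bsub>relative_homology_group (int p) X S\<^esub>
       homologous_rel_set p X S (frag_cmul (int n) a) = homologous_rel_set p X S (frag_cmul m a + frag_cmul (int n) a)"
      by (intro homology_class_add singular_relcycle_cmul assms)
    also have "frag_cmul m a + frag_cmul (int n) a = 0"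
      by (rule poly_mapping_eqI) (simp add: m lookup_add)
    also have "homologous_rel_set p X S 0 = \<one>\<^bsub>relative_homology_group (int p) X S\<^esub>"
      by (metis homologous_rel_set_eq_relboundary one_relative_homology_group singular_relboundary_0)
    finally have "inv\<^bsub>relative_homology_group (int p) X S\<^esub> (homologous_rel_set p X S (frag_cmul (int n) a)) = homologous_rel_set p X S (frag_cmul m a)"
      by (rule inv_equality) (use assms in \<open>auto simp: carrier_relative_homology_group singular_relcycle_cmul\<close>)
    then show ?thesis using m c assms by (simp add: int_pow_neg int_pow_int homology_class_pow)
  qed
qed

lemma homology_class_eq_one:
  "homologous_rel_set p X S a = \<one>\<^bsub>relative_homology_group (int p) X S\<^esub> \<longleftrightarrow> singular_relboundary p X S a"
  by (simp add: homologous_rel_set_eq_relboundary)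

section \<open>Real cohomology classes as functionals on integral cycles\<close>

lemma real_cocycle_eval_boundary:
  assumes "real_cocycle p X c" "singular_relboundary p X {} z"
  shows "cochain_eval c z = 0"
proof -
  obtain d where d: "singular_chain (Suc p) X d" "chain_boundary (Suc p) d = z"
    using assms(2) by (auto simp: singular_boundary)
  have "cochain_eval c z = cochain_eval (coboundary_val (Suc p) c) d"
    using d cochain_eval_boundary[of "Suc p" c d] by simp
  also have "\<dots> = cochain_eval (\<lambda>_. 0) d"
    by (rule cochain_eval_eq_on[OF d(1)]) (use assms(1) in \<open>simp add: real_cocycle_def\<close>)
  finally show ?thesis by (simp add: cochain_eval_def)
qed

text \<open>The vanishing of Ext into the reals, in concrete form: if \<open>c\<close> kills all
  cycles, its value on a chain depends only on the boundary of the chain. This additive functional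
  on boundaries extends to all chains one degree lower, and the extension is a primitive of
  \<open>c\<close>.\<close>

lemma real_coboundary_iff_vanishes_on_cycles:
  "real_coboundary p X c \<longleftrightarrow> (\<forall>z. singular_relcycle p X {} z \<longrightarrow> cochain_eval c z = 0)"
proof (cases "p = 0")
  \<comment> \<open>In degree 0 being a coboundary means vanishing, and every 0-simplex is itself a
    cycle.\<close>
  case True
  have "cochain_eval c z = cochain_eval (\<lambda>_. 0) z"
    if "\<forall>s. singular_simplex 0 X s \<longrightarrow> c s = 0" "singular_relcycle 0 X {} z" for z
    using that by (intro cochain_eval_eq_on[of 0 X]) (auto simp: singular_cycle)
  moreover have "c s = 0" if "\<forall>z. singular_relcycle 0 X {} z \<longrightarrow> cochain_eval c z = 0" "singular_simplex 0 X s" for s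
    using that(1)[rule_format, of "frag_of s"] that(2) by (simp add: singular_cycle singular_chain_of chain_boundary_def)
  ultimately show ?thesis using True by (auto simp: real_coboundary_def cochain_eval_def)
next
  case False
  show ?thesis
  proof
    assume "real_coboundary p X c"
    then obtain b where b: "\<And>s. singular_simplex p X s \<Longrightarrow> c s = coboundary_val p b s"
      using False by (auto simp: real_coboundary_def)
    show "\<forall>z. singular_relcycle p X {} z \<longrightarrow> cochain_eval c z = 0"
    proof (intro allI impI)
      fix z assume z: "singular_relcycle p X {} z"
      have "cochain_eval c z = cochain_eval (coboundary_val p b) z"
        by (rule cochain_eval_eq_on[of p X]) (use z b in \<open>auto simp: singular_cycle\<close>)
      then show "cochain_eval c z = 0" using cochain_eval_boundary[of p b z] z False by (simp add: singular_cycle)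
    qed
  next
    assume van: "\<forall>z. singular_relcycle p X {} z \<longrightarrow> cochain_eval c z = 0"
    obtain b where b: "\<And>z. z \<in> singular_chain_set p X \<Longrightarrow> cochain_eval c z = cochain_eval b (chain_boundary p z)"
      by (rule additive_functional_extends[of "singular_chain_set p X" "chain_boundary p" "cochain_eval c"])
         (auto simp: singular_chain_add singular_chain_cmul chain_boundary_add chain_boundary_cmul cochain_eval_add
           singular_cycle van)
    have "c s = coboundary_val p b s" if "singular_simplex p X s" for s
      using b[of "frag_of s"] that False by (simp add: singular_chain_of coboundary_val_eval)
    then show "real_coboundary p X c" using False by (auto simp: real_coboundary_def)
  qed
qed

text \<open>If \<open>n\<close> times a cycle bounds, a cocycle takes a real value on the cycle
  whose \<open>n\<close>-fold is 0.\<close>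

lemma torsion_homology_imp_cohom_trivial:
  assumes "torsion_group (homology_group (int p) X)"
  shows "cohom_trivial p X"
  unfolding cohom_trivial_def real_coboundary_iff_vanishes_on_cycles
proof (intro allI impI)
  fix c z assume c: "real_cocycle p X c" and z: "singular_relcycle p X {} z"
  then obtain n where n: "n > 0" "homologous_rel_set p X {} z [^]\<^bsub>homology_group (int p) X\<^esub> (n::nat) = \<one>\<^bsub>homology_group (int p) X\<^esub>"
    using assms unfolding torsion_group_def by (force simp: carrier_relative_homology_group)
  then have "singular_relboundary p X {} (frag_cmul (int n) z)"
    by (metis homology_class_eq_one homology_class_pow z)
  then have "cochain_eval c (frag_cmul (int n) z) = 0" by (rule real_cocycle_eval_boundary[OF c])
  then show "cochain_eval c z = 0" using n by simp
qed

text \<open>The generating cocycle is the coordinate with respect to \<open>z0\<close>: a cycle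
  \<open>z\<close> for which \<open>n\<close> times \<open>z\<close> is homologous to
  \<open>m\<close> times \<open>z0\<close> is sent to \<open>m / n\<close>. This functional on
  cycles extends to chains, and any cocycle \<open>c\<close> differs from
  \<open>cochain_eval c z0\<close> times it by a cochain that kills all cycles.\<close>

lemma rank_one_homology_imp_cohom_is_R:
  assumes "rank_one_group (homology_group (int p) X)"
  shows "cohom_is_R p X"
proof -
  obtain z0 where z0: "singular_relcycle p X {} z0"
    and z0': "\<And>n. n > 0 \<Longrightarrow> homologous_rel_set p X {} z0 [^]\<^bsub>homology_group (int p) X\<^esub> (n::nat) \<noteq> \<one>\<^bsub>homology_group (int p) X\<^esub>"
    and gen: "\<And>z. singular_relcycle p X {} z \<Longrightarrow> \<exists>n>0. \<exists>m::int. homologous_rel_set p X {} z [^]\<^bsub>homology_group (int p) X\<^esub> (n::nat)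
       = homologous_rel_set p X {} z0 [^]\<^bsub>homology_group (int p) X\<^esub> m"
    using assms unfolding rank_one_group_def by (force simp: carrier_relative_homology_group)
  let ?B = "singular_relboundary p X {}"
  \<comment> \<open>The graph of the coordinate, with numerator and denominator kept apart until the
    ratio is known to be unique.\<close>
  define R where "R z n m \<longleftrightarrow> ?B (frag_cmul n z - frag_cmul m z0)" for z n m
  have Rex: "\<exists>n>0. \<exists>m. R z n m" if z: "singular_relcycle p X {} z" for z
  proof -
    obtain n m where n: "n > 0" "homologous_rel_set p X {} z [^]\<^bsub>homology_group (int p) X\<^esub> (n::nat)
       = homologous_rel_set p X {} z0 [^]\<^bsub>homology_group (int p) X\<^esub> (m::int)"
      using gen[OF z] by blast
    then have "homologous_rel_set p X {} (frag_cmul (int n) z) = homologous_rel_set p X {} (frag_cmul m z0)"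
      by (simp add: homology_class_pow homology_class_int_pow z z0)
    then have "R z (int n) m" by (metis R_def homologous_rel_def homologous_rel_set_eq)
    then show ?thesis using n by (metis of_nat_0_less_iff)
  qed
  have nontors: "k = 0" if "?B (frag_cmul k z0)" for k
  proof (rule ccontr)
    assume "k \<noteq> 0"
    have "?B (frag_cmul (int (nat \<bar>k\<bar>)) z0)"
      using that singular_relboundary_cmul[OF that, of "sgn k"]
      by (simp add: mult.commute abs_mult_sgn flip: abs_sgn)
    then have "homologous_rel_set p X {} z0 [^]\<^bsub>homology_group (int p) X\<^esub> (nat \<bar>k\<bar>) = \<one>\<^bsub>homology_group (int p) X\<^esub>"
      by (metis homology_class_eq_one homology_class_pow z0)
    moreover have "nat \<bar>k\<bar> > 0" using \<open>k \<noteq> 0\<close> by simp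
    ultimately show False using z0' by blast
  qed
  have Runique: "n' * m = n * m'" if "R z n m" "R z n' m'" for z n m n' m'
  proof -
    have "?B (frag_cmul n' (frag_cmul n z - frag_cmul m z0) - frag_cmul n (frag_cmul n' z - frag_cmul m' z0))"
      by (rule singular_relboundary_diff[OF singular_relboundary_cmul singular_relboundary_cmul,
            OF that(1)[unfolded R_def] that(2)[unfolded R_def]])
    also have "frag_cmul n' (frag_cmul n z - frag_cmul m z0) - frag_cmul n (frag_cmul n' z - frag_cmul m' z0)
        = frag_cmul (n * m' - n' * m) z0"
      by (rule poly_mapping_eqI) (simp add: lookup_minus algebra_simps)
    finally show ?thesis using nontors by fastforce
  qed
  define F where "F z = (let (n, m) = (SOME (n,m). n > 0 \<and> R z n m) in real_of_int m / real_of_int n)" for z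
  have F: "F z = real_of_int m / real_of_int n" if "n > 0" "R z n m" for z n m
  proof -
    obtain n' m' where e: "(SOME (n,m). n > 0 \<and> R z n m) = (n', m')" by fastforce
    have "case (n', m') of (n, m) \<Rightarrow> n > 0 \<and> R z n m"
      unfolding e[symmetric] by (rule someI[of _ "(n, m)"]) (use that in auto)
    then have "n' > 0" "n' * m = n * m'" using that Runique by auto
    then have "real_of_int n' * real_of_int m = real_of_int n * real_of_int m'" by (metis of_int_mult)
    then show ?thesis unfolding F_def e using that \<open>n' > 0\<close> by (simp add: field_simps)
  qed
  have Fadd: "F (x + y) = F x + F y" if cyc: "singular_relcycle p X {} x" "singular_relcycle p X {} y" for x y
  proof -
    obtain n m n' m' where x: "n > 0" "R x n m" and y: "n' > 0" "R y n' m'"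
      using Rex[OF cyc(1)] Rex[OF cyc(2)] by blast
    have "?B (frag_cmul n' (frag_cmul n x - frag_cmul m z0) + frag_cmul n (frag_cmul n' y - frag_cmul m' z0))"
      by (rule singular_relboundary_add[OF singular_relboundary_cmul singular_relboundary_cmul,
            OF x(2)[unfolded R_def] y(2)[unfolded R_def]])
    also have "frag_cmul n' (frag_cmul n x - frag_cmul m z0) + frag_cmul n (frag_cmul n' y - frag_cmul m' z0)
        = frag_cmul (n * n') (x + y) - frag_cmul (n' * m + n * m') z0"
      by (rule poly_mapping_eqI) (simp add: lookup_minus lookup_add algebra_simps)
    finally have "R (x + y) (n * n') (n' * m + n * m')" unfolding R_def .
    moreover have "n * n' > 0" using x y by simp
    ultimately have "F (x + y) = real_of_int (n' * m + n * m') / real_of_int (n * n')" by (rule F[rotated])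
    also have "\<dots> = real_of_int m / real_of_int n + real_of_int m' / real_of_int n'"
      using x(1) y(1) by (simp add: field_simps)
    finally show ?thesis using F[OF x] F[OF y] by simp
  qed
  have Fcmul: "F (frag_cmul k x) = of_int k * F x" if cyc: "singular_relcycle p X {} x" for x k
  proof -
    obtain n m where x: "n > 0" "R x n m" using Rex[OF cyc] by blast
    have "?B (frag_cmul k (frag_cmul n x - frag_cmul m z0))"
      by (rule singular_relboundary_cmul[OF x(2)[unfolded R_def]])
    also have "frag_cmul k (frag_cmul n x - frag_cmul m z0) = frag_cmul n (frag_cmul k x) - frag_cmul (k * m) z0"
      by (rule poly_mapping_eqI) (simp add: lookup_minus algebra_simps)
    finally have "R (frag_cmul k x) n (k * m)" unfolding R_def .
    then show ?thesis using x F[of n "frag_cmul k x"] F[OF x] by simp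
  qed
  have FB: "F x = 0" if "?B x" for x
    using F[of 1 x 0] that by (simp add: R_def)
  \<comment> \<open>Here \<open>d\<close> is the identity, so the lemma extends a functional from
    the cycles to all chains.\<close>
  obtain \<zeta> where \<zeta>: "\<And>z. z \<in> singular_relcycle_set p X {} \<Longrightarrow> F z = cochain_eval \<zeta> z"
    by (rule additive_functional_extends[of "singular_relcycle_set p X {}" "\<lambda>z. z" F])
       (auto simp: singular_relcycle_add singular_relcycle_cmul Fadd Fcmul FB)
  have cyc: "real_cocycle p X \<zeta>"
    unfolding real_cocycle_def
  proof (intro allI impI)
    fix s assume s: "singular_simplex (Suc p) X s"
    have b: "?B (chain_boundary (Suc p) (frag_of s))"
      using s by (auto simp: singular_boundary singular_chain_of intro!: exI[of _ "frag_of s"])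
    then have "singular_relcycle p X {} (chain_boundary (Suc p) (frag_of s))"
      by (rule singular_relboundary_imp_relcycle)
    then show "coboundary_val (Suc p) \<zeta> s = 0"
      using FB[OF b] \<zeta> by (simp add: coboundary_val_eval)
  qed
  have z01: "cochain_eval \<zeta> z0 = 1"
    using \<zeta>[of z0] z0 F[of 1 z0 1] by (simp add: R_def)
  show ?thesis unfolding cohom_is_R_def
  proof (intro exI[of _ \<zeta>] conjI allI impI cyc)
    show "\<not> real_coboundary p X \<zeta>"
      using z01 z0 by (auto simp: real_coboundary_iff_vanishes_on_cycles)
    fix c assume c: "real_cocycle p X c"
    have "cochain_eval c z = cochain_eval c z0 * cochain_eval \<zeta> z" if z: "singular_relcycle p X {} z" for z
    proof -
      obtain n m where x: "n > 0" "R z n m" using Rex[OF z] by blast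
      then have "cochain_eval c (frag_cmul n z - frag_cmul m z0) = 0"
        using real_cocycle_eval_boundary[OF c] by (simp add: R_def)
      moreover have "cochain_eval \<zeta> z = real_of_int m / real_of_int n" using \<zeta>[of z] z F[OF x] by simp
      moreover from calculation have "cochain_eval c z = real_of_int m / real_of_int n * cochain_eval c z0"
        using x(1) by (simp add: cochain_eval_diff field_simps)
      ultimately show ?thesis by simp
    qed
    then show "\<exists>a. real_coboundary p X (\<lambda>\<sigma>. c \<sigma> - a * \<zeta> \<sigma>)"
      by (intro exI[of _ "cochain_eval c z0"]) (simp add: real_coboundary_iff_vanishes_on_cycles cochain_eval_linear)
  qed
qed

section \<open>Isomorphisms modulo torsion\<close>

text \<open>Kernel and cokernel are torsion: for abelian groups, \<open>f\<close> becomes an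
  isomorphism after tensoring with the rationals.\<close>

definition rational_iso :: "('a, 'b) monoid_scheme \<Rightarrow> ('c, 'd) monoid_scheme \<Rightarrow> ('a \<Rightarrow> 'c) \<Rightarrow> bool" where
  "rational_iso A B f \<longleftrightarrow> f \<in> hom A B \<and>
     (\<forall>x\<in>carrier A. f x = \<one>\<^bsub>B\<^esub> \<longrightarrow> (\<exists>n>0. x [^]\<^bsub>A\<^esub> (n::nat) = \<one>\<^bsub>A\<^esub>)) \<and>
     (\<forall>y\<in>carrier B. \<exists>n>0. \<exists>x\<in>carrier A. f x = y [^]\<^bsub>B\<^esub> (n::nat))"

lemma rational_iso_iso:
  assumes "f \<in> iso A B" "group A" "group B"
  shows "rational_iso A B f"
proof -
  interpret f: group_hom A B f using assms by (simp add: group_hom_def group_hom_axioms_def iso_def)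
  have inj: "inj_on f (carrier A)" and surj: "f ` carrier A = carrier B"
    using assms(1) by (auto simp: iso_def bij_betw_def)
  have "\<exists>n>0. x [^]\<^bsub>A\<^esub> (n::nat) = \<one>\<^bsub>A\<^esub>" if "x \<in> carrier A" "f x = \<one>\<^bsub>B\<^esub>" for x
  proof -
    have "x = \<one>\<^bsub>A\<^esub>" using inj_onD[OF inj, of x "\<one>\<^bsub>A\<^esub>"] that by simp
    then have "x [^]\<^bsub>A\<^esub> (1::nat) = \<one>\<^bsub>A\<^esub>" by simp
    then show ?thesis by (rule exI[of _ 1, OF conjI, rotated]) simp
  qed
  moreover have "\<exists>n>0. \<exists>x\<in>carrier A. f x = y [^]\<^bsub>B\<^esub> (n::nat)" if y: "y \<in> carrier B" for y
  proof -
    have "y \<in> f ` carrier A" using surj y by simp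
    then obtain x where x: "x \<in> carrier A" "f x = y" by (auto elim: imageE)
    then have "f x = y [^]\<^bsub>B\<^esub> (1::nat)" using y by simp
    then show ?thesis using x by (metis zero_less_one)
  qed
  ultimately show ?thesis unfolding rational_iso_def using f.homh by auto
qed

lemma rational_iso_compose:
  assumes f: "rational_iso A B f" and g: "rational_iso B C g" and grp: "group A" "group B" "group C"
  shows "rational_iso A C (g \<circ> f)"
proof -
  interpret f: group_hom A B f using assms by (simp add: group_hom_def group_hom_axioms_def rational_iso_def)
  interpret g: group_hom B C g using assms by (simp add: group_hom_def group_hom_axioms_def rational_iso_def)
  have "\<exists>n>0. x [^]\<^bsub>A\<^esub> (n::nat) = \<one>\<^bsub>A\<^esub>" if x: "x \<in> carrier A" "g (f x) = \<one>\<^bsub>C\<^esub>" for x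
  proof -
    obtain n :: nat where n: "n > 0" "f x [^]\<^bsub>B\<^esub> n = \<one>\<^bsub>B\<^esub>"
      using g f.hom_closed[OF x(1)] x(2) unfolding rational_iso_def by blast
    then have "f (x [^]\<^bsub>A\<^esub> n) = \<one>\<^bsub>B\<^esub>" using x by (simp add: f.hom_nat_pow)
    then obtain m :: nat where m: "m > 0" "(x [^]\<^bsub>A\<^esub> n) [^]\<^bsub>A\<^esub> m = \<one>\<^bsub>A\<^esub>"
      using f f.G.nat_pow_closed[OF x(1)] unfolding rational_iso_def by blast
    then show ?thesis using n x by (intro exI[of _ "n * m"]) (simp add: f.G.nat_pow_pow)
  qed
  moreover have "\<exists>n>0. \<exists>x\<in>carrier A. g (f x) = z [^]\<^bsub>C\<^esub> (n::nat)" if z: "z \<in> carrier C" for z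
  proof -
    obtain n :: nat and y where y: "n > 0" "y \<in> carrier B" "g y = z [^]\<^bsub>C\<^esub> n" using g z unfolding rational_iso_def by blast
    obtain m :: nat and x where x: "m > 0" "x \<in> carrier A" "f x = y [^]\<^bsub>B\<^esub> m" using f y unfolding rational_iso_def by blast
    then show ?thesis using y z by (intro exI[of _ "n * m"]) (auto intro!: bexI[of _ x] simp: g.hom_nat_pow g.H.nat_pow_pow)
  qed
  ultimately show ?thesis unfolding rational_iso_def using hom_compose[OF f.homh g.homh] by (auto simp: o_def)
qed

text \<open>Two out of three. It serves to show that an inclusion is a rational isomorphism when a
  map and its composite with the inclusion both are.\<close>

lemma rational_iso_cancel:
  assumes f: "rational_iso A B f" and gf: "rational_iso A C (g \<circ> f)" and g: "g \<in> hom B C"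
    and grp: "group A" "group B" "group C"
  shows "rational_iso B C g"
proof -
  interpret f: group_hom A B f using assms by (simp add: group_hom_def group_hom_axioms_def rational_iso_def)
  interpret g: group_hom B C g using assms by (simp add: group_hom_def group_hom_axioms_def)
  have "\<exists>n>0. y [^]\<^bsub>B\<^esub> (n::nat) = \<one>\<^bsub>B\<^esub>" if y: "y \<in> carrier B" "g y = \<one>\<^bsub>C\<^esub>" for y
  proof -
    obtain m :: nat and x where x: "m > 0" "x \<in> carrier A" "f x = y [^]\<^bsub>B\<^esub> m" using f y unfolding rational_iso_def by blast
    then have "(g \<circ> f) x = \<one>\<^bsub>C\<^esub>" using y by (simp add: g.hom_nat_pow)
    then obtain n :: nat where n: "n > 0" "x [^]\<^bsub>A\<^esub> n = \<one>\<^bsub>A\<^esub>" using gf x unfolding rational_iso_def by blast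
    have "y [^]\<^bsub>B\<^esub> (m * n) = f (x [^]\<^bsub>A\<^esub> n)" using x y by (simp add: f.hom_nat_pow f.H.nat_pow_pow)
    then show ?thesis using n x by (intro exI[of _ "m * n"]) simp
  qed
  moreover have "\<exists>n>0. \<exists>x\<in>carrier B. g x = z [^]\<^bsub>C\<^esub> (n::nat)" if z: "z \<in> carrier C" for z
  proof -
    obtain n :: nat and x where x: "n > 0" "x \<in> carrier A" "(g \<circ> f) x = z [^]\<^bsub>C\<^esub> n"
      using gf z unfolding rational_iso_def by blast
    then show ?thesis by (intro exI[of _ n]) (auto intro!: bexI[of _ "f x"])
  qed
  ultimately show ?thesis unfolding rational_iso_def using g by auto
qed

lemma rational_iso_torsion:
  assumes f: "rational_iso A B f" and grp: "group A" "group B"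
  shows "torsion_group A \<longleftrightarrow> torsion_group B"
proof -
  interpret f: group_hom A B f using assms by (simp add: group_hom_def group_hom_axioms_def rational_iso_def)
  show ?thesis
  proof
    assume A: "torsion_group A"
    show "torsion_group B" unfolding torsion_group_def
    proof
      fix y assume y: "y \<in> carrier B"
      obtain m :: nat and x where x: "m > 0" "x \<in> carrier A" "f x = y [^]\<^bsub>B\<^esub> m" using f y unfolding rational_iso_def by blast
      obtain n :: nat where n: "n > 0" "x [^]\<^bsub>A\<^esub> n = \<one>\<^bsub>A\<^esub>" using A x unfolding torsion_group_def by blast
      have "y [^]\<^bsub>B\<^esub> (m * n) = f (x [^]\<^bsub>A\<^esub> n)" using x y by (simp add: f.hom_nat_pow f.H.nat_pow_pow)
      then show "\<exists>n>0. y [^]\<^bsub>B\<^esub> (n::nat) = \<one>\<^bsub>B\<^esub>" using n x by (intro exI[of _ "m * n"]) simp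
    qed
  next
    assume B: "torsion_group B"
    show "torsion_group A" unfolding torsion_group_def
    proof
      fix x assume x: "x \<in> carrier A"
      obtain n :: nat where n: "n > 0" "f x [^]\<^bsub>B\<^esub> n = \<one>\<^bsub>B\<^esub>" using B f.hom_closed[OF x] unfolding torsion_group_def by blast
      then have "f (x [^]\<^bsub>A\<^esub> n) = \<one>\<^bsub>B\<^esub>" using x by (simp add: f.hom_nat_pow)
      then obtain m :: nat where m: "m > 0" "(x [^]\<^bsub>A\<^esub> n) [^]\<^bsub>A\<^esub> m = \<one>\<^bsub>A\<^esub>"
        using f f.G.nat_pow_closed[OF x(1)] unfolding rational_iso_def by blast
      then show "\<exists>n>0. x [^]\<^bsub>A\<^esub> (n::nat) = \<one>\<^bsub>A\<^esub>" using n x by (intro exI[of _ "n * m"]) (simp add: f.G.nat_pow_pow)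
    qed
  qed
qed

lemma rational_iso_rank_one:
  assumes f: "rational_iso A B f" and grp: "group A" "group B" and A: "rank_one_group A"
  shows "rank_one_group B"
proof -
  interpret f: group_hom A B f using assms by (simp add: group_hom_def group_hom_axioms_def rational_iso_def)
  obtain g where g: "g \<in> carrier A" "\<And>n::nat. n > 0 \<Longrightarrow> g [^]\<^bsub>A\<^esub> n \<noteq> \<one>\<^bsub>A\<^esub>"
    and gen: "\<And>x. x \<in> carrier A \<Longrightarrow> \<exists>n>0. \<exists>m::int. x [^]\<^bsub>A\<^esub> (n::nat) = g [^]\<^bsub>A\<^esub> m"
    using A unfolding rank_one_group_def by blast
  show ?thesis unfolding rank_one_group_def
  proof (intro bexI[of _ "f g"] conjI ballI allI impI)
    fix n :: nat assume n: "n > 0"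
    show "f g [^]\<^bsub>B\<^esub> n \<noteq> \<one>\<^bsub>B\<^esub>"
    proof
      assume "f g [^]\<^bsub>B\<^esub> n = \<one>\<^bsub>B\<^esub>"
      then have "f (g [^]\<^bsub>A\<^esub> n) = \<one>\<^bsub>B\<^esub>" using g by (simp add: f.hom_nat_pow)
      then obtain m :: nat where m: "m > 0" "(g [^]\<^bsub>A\<^esub> n) [^]\<^bsub>A\<^esub> m = \<one>\<^bsub>A\<^esub>"
        using f f.G.nat_pow_closed[OF g(1)] unfolding rational_iso_def by blast
      then show False using g(2)[of "n * m"] g(1) n by (simp add: f.G.nat_pow_pow)
    qed
  next
    fix y assume y: "y \<in> carrier B"
    obtain m :: nat and x where x: "m > 0" "x \<in> carrier A" "f x = y [^]\<^bsub>B\<^esub> m" using f y unfolding rational_iso_def by blast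
    obtain n :: nat and k :: int where n: "n > 0" "x [^]\<^bsub>A\<^esub> n = g [^]\<^bsub>A\<^esub> k" using gen x by blast
    have "y [^]\<^bsub>B\<^esub> (m * n) = f (x [^]\<^bsub>A\<^esub> n)" using x y by (simp add: f.hom_nat_pow f.H.nat_pow_pow)
    also have "\<dots> = f g [^]\<^bsub>B\<^esub> k" using n g by (simp add: f.hom_int_pow)
    finally show "\<exists>n>0. \<exists>k::int. y [^]\<^bsub>B\<^esub> (n::nat) = f g [^]\<^bsub>B\<^esub> k"
      using x n by (intro exI[of _ "m * n"]) auto
  qed (use g in auto)
qed

lemma torsion_group_trivial: "trivial_group A \<Longrightarrow> torsion_group A"
  unfolding torsion_group_def trivial_group_def
  by (metis group.is_monoid monoid.nat_pow_one singletonD zero_less_one)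

lemma torsion_group_iso: "A \<cong> B \<Longrightarrow> group A \<Longrightarrow> group B \<Longrightarrow> torsion_group A \<longleftrightarrow> torsion_group B"
  unfolding is_iso_def using rational_iso_iso rational_iso_torsion by blast

lemma rank_one_group_iso:
  assumes "A \<cong> B" "group A" "group B"
  shows "rank_one_group A \<longleftrightarrow> rank_one_group B"
proof -
  have "B \<cong> A" using assms group.iso_sym by blast
  then show ?thesis using assms unfolding is_iso_def
    by (metis rational_iso_iso rational_iso_rank_one ex_in_conv)
qed

lemma rank_one_integer_group: "rank_one_group integer_group"
proof -
  have np: "x [^]\<^bsub>integer_group\<^esub> (n::nat) = int n * x" for x n
    by (induction n) (auto simp: nat_pow_def algebra_simps)
  interpret group integer_group by (rule group_integer_group)
  have ip: "1 [^]\<^bsub>integer_group\<^esub> (k::int) = k" for k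
  proof (cases "k \<ge> 0")
    case True then show ?thesis by (metis int_nat_eq int_pow_int mult.right_neutral np)
  next
    case False
    then have "k = - int (nat (- k))" by simp
    then show ?thesis by (metis int_pow_int int_pow_neg inv_integer_group mult.right_neutral np UNIV_I carrier_integer_group)
  qed
  show ?thesis unfolding rank_one_group_def
    by (intro bexI[of _ 1]) (auto simp: np ip intro!: exI[of _ 1])
qed

text \<open>The kernel of \<open>g\<close> is the image of \<open>f\<close> and its cokernel embeds
  by \<open>h\<close>; both images consist of torsion elements.\<close>

lemma exact_rational_iso:
  assumes ex1: "kernel B C g = f ` carrier A" and ex2: "kernel C D h = g ` carrier B"
    and hom: "f \<in> hom A B" "g \<in> hom B C" "h \<in> hom C D"
    and grp: "group A" "group B" "group C" "group D"
    and tors: "\<And>a. a \<in> carrier A \<Longrightarrow> \<exists>n>0. f a [^]\<^bsub>B\<^esub> (n::nat) = \<one>\<^bsub>B\<^esub>"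
      "\<And>c. c \<in> carrier C \<Longrightarrow> \<exists>n>0. h c [^]\<^bsub>D\<^esub> (n::nat) = \<one>\<^bsub>D\<^esub>"
  shows "rational_iso B C g"
proof -
  interpret h: group_hom C D h using assms by (simp add: group_hom_def group_hom_axioms_def)
  have "\<exists>n>0. x [^]\<^bsub>B\<^esub> (n::nat) = \<one>\<^bsub>B\<^esub>" if "x \<in> carrier B" "g x = \<one>\<^bsub>C\<^esub>" for x
  proof -
    have "x \<in> kernel B C g" using that by (simp add: kernel_def)
    then show ?thesis using tors(1) ex1 by auto
  qed
  moreover have "\<exists>n>0. \<exists>x\<in>carrier B. g x = y [^]\<^bsub>C\<^esub> (n::nat)" if y: "y \<in> carrier C" for y
  proof -
    obtain n :: nat where n: "n > 0" "h y [^]\<^bsub>D\<^esub> n = \<one>\<^bsub>D\<^esub>" using tors(2)[OF y] by blast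
    then have "y [^]\<^bsub>C\<^esub> n \<in> kernel C D h" using y by (simp add: kernel_def h.hom_nat_pow)
    then show ?thesis using ex2 n by (metis imageE)
  qed
  ultimately show ?thesis using hom by (auto simp: rational_iso_def)
qed

lemma torsion_group_image:
  assumes "torsion_group A" "f \<in> hom A B" "group A" "group B" "a \<in> carrier A"
  shows "\<exists>n>0. f a [^]\<^bsub>B\<^esub> (n::nat) = \<one>\<^bsub>B\<^esub>"
proof -
  interpret f: group_hom A B f using assms by (simp add: group_hom_def group_hom_axioms_def)
  show ?thesis using assms(1,5) unfolding torsion_group_def by (metis f.hom_nat_pow f.hom_one)
qed

text \<open>The five-term sequence \<open>A, B, C, D, E\<close> modulo torsion: since
  \<open>k\<close> is injective up to torsion, a multiple of any element of \<open>C\<close> comes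
  from \<open>B\<close>; since \<open>f\<close> is surjective up to torsion, a further multiple
  comes from \<open>A\<close> and so dies in \<open>C\<close>.\<close>

lemma exact_torsion:
  assumes ex1: "kernel C D h = g ` carrier B" and ex2: "kernel D E k = h ` carrier C"
    and f: "rational_iso A B f" and gf: "\<And>a. a \<in> carrier A \<Longrightarrow> g (f a) = \<one>\<^bsub>C\<^esub>" and k: "rational_iso D E k"
    and hom: "g \<in> hom B C" "h \<in> hom C D"
    and grp: "group A" "group B" "group C" "group D" "group E"
  shows "torsion_group C"
  unfolding torsion_group_def
proof
  interpret h: group_hom C D h using assms by (simp add: group_hom_def group_hom_axioms_def)
  interpret g: group_hom B C g using assms by (simp add: group_hom_def group_hom_axioms_def)
  fix y assume y: "y \<in> carrier C"
  have "h y \<in> kernel D E k" using ex2 y by blast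
  then obtain n :: nat where n: "n > 0" "h y [^]\<^bsub>D\<^esub> n = \<one>\<^bsub>D\<^esub>"
    using k unfolding rational_iso_def kernel_def by blast
  then have "y [^]\<^bsub>C\<^esub> n \<in> kernel C D h" using y by (simp add: kernel_def h.hom_nat_pow)
  then obtain b where b: "b \<in> carrier B" "y [^]\<^bsub>C\<^esub> n = g b" using ex1 by auto
  obtain m :: nat and a where a: "m > 0" "a \<in> carrier A" "f a = b [^]\<^bsub>B\<^esub> m" using f b unfolding rational_iso_def by blast
  have "y [^]\<^bsub>C\<^esub> (n * m) = g b [^]\<^bsub>C\<^esub> m" using y b by (metis h.G.nat_pow_pow)
  also have "\<dots> = g (f a)" using a b by (simp add: g.hom_nat_pow)
  finally show "\<exists>n>0. y [^]\<^bsub>C\<^esub> (n::nat) = \<one>\<^bsub>C\<^esub>" using gf[OF a(2)] a(1,3) n(1) by (intro exI[of _ "n * m"]) simp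
qed

section \<open>Exact sequences of pairs and excision modulo torsion\<close>

lemma hom_hom_induced [simp]:
  "hom_induced p X S Y T f \<in> hom (relative_homology_group p X S) (relative_homology_group p Y T)"
  by (rule hom_induced_hom)

lemma hom_hom_boundary [simp]:
  "hom_boundary p X S \<in> hom (relative_homology_group p X S) (homology_group (p - 1) (subtopology X S))"
  by (rule hom_boundary_hom)

lemma homology_exact_1:
  "kernel (relative_homology_group p X S) (homology_group (p-1) (subtopology X S)) (hom_boundary p X S)
    = hom_induced p X {} X S id ` carrier (homology_group p X)"
  using homology_exactness_axiom_1[of p X S] by simp

lemma homology_exact_2:
  "kernel (homology_group p (subtopology X S)) (homology_group p X) (hom_induced p (subtopology X S) {} X {} id)
    = hom_boundary (p+1) X S ` carrier (relative_homology_group (p+1) X S)"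
  using homology_exactness_axiom_2[of "p+1" X S] by simp

lemma homology_exact_3:
  "kernel (homology_group p X) (relative_homology_group p X S) (hom_induced p X {} X S id)
    = hom_induced p (subtopology X S) {} X {} id ` carrier (homology_group p (subtopology X S))"
  using homology_exactness_axiom_3[of p X S] by simp

text \<open>The relative group in degree \<open>p\<close> sits between the inclusions in degrees
  \<open>p\<close> and \<open>p - 1\<close>, which is why the hypothesis concerns all
  degrees.\<close>

lemma rational_iso_inclusion_imp_torsion:
  assumes "\<And>p. rational_iso (homology_group p (subtopology X S)) (homology_group p X)
      (hom_induced p (subtopology X S) {} X {} id)"
  shows "torsion_group (relative_homology_group p X S)"
proof (rule exact_torsion[OF homology_exact_1 _ assms _ assms])
  show "kernel (homology_group (p-1) (subtopology X S)) (homology_group (p-1) X) (hom_induced (p-1) (subtopology X S) {} X {} id)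
    = hom_boundary p X S ` carrier (relative_homology_group p X S)"
    using homology_exact_2[of "p-1" X S] by simp
  fix a assume "a \<in> carrier (homology_group p (subtopology X S))"
  then have "hom_induced p (subtopology X S) {} X {} id a \<in> kernel (homology_group p X) (relative_homology_group p X S) (hom_induced p X {} X S id)"
    unfolding homology_exact_3 by blast
  then show "hom_induced p X {} X S id (hom_induced p (subtopology X S) {} X {} id a) = \<one>\<^bsub>relative_homology_group p X S\<^esub>"
    by (simp add: kernel_def)
qed auto

lemma torsion_imp_rational_iso_inclusion:
  assumes "torsion_group (relative_homology_group (p+1) X S)" "torsion_group (relative_homology_group p X S)"
  shows "rational_iso (homology_group p (subtopology X S)) (homology_group p X)
      (hom_induced p (subtopology X S) {} X {} id)"
proof (rule exact_rational_iso[OF homology_exact_2 homology_exact_3])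
  show bd: "hom_boundary (p + 1) X S \<in> hom (relative_homology_group (p+1) X S) (homology_group p (subtopology X S))"
    using hom_hom_boundary[of "p+1" X S] by simp
  show "\<exists>n>0. hom_boundary (p + 1) X S a [^]\<^bsub>homology_group p (subtopology X S)\<^esub> (n::nat) = \<one>\<^bsub>homology_group p (subtopology X S)\<^esub>"
    if "a \<in> carrier (relative_homology_group (p+1) X S)" for a
    by (rule torsion_group_image[OF assms(1) bd _ _ that]) auto
  show "\<exists>n>0. hom_induced p X {} X S id c [^]\<^bsub>relative_homology_group p X S\<^esub> (n::nat) = \<one>\<^bsub>relative_homology_group p X S\<^esub>"
    if "c \<in> carrier (homology_group p X)" for c
    using assms(2) hom_induced_carrier[of p X "{}" X S id c] unfolding torsion_group_def by blast
qed auto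

text \<open>The set excised is the complement of \<open>V\<close>, which is closed and contained in
  the open set \<open>U\<close>.\<close>

lemma open_cover_excision:
  assumes "openin X U" "openin X V" "U \<union> V = topspace X"
  shows "hom_induced p (subtopology X V) (U \<inter> V) X U id
    \<in> iso (relative_homology_group p (subtopology X V) (U \<inter> V)) (relative_homology_group p X U)"
proof -
  have UV: "U \<subseteq> topspace X" "V \<subseteq> topspace X" using assms openin_subset by auto
  have "closedin X (topspace X - V)" using assms by blast
  then have 1: "X closure_of (topspace X - V) = topspace X - V" by (simp add: closure_of_closedin)
  have 2: "X interior_of U = U" using assms by (simp add: interior_of_openin)
  have "X closure_of (topspace X - V) \<subseteq> X interior_of U" unfolding 1 2 using assms by blast
  from homology_excision_axiom[OF this UV(1), of p]
  have "hom_induced p (subtopology X (topspace X - (topspace X - V))) (U - (topspace X - V)) (subtopology X (topspace X)) U id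
    \<in> iso (relative_homology_group p (subtopology X (topspace X - (topspace X - V))) (U - (topspace X - V)))
        (relative_homology_group p (subtopology X (topspace X)) U)" .
  moreover have "topspace X - (topspace X - V) = V" "U - (topspace X - V) = U \<inter> V" using UV by auto
  ultimately show ?thesis by simp
qed

text \<open>The two orbit maps over \<open>U \<inter> V\<close> and \<open>V\<close> show that \<open>U \<inter> V \<rightarrow> V\<close> is a rational isomorphism;
  by excision so is \<open>U \<rightarrow> X\<close>.\<close>

lemma rational_iso_open_cover:
  assumes UV: "openin X U" "openin X V" "U \<union> V = topspace X"
    and u: "\<And>p. rational_iso (homology_group p G) (homology_group p (subtopology X U)) (hom_induced p G {} (subtopology X U) {} u)"
    and v: "\<And>p. rational_iso (homology_group p G) (homology_group p (subtopology X V)) (hom_induced p G {} (subtopology X V) {} v)"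
    and w: "\<And>p. rational_iso (homology_group p G) (homology_group p (subtopology X (U \<inter> V))) (hom_induced p G {} (subtopology X (U \<inter> V)) {} w)"
    and cont: "continuous_map G (subtopology X U) u" "continuous_map G (subtopology X (U \<inter> V)) w"
    and vw: "homotopic_with (\<lambda>_. True) G (subtopology X V) w v"
  shows "rational_iso (homology_group p G) (homology_group p X) (hom_induced p G {} X {} u)"
proof -
  have sub: "subtopology (subtopology X V) (U \<inter> V) = subtopology X (U \<inter> V)"
    by (simp add: subtopology_subtopology inf_left_commute)
  have incl: "rational_iso (homology_group p (subtopology (subtopology X V) (U \<inter> V))) (homology_group p (subtopology X V))
      (hom_induced p (subtopology (subtopology X V) (U \<inter> V)) {} (subtopology X V) {} id)" for p
    unfolding sub
  proof (rule rational_iso_cancel[OF w])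
    have "hom_induced p (subtopology X (U \<inter> V)) {} (subtopology X V) {} id \<circ> hom_induced p G {} (subtopology X (U \<inter> V)) {} w
      = hom_induced p G {} (subtopology X V) {} (id \<circ> w)"
      by (rule hom_induced_compose[symmetric])
        (use cont in \<open>auto simp: continuous_map_in_subtopology intro: continuous_map_from_subtopology\<close>)
    also have "\<dots> = hom_induced p G {} (subtopology X V) {} v"
      using homology_homotopy_empty[OF vw] by simp
    finally show "rational_iso (homology_group p G) (homology_group p (subtopology X V))
       (hom_induced p (subtopology X (U \<inter> V)) {} (subtopology X V) {} id \<circ> hom_induced p G {} (subtopology X (U \<inter> V)) {} w)"
      using v by simp
  qed auto
  have "torsion_group (relative_homology_group p (subtopology X V) (U \<inter> V))" for p
    by (rule rational_iso_inclusion_imp_torsion[OF incl])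
  moreover have "relative_homology_group p (subtopology X V) (U \<inter> V) \<cong> relative_homology_group p X U" for p
    using open_cover_excision[OF UV] by (auto simp: is_iso_def)
  ultimately have tors: "torsion_group (relative_homology_group p X U)" for p
    using torsion_group_iso by (metis group_relative_homology_group)
  have "rational_iso (homology_group p G) (homology_group p X)
     (hom_induced p (subtopology X U) {} X {} id \<circ> hom_induced p G {} (subtopology X U) {} u)"
    by (rule rational_iso_compose[OF u torsion_imp_rational_iso_inclusion[OF tors tors]]) auto
  also have "hom_induced p (subtopology X U) {} X {} id \<circ> hom_induced p G {} (subtopology X U) {} u
      = hom_induced p G {} X {} (id \<circ> u)"
    by (rule hom_induced_compose[symmetric]) (use cont in auto)
  finally show ?thesis by simp
qed

section \<open>Finite coverings and the transfer\<close>

lemma frag_cmul_diff_right: "frag_cmul k (a - b) = frag_cmul k a - frag_cmul k b"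
  by (rule poly_mapping_eqI) (simp add: lookup_minus algebra_simps)

definition simplex_lifts :: "nat \<Rightarrow> 'y topology \<Rightarrow> ('y \<Rightarrow> 'x) \<Rightarrow> ((nat \<Rightarrow> real) \<Rightarrow> 'x) \<Rightarrow> ((nat \<Rightarrow> real) \<Rightarrow> 'y) set" where
  "simplex_lifts p Y \<phi> \<sigma> = {\<tau>. singular_simplex p Y \<tau> \<and> (\<forall>t\<in>standard_simplex p. \<phi> (\<tau> t) = \<sigma> t)}"

text \<open>The consequence of a finite covering on which the transfer rests. Isolating it keeps the
  chain-level argument free of covering space theory.\<close>

definition lifts_simplices :: "nat \<Rightarrow> 'y topology \<Rightarrow> ('y \<Rightarrow> 'x) \<Rightarrow> 'x topology \<Rightarrow> bool" where
  "lifts_simplices n Y \<phi> X \<longleftrightarrow> continuous_map Y X \<phi> \<and>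
     (\<forall>p \<sigma>. singular_simplex p X \<sigma> \<longrightarrow> finite (simplex_lifts p Y \<phi> \<sigma>) \<and> card (simplex_lifts p Y \<phi> \<sigma>) = n \<and>
       (\<forall>\<tau>\<in>simplex_lifts p Y \<phi> \<sigma>. \<forall>\<tau>'\<in>simplex_lifts p Y \<phi> \<sigma>. \<forall>t\<in>standard_simplex p. \<tau> t = \<tau>' t \<longrightarrow> \<tau> = \<tau>'))"

definition transfer_chain :: "nat \<Rightarrow> 'y topology \<Rightarrow> ('y \<Rightarrow> 'x) \<Rightarrow> 'x chain \<Rightarrow> 'y chain" where
  "transfer_chain p Y \<phi> = frag_extend (\<lambda>\<sigma>. \<Sum>\<tau>\<in>simplex_lifts p Y \<phi> \<sigma>. frag_of \<tau>)"

context
  fixes n :: nat and Y :: "'y topology" and \<phi> :: "'y \<Rightarrow> 'x" and X :: "'x topology"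
  assumes lifts: "lifts_simplices n Y \<phi> X"
begin

lemma lifts_continuous: "continuous_map Y X \<phi>"
  using lifts by (simp add: lifts_simplices_def)

lemma finite_simplex_lifts: "singular_simplex p X \<sigma> \<Longrightarrow> finite (simplex_lifts p Y \<phi> \<sigma>)"
  using lifts by (simp add: lifts_simplices_def)

lemma card_simplex_lifts: "singular_simplex p X \<sigma> \<Longrightarrow> card (simplex_lifts p Y \<phi> \<sigma>) = n"
  using lifts by (simp add: lifts_simplices_def)

lemma simplex_lifts_unique:
  "\<lbrakk>singular_simplex p X \<sigma>; \<tau> \<in> simplex_lifts p Y \<phi> \<sigma>; \<tau>' \<in> simplex_lifts p Y \<phi> \<sigma>;
    t \<in> standard_simplex p; \<tau> t = \<tau>' t\<rbrakk> \<Longrightarrow> \<tau> = \<tau>'"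
  using lifts unfolding lifts_simplices_def by blast

text \<open>Restriction of lifts to a face is injective by unique lifting, hence bijective because
  both sets have \<open>n\<close> elements.\<close>

lemma bij_betw_face_simplex_lifts:
  assumes \<sigma>: "singular_simplex p X \<sigma>" and p: "1 \<le> p" "k \<le> p"
  shows "bij_betw (singular_face p k) (simplex_lifts p Y \<phi> \<sigma>) (simplex_lifts (p-1) Y \<phi> (singular_face p k \<sigma>))"
proof -
  have f\<sigma>: "singular_simplex (p-1) X (singular_face p k \<sigma>)"
    using singular_simplex_singular_face[OF \<sigma> p] by simp
  have inj: "inj_on (singular_face p k) (simplex_lifts p Y \<phi> \<sigma>)"
  proof (rule inj_onI)
    fix \<tau> \<tau>' assume \<tau>: "\<tau> \<in> simplex_lifts p Y \<phi> \<sigma>" "\<tau>' \<in> simplex_lifts p Y \<phi> \<sigma>"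
      and eq: "singular_face p k \<tau> = singular_face p k \<tau>'"
    obtain t where t: "t \<in> standard_simplex (p - Suc 0)" using nonempty_standard_simplex by blast
    then have "\<tau> (simplical_face k t) = \<tau>' (simplical_face k t)"
      using fun_cong[OF eq, of t] by (simp add: singular_face_def)
    then show "\<tau> = \<tau>'" using simplex_lifts_unique[OF \<sigma> \<tau>] simplical_face_in_standard_simplex[OF p t] by blast
  qed
  have sub: "singular_face p k ` simplex_lifts p Y \<phi> \<sigma> \<subseteq> simplex_lifts (p-1) Y \<phi> (singular_face p k \<sigma>)"
    using singular_simplex_singular_face[OF _ p] simplical_face_in_standard_simplex[OF p]
    by (auto simp: simplex_lifts_def singular_face_def)
  show ?thesis
    unfolding bij_betw_def
  proof (intro conjI inj card_subset_eq sub)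
    show "finite (simplex_lifts (p-1) Y \<phi> (singular_face p k \<sigma>))" by (rule finite_simplex_lifts[OF f\<sigma>])
    show "card (singular_face p k ` simplex_lifts p Y \<phi> \<sigma>) = card (simplex_lifts (p-1) Y \<phi> (singular_face p k \<sigma>))"
      using card_simplex_lifts[OF f\<sigma>] card_simplex_lifts[OF \<sigma>] card_image[OF inj] by simp
  qed
qed

lemma transfer_chain_of [simp]:
  "transfer_chain p Y \<phi> (frag_of \<sigma>) = (\<Sum>\<tau>\<in>simplex_lifts p Y \<phi> \<sigma>. frag_of \<tau>)"
  by (simp add: transfer_chain_def)

lemma transfer_chain_diff:
  "transfer_chain p Y \<phi> (a - b) = transfer_chain p Y \<phi> a - transfer_chain p Y \<phi> b"
  by (simp add: transfer_chain_def frag_extend_diff)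

lemma transfer_chain_0 [simp]: "transfer_chain p Y \<phi> 0 = 0"
  by (simp add: transfer_chain_def)

lemma transfer_chain_cmul: "transfer_chain p Y \<phi> (frag_cmul k a) = frag_cmul k (transfer_chain p Y \<phi> a)"
  by (simp add: transfer_chain_def frag_extend_cmul)

lemma transfer_chain_sum:
  "finite I \<Longrightarrow> transfer_chain p Y \<phi> (sum f I) = (\<Sum>i\<in>I. transfer_chain p Y \<phi> (f i))"
  by (simp add: transfer_chain_def frag_extend_sum o_def)

lemma singular_chain_transfer: "singular_chain p X c \<Longrightarrow> singular_chain p Y (transfer_chain p Y \<phi> c)"
  unfolding transfer_chain_def
  by (intro singular_chain_extend singular_chain_sum) (auto simp: simplex_lifts_def singular_chain_of)

text \<open>After exchanging the sums over faces and over lifts, the bijection between lifts of a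
  simplex and lifts of its face matches the terms.\<close>

lemma chain_boundary_transfer:
  assumes "singular_chain p X c"
  shows "chain_boundary p (transfer_chain p Y \<phi> c) = transfer_chain (p-1) Y \<phi> (chain_boundary p c)"
proof (cases "p = 0")
  case True then show ?thesis by (simp add: chain_boundary_def)
next
  case False
  show ?thesis
    using assms unfolding singular_chain_def
  proof (induction c rule: frag_induction)
    case (one \<sigma>)
    then have \<sigma>: "singular_simplex p X \<sigma>" by simp
    have "chain_boundary p (transfer_chain p Y \<phi> (frag_of \<sigma>))
      = (\<Sum>\<tau>\<in>simplex_lifts p Y \<phi> \<sigma>. \<Sum>k\<le>p. frag_cmul ((-1) ^ k) (frag_of (singular_face p k \<tau>)))"
      using False by (simp add: chain_boundary_sum chain_boundary_of o_def)
    also have "\<dots> = (\<Sum>k\<le>p. \<Sum>\<tau>\<in>simplex_lifts p Y \<phi> \<sigma>. frag_cmul ((-1) ^ k) (frag_of (singular_face p k \<tau>)))"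
      by (rule sum.swap)
    also have "\<dots> = (\<Sum>k\<le>p. \<Sum>\<tau>\<in>simplex_lifts (p-1) Y \<phi> (singular_face p k \<sigma>). frag_cmul ((-1) ^ k) (frag_of \<tau>))"
      by (intro sum.cong refl sum.reindex_bij_betw[OF bij_betw_face_simplex_lifts[OF \<sigma>]]) (use False in auto)
    also have "\<dots> = transfer_chain (p-1) Y \<phi> (chain_boundary p (frag_of \<sigma>))"
      using False by (simp add: chain_boundary_of transfer_chain_sum transfer_chain_cmul frag_cmul_sum o_def)
    finally show ?case .
  next
    case (diff a b) then show ?case by (simp add: chain_boundary_diff transfer_chain_diff)
  qed simp
qed

lemma chain_map_transfer:
  assumes "singular_chain p X c"
  shows "chain_map p \<phi> (transfer_chain p Y \<phi> c) = frag_cmul (int n) c"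
  using assms unfolding singular_chain_def
proof (induction c rule: frag_induction)
  case (one \<sigma>)
  then have \<sigma>: "singular_simplex p X \<sigma>" by simp
  have "simplex_map p \<phi> \<tau> = \<sigma>" if "\<tau> \<in> simplex_lifts p Y \<phi> \<sigma>" for \<tau>
    using that \<sigma> by (auto simp: simplex_lifts_def simplex_map_def singular_simplex_def extensional_def)
  then have "chain_map p \<phi> (transfer_chain p Y \<phi> (frag_of \<sigma>)) = (\<Sum>\<tau>\<in>simplex_lifts p Y \<phi> \<sigma>. frag_of \<sigma>)"
    by (simp add: chain_map_sum finite_simplex_lifts[OF \<sigma>])
  also have "\<dots> = frag_cmul (int n) (frag_of \<sigma>)"
    by (rule poly_mapping_eqI) (simp add: lookup_sum card_simplex_lifts[OF \<sigma>])
  finally show ?case .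
next
  case (diff a b) then show ?case by (simp add: transfer_chain_diff chain_map_diff frag_cmul_diff_right)
qed simp

text \<open>The \<open>n\<close> maps \<open>l i\<close> lift \<open>h\<close> and are pointwise
  distinct, so on each simplex they give \<open>n\<close> different lifts; as there are only
  \<open>n\<close> lifts, these are all of them.\<close>

lemma transfer_chain_map:
  assumes I: "finite I" "card I = n"
    and l: "\<And>i. i \<in> I \<Longrightarrow> continuous_map G Y (l i)"
    and lo: "\<And>i g. i \<in> I \<Longrightarrow> g \<in> topspace G \<Longrightarrow> \<phi> (l i g) = h g"
    and ldist: "\<And>i j g. i \<in> I \<Longrightarrow> j \<in> I \<Longrightarrow> g \<in> topspace G \<Longrightarrow> l i g = l j g \<Longrightarrow> i = j"
    and h: "continuous_map G X h" and c: "singular_chain p G c"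
  shows "transfer_chain p Y \<phi> (chain_map p h c) = (\<Sum>i\<in>I. chain_map p (l i) c)"
  using c unfolding singular_chain_def
proof (induction c rule: frag_induction)
  case (one s)
  then have s: "singular_simplex p G s" by simp
  have sim: "s t \<in> topspace G" if "t \<in> standard_simplex p" for t
    using s that by (auto simp: singular_simplex_def continuous_map_def)
  have hs: "singular_simplex p X (simplex_map p h s)" by (rule singular_simplex_simplex_map[OF s h])
  have inj: "inj_on (\<lambda>i. simplex_map p (l i) s) I"
  proof (rule inj_onI)
    fix i j assume ij: "i \<in> I" "j \<in> I" "simplex_map p (l i) s = simplex_map p (l j) s"
    obtain t where t: "t \<in> standard_simplex p" using nonempty_standard_simplex by blast
    then have "l i (s t) = l j (s t)" using fun_cong[OF ij(3), of t] by (simp add: simplex_map_def)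
    then show "i = j" using ldist ij sim[OF t] by blast
  qed
  have "(\<lambda>i. simplex_map p (l i) s) ` I = simplex_lifts p Y \<phi> (simplex_map p h s)"
  proof (rule card_subset_eq[OF finite_simplex_lifts[OF hs]])
    show "(\<lambda>i. simplex_map p (l i) s) ` I \<subseteq> simplex_lifts p Y \<phi> (simplex_map p h s)"
      using singular_simplex_simplex_map[OF s l] lo sim by (auto simp: simplex_lifts_def simplex_map_def)
    show "card ((\<lambda>i. simplex_map p (l i) s) ` I) = card (simplex_lifts p Y \<phi> (simplex_map p h s))"
      using card_simplex_lifts[OF hs] card_image[OF inj] I by simp
  qed
  then have "(\<Sum>i\<in>I. frag_of (simplex_map p (l i) s)) = transfer_chain p Y \<phi> (frag_of (simplex_map p h s))"
    using sum.reindex[OF inj, of frag_of] by (simp add: o_def)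
  then show ?case by simp
next
  case (diff a b) then show ?case by (simp add: transfer_chain_diff chain_map_diff sum_subtractf)
qed simp

text \<open>All lifts of \<open>h\<close> are homotopic to a homotopy equivalence, so the transfer inverts \<open>h\<close> up to the degree.\<close>

theorem rational_iso_of_homotopic_lifts:
  assumes n: "n > 0" and I: "finite I" "card I = n"
    and l: "\<And>i. i \<in> I \<Longrightarrow> continuous_map G Y (l i)"
    and lo: "\<And>i g. i \<in> I \<Longrightarrow> g \<in> topspace G \<Longrightarrow> \<phi> (l i g) = h g"
    and ldist: "\<And>i j g. i \<in> I \<Longrightarrow> j \<in> I \<Longrightarrow> g \<in> topspace G \<Longrightarrow> l i g = l j g \<Longrightarrow> i = j"
    and h: "continuous_map G X h"
    and m: "continuous_map G Y m" and mh: "\<And>g. g \<in> topspace G \<Longrightarrow> \<phi> (m g) = h g"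
    and lm: "\<And>i. i \<in> I \<Longrightarrow> homotopic_with (\<lambda>_. True) G Y (l i) m"
    and r: "continuous_map Y G r" and rm: "\<And>g. g \<in> topspace G \<Longrightarrow> r (m g) = g"
    and mr: "homotopic_with (\<lambda>_. True) Y Y (m \<circ> r) id"
  shows "rational_iso (homology_group p G) (homology_group p X) (hom_induced p G {} X {} h)"
proof (cases "p < 0")
  \<comment> \<open>Homology is indexed by integers; in negative degrees both groups are
    trivial.\<close>
  case True
  have "trivial_group (homology_group p G)" "trivial_group (homology_group p X)" using True by simp_all
  moreover interpret gh: group_hom "homology_group p G" "homology_group p X" "hom_induced p G {} X {} h"
    by (simp add: group_hom_def group_hom_axioms_def)
  have "hom_induced p G {} X {} h \<one>\<^bsub>homology_group p G\<^esub> = \<one>\<^bsub>homology_group p X\<^esub>"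
    by (rule gh.hom_one)
  ultimately have "hom_induced p G {} X {} h \<in> iso (homology_group p G) (homology_group p X)"
    by (simp add: iso_def bij_betw_def trivial_group_def)
  then show ?thesis by (rule rational_iso_iso) auto
next
  case False
  define q where "q = nat p"
  have q: "p = int q" using False by (simp add: q_def)
  \<comment> \<open>All lifts are homotopic to \<open>m\<close>, so on classes the sum over the
    lifts is \<open>n\<close> times \<open>m\<close>.\<close>
  have sum_l: "homologous_rel q Y {} (\<Sum>i\<in>I. chain_map q (l i) z) (frag_cmul (int n) (chain_map q m z))"
    if z: "singular_relcycle q G {} z" for z
  proof -
    have "homologous_rel q Y {} (\<Sum>i\<in>I. chain_map q (l i) z) (\<Sum>i\<in>I. chain_map q m z)"
      using I by (intro homologous_rel_sum homotopic_imp_homologous_rel_chain_maps[OF _ z] )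
        (auto intro!: lm homotopic_with_mono[OF lm])
    also have "(\<Sum>i\<in>I. chain_map q m z) = frag_cmul (int n) (chain_map q m z)"
      by (rule poly_mapping_eqI) (simp add: lookup_sum I)
    finally show ?thesis .
  qed
  \<comment> \<open>The transfer of a chain bounded by the image of \<open>z\<close> bounds
    \<open>n\<close> times the image of \<open>z\<close> under \<open>m\<close>; applying
    \<open>r\<close>, a left inverse of \<open>m\<close>, returns to \<open>G\<close>.\<close>
  have ker: "singular_relboundary q G {} (frag_cmul (int n) z)"
    if z: "singular_relcycle q G {} z" and b: "singular_relboundary q X {} (chain_map q h z)" for z
  proof -
    have zc: "singular_chain q G z" using z by (simp add: singular_cycle)
    obtain d where d: "singular_chain (Suc q) X d" "chain_boundary (Suc q) d = chain_map q h z"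
      using b by (auto simp: singular_boundary)
    have "transfer_chain q Y \<phi> (chain_map q h z) = chain_boundary (Suc q) (transfer_chain (Suc q) Y \<phi> d)"
      using chain_boundary_transfer[OF d(1)] d(2) by simp
    then have "singular_relboundary q Y {} (\<Sum>i\<in>I. chain_map q (l i) z)"
      using transfer_chain_map[OF I l lo ldist h zc] singular_chain_transfer[OF d(1)]
      by (auto simp: singular_boundary)
    with sum_l[OF z] have "singular_relboundary q Y {} (frag_cmul (int n) (chain_map q m z))"
      by (metis homologous_rel_eq homologous_rel_eq_relboundary)
    then have "singular_relboundary q G {} (chain_map q r (frag_cmul (int n) (chain_map q m z)))"
      by (rule singular_relboundary_chain_map[OF _ r]) auto
    moreover have "chain_map q r (chain_map q m z) = z"
      using chain_map_id_gen[OF zc, of "r \<circ> m"] rm by (simp add: chain_map_compose)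
    ultimately show ?thesis by simp
  qed
  \<comment> \<open>The preimage of \<open>n\<close> times \<open>c\<close> is the transfer of
    \<open>c\<close> pushed down by \<open>r\<close>: up to homotopy \<open>m\<close> after
    \<open>r\<close> is the identity, and \<phi> after the transfer is multiplication by
    \<open>n\<close>.\<close>
  have coker: "\<exists>z. singular_relcycle q G {} z \<and> homologous_rel q X {} (chain_map q h z) (frag_cmul (int n) c)"
    if c: "singular_relcycle q X {} c" for c
  proof -
    let ?t = "transfer_chain q Y \<phi> c"
    have cc: "singular_chain q X c" and cb: "chain_boundary q c = 0" using c by (auto simp: singular_cycle)
    have t: "singular_relcycle q Y {} ?t"
      using chain_boundary_transfer[OF cc] cb singular_chain_transfer[OF cc] by (simp add: singular_cycle)
    let ?z = "chain_map q r ?t"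
    have z: "singular_relcycle q G {} ?z" by (rule singular_relcycle_chain_map[OF t r]) auto
    have "homologous_rel q Y {} (chain_map q (m \<circ> r) ?t) (chain_map q id ?t)"
      by (rule homotopic_imp_homologous_rel_chain_maps[OF _ t]) (use mr in simp)
    moreover have "chain_map q id ?t = ?t" by (rule chain_map_ident[OF singular_chain_transfer[OF cc]])
    moreover have "chain_map q (m \<circ> r) ?t = chain_map q m ?z" by (simp add: chain_map_compose)
    ultimately have "singular_relboundary q Y {} (chain_map q m ?z - ?t)"
      by (simp only: homologous_rel_def)
    then have "singular_relboundary q X {} (chain_map q \<phi> (chain_map q m ?z - ?t))"
      using singular_relboundary_chain_map[OF _ lifts_continuous, of q "{}" _ "{}"] by simp
    then have "homologous_rel q X {} (chain_map q \<phi> (chain_map q m ?z)) (chain_map q \<phi> ?t)"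
      by (simp add: homologous_rel_def chain_map_diff)
    moreover have "chain_map q \<phi> (chain_map q m ?z) = chain_map q h ?z"
      using chain_map_eq[of q G ?z "\<phi> \<circ> m" h] mh z by (simp add: chain_map_compose singular_cycle)
    ultimately show ?thesis using z chain_map_transfer[OF cc] by auto
  qed
  show ?thesis
    unfolding rational_iso_def q
  proof (intro conjI ballI impI)
    fix x assume x: "x \<in> carrier (homology_group (int q) G)"
      and x1: "hom_induced (int q) G {} X {} h x = \<one>\<^bsub>homology_group (int q) X\<^esub>"
    then obtain z where z: "singular_relcycle q G {} z" "x = homologous_rel_set q G {} z"
      by (auto simp: carrier_relative_homology_group)
    have "singular_relboundary q X {} (chain_map q h z)"
      using x1 hom_induced_chain_map[OF h _ z(1)] z(2) homology_class_eq_one by auto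
    then have "x [^]\<^bsub>homology_group (int q) G\<^esub> n = \<one>\<^bsub>homology_group (int q) G\<^esub>"
      using ker[OF z(1)] homology_class_pow[OF z(1), of n] homology_class_eq_one z(2) by metis
    then show "\<exists>n>0. x [^]\<^bsub>homology_group (int q) G\<^esub> (n::nat) = \<one>\<^bsub>homology_group (int q) G\<^esub>" using n by blast
  next
    fix y assume "y \<in> carrier (homology_group (int q) X)"
    then obtain c where c: "singular_relcycle q X {} c" "y = homologous_rel_set q X {} c"
      by (auto simp: carrier_relative_homology_group)
    obtain z where z: "singular_relcycle q G {} z" "homologous_rel q X {} (chain_map q h z) (frag_cmul (int n) c)"
      using coker[OF c(1)] by blast
    have "hom_induced (int q) G {} X {} h (homologous_rel_set q G {} z) = y [^]\<^bsub>homology_group (int q) X\<^esub> n"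
      using hom_induced_chain_map[OF h _ z(1), of "{}"] z(2) homology_class_pow[OF c(1), of n] c(2)
      by (simp add: homologous_rel_set_eq)
    then show "\<exists>n>0. \<exists>x\<in>carrier (homology_group (int q) G). hom_induced (int q) G {} X {} h x = y [^]\<^bsub>homology_group (int q) X\<^esub> (n::nat)"
      using n imageI[of z "singular_relcycle_set q G {}" "homologous_rel_set q G {}"] z(1)
      unfolding carrier_relative_homology_group by blast
  qed simp
qed

end

section \<open>Finite coverings and unique lifting of simplices\<close>

definition evenly_covers :: "nat \<Rightarrow> 'y::real_normed_vector set \<Rightarrow> ('y \<Rightarrow> 'x) \<Rightarrow> 'x topology \<Rightarrow> bool" where
  "evenly_covers n Y \<phi> X \<longleftrightarrow> continuous_map (top_of_set Y) X \<phi> \<and>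
     (\<forall>x\<in>topspace X. \<exists>T V. openin X T \<and> x \<in> T \<and> finite V \<and> card V = n \<and> pairwise disjnt V \<and>
        \<Union>V = {y \<in> Y. \<phi> y \<in> T} \<and>
        (\<forall>v\<in>V. openin (top_of_set Y) v \<and> (\<exists>\<psi>. homeomorphic_maps (top_of_set v) (subtopology X T) \<phi> \<psi>)))"

text \<open>The base \<open>X\<close> is an abstract topology, since the projectivised space is a
  quotient. Pulling the covering back along a map from a subset \<open>K\<close> of a topological
  space gives a covering of \<open>K\<close>, to which the lifting theorems apply.\<close>

lemma covering_space_pullback:
  fixes Y :: "'y::real_normed_vector set" and K :: "'c::topological_space set"
  assumes cov: "evenly_covers n Y \<phi> X" and n: "n > 0" and s: "continuous_map (top_of_set K) X s"
  shows "covering_space {(k, y). k \<in> K \<and> y \<in> Y \<and> s k = \<phi> y} fst K"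
proof
  let ?E = "{(k, y). k \<in> K \<and> y \<in> Y \<and> s k = \<phi> y}"
  have even: "\<exists>T V. openin X T \<and> x \<in> T \<and> finite V \<and> card V = n \<and> pairwise disjnt V \<and>
        \<Union>V = {y \<in> Y. \<phi> y \<in> T} \<and>
        (\<forall>v\<in>V. openin (top_of_set Y) v \<and> (\<exists>\<psi>. homeomorphic_maps (top_of_set v) (subtopology X T) \<phi> \<psi>))"
    if "x \<in> topspace X" for x
    using cov that unfolding evenly_covers_def by blast
  have sK: "s k \<in> topspace X" if "k \<in> K" for k
    using s that by (auto simp: continuous_map_def)
  show "continuous_on ?E fst" by (intro continuous_intros)
  show "fst ` ?E = K"
  proof
    show "K \<subseteq> fst ` ?E"
    proof
      fix k assume k: "k \<in> K"
      obtain T V where TV: "openin X T" "s k \<in> T" "finite V" "card V = n" "\<Union>V = {y \<in> Y. \<phi> y \<in> T}"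
        "\<forall>v\<in>V. openin (top_of_set Y) v \<and> (\<exists>\<psi>. homeomorphic_maps (top_of_set v) (subtopology X T) \<phi> \<psi>)"
        using even[OF sK[OF k]] by blast
      obtain v where v: "v \<in> V" using TV n by fastforce
      then obtain \<psi> where \<psi>: "homeomorphic_maps (top_of_set v) (subtopology X T) \<phi> \<psi>" using TV by blast
      have "\<psi> (s k) \<in> v" "\<phi> (\<psi> (s k)) = s k"
        using \<psi> TV(2) sK[OF k] by (auto simp: homeomorphic_maps_def continuous_map_def)
      then show "k \<in> fst ` ?E" using TV(5) v k by (force intro!: image_eqI[of _ _ "(k, \<psi> (s k))"])
    qed
  qed auto
  fix k assume k: "k \<in> K"
  obtain T V where TV: "openin X T" "s k \<in> T" "pairwise disjnt V" "\<Union>V = {y \<in> Y. \<phi> y \<in> T}"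
    "\<forall>v\<in>V. openin (top_of_set Y) v \<and> (\<exists>\<psi>. homeomorphic_maps (top_of_set v) (subtopology X T) \<phi> \<psi>)"
    using even[OF sK[OF k]] by blast
  let ?T = "{k \<in> K. s k \<in> T}"
  let ?u = "\<lambda>v. ?E \<inter> snd -` v"
  show "\<exists>T. k \<in> T \<and> openin (top_of_set K) T \<and>
      (\<exists>v. \<Union>v = ?E \<inter> fst -` T \<and> (\<forall>u\<in>v. openin (top_of_set ?E) u) \<and> pairwise disjnt v \<and>
         (\<forall>u\<in>v. \<exists>q. homeomorphism u T fst q))"
  proof (intro exI[of _ ?T] conjI exI[of _ "?u ` V"] ballI)
    show "k \<in> ?T" using k TV by simp
    show "openin (top_of_set K) ?T" using openin_continuous_map_preimage[OF s TV(1)] by simp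
    show "\<Union> (?u ` V) = ?E \<inter> fst -` ?T" using TV(4) by (auto simp: set_eq_iff)
    show "pairwise disjnt (?u ` V)"
      using TV(3) by (auto simp: pairwise_def disjnt_def)
    fix u assume "u \<in> ?u ` V"
    then obtain v where v: "v \<in> V" "u = ?u v" by blast
    then obtain \<psi> where \<psi>: "homeomorphic_maps (top_of_set v) (subtopology X T) \<phi> \<psi>" and ov: "openin (top_of_set Y) v"
      using TV by blast
    have vY: "v \<subseteq> Y" using ov openin_imp_subset by blast
    obtain W where W: "open W" "v = Y \<inter> W" using ov by (auto simp: openin_open)
    have u: "u = ?E \<inter> ((UNIV :: 'c set) \<times> W)" using v(2) W(2) by auto
    have "open ((UNIV :: 'c set) \<times> W)" using W(1) by (intro open_Times) auto
    then show "openin (top_of_set ?E) u" unfolding u by (rule openin_open_Int)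
    have \<psi>s: "continuous_on ?T (\<lambda>k. \<psi> (s k))" and \<psi>v: "\<And>k. k \<in> ?T \<Longrightarrow> \<psi> (s k) \<in> v"
    proof -
      have 1: "continuous_map (top_of_set ?T) (subtopology X T) s"
        unfolding continuous_map_in_subtopology
      proof
        show "continuous_map (top_of_set ?T) X s" by (rule continuous_map_from_subtopology_mono[OF s]) blast
        show "s \<in> topspace (top_of_set ?T) \<rightarrow> T" by simp
      qed
      have 2: "continuous_map (subtopology X T) (top_of_set v) \<psi>" using \<psi> by (simp add: homeomorphic_maps_def)
      have "continuous_map (top_of_set ?T) (top_of_set v) (\<psi> \<circ> s)" by (rule continuous_map_compose[OF 1 2])
      then have 3: "continuous_on ?T (\<psi> \<circ> s)" "(\<psi> \<circ> s) \<in> ?T \<rightarrow> v"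
        by (simp_all only: continuous_map_in_subtopology continuous_map_iff_continuous topspace_euclidean_subtopology)
      then show "continuous_on ?T (\<lambda>k. \<psi> (s k))" by (simp only: o_def)
      show "\<psi> (s k) \<in> v" if "k \<in> ?T" for k using funcset_mem[OF 3(2) that] by (simp only: o_apply)
    qed
    have \<phi>\<psi>: "\<phi> (\<psi> (s k)) = s k" if "k \<in> ?T" for k
      using \<psi> that sK by (auto simp: homeomorphic_maps_def)
    have \<psi>\<phi>: "\<psi> (\<phi> y) = y" if "y \<in> v" for y
      using \<psi> that by (auto simp: homeomorphic_maps_def)
    \<comment> \<open>Over \<open>?T\<close> the sheet is the graph of \<open>s\<close> followed by
      the local inverse of \<phi>.\<close>
    show "\<exists>q. homeomorphism u ?T fst q"
    proof (intro exI[of _ "\<lambda>k. (k, \<psi> (s k))"] homeomorphismI)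
      show "continuous_on ?T (\<lambda>k. (k, \<psi> (s k)))" by (intro continuous_intros \<psi>s)
      show "fst ` u \<subseteq> ?T" using TV(4) v by auto
      show "(\<lambda>k. (k, \<psi> (s k))) ` ?T \<subseteq> u" using v(2) \<phi>\<psi> \<psi>v vY by auto
      show "(\<lambda>k. (k, \<psi> (s k))) (fst x) = x" if "x \<in> u" for x
        using that v \<psi>\<phi> by auto
    qed (auto intro!: continuous_intros)
  qed
qed

text \<open>The fibre meets each of the \<open>n\<close> sheets in exactly one point.\<close>

lemma evenly_covers_fibre:
  assumes cov: "evenly_covers n Y \<phi> X" and x: "x \<in> topspace X"
  shows "finite {y \<in> Y. \<phi> y = x}" "card {y \<in> Y. \<phi> y = x} = n"
proof -
  have "\<exists>T V. openin X T \<and> x \<in> T \<and> finite V \<and> card V = n \<and> pairwise disjnt V \<and>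
        \<Union>V = {y \<in> Y. \<phi> y \<in> T} \<and>
        (\<forall>v\<in>V. openin (top_of_set Y) v \<and> (\<exists>\<psi>. homeomorphic_maps (top_of_set v) (subtopology X T) \<phi> \<psi>))"
    using cov x unfolding evenly_covers_def by blast
  then obtain T V where TV: "openin X T" "x \<in> T" "finite V" "card V = n" "pairwise disjnt V" "\<Union>V = {y \<in> Y. \<phi> y \<in> T}"
    "\<forall>v\<in>V. openin (top_of_set Y) v \<and> (\<exists>\<psi>. homeomorphic_maps (top_of_set v) (subtopology X T) \<phi> \<psi>)"
    by (elim exE conjE) (rule that)
  have "\<forall>v\<in>V. \<exists>\<psi>. homeomorphic_maps (top_of_set v) (subtopology X T) \<phi> \<psi>" using TV(7) by blast
  then obtain \<psi> where "\<forall>v\<in>V. homeomorphic_maps (top_of_set v) (subtopology X T) \<phi> (\<psi> v)"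
    by (rule bchoice[THEN exE])
  then have \<psi>: "\<And>v. v \<in> V \<Longrightarrow> homeomorphic_maps (top_of_set v) (subtopology X T) \<phi> (\<psi> v)" by blast
  have 1: "\<psi> v x \<in> v" "\<phi> (\<psi> v x) = x" if "v \<in> V" for v
    using \<psi>[OF that] TV(2) x by (auto simp: homeomorphic_maps_def continuous_map_def)
  have 2: "y = \<psi> v x" if "v \<in> V" "y \<in> v" "\<phi> y = x" for v y
    using \<psi>[OF that(1)] that by (auto simp: homeomorphic_maps_def)
  have "bij_betw (\<lambda>v. \<psi> v x) V {y \<in> Y. \<phi> y = x}"
    unfolding bij_betw_def
  proof
    show "inj_on (\<lambda>v. \<psi> v x) V"
      using 1 TV(5) by (intro inj_onI) (metis disjnt_iff pairwiseD)
    show "(\<lambda>v. \<psi> v x) ` V = {y \<in> Y. \<phi> y = x}"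
    proof
      show "(\<lambda>v. \<psi> v x) ` V \<subseteq> {y \<in> Y. \<phi> y = x}" using 1 TV(6) by blast
      show "{y \<in> Y. \<phi> y = x} \<subseteq> (\<lambda>v. \<psi> v x) ` V"
      proof
        fix y assume y: "y \<in> {y \<in> Y. \<phi> y = x}"
        then have "y \<in> \<Union>V" unfolding TV(6) using TV(2) by simp
        then obtain v where "v \<in> V" "y \<in> v" by blast
        then show "y \<in> (\<lambda>v. \<psi> v x) ` V" using 2 y by blast
      qed
    qed
  qed
  then show "finite {y \<in> Y. \<phi> y = x}" "card {y \<in> Y. \<phi> y = x} = n"
    using TV by (auto simp: bij_betw_finite bij_betw_same_card)
qed

text \<open>The library lifts maps between normed spaces, so the simplex is embedded in the bounded sequences.\<close>

definition unit_sequence :: "nat \<Rightarrow> (nat \<Rightarrow>\<^sub>C real)" where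
  "unit_sequence i = Bcontfun (\<lambda>j. if j = i then 1 else 0)"

definition embed_simplex :: "nat \<Rightarrow> (nat \<Rightarrow> real) \<Rightarrow> (nat \<Rightarrow>\<^sub>C real)" where
  "embed_simplex p x = (\<Sum>i\<le>p. x i *\<^sub>R unit_sequence i)"

lemma apply_unit_sequence [simp]: "apply_bcontfun (unit_sequence i) j = (if j = i then 1 else 0)"
proof -
  have "(\<lambda>j. if j = i then 1 else 0 :: real) \<in> bcontfun"
    by (rule bcontfun_normI[where b = 1]) (auto simp: continuous_on_discrete)
  then show ?thesis by (simp add: unit_sequence_def Bcontfun_inverse)
qed

lemma apply_embed_simplex: "apply_bcontfun (embed_simplex p x) j = (if j \<le> p then x j else 0)"
proof -
  have "apply_bcontfun (\<Sum>i\<in>A. x i *\<^sub>R unit_sequence i) j = (\<Sum>i\<in>A. if j = i then x i else 0)" if "finite A" for A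
    using that by (induction A rule: finite_induct) (auto simp: plus_bcontfun.rep_eq scaleR_bcontfun.rep_eq zero_bcontfun.rep_eq)
  then show ?thesis by (simp add: embed_simplex_def)
qed

lemma apply_embed_simplex_id: "x \<in> standard_simplex p \<Longrightarrow> apply_bcontfun (embed_simplex p x) = x"
  by (auto simp: apply_embed_simplex standard_simplex_def fun_eq_iff)

lemma continuous_on_embed_simplex: "continuous_on S (embed_simplex p)"
  unfolding embed_simplex_def
  by (intro continuous_intros continuous_on_product_coordinates[THEN continuous_on_subset]) auto

lemma convex_embed_simplex: "convex (embed_simplex p ` standard_simplex p)"
  unfolding convex_alt
proof clarify
  fix x y u assume xy: "x \<in> standard_simplex p" "y \<in> standard_simplex p" "(0::real) \<le> u" "u \<le> 1"
  have "(1 - u) *\<^sub>R embed_simplex p x + u *\<^sub>R embed_simplex p y = embed_simplex p (\<lambda>i. (1 - u) * x i + u * y i)"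
    by (rule bcontfun_eqI) (simp add: plus_bcontfun.rep_eq scaleR_bcontfun.rep_eq apply_embed_simplex)
  then show "(1 - u) *\<^sub>R embed_simplex p x + u *\<^sub>R embed_simplex p y \<in> embed_simplex p ` standard_simplex p"
    using convex_standard_simplex[OF xy] by auto
qed

text \<open>Provides the continuous inverse of \<open>embed_simplex\<close>: the uniform norm
  dominates every coordinate.\<close>

lemma continuous_on_apply_bcontfun_fun: "continuous_on S (\<lambda>f :: nat \<Rightarrow>\<^sub>C real. apply_bcontfun f)"
proof (rule continuous_on_coordinatewise_then_product)
  fix i
  have "dist (apply_bcontfun f i) (apply_bcontfun g i) \<le> dist f g" for f g :: "nat \<Rightarrow>\<^sub>C real"
    by (rule dist_bounded)
  then show "continuous_on S (\<lambda>f :: nat \<Rightarrow>\<^sub>C real. apply_bcontfun f i)"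
    unfolding continuous_on_iff by (meson le_less_trans)
qed

lemma singular_simplex_top_of_set:
  "singular_simplex p (top_of_set Y) \<tau> \<longleftrightarrow>
     continuous_on (standard_simplex p) \<tau> \<and> \<tau> ` standard_simplex p \<subseteq> Y \<and> \<tau> \<in> extensional (standard_simplex p)"
  by (auto simp: singular_simplex_def euclidean_product_topology continuous_map_in_subtopology)

text \<open>Evaluation at one point of the simplex is a bijection from lifts to the fibre there:
  injective because the simplex is connected, surjective because its embedded copy is convex, hence
  simply connected and locally path connected.\<close>

theorem evenly_covers_imp_lifts_simplices:
  fixes Y :: "'y::real_normed_vector set"
  assumes cov: "evenly_covers n Y \<phi> X" and n: "n > 0"
  shows "lifts_simplices n (top_of_set Y) \<phi> X"
  unfolding lifts_simplices_def
proof (intro conjI allI impI)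
  show "continuous_map (top_of_set Y) X \<phi>" using cov by (simp add: evenly_covers_def)
  fix p \<sigma> assume \<sigma>: "singular_simplex p X \<sigma>"
  let ?D = "standard_simplex p"
  let ?K = "embed_simplex p ` ?D"
  let ?s = "\<sigma> \<circ> apply_bcontfun"
  let ?E = "{(k, y). k \<in> ?K \<and> y \<in> Y \<and> ?s k = \<phi> y}"
  let ?L = "simplex_lifts p (top_of_set Y) \<phi> \<sigma>"
  have "continuous_map (top_of_set ?K) (top_of_set ?D) apply_bcontfun"
    by (auto simp: continuous_map_in_subtopology continuous_on_apply_bcontfun_fun apply_embed_simplex_id)
  moreover have "continuous_map (top_of_set ?D) X \<sigma>"
    using \<sigma> by (simp add: singular_simplex_def euclidean_product_topology)
  ultimately have s: "continuous_map (top_of_set ?K) X ?s" by (rule continuous_map_compose)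
  have cs: "covering_space ?E fst ?K" by (rule covering_space_pullback[OF cov n s])
  have E: "(embed_simplex p t, \<tau> t) \<in> ?E" if "\<tau> \<in> ?L" "t \<in> ?D" for \<tau> t
    using that by (auto simp: simplex_lifts_def singular_simplex_top_of_set apply_embed_simplex_id)
  have uniq: "\<tau> = \<tau>'" if \<tau>: "\<tau> \<in> ?L" "\<tau>' \<in> ?L" and t: "t \<in> ?D" "\<tau> t = \<tau>' t" for \<tau> \<tau>' t
  proof -
    have c: "continuous_on ?D \<tau>" "continuous_on ?D \<tau>'" "\<tau> \<in> extensional ?D" "\<tau>' \<in> extensional ?D"
      using \<tau> by (auto simp: simplex_lifts_def singular_simplex_top_of_set)
    have con: "connected ?D"
      using connectedin_standard_simplex[of p] by (simp add: euclidean_product_topology)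
    have "(embed_simplex p u, \<tau> u) = (embed_simplex p u, \<tau>' u)" if u: "u \<in> ?D" for u
      by (rule covering_space_lift_unique[OF cs, of "\<lambda>t. (embed_simplex p t, \<tau> t)" t "\<lambda>t. (embed_simplex p t, \<tau>' t)" ?D "embed_simplex p"])
        (use t E[OF \<tau>(1)] E[OF \<tau>(2)] con u c in \<open>auto intro!: continuous_intros continuous_on_embed_simplex\<close>)
    then show ?thesis using c by (metis extensionalityI prod.inject)
  qed
  have ex: "\<exists>\<tau>\<in>?L. \<tau> t = y" if t: "t \<in> ?D" and y: "y \<in> Y" "\<phi> y = \<sigma> t" for t y
  proof -
    obtain g where g: "continuous_on ?K g" "g \<in> ?K \<rightarrow> ?E" "g (embed_simplex p t) = (embed_simplex p t, y)"
      "\<And>k. k \<in> ?K \<Longrightarrow> fst (g k) = id k"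
    proof (rule covering_space_lift_strong[OF cs, of "(embed_simplex p t, y)" "embed_simplex p t" ?K id])
      show "simply_connected ?K" by (rule convex_imp_simply_connected[OF convex_embed_simplex])
      show "locally path_connected ?K" by (rule convex_imp_locally_path_connected[OF convex_embed_simplex])
      show "(embed_simplex p t, y) \<in> ?E" using t y by (simp add: apply_embed_simplex_id)
      show "embed_simplex p t \<in> ?K" using t by simp
      show "continuous_on ?K id" by simp
      show "id \<in> ?K \<rightarrow> ?K" by simp
      show "id (embed_simplex p t) = fst (embed_simplex p t, y)" by simp
    qed (rule that)
    define \<tau> where "\<tau> = restrict (\<lambda>u. snd (g (embed_simplex p u))) ?D"
    have "continuous_on ?D (\<lambda>u. g (embed_simplex p u))"
      by (rule continuous_on_compose2[OF g(1) continuous_on_embed_simplex]) auto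
    then have "continuous_on ?D (\<lambda>u. snd (g (embed_simplex p u)))" by (intro continuous_intros)
    then have "continuous_on ?D \<tau>" by (rule continuous_on_eq) (simp add: \<tau>_def)
    moreover have "\<tau> u \<in> Y \<and> \<phi> (\<tau> u) = \<sigma> u" if u: "u \<in> ?D" for u
    proof -
      have "g (embed_simplex p u) \<in> ?E" by (rule funcset_mem[OF g(2)]) (use u in blast)
      moreover have "fst (g (embed_simplex p u)) = embed_simplex p u" using g(4) u by simp
      ultimately show ?thesis using u by (auto simp: \<tau>_def apply_embed_simplex_id)
    qed
    ultimately have "\<tau> \<in> ?L" by (auto simp: simplex_lifts_def singular_simplex_top_of_set \<tau>_def)
    moreover have "\<tau> t = y" using t g(3) by (simp add: \<tau>_def)
    ultimately show ?thesis by blast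
  qed
  obtain t where t: "t \<in> ?D" using nonempty_standard_simplex by blast
  have st: "\<sigma> t \<in> topspace X" using \<sigma> t by (auto simp: singular_simplex_def continuous_map_def)
  have "bij_betw (\<lambda>\<tau>. \<tau> t) ?L {y \<in> Y. \<phi> y = \<sigma> t}"
    unfolding bij_betw_def
  proof
    show "inj_on (\<lambda>\<tau>. \<tau> t) ?L" using uniq t by (auto intro!: inj_onI)
    show "(\<lambda>\<tau>. \<tau> t) ` ?L = {y \<in> Y. \<phi> y = \<sigma> t}"
    proof
      show "(\<lambda>\<tau>. \<tau> t) ` ?L \<subseteq> {y \<in> Y. \<phi> y = \<sigma> t}"
        using t by (auto simp: simplex_lifts_def singular_simplex_top_of_set)
      show "{y \<in> Y. \<phi> y = \<sigma> t} \<subseteq> (\<lambda>\<tau>. \<tau> t) ` ?L" using ex[OF t] by blast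
    qed
  qed
  then show "finite ?L" "card ?L = n"
    using evenly_covers_fibre[OF cov st] by (auto simp: bij_betw_finite bij_betw_same_card)
  show "\<forall>\<tau>\<in>?L. \<forall>\<tau>'\<in>?L. \<forall>t\<in>?D. \<tau> t = \<tau>' t \<longrightarrow> \<tau> = \<tau>'" using uniq by blast
qed

text \<open>Disjoint neighbourhoods on which \<phi> is injective are chosen around the
  \<open>n\<close> points of a fibre, and \<open>T\<close> is the intersection of their images. A
  point of \<open>T\<close> has a preimage in each neighbourhood; as its fibre has \<open>n\<close>
  points, there is no other preimage.\<close>

lemma open_map_imp_evenly_covers:
  fixes Y :: "'y::real_normed_vector set"
  assumes cont: "continuous_map (top_of_set Y) X \<phi>"
    and opn: "\<And>W. openin (top_of_set Y) W \<Longrightarrow> openin X (\<phi> ` W)"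
    and inj: "\<And>y. y \<in> Y \<Longrightarrow> \<exists>W. openin (top_of_set Y) W \<and> y \<in> W \<and> inj_on \<phi> W"
    and fib: "\<And>x. x \<in> topspace X \<Longrightarrow> finite {y \<in> Y. \<phi> y = x} \<and> card {y \<in> Y. \<phi> y = x} = n" and n: "n > 0"
  shows "evenly_covers n Y \<phi> X"
  unfolding evenly_covers_def
proof (intro conjI ballI cont)
  fix x assume x: "x \<in> topspace X"
  let ?F = "{y \<in> Y. \<phi> y = x}"
  have F: "finite ?F" "card ?F = n" using fib[OF x] by auto
  obtain W where W: "\<And>y. y \<in> ?F \<Longrightarrow> openin (top_of_set Y) (W y) \<and> y \<in> W y \<and> inj_on \<phi> (W y)"
    using inj by (metis (mono_tags, lifting) mem_Collect_eq)
  have "\<exists>d>0. \<forall>y\<in>?F. \<forall>z\<in>?F. y \<noteq> z \<longrightarrow> d \<le> dist y z"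
    using finite_set_avoid
  proof -
    have "\<exists>d>0. \<forall>z\<in>?F. z \<noteq> y \<longrightarrow> d \<le> dist y z" for y using finite_set_avoid[OF F(1), of y] by blast
    then obtain d where d: "\<And>y. d y > 0" "\<And>y z. z \<in> ?F \<Longrightarrow> z \<noteq> y \<Longrightarrow> d y \<le> dist y z" by metis
    show ?thesis
    proof (cases "?F = {}")
      case False
      show ?thesis
      proof (intro exI[of _ "Min (d ` ?F)"] conjI ballI impI)
        show "0 < Min (d ` ?F)" using F False d by (subst Min_gr_iff) auto
        fix y z assume yz: "y \<in> ?F" "z \<in> ?F" "y \<noteq> z"
        have "Min (d ` ?F) \<le> d y" using F yz by (intro Min_le) auto
        also have "\<dots> \<le> dist y z" using d(2)[of z y] yz by simp
        finally show "Min (d ` ?F) \<le> dist y z" .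
      qed
    qed (auto intro: exI[of _ 1])
  qed
  then obtain d where d: "d > 0" "\<And>y z. y \<in> ?F \<Longrightarrow> z \<in> ?F \<Longrightarrow> y \<noteq> z \<Longrightarrow> d \<le> dist y z" by blast
  \<comment> \<open>Half of the minimal distance in the fibre keeps the balls disjoint.\<close>
  define B where "B y = W y \<inter> ball y (d/2)" for y
  have B: "openin (top_of_set Y) (B y)" "y \<in> B y" "inj_on \<phi> (B y)" if "y \<in> ?F" for y
    using W[OF that] d(1) unfolding B_def
    by (auto intro: openin_Int_open inj_on_subset)
  have Bdisj: "B y \<inter> B z = {}" if "y \<in> ?F" "z \<in> ?F" "y \<noteq> z" for y z
  proof -
    have "d \<le> dist y z" by (rule d(2)[OF that])
    moreover have "dist y z < d" if "x \<in> B y" "x \<in> B z" for x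
      using that dist_triangle[of y z x] by (auto simp: B_def dist_commute)
    ultimately show ?thesis by force
  qed
  have Fne: "?F \<noteq> {}" using F n by force
  define T where "T = (\<Inter>y\<in>?F. \<phi> ` B y)"
  have T: "openin X T" unfolding T_def using F(1) Fne opn[OF B(1)] by (intro openin_INT2) auto
  have xT: "x \<in> T" unfolding T_def using B(2) by force
  define C where "C y = B y \<inter> {z \<in> Y. \<phi> z \<in> T}" for y
  have BY: "B y \<subseteq> Y" if "y \<in> ?F" for y using B(1)[OF that] openin_imp_subset by blast
  have C: "openin (top_of_set Y) (C y)" if "y \<in> ?F" for y
    unfolding C_def using openin_continuous_map_preimage[OF cont T] by (intro openin_Int B(1) that) simp
  have Cinj: "inj_on \<phi> (C y)" if "y \<in> ?F" for y
    using B(3)[OF that] by (rule inj_on_subset) (auto simp: C_def)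
  have Cim: "\<phi> ` C y = T" if "y \<in> ?F" for y
  proof
    show "\<phi> ` C y \<subseteq> T" by (auto simp: C_def)
    show "T \<subseteq> \<phi> ` C y"
    proof
      fix t assume t: "t \<in> T"
      then have "t \<in> \<phi> ` B y" using that unfolding T_def by blast
      then obtain z where "z \<in> B y" "t = \<phi> z" by blast
      then show "t \<in> \<phi> ` C y" using t BY[OF that] unfolding C_def by blast
    qed
  qed
  have Cdisj: "C y \<inter> C z = {}" if "y \<in> ?F" "z \<in> ?F" "y \<noteq> z" for y z
    using Bdisj[OF that] by (auto simp: C_def)
  have yC: "y \<in> C y" if "y \<in> ?F" for y using B(2)[OF that] that xT by (auto simp: C_def)
  have injC: "inj_on C ?F"
  proof (rule inj_onI, rule ccontr)
    fix y z assume yz: "y \<in> ?F" "z \<in> ?F" "C y = C z" "y \<noteq> z"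
    show False using Cdisj[OF yz(1,2,4)] yC[OF yz(1)] yz(3) by auto
  qed
  have TX: "T \<subseteq> topspace X" using T openin_subset by blast
  have cover: "\<Union> (C ` ?F) = {y \<in> Y. \<phi> y \<in> T}"
  proof
    show "\<Union> (C ` ?F) \<subseteq> {y \<in> Y. \<phi> y \<in> T}" by (auto simp: C_def)
    show "{y \<in> Y. \<phi> y \<in> T} \<subseteq> \<Union> (C ` ?F)"
    proof clarify
      fix z assume z: "z \<in> Y" "\<phi> z \<in> T"
      let ?Fz = "{y \<in> Y. \<phi> y = \<phi> z}"
      have Fz: "finite ?Fz" "card ?Fz = n" using fib[of "\<phi> z"] z TX by auto
      \<comment> \<open>One preimage of \<open>\<phi> z\<close> is picked in each sheet; being
        \<open>n\<close> distinct points, they exhaust the fibre, so \<open>z\<close> is among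
        them.\<close>
      have "\<exists>w. w \<in> C y \<and> \<phi> w = \<phi> z" if "y \<in> ?F" for y
        using Cim[OF that] z(2) by force
      then have "\<forall>y\<in>?F. \<exists>w. w \<in> C y \<and> \<phi> w = \<phi> z" by blast
      then obtain w where "\<forall>y\<in>?F. w y \<in> C y \<and> \<phi> (w y) = \<phi> z" by (rule bchoice[THEN exE])
      then have w: "\<And>y. y \<in> ?F \<Longrightarrow> w y \<in> C y \<and> \<phi> (w y) = \<phi> z" by blast
      have "inj_on w ?F"
      proof (rule inj_onI, rule ccontr)
        fix y z assume yz: "y \<in> ?F" "z \<in> ?F" "w y = w z" "y \<noteq> z"
        show False using Cdisj[OF yz(1,2,4)] w[OF yz(1)] w[OF yz(2)] yz(3) by auto
      qed
      then have "card (w ` ?F) = n" using F(2) by (simp add: card_image)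
      moreover have "w ` ?F \<subseteq> ?Fz" using w by (auto simp: C_def)
      ultimately have "w ` ?F = ?Fz" using Fz by (intro card_subset_eq) auto
      then have "z \<in> w ` ?F" using z by simp
      then obtain y where "y \<in> ?F" "z = w y" by blast
      then show "z \<in> \<Union> (C ` ?F)" using w by auto
    qed
  qed
  show "\<exists>T V. openin X T \<and> x \<in> T \<and> finite V \<and> card V = n \<and> pairwise disjnt V \<and>
        \<Union>V = {y \<in> Y. \<phi> y \<in> T} \<and>
        (\<forall>v\<in>V. openin (top_of_set Y) v \<and> (\<exists>\<psi>. homeomorphic_maps (top_of_set v) (subtopology X T) \<phi> \<psi>))"
  proof (intro exI[of _ T] exI[of _ "C ` ?F"] conjI ballI T xT cover)
    show "finite (C ` ?F)" using F by simp
    show "card (C ` ?F) = n" using F card_image[OF injC] by simp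
    show "pairwise disjnt (C ` ?F)" using Cdisj unfolding pairwise_def disjnt_def by blast
    fix v assume "v \<in> C ` ?F"
    then obtain y where y: "y \<in> ?F" "v = C y" by blast
    show "openin (top_of_set Y) v" using C y by simp
    have vY: "v \<subseteq> Y" using C[OF y(1)] y(2) openin_imp_subset by blast
    have "homeomorphic_map (top_of_set v) (subtopology X T) \<phi>"
    proof (rule bijective_open_imp_homeomorphic_map)
      show "continuous_map (top_of_set v) (subtopology X T) \<phi>"
        using continuous_map_from_subtopology_mono[OF cont vY] Cim[OF y(1)] y(2)
        by (auto simp: continuous_map_in_subtopology)
      show "open_map (top_of_set v) (subtopology X T) \<phi>"
        unfolding open_map_def
      proof (intro allI impI)
        fix W assume W: "openin (top_of_set v) W"
        then have "openin (top_of_set Y) W" using C[OF y(1)] y(2) openin_trans by blast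
        then have "openin X (\<phi> ` W)" by (rule opn)
        moreover have "\<phi> ` W \<subseteq> T" using W Cim[OF y(1)] y(2) openin_imp_subset by blast
        ultimately show "openin (subtopology X T) (\<phi> ` W)" using T by (simp add: openin_open_subtopology)
      qed
      show "\<phi> ` topspace (top_of_set v) = topspace (subtopology X T)"
        using Cim[OF y(1)] y(2) TX by auto
      show "inj_on \<phi> (topspace (top_of_set v))" using Cinj[OF y(1)] y(2) by simp
    qed
    then show "\<exists>\<psi>. homeomorphic_maps (top_of_set v) (subtopology X T) \<phi> \<psi>"
      by (simp add: homeomorphic_map_maps)
  qed
qed

section \<open>Plane cubics\<close>

lemma cubic_monomials_explicit:
  "cubic_monomials = {(3,0,0),(0,3,0),(0,0,3),(2,1,0),(2,0,1),(1,2,0),(0,2,1),(1,0,2),(0,1,2),(1,1,1)}"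
proof -
  have "(a, b, c) \<in> cubic_monomials \<longleftrightarrow> (a, b, c) \<in> {(3,0,0),(0,3,0),(0,0,3),(2,1,0),(2,0,1),(1,2,0),(0,2,1),(1,0,2),(0,1,2),(1,1,1)}"
    for a b c :: nat
  proof -
    have "a + b + c = 3 \<longleftrightarrow> (a = 3 \<and> b = 0 \<and> c = 0) \<or> (a = 0 \<and> b = 3 \<and> c = 0) \<or> (a = 0 \<and> b = 0 \<and> c = 3)
      \<or> (a = 2 \<and> b = 1 \<and> c = 0) \<or> (a = 2 \<and> b = 0 \<and> c = 1) \<or> (a = 1 \<and> b = 2 \<and> c = 0) \<or> (a = 0 \<and> b = 2 \<and> c = 1)
      \<or> (a = 1 \<and> b = 0 \<and> c = 2) \<or> (a = 0 \<and> b = 1 \<and> c = 2) \<or> (a = 1 \<and> b = 1 \<and> c = 1)"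
      by presburger
    then show ?thesis by (simp only: cubic_monomials_def mem_Collect_eq prod.case insert_iff empty_iff prod.inject simp_thms disj_assoc)
  qed
  then show ?thesis unfolding set_eq_iff split_paired_All by blast
qed

definition cubic_fun :: "(nat \<times> nat \<times> nat \<Rightarrow> complex) \<Rightarrow> complex^3 \<Rightarrow> complex" where
  "cubic_fun f x = eval_cubic f (x$1) (x$2) (x$3)"

lemma cubic_fun_explicit:
  "cubic_fun f x = f (3,0,0) * x$1^3 + f (0,3,0) * x$2^3 + f (0,0,3) * x$3^3
    + f (2,1,0) * x$1^2 * x$2 + f (2,0,1) * x$1^2 * x$3 + f (1,2,0) * x$1 * x$2^2
    + f (0,2,1) * x$2^2 * x$3 + f (1,0,2) * x$1 * x$3^2 + f (0,1,2) * x$2 * x$3^2 + f (1,1,1) * x$1 * x$2 * x$3"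
  by (simp add: cubic_fun_def eval_cubic_def cubic_monomials_explicit)

abbreviation vec3 :: "complex \<Rightarrow> complex \<Rightarrow> complex \<Rightarrow> complex^3" where
  "vec3 a b c \<equiv> vector [a, b, c]"

lemma vec3_eq_iff: "(x :: complex^3) = y \<longleftrightarrow> x$1 = y$1 \<and> x$2 = y$2 \<and> x$3 = y$3"
  by (simp add: vec_eq_iff forall_3)

text \<open>The coefficients of a cubic are finite combinations of its values; so cubics may be treated
  as functions, and they depend continuously on parameters coefficientwise iff pointwise.\<close>

definition cubic_coeffs :: "(complex^3 \<Rightarrow> complex) \<Rightarrow> nat \<times> nat \<times> nat \<Rightarrow> complex" where
  "cubic_coeffs P m = (
     if m = (3,0,0) then P (vec3 1 0 0)
     else if m = (0,3,0) then P (vec3 0 1 0)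
     else if m = (0,0,3) then P (vec3 0 0 1)
     else if m = (2,1,0) then (P (vec3 1 1 0) - P (vec3 1 (-1) 0)) / 2 - P (vec3 0 1 0)
     else if m = (1,2,0) then (P (vec3 1 1 0) + P (vec3 1 (-1) 0)) / 2 - P (vec3 1 0 0)
     else if m = (2,0,1) then (P (vec3 1 0 1) - P (vec3 1 0 (-1))) / 2 - P (vec3 0 0 1)
     else if m = (1,0,2) then (P (vec3 1 0 1) + P (vec3 1 0 (-1))) / 2 - P (vec3 1 0 0)
     else if m = (0,2,1) then (P (vec3 0 1 1) - P (vec3 0 1 (-1))) / 2 - P (vec3 0 0 1)
     else if m = (0,1,2) then (P (vec3 0 1 1) + P (vec3 0 1 (-1))) / 2 - P (vec3 0 1 0)
     else if m = (1,1,1) then P (vec3 1 1 1) - P (vec3 1 1 0) - P (vec3 1 0 1) - P (vec3 0 1 1)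
         + P (vec3 1 0 0) + P (vec3 0 1 0) + P (vec3 0 0 1)
     else 0)"

text \<open>Equivalent to \<open>P\<close> being \<open>cubic_fun f\<close> for some
  \<open>f\<close> in \<open>Pi32\<close>, but without an existential quantifier, since the
  coefficients can be read off from \<open>P\<close>.\<close>

definition is_cubic :: "(complex^3 \<Rightarrow> complex) \<Rightarrow> bool" where
  "is_cubic P \<longleftrightarrow> (\<forall>x. cubic_fun (cubic_coeffs P) x = P x)"

lemma cubic_coeffs_in_Pi32 [simp]: "cubic_coeffs P \<in> Pi32"
  by (auto simp: Pi32_def cubic_coeffs_def cubic_monomials_explicit)

lemma cubic_coeffs_cubic_fun: 
  assumes "f \<in> Pi32" shows "cubic_coeffs (cubic_fun f) = f"
proof
  fix m :: "nat \<times> nat \<times> nat"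
  show "cubic_coeffs (cubic_fun f) m = f m"
  proof (cases "m \<in> cubic_monomials")
    case True
    then show ?thesis
      unfolding cubic_monomials_explicit
      by (elim insertE emptyE; hypsubst) (simp_all add: cubic_coeffs_def cubic_fun_explicit algebra_simps)
  next
    case False
    then have "f m = 0" using assms unfolding Pi32_def by blast
    then show ?thesis using False by (auto simp: cubic_coeffs_def cubic_monomials_explicit)
  qed
qed

lemma is_cubic_cubic_fun: "f \<in> Pi32 \<Longrightarrow> is_cubic (cubic_fun f)"
  by (simp add: is_cubic_def cubic_coeffs_cubic_fun)

lemma cubic_fun_cubic_coeffs: "is_cubic P \<Longrightarrow> cubic_fun (cubic_coeffs P) = P"
  by (auto simp: is_cubic_def)

lemma cubic_coeffs_add: "cubic_coeffs (\<lambda>x. P x + Q x) m = cubic_coeffs P m + cubic_coeffs Q m"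
  by (simp add: cubic_coeffs_def algebra_simps diff_divide_distrib add_divide_distrib)

lemma cubic_coeffs_scale: "cubic_coeffs (\<lambda>x. c * P x) m = c * cubic_coeffs P m"
  by (simp add: cubic_coeffs_def algebra_simps diff_divide_distrib add_divide_distrib)

lemma cubic_fun_add: "cubic_fun (\<lambda>m. f m + g m) x = cubic_fun f x + cubic_fun g x"
  by (simp add: cubic_fun_explicit algebra_simps)

lemma cubic_fun_scale: "cubic_fun (\<lambda>m. c * f m) x = c * cubic_fun f x"
  by (simp add: cubic_fun_explicit algebra_simps)

lemma is_cubic_add: "is_cubic P \<Longrightarrow> is_cubic Q \<Longrightarrow> is_cubic (\<lambda>x. P x + Q x)"
  by (simp add: is_cubic_def cubic_coeffs_add[abs_def] cubic_fun_add)

lemma is_cubic_scale: "is_cubic P \<Longrightarrow> is_cubic (\<lambda>x. c * P x)"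
  by (simp add: is_cubic_def cubic_coeffs_scale[abs_def] cubic_fun_scale)

text \<open>The source of the other closure properties: linear substitution turns monomials into
  products of three linear forms, and the Hessian determinant is a combination of such
  products.\<close>

lemma is_cubic_product:
  "is_cubic (\<lambda>x. (a1 * x$1 + a2 * x$2 + a3 * x$3) * (b1 * x$1 + b2 * x$2 + b3 * x$3) * (c1 * x$1 + c2 * x$2 + c3 * x$3))"
proof -
  define f :: "nat \<times> nat \<times> nat \<Rightarrow> complex" where "f m = (
     if m = (3,0,0) then a1 * b1 * c1 else if m = (0,3,0) then a2 * b2 * c2 else if m = (0,0,3) then a3 * b3 * c3
     else if m = (2,1,0) then a1 * b1 * c2 + a1 * b2 * c1 + a2 * b1 * c1
     else if m = (2,0,1) then a1 * b1 * c3 + a1 * b3 * c1 + a3 * b1 * c1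
     else if m = (1,2,0) then a2 * b2 * c1 + a2 * b1 * c2 + a1 * b2 * c2
     else if m = (0,2,1) then a2 * b2 * c3 + a2 * b3 * c2 + a3 * b2 * c2
     else if m = (1,0,2) then a3 * b3 * c1 + a3 * b1 * c3 + a1 * b3 * c3
     else if m = (0,1,2) then a3 * b3 * c2 + a3 * b2 * c3 + a2 * b3 * c3
     else if m = (1,1,1) then a1 * b2 * c3 + a1 * b3 * c2 + a2 * b1 * c3 + a2 * b3 * c1 + a3 * b1 * c2 + a3 * b2 * c1
     else 0)" for m
  have "f \<in> Pi32" by (auto simp: Pi32_def f_def cubic_monomials_explicit)
  moreover have "cubic_fun f = (\<lambda>x. (a1 * x$1 + a2 * x$2 + a3 * x$3) * (b1 * x$1 + b2 * x$2 + b3 * x$3) * (c1 * x$1 + c2 * x$2 + c3 * x$3))"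
    by (rule ext) (simp add: cubic_fun_explicit f_def algebra_simps power2_eq_square power3_eq_cube)
  ultimately show ?thesis using is_cubic_cubic_fun by metis
qed

lemma mat3_vec: "((A :: complex^3^3) *v x) $ i = A$i$1 * x$1 + A$i$2 * x$2 + A$i$3 * x$3"
  by (simp add: matrix_vector_mult_def sum_3)

lemma is_cubic_compose:
  assumes "is_cubic P" shows "is_cubic (\<lambda>x. P (A *v x))"
proof -
  have prod: "is_cubic (\<lambda>x. (A *v x)$i * (A *v x)$j * (A *v x)$k)" for i j k
    unfolding mat3_vec by (rule is_cubic_product)
  have "P (A *v x) = cubic_fun (cubic_coeffs P) (A *v x)" for x using assms by (simp add: is_cubic_def)
  moreover have "is_cubic (\<lambda>x. cubic_fun f (A *v x))" for f
    unfolding cubic_fun_explicit power2_eq_square power3_eq_cube mult.assoc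
    by (intro is_cubic_add is_cubic_scale prod[unfolded mult.assoc])
  ultimately show ?thesis by simp
qed

text \<open>For a cubic form, the part of \<open>P (x + v)\<close> that is odd in \<open>v\<close>
  is the derivative at \<open>x\<close> along \<open>v\<close> plus \<open>P v\<close>. So this
  difference quotient is the exact directional derivative, and its behaviour under linear
  substitution is immediate.\<close>

definition cubic_deriv :: "(complex^3 \<Rightarrow> complex) \<Rightarrow> complex^3 \<Rightarrow> complex^3 \<Rightarrow> complex" where
  "cubic_deriv P x v = (P (x + v) - P (x - v)) / 2 - P v"

definition cubic_smooth :: "(complex^3 \<Rightarrow> complex) \<Rightarrow> bool" where
  "cubic_smooth P \<longleftrightarrow> (\<forall>x. x \<noteq> 0 \<longrightarrow> (\<exists>v. cubic_deriv P x v \<noteq> 0))"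

lemma cubic_deriv_partial:
  "cubic_deriv (cubic_fun f) x v = dx_cubic f (x$1) (x$2) (x$3) * v$1 + dy_cubic f (x$1) (x$2) (x$3) * v$2
     + dz_cubic f (x$1) (x$2) (x$3) * v$3" (is "_ = ?D")
proof -
  have "cubic_fun f (x + v) - cubic_fun f (x - v) = 2 * (?D + cubic_fun f v)"
    by (simp add: cubic_fun_explicit dx_cubic_def dy_cubic_def dz_cubic_def cubic_monomials_explicit
      algebra_simps power2_eq_square power3_eq_cube)
  then show ?thesis unfolding cubic_deriv_def by (simp only: nonzero_mult_div_cancel_left zero_neq_numeral[symmetric] not_False_eq_True add_diff_cancel_right')
qed

lemma nonsingular_iff_cubic_smooth: "f \<in> Pi32 - Sigma32 \<longleftrightarrow> f \<in> Pi32 \<and> cubic_smooth (cubic_fun f)"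
proof -
  have "(\<exists>v. cubic_deriv (cubic_fun f) x v \<noteq> 0) \<longleftrightarrow>
     \<not> (dx_cubic f (x$1) (x$2) (x$3) = 0 \<and> dy_cubic f (x$1) (x$2) (x$3) = 0 \<and> dz_cubic f (x$1) (x$2) (x$3) = 0)" for x :: "complex^3"
  proof
    assume "\<not> (dx_cubic f (x$1) (x$2) (x$3) = 0 \<and> dy_cubic f (x$1) (x$2) (x$3) = 0 \<and> dz_cubic f (x$1) (x$2) (x$3) = 0)"
    moreover have "cubic_deriv (cubic_fun f) x (vec3 1 0 0) = dx_cubic f (x$1) (x$2) (x$3)"
       "cubic_deriv (cubic_fun f) x (vec3 0 1 0) = dy_cubic f (x$1) (x$2) (x$3)"
       "cubic_deriv (cubic_fun f) x (vec3 0 0 1) = dz_cubic f (x$1) (x$2) (x$3)"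
      by (simp_all add: cubic_deriv_partial)
    ultimately show "\<exists>v. cubic_deriv (cubic_fun f) x v \<noteq> 0" by metis
  qed (auto simp: cubic_deriv_partial)
  then have "cubic_smooth (cubic_fun f) \<longleftrightarrow> (\<forall>x::complex^3. x \<noteq> 0 \<longrightarrow>
     \<not> (dx_cubic f (x$1) (x$2) (x$3) = 0 \<and> dy_cubic f (x$1) (x$2) (x$3) = 0 \<and> dz_cubic f (x$1) (x$2) (x$3) = 0))"
    by (simp only: cubic_smooth_def)
  also have "\<dots> \<longleftrightarrow> (\<forall>x y z. (x, y, z) \<noteq> (0, 0, 0) \<longrightarrow> \<not> (dx_cubic f x y z = 0 \<and> dy_cubic f x y z = 0 \<and> dz_cubic f x y z = 0))"
  proof (intro iffI allI impI)
    fix x y z :: complex assume 1: "\<forall>x::complex^3. x \<noteq> 0 \<longrightarrow>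
     \<not> (dx_cubic f (x$1) (x$2) (x$3) = 0 \<and> dy_cubic f (x$1) (x$2) (x$3) = 0 \<and> dz_cubic f (x$1) (x$2) (x$3) = 0)"
     and 2: "(x, y, z) \<noteq> (0, 0, 0 :: complex)"
    show "\<not> (dx_cubic f x y z = 0 \<and> dy_cubic f x y z = 0 \<and> dz_cubic f x y z = 0)"
      using 1[rule_format, of "vec3 x y z"] 2 by (auto simp: vec3_eq_iff)
  qed (auto simp: vec3_eq_iff)
  finally show ?thesis by (auto simp: Sigma32_def)
qed

lemma cubic_deriv_compose: "cubic_deriv (\<lambda>x. P (A *v x)) x v = cubic_deriv P (A *v x) (A *v v)"
  by (simp add: cubic_deriv_def matrix_vector_right_distrib matrix_vector_mult_diff_distrib)

lemma cubic_smooth_compose: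
  assumes "cubic_smooth P" "invertible (A :: complex^3^3)"
  shows "cubic_smooth (\<lambda>x. P (A *v x))"
  unfolding cubic_smooth_def cubic_deriv_compose
proof (intro allI impI)
  fix x :: "complex^3" assume "x \<noteq> 0"
  obtain B where B: "A ** B = mat 1" "B ** A = mat 1" using assms(2) by (auto simp: invertible_def)
  have "A *v x \<noteq> 0"
  proof
    assume "A *v x = 0"
    then have "B *v (A *v x) = 0" by simp
    then show False using B \<open>x \<noteq> 0\<close> by (simp add: matrix_vector_mul_assoc)
  qed
  then obtain v where "cubic_deriv P (A *v x) v \<noteq> 0" using assms(1) by (auto simp: cubic_smooth_def)
  then have "cubic_deriv P (A *v x) (A *v (B *v v)) \<noteq> 0" using B by (simp add: matrix_vector_mul_assoc)
  then show "\<exists>v. cubic_deriv P (A *v x) (A *v v) \<noteq> 0" by blast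
qed

section \<open>Weierstrass cubics, their flexes and their equivalences\<close>

definition weier :: "complex \<Rightarrow> complex \<Rightarrow> complex^3 \<Rightarrow> complex" where
  "weier a b x = x$2^2 * x$3 - x$1^3 - 3 * a * x$1 * x$3^2 - 2 * b * x$3^3"

lemma is_cubic_weier: "is_cubic (weier a b)"
  by (simp add: is_cubic_def weier_def cubic_fun_explicit cubic_coeffs_def field_simps)

lemma cubic_deriv_weier:
  "cubic_deriv (weier a b) x v = v$1 * (- 3 * x$1^2 - 3 * a * x$3^2) + v$2 * (2 * x$2 * x$3)
     + v$3 * (x$2^2 - 6 * a * x$1 * x$3 - 6 * b * x$3^2)"
  by (simp add: cubic_deriv_def weier_def field_simps power2_eq_square power3_eq_cube)

text \<open>The factors 3 and 2 in \<open>weier\<close> normalise the discriminant of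
  \<open>x^3 + 3 a x + 2 b\<close> to a constant multiple of \<open>a^3 + b^2\<close>.\<close>

lemma cubic_smooth_weier: "cubic_smooth (weier a b) \<longleftrightarrow> a^3 + b^2 \<noteq> 0"
proof
  assume s: "cubic_smooth (weier a b)"
  show "a^3 + b^2 \<noteq> 0"
  proof
    assume d: "a^3 + b^2 = 0"
    \<comment> \<open>The double root of the cubic in \<open>x\<close>. If \<open>a = 0\<close>,
      then \<open>b = 0\<close> as well, and the value 0 of the division is the right one.\<close>
    define t where "t = - b / a"
    have t: "t^2 = - a" "a * t = - b"
    proof -
      show "a * t = - b" using d by (cases "a = 0") (auto simp: t_def)
      show "t^2 = - a"
      proof (cases "a = 0")
        case False
        then have "t^2 * a^2 = b^2" by (simp add: t_def power_divide)
        also have "\<dots> = - a * a^2" using d by (simp add: power2_eq_square power3_eq_cube eq_neg_iff_add_eq_0 add.commute mult.assoc)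
        finally show ?thesis using False by (metis mult_right_cancel power_not_zero)
      qed (use d in \<open>simp add: t_def\<close>)
    qed
    have "cubic_deriv (weier a b) (vec3 t 0 1) v = 0" for v
      using t by (simp add: cubic_deriv_weier mult.assoc)
    moreover have "vec3 t 0 1 \<noteq> 0" by (simp add: vec3_eq_iff)
    ultimately show False using s unfolding cubic_smooth_def by blast
  qed
next
  assume d: "a^3 + b^2 \<noteq> 0"
  show "cubic_smooth (weier a b)"
    unfolding cubic_smooth_def
  proof (intro allI impI, rule ccontr)
    fix x :: "complex^3" assume x: "x \<noteq> 0" and "\<nexists>v. cubic_deriv (weier a b) x v \<noteq> 0"
    then have z: "cubic_deriv (weier a b) x v = 0" for v by blast
    have "- 3 * x$1^2 - 3 * a * x$3^2 = 0" using z[of "vec3 1 0 0"] by (simp add: cubic_deriv_weier)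
    then have 1: "x$1^2 = - a * x$3^2" by Groebner_Basis.algebra
    have 2: "x$2 * x$3 = 0" using z[of "vec3 0 1 0"] by (simp add: cubic_deriv_weier)
    have "x$2^2 - 6 * a * x$1 * x$3 - 6 * b * x$3^2 = 0" using z[of "vec3 0 0 1"] by (simp add: cubic_deriv_weier)
    then have 3: "x$2^2 = 6 * a * x$1 * x$3 + 6 * b * x$3^2" by Groebner_Basis.algebra
    have "x$3 \<noteq> 0" using 1 3 x by (auto simp: vec3_eq_iff)
    then have "x$2 = 0" using 2 by simp
    then have "x$3 * (a * x$1 + b * x$3) = 0" using 3 by Groebner_Basis.algebra
    then have "a * x$1 + b * x$3 = 0" using \<open>x$3 \<noteq> 0\<close> by (metis mult_eq_0_iff)
    then have "(a^3 + b^2) * x$3^2 = 0" using 1 by Groebner_Basis.algebra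
    then show False using d \<open>x$3 \<noteq> 0\<close> by simp
  qed
qed

text \<open>The restriction of \<open>P\<close> to the line through \<open>p\<close> and
  \<open>v\<close> has four coefficients; three of them are required to vanish, so the line meets
  the cubic at \<open>p\<close> with multiplicity at least three. Thus \<open>p\<close> is a flex
  and \<open>v\<close> a second point of its tangent.\<close>

definition flex_pair :: "(complex^3 \<Rightarrow> complex) \<Rightarrow> complex^3 \<Rightarrow> complex^3 \<Rightarrow> bool" where
  "flex_pair P p v \<longleftrightarrow> p \<noteq> 0 \<and> (\<forall>c. v \<noteq> c *s p) \<and> P p = 0 \<and> cubic_deriv P p v = 0 \<and> cubic_deriv P v p = 0"

text \<open>The quartic is one third of the 3-division polynomial of
  \<open>y^2 = x^3 + 3 a x + 2 b\<close>: flexes are the points of order dividing three.\<close>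

definition affine_flexes :: "complex \<Rightarrow> complex \<Rightarrow> (complex \<times> complex) set" where
  "affine_flexes a b = {(x, y). x^4 + 6 * a * x^2 + 8 * b * x - 3 * a^2 = 0 \<and> y^2 = x^3 + 3 * a * x + 2 * b}"

lemma flex_pair_weier_infinite:
  assumes "flex_pair (weier a b) p v" "p$3 = 0"
  shows "p$1 = 0" "p$2 \<noteq> 0" "v$3 = 0"
proof -
  show p1: "p$1 = 0" using assms by (simp add: flex_pair_def weier_def)
  show p2: "p$2 \<noteq> 0" using assms p1 by (auto simp: flex_pair_def vec3_eq_iff)
  have "v$3 * p$2^2 = 0" using assms p1 by (simp add: flex_pair_def cubic_deriv_weier)
  then show "v$3 = 0" using p2 by simp
qed

lemma flex_pair_weier_affine:
  assumes f: "flex_pair (weier a b) p v" and p3: "p$3 \<noteq> 0"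
  shows "(p$1 / p$3, p$2 / p$3) \<in> affine_flexes a b"
proof -
  define x y where "x = p$1 / p$3" and "y = p$2 / p$3"
  have p: "p$1 = x * p$3" "p$2 = y * p$3" using p3 by (auto simp: x_def y_def)
  define c where "c = v$3 / p$3"
  \<comment> \<open>Subtracting a multiple of \<open>p\<close> makes the third coordinate of the
    tangent vector 0; \<open>(u1, u2)\<close> is the tangent direction in the affine plane, and
    eliminating it leaves the quartic in \<open>x\<close>.\<close>
  define u1 u2 where "u1 = v$1 - c * p$1" and "u2 = v$2 - c * p$2"
  have v: "v$1 = u1 + c * (x * p$3)" "v$2 = u2 + c * (y * p$3)" "v$3 = c * p$3"
    using p3 by (auto simp: u1_def u2_def c_def p)
  have "weier a b p = 0" using f by (simp add: flex_pair_def)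
  then have "p$3^3 * (y^2 - x^3 - 3 * a * x - 2 * b) = 0" unfolding weier_def p by Groebner_Basis.algebra
  then have "y^2 - x^3 - 3 * a * x - 2 * b = 0" using p3 by (metis mult_eq_0_iff power_not_zero)
  then have y: "y^2 = x^3 + 3 * a * x + 2 * b" by Groebner_Basis.algebra
  have "cubic_deriv (weier a b) p v = 0" using f by (simp add: flex_pair_def)
  then have "p$3^2 * (- 3 * u1 * (x^2 + a) + 2 * u2 * y) = 0"
    unfolding cubic_deriv_weier p v using y by Groebner_Basis.algebra
  then have "- 3 * u1 * (x^2 + a) + 2 * u2 * y = 0" using p3 by (metis mult_eq_0_iff power_not_zero)
  then have 1: "2 * u2 * y = 3 * u1 * (x^2 + a)" by Groebner_Basis.algebra
  have "cubic_deriv (weier a b) v p = 0" using f by (simp add: flex_pair_def)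
  then have "p$3 * (u2^2 - 3 * x * u1^2) = 0"
    unfolding cubic_deriv_weier p v using y 1 by Groebner_Basis.algebra
  then have 2: "u2^2 = 3 * x * u1^2" using p3 by simp
  have "u1 \<noteq> 0"
  proof
    assume "u1 = 0"
    then have "v = c *s p" using 2 v p by (simp add: vec3_eq_iff)
    then show False using f by (simp add: flex_pair_def)
  qed
  moreover have "u1^2 * (x^4 + 6 * a * x^2 + 8 * b * x - 3 * a^2) = 0" using 1 2 y by Groebner_Basis.algebra
  ultimately show ?thesis using y by (simp add: affine_flexes_def x_def y_def)
qed

text \<open>The quotient is the slope \<open>m\<close> of the tangent. A line of slope
  \<open>m\<close> meets the curve in points whose abscissae sum to \<open>m^2\<close>, and at a
  flex all three coincide.\<close>

lemma affine_flex_slope: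
  assumes d: "a^3 + b^2 \<noteq> 0" and q: "(x, y) \<in> affine_flexes a b"
  shows "y \<noteq> 0" "(3 * (x^2 + a) / (2 * y))^2 = 3 * x"
proof -
  have 1: "x^4 + 6 * a * x^2 + 8 * b * x - 3 * a^2 = 0" and 2: "y^2 = x^3 + 3 * a * x + 2 * b"
    using q by (auto simp: affine_flexes_def)
  have 3: "3 * (x^2 + a)^2 = 4 * x * y^2" using 1 2 by Groebner_Basis.algebra
  show y: "y \<noteq> 0"
  proof
    assume "y = 0"
    then have "(x^2 + a)^2 = 0" "x^3 + 3 * a * x + 2 * b = 0" using 2 3 by auto
    then have "x^2 = - a" "x^3 + 3 * a * x + 2 * b = 0" by (simp_all add: eq_neg_iff_add_eq_0)
    then have "a^3 + b^2 = 0" by Groebner_Basis.algebra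
    then show False using d by simp
  qed
  show "(3 * (x^2 + a) / (2 * y))^2 = 3 * x"
  proof -
    have e: "(3 * (x^2 + a))^2 = 3 * x * (2 * y)^2" using 3 by Groebner_Basis.algebra
    show ?thesis unfolding power_divide e using y by simp
  qed
qed

text \<open>With \<open>X = x - x0 z\<close> and \<open>L = y - y0 z - m X\<close> a flex \<open>(x0 : y0 : 1)\<close> gives
  \<open>weier a b = z L (L + 2 y0 z + 2 m X) - X^3\<close>, which is symmetric under exchanging \<open>L\<close> and \<open>2 y0 z\<close>;
  this involution swaps the flexes \<open>(0 : 1 : 0)\<close> and \<open>(x0 : y0 : 1)\<close>.\<close>

definition flex_swap :: "complex \<Rightarrow> complex \<Rightarrow> complex \<Rightarrow> complex^3^3" where
  "flex_swap m x y = (let k = 1 / (2 * y) in vector [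
     vec3 (1 - x * k * m) (x * k) (x * k * (m * x - y) - x),
     vec3 (m * y * k) (y * k) (y * k * (m * x - y) + 2 * y - m * x),
     vec3 (- k * m) k (k * (m * x - y))])"

lemma flex_swap_nth:
  assumes "y \<noteq> 0"
  shows "(flex_swap m x y *v v)$3 = (v$2 - y * v$3 - m * (v$1 - x * v$3)) / (2 * y)"
    "(flex_swap m x y *v v)$1 = v$1 - x * v$3 + x * (flex_swap m x y *v v)$3"
    "(flex_swap m x y *v v)$2 = 2 * y * v$3 + m * (v$1 - x * v$3) + y * (flex_swap m x y *v v)$3"
  using assms by (simp_all add: mat3_vec flex_swap_def Let_def field_simps)

lemma weier_flex_form:
  assumes "y^2 = x^3 + 3 * a * x + 2 * b" "2 * y * m = 3 * (x^2 + a)" "m^2 = 3 * x"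
    and "X = v$1 - x * v$3" "L = v$2 - y * v$3 - m * X"
  shows "weier a b v = v$3 * L * (L + 2 * y * v$3 + 2 * m * X) - X^3"
  unfolding weier_def using assms by Groebner_Basis.algebra

lemma weier_flex_swap:
  assumes y0: "y \<noteq> 0" and "y^2 = x^3 + 3 * a * x + 2 * b" "2 * y * m = 3 * (x^2 + a)" "m^2 = 3 * x"
  shows "weier a b (flex_swap m x y *v v) = weier a b v"
proof -
  let ?w = "flex_swap m x y *v v"
  define X L where "X = v$1 - x * v$3" and "L = v$2 - y * v$3 - m * X"
  have 3: "2 * y * ?w$3 = L" using y0 by (simp add: flex_swap_nth L_def X_def)
  have X: "X = ?w$1 - x * ?w$3" using y0 by (simp add: flex_swap_nth(2) X_def)
  have L: "2 * y * v$3 = ?w$2 - y * ?w$3 - m * X"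
    using y0 X by (simp add: flex_swap_nth(2,3) X_def)
  have "weier a b ?w = ?w$3 * (2 * y * v$3) * (2 * y * v$3 + 2 * y * ?w$3 + 2 * m * X) - X^3"
    by (rule weier_flex_form[OF assms(2-4) X L])
  also have "\<dots> = v$3 * L * (L + 2 * y * v$3 + 2 * m * X) - X^3" unfolding 3[symmetric] by (simp add: algebra_simps)
  also have "\<dots> = weier a b v" by (rule weier_flex_form[OF assms(2-4) X_def L_def, symmetric])
  finally show ?thesis .
qed

lemma flex_swap_involution:
  assumes "y \<noteq> 0"
  shows "flex_swap m x y ** flex_swap m x y = mat 1"
proof -
  have "flex_swap m x y *v (flex_swap m x y *v v) = v" for v
  proof -
    let ?w = "flex_swap m x y *v v"
    have "?w$2 - y * ?w$3 - m * (?w$1 - x * ?w$3) = v$3 * (2 * y)"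
      unfolding flex_swap_nth(2,3)[OF assms, of m x v] by (simp add: algebra_simps)
    then have 3: "(flex_swap m x y *v ?w)$3 = v$3"
      using assms by (simp add: flex_swap_nth(1)[OF assms, of m x ?w])
    have 1: "(flex_swap m x y *v ?w)$1 = v$1"
      using flex_swap_nth(2)[OF assms, of m x ?w] flex_swap_nth(2)[OF assms, of m x v] 3 by simp
    have "(flex_swap m x y *v ?w)$2 = 2 * y * ?w$3 + m * (v$1 - x * v$3) + y * v$3"
      using flex_swap_nth(3)[OF assms, of m x ?w] flex_swap_nth(2)[OF assms, of m x v] 3 by simp
    also have "2 * y * ?w$3 = v$2 - y * v$3 - m * (v$1 - x * v$3)"
      using assms by (simp add: flex_swap_nth(1)[OF assms])
    also have "v$2 - y * v$3 - m * (v$1 - x * v$3) + m * (v$1 - x * v$3) + y * v$3 = v$2" by simp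
    finally show ?thesis using 1 3 by (simp add: vec3_eq_iff)
  qed
  then show ?thesis
    by (metis matrix_eq matrix_vector_mul_assoc matrix_vector_mul_lid)
qed

lemma flex_swap_flex: "y \<noteq> 0 \<Longrightarrow> flex_swap m x y *v vec3 x y 1 = vec3 0 (2 * y) 0"
  by (simp add: vec3_eq_iff flex_swap_nth)

lemma flex_swap_infinity: "y \<noteq> 0 \<Longrightarrow> flex_swap m x y *v vec3 0 1 0 = (1 / (2 * y)) *s vec3 x y 1"
  by (simp add: vec3_eq_iff flex_swap_nth)

text \<open>In the coordinates \<open>X\<close>, \<open>L\<close> and \<open>2 y z\<close> the map
  fixes the first and exchanges the other two. The sign has to be corrected by a scalar when the
  determinant is prescribed.\<close>

lemma det_flex_swap: "y \<noteq> 0 \<Longrightarrow> det (flex_swap m x y) = -1"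
proof -
  assume y: "y \<noteq> 0"
  define k where "k = 1 / (2 * y)"
  have k: "2 * y * k = 1" using y by (simp add: k_def)
  have "det (flex_swap m x y) = (1 - x * k * m) * (y * k) * (k * (m * x - y)) + (x * k) * (y * k * (m * x - y) + 2 * y - m * x) * (- k * m)
     + (x * k * (m * x - y) - x) * (m * y * k) * k - (1 - x * k * m) * (y * k * (m * x - y) + 2 * y - m * x) * k
     - (x * k) * (m * y * k) * (k * (m * x - y)) - (x * k * (m * x - y) - x) * (y * k) * (- k * m)"
    unfolding flex_swap_def k_def[symmetric] Let_def det_3 by simp
  also have "\<dots> = - 1" using k by Groebner_Basis.algebra
  finally show ?thesis .
qed

definition swap_matrix :: "complex \<Rightarrow> complex \<Rightarrow> (complex \<times> complex) option \<Rightarrow> complex^3^3" where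
  "swap_matrix a b q = (case q of None \<Rightarrow> mat 1 | Some (x, y) \<Rightarrow> flex_swap (3 * (x^2 + a) / (2 * y)) x y)"

text \<open>\<open>None\<close> stands for the flex \<open>(0 : 1 : 0)\<close>, for which the swap
  is the identity.\<close>

definition flexes :: "complex \<Rightarrow> complex \<Rightarrow> (complex \<times> complex) option set" where
  "flexes a b = insert None (Some ` affine_flexes a b)"

lemma weier_swap_matrix:
  assumes d: "a^3 + b^2 \<noteq> 0" and q: "q \<in> flexes a b"
  shows "weier a b (swap_matrix a b q *v v) = weier a b v"
    and "swap_matrix a b q ** swap_matrix a b q = mat 1"
proof -
  have "weier a b (swap_matrix a b q *v v) = weier a b v \<and> swap_matrix a b q ** swap_matrix a b q = mat 1"
  proof (cases q)
    case None
    then show ?thesis by (simp add: swap_matrix_def)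
  next
    case (Some r)
    obtain x y where r: "r = (x, y)" by fastforce
    have xy: "(x, y) \<in> affine_flexes a b" using q Some r by (auto simp: flexes_def)
    let ?m = "3 * (x^2 + a) / (2 * y)"
    note y = affine_flex_slope[OF d xy]
    have "2 * y * ?m = 3 * (x^2 + a)" using y(1) by simp
    moreover have "y^2 = x^3 + 3 * a * x + 2 * b" using xy by (simp add: affine_flexes_def)
    ultimately have "weier a b (flex_swap ?m x y *v v) = weier a b v" using weier_flex_swap[OF y(1)] y(2) by blast
    then show ?thesis using Some r flex_swap_involution[OF y(1)] by (simp add: swap_matrix_def)
  qed
  then show "weier a b (swap_matrix a b q *v v) = weier a b v" "swap_matrix a b q ** swap_matrix a b q = mat 1" by auto
qed

text \<open>The last entry is forced by the coefficient of \<open>y^2 z\<close>; the coefficient of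
  \<open>x^3\<close> later forces \<open>\<alpha>^3 = 1\<close>.\<close>

definition diag_matrix :: "complex \<Rightarrow> complex \<Rightarrow> complex^3^3" where
  "diag_matrix \<alpha> \<beta> = vector [vec3 \<alpha> 0 0, vec3 0 \<beta> 0, vec3 0 0 (1 / \<beta>^2)]"

lemma diag_matrix_vec [simp]:
  "(diag_matrix \<alpha> \<beta> *v v)$1 = \<alpha> * v$1" "(diag_matrix \<alpha> \<beta> *v v)$2 = \<beta> * v$2"
  "(diag_matrix \<alpha> \<beta> *v v)$3 = v$3 / \<beta>^2"
  by (simp_all add: mat3_vec diag_matrix_def)

lemma weier_diag_matrix:
  assumes "\<alpha>^3 = 1" "\<beta> \<noteq> 0"
  shows "weier a b (diag_matrix \<alpha> \<beta> *v v) = weier (a * \<alpha> / \<beta>^4) (b / \<beta>^6) v"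
  using assms by (simp add: weier_def field_simps power_mult_distrib flip: power_add power_mult)

text \<open>The vanishing entries say that \<open>h\<close> fixes the flex at infinity and its
  tangent \<open>z = 0\<close>. The coefficients of \<open>y z^2\<close>, \<open>x y z\<close> and
  \<open>x^2 z\<close>, isolated by evaluation at a few points, then kill \<zeta>, \<epsilon> and
  \<delta> in this order.\<close>

lemma weier_equiv_triangular:
  assumes eq: "\<And>v. weier a b (h *v v) = weier a' b' v"
    and h: "h$1$2 = 0" "h$3$2 = 0" "h$3$1 = 0"
  shows "\<exists>\<alpha> \<beta>. \<alpha>^3 = 1 \<and> \<beta> \<noteq> 0 \<and> a' = a * \<alpha> / \<beta>^4 \<and> b' = b / \<beta>^6 \<and> h = diag_matrix \<alpha> \<beta>"
proof -
  define \<alpha> \<delta> \<epsilon> \<beta> \<zeta> \<gamma> where "\<alpha> = h$1$1" "\<delta> = h$1$3" "\<epsilon> = h$2$1" "\<beta> = h$2$2" "\<zeta> = h$2$3" "\<gamma> = h$3$3"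
  note hs = this h
  have W: "(\<epsilon> * x + \<beta> * y + \<zeta> * z)^2 * (\<gamma> * z) - (\<alpha> * x + \<delta> * z)^3 - 3 * a * (\<alpha> * x + \<delta> * z) * (\<gamma> * z)^2
      - 2 * b * (\<gamma> * z)^3 = y^2 * z - x^3 - 3 * a' * x * z^2 - 2 * b' * z^3" for x y z
    using eq[of "vec3 x y z"] by (simp add: weier_def mat3_vec hs)
  have \<alpha>: "\<alpha>^3 = 1" using W[of 1 0 0] by simp
  have "2 * \<beta>^2 * \<gamma> = 2" using W[of 0 1 1, simplified] W[of 0 "-1" 1, simplified] W[of 0 0 1, simplified] by Groebner_Basis.algebra
  then have \<beta>\<gamma>: "\<beta>^2 * \<gamma> = 1" by simp
  have \<beta>: "\<beta> \<noteq> 0" using \<beta>\<gamma> by auto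
  then have \<gamma>: "\<gamma> = 1 / \<beta>^2" using \<beta>\<gamma> by (simp add: field_simps)
  have "4 * \<beta> * \<zeta> * \<gamma> = 0" using W[of 0 1 1, simplified] W[of 0 "-1" 1, simplified] by Groebner_Basis.algebra
  then have \<zeta>: "\<zeta> = 0" using \<beta> \<gamma> by simp
  have "4 * \<epsilon> * \<beta> * \<gamma> = 0" using W[of 1 1 1, simplified] W[of 1 "-1" 1, simplified] \<zeta> by Groebner_Basis.algebra
  then have \<epsilon>: "\<epsilon> = 0" using \<beta> \<gamma> by simp
  have "6 * \<alpha>^2 * \<delta> = 0" using W[of 1 0 1, simplified] W[of "-1" 0 1, simplified] W[of 0 0 1, simplified] \<zeta> \<epsilon> by Groebner_Basis.algebra
  then have \<delta>: "\<delta> = 0" using \<alpha> by (metis mult_eq_0_iff power_eq_0_iff power_zero_numeral zero_neq_numeral zero_neq_one)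
  have b': "b' = b * \<gamma>^3" using W[of 0 0 1] \<delta> \<zeta> by (simp add: power_mult_distrib)
  have "3 * a' = 3 * a * \<alpha> * \<gamma>^2" using W[of 1 0 1, simplified] \<delta> \<zeta> \<epsilon> \<alpha> b' by Groebner_Basis.algebra
  then have a': "a' = a * \<alpha> * \<gamma>^2" by simp
  have "h = diag_matrix \<alpha> \<beta>"
    using \<gamma> \<delta> \<epsilon> \<zeta> h unfolding hs(1-6) by (simp add: diag_matrix_def vec_eq_iff forall_3)
  then show ?thesis using \<alpha> \<beta> a' b' \<gamma> by (intro exI[of _ \<alpha>] exI[of _ \<beta>]) (simp add: power_divide flip: power_mult)
qed

lemma flex_pair_compose:
  assumes "flex_pair P p v" "\<And>x. Q (h *v x) = P x" "invertible (h :: complex^3^3)"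
  shows "flex_pair Q (h *v p) (h *v v)"
proof -
  obtain B where B: "B ** h = mat 1" using assms(3) by (auto simp: invertible_def)
  have inj: "x = y" if "h *v x = h *v y" for x y :: "complex^3"
    using arg_cong[OF that, of "\<lambda>z. B *v z"] B by (simp add: matrix_vector_mul_assoc)
  have PQ: "P = (\<lambda>x. Q (h *v x))" using assms(2) by auto
  have D: "cubic_deriv Q (h *v x) (h *v y) = cubic_deriv P x y" for x y
    unfolding PQ by (simp add: cubic_deriv_compose)
  show ?thesis
    unfolding flex_pair_def D assms(2)
  proof (intro conjI allI)
    show "h *v p \<noteq> 0" using assms(1) inj[of p 0] by (auto simp: flex_pair_def)
    fix c
    show "h *v v \<noteq> c *s (h *v p)"
    proof
      assume "h *v v = c *s (h *v p)"
      then have "h *v v = h *v (c *s p)" by (simp add: vector_scalar_commute)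
      then show False using inj assms(1) unfolding flex_pair_def by blast
    qed
  qed (use assms(1) in \<open>auto simp: flex_pair_def\<close>)
qed

lemma flex_pair_weier_standard: "flex_pair (weier a b) (vec3 0 1 0) (vec3 1 0 0)"
  by (auto simp: flex_pair_def vec3_eq_iff weier_def cubic_deriv_weier)

text \<open>The image under \<open>h\<close> of the flex at infinity is some flex. Composing with
  the swap at that flex gives an equivalence that fixes the flex at infinity, hence a diagonal one,
  and the swap is its own inverse.\<close>

theorem weier_equivalences:
  assumes d: "a^3 + b^2 \<noteq> 0" and inv: "invertible h" and eq: "\<And>v. weier a b (h *v v) = weier a' b' v"
  shows "\<exists>q\<in>flexes a b. \<exists>\<alpha> \<beta>. \<alpha>^3 = 1 \<and> \<beta> \<noteq> 0 \<and> a' = a * \<alpha> / \<beta>^4 \<and> b' = b / \<beta>^6 \<and> h = swap_matrix a b q ** diag_matrix \<alpha> \<beta>"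
proof -
  have col: "(h *v vec3 1 0 0)$i = h$i$1" "(h *v vec3 0 1 0)$i = h$i$2" for h :: "complex^3^3" and i
    by (simp_all add: mat3_vec)
  have tri: "\<exists>\<alpha> \<beta>. \<alpha>^3 = 1 \<and> \<beta> \<noteq> 0 \<and> a' = a * \<alpha> / \<beta>^4 \<and> b' = b / \<beta>^6 \<and> h = diag_matrix \<alpha> \<beta>"
    if inv: "invertible h" and eq: "\<And>v. weier a b (h *v v) = weier a' b' v" and "h$3$2 = 0" for h
  proof (rule weier_equiv_triangular[OF eq])
    note f = flex_pair_compose[OF flex_pair_weier_standard eq inv]
    show "h$1$2 = 0" "h$3$2 = 0" "h$3$1 = 0" using flex_pair_weier_infinite[OF f] that(3) by (simp_all add: col)
  qed
  show ?thesis
  proof (cases "h$3$2 = 0")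
    case True
    show ?thesis using tri[OF inv eq True] by (intro bexI[of _ None]) (auto simp: swap_matrix_def flexes_def)
  next
    case False
    define x y where "x = h$1$2 / h$3$2" and "y = h$2$2 / h$3$2"
    have q: "(x, y) \<in> affine_flexes a b"
      using flex_pair_weier_affine[OF flex_pair_compose[OF flex_pair_weier_standard eq inv]] False by (simp add: col x_def y_def)
    then have qf: "Some (x, y) \<in> flexes a b" by (simp add: flexes_def)
    let ?t = "swap_matrix a b (Some (x, y))"
    have y0: "y \<noteq> 0" using affine_flex_slope[OF d q] by simp
    have "h *v vec3 0 1 0 = h$3$2 *s vec3 x y 1" using False by (simp add: vec3_eq_iff col x_def y_def)
    then have "(?t ** h) *v vec3 0 1 0 = h$3$2 *s vec3 0 (2 * y) 0"
      by (simp add: swap_matrix_def flex_swap_flex[OF y0] vector_scalar_commute flip: matrix_vector_mul_assoc)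
    then have 32: "(?t ** h)$3$2 = 0" using col(2)[of "?t ** h" 3] by simp
    have inv': "invertible (?t ** h)"
      using inv weier_swap_matrix(2)[OF d qf] by (intro invertible_mult) (auto simp: invertible_def)
    have "weier a b ((?t ** h) *v v) = weier a' b' v" for v
      using weier_swap_matrix(1)[OF d qf] eq by (simp flip: matrix_vector_mul_assoc)
    from tri[OF inv' this 32] obtain \<alpha> \<beta> where ab: "\<alpha>^3 = 1" "\<beta> \<noteq> 0" "a' = a * \<alpha> / \<beta>^4" "b' = b / \<beta>^6" "?t ** h = diag_matrix \<alpha> \<beta>"
      by blast
    have "h = (?t ** ?t) ** h" unfolding weier_swap_matrix(2)[OF d qf] by simp
    also have "\<dots> = ?t ** diag_matrix \<alpha> \<beta>" unfolding ab(5)[symmetric] by (rule matrix_mul_assoc[symmetric])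
    finally have "h = ?t ** diag_matrix \<alpha> \<beta>" .
    then show ?thesis using ab qf by blast
  qed
qed

text \<open>The image of the flex at infinity, from which the flex \<open>q\<close> can be
  recovered. Both the local rigidity and the count of sheets use this.\<close>

lemma swap_diag_column:
  assumes d: "a^3 + b^2 \<noteq> 0" and q: "q \<in> flexes a b"
  shows "(swap_matrix a b q ** diag_matrix \<alpha> \<beta>) *v vec3 0 1 0 =
     (case q of None \<Rightarrow> vec3 0 \<beta> 0 | Some (x, y) \<Rightarrow> (\<beta> / (2 * y)) *s vec3 x y 1)"
proof -
  have 1: "diag_matrix \<alpha> \<beta> *v vec3 0 1 0 = \<beta> *s vec3 0 1 0" by (simp add: vec3_eq_iff)
  show ?thesis
  proof (cases q)
    case None
    then show ?thesis by (simp add: swap_matrix_def vec3_eq_iff)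
  next
    case (Some r)
    obtain x y where r: "r = (x, y)" by fastforce
    have "(x, y) \<in> affine_flexes a b" using q Some r by (auto simp: flexes_def)
    then have "y \<noteq> 0" using affine_flex_slope[OF d] by blast
    then show ?thesis using Some r 1
      by (simp add: swap_matrix_def vector_scalar_commute flex_swap_infinity flip: matrix_vector_mul_assoc)
  qed
qed

text \<open>The derivative of the quartic is four times the cubic in \<open>x\<close>, so a multiple
  root would give a flex with \<open>y = 0\<close>, which smoothness excludes. Hence there are four
  abscissae with two values of \<open>y\<close> each, and the flex at infinity.\<close>

lemma card_flexes:
  assumes d: "a^3 + b^2 \<noteq> 0"
  shows "finite (flexes a b)" "card (flexes a b) = 9"
proof -
  define \<psi> :: "complex poly" where "\<psi> = [:- 3 * a^2, 8 * b, 6 * a, 0, 1:]"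
  let ?R = "{x. poly \<psi> x = 0}"
  have \<psi>: "poly \<psi> x = x^4 + 6 * a * x^2 + 8 * b * x - 3 * a^2" for x
    by (simp add: \<psi>_def algebra_simps power2_eq_square power4_eq_xxxx)
  have cubic0: "x^3 + 3 * a * x + 2 * b \<noteq> 0" if "poly \<psi> x = 0" for x
  proof
    assume "x^3 + 3 * a * x + 2 * b = 0"
    then have "(x, 0) \<in> affine_flexes a b" using that by (simp add: affine_flexes_def \<psi>)
    then show False using affine_flex_slope(1)[OF d] by blast
  qed
  have "rsquarefree \<psi>"
    unfolding rsquarefree_roots
  proof (intro allI notI)
    fix x assume x: "poly \<psi> x = 0 \<and> poly (pderiv \<psi>) x = 0"
    have "poly (pderiv \<psi>) x = 4 * (x^3 + 3 * a * x + 2 * b)"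
      by (simp add: \<psi>_def pderiv_pCons algebra_simps power3_eq_cube)
    then have "x^3 + 3 * a * x + 2 * b = 0" using x by (metis mult_eq_0_iff zero_neq_numeral)
    then show False using cubic0 x by blast
  qed
  moreover have "degree \<psi> = 4" "\<psi> \<noteq> 0" by (simp_all add: \<psi>_def)
  moreover have fin: "finite ?R" by (rule poly_roots_finite) (simp add: \<psi>_def)
  moreover have "degree (\<Prod>z\<in>?R. [:- z, 1:]) = card ?R"
    by (subst degree_prod_sum_eq) auto
  ultimately have R: "card ?R = 4" "finite ?R"
    using arg_cong[OF complex_poly_decompose_rsquarefree[of \<psi>], of degree] by (auto split: if_splits)
  have sq: "finite {y. y^2 = c} \<and> card {y. y^2 = c} = 2" if c: "c \<noteq> 0" for c :: complex
  proof -
    have "{y. y^2 = c} = {csqrt c, - csqrt c}" using power2_eq_iff[of _ "csqrt c"] by auto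
    then show ?thesis using c by simp
  qed
  have aff: "affine_flexes a b = Sigma ?R (\<lambda>x. {y. y^2 = x^3 + 3 * a * x + 2 * b})"
    by (auto simp: affine_flexes_def \<psi>)
  have fin: "finite (affine_flexes a b)" unfolding aff using R sq cubic0 by (intro finite_SigmaI) auto
  have "card (affine_flexes a b) = (\<Sum>x\<in>?R. card {y. y^2 = x^3 + 3 * a * x + 2 * b})"
    unfolding aff using R sq cubic0 by (intro card_SigmaI) auto
  also have "\<dots> = (\<Sum>x\<in>?R. 2)" using sq cubic0 by (intro sum.cong) auto
  finally have "card (affine_flexes a b) = 8" using R by simp
  then show "finite (flexes a b)" "card (flexes a b) = 9"
    using fin by (simp_all add: flexes_def card_image)
qed

section \<open>The Weierstrass normal form\<close>

text \<open>Counted with multiplicity, \<open>p\<close> has more roots than \<open>u\<close> can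
  absorb; dividing out the shared roots one at a time leaves a root of \<open>p\<close> at which
  \<open>r\<close> vanishes.\<close>

lemma common_root_of_dvd:
  fixes p r u :: "complex poly"
  assumes "p dvd r * u" "u \<noteq> 0" "degree u < degree p"
  shows "\<exists>y. poly p y = 0 \<and> poly r y = 0"
  using assms
proof (induction "degree p" arbitrary: p u)
  case 0 then show ?case by simp
next
  case (Suc n)
  have "degree p > 0" using Suc.hyps(2) by simp
  then obtain y where y: "poly p y = 0" using alg_closed_imp_poly_has_root by blast
  obtain w where w: "r * u = p * w" using Suc.prems(1) by (auto elim: dvdE)
  have "poly r y * poly u y = 0" using arg_cong[OF w, of "\<lambda>q. poly q y"] y by simp
  then consider "poly r y = 0" | "poly u y = 0" by auto
  then show ?case
  proof cases
    case 1 then show ?thesis using y by blast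
  next
    case 2
    obtain p' where p': "p = [:- y, 1:] * p'" using y by (auto simp: poly_eq_0_iff_dvd elim: dvdE)
    obtain u' where u': "u = [:- y, 1:] * u'" using 2 by (auto simp: poly_eq_0_iff_dvd elim: dvdE)
    have "p \<noteq> 0" using Suc.hyps(2) by auto
    then have p0: "p' \<noteq> 0" and u0: "u' \<noteq> 0" using p' u' Suc.prems(2) by auto
    have dp: "degree p = Suc (degree p')" unfolding p' using p0 by (subst degree_mult_eq) auto
    have du: "degree u = Suc (degree u')" unfolding u' using u0 by (subst degree_mult_eq) auto
    have "[:- y, 1:] * (r * u') = [:- y, 1:] * (p' * w)"
      using w unfolding p' u' by (simp only: mult.left_commute mult.assoc)
    then have "r * u' = p' * w" by (subst (asm) mult_cancel_left) auto
    then have "p' dvd r * u'" by simp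
    moreover have "n = degree p'" "degree u' < degree p'" using dp du Suc by auto
    ultimately obtain z where "poly p' z = 0" "poly r z = 0" using Suc.hyps(1) u0 by blast
    then show ?thesis using p' by auto
  qed
qed

lemma exists_kernel_vector:
  fixes M :: "complex^3^3"
  assumes "det M = 0"
  obtains v where "v \<noteq> 0" "M *v v = 0"
  using assms invertible_det_nz[of M] invertible_left_inverse[of M] matrix_left_invertible_ker[of M] by blast

text \<open>Lets a nested expression be recognised as polynomial by closure rules, without computing
  its coefficients.\<close>

definition polynomial_fun :: "(complex \<Rightarrow> complex) \<Rightarrow> bool" where
  "polynomial_fun f \<longleftrightarrow> (\<exists>q. \<forall>x. f x = poly q x)"

lemma polynomial_fun_intros:
  "polynomial_fun (\<lambda>x. c)" "polynomial_fun (\<lambda>x. x)"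
  "polynomial_fun f \<Longrightarrow> polynomial_fun g \<Longrightarrow> polynomial_fun (\<lambda>x. f x + g x)"
  "polynomial_fun f \<Longrightarrow> polynomial_fun g \<Longrightarrow> polynomial_fun (\<lambda>x. f x - g x)"
  "polynomial_fun f \<Longrightarrow> polynomial_fun g \<Longrightarrow> polynomial_fun (\<lambda>x. f x * g x)"
  "polynomial_fun f \<Longrightarrow> polynomial_fun (\<lambda>x. - f x)"
  unfolding polynomial_fun_def
  by (force intro: exI[of _ "[:c:]"] exI[of _ "[:0,1:]"] exI[of _ "_ + _ :: complex poly"] exI[of _ "_ - _ :: complex poly"]
      exI[of _ "_ * _ :: complex poly"] exI[of _ "- _ :: complex poly"])+

lemma polynomial_fun_cases:
  assumes "polynomial_fun f"
  obtains x where "f x = 0" | c where "\<And>x. f x = c"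
proof -
  obtain q where q: "\<And>x. f x = poly q x" using assms by (auto simp: polynomial_fun_def)
  show ?thesis
  proof (cases "degree q = 0")
    case True
    then obtain c where "q = [:c:]" by (meson degree_0_id degree_eq_zeroE)
    then show ?thesis using that(2)[of c] q by simp
  next
    case False
    then show ?thesis using alg_closed_imp_poly_has_root[of q] that(1) q by auto
  qed
qed

text \<open>Either the dehomogenised form has a root, or it is a constant \<open>c\<close>; then the
  form is \<open>c z^k\<close>, which vanishes at \<open>(1, 0)\<close>.\<close>

lemma binary_form_has_zero:
  fixes N :: "complex \<Rightarrow> complex \<Rightarrow> complex"
  assumes hom: "\<And>t x z. N (t * x) (t * z) = t ^ k * N x z" and k: "k > 0"
    and poly: "polynomial_fun (\<lambda>x. N x 1)" and cont: "isCont (\<lambda>z. N 1 z) 0"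
  obtains x z where "(x, z) \<noteq> (0, 0)" "N x z = 0"
  using poly
proof (cases rule: polynomial_fun_cases)
  case (1 x) then show ?thesis using that[of x 1] by simp
next
  case (2 c)
  \<comment> \<open>Homogeneity gives the formula only for nonzero \<open>z\<close>; continuity
    carries it to \<open>z = 0\<close>.\<close>
  have "N 1 z = c * z ^ k" if "z \<noteq> 0" for z
    using hom[of z "1/z" 1] 2[of "1/z"] that by simp
  then have "eventually (\<lambda>z. c * z ^ k = N 1 z) (at 0)"
    by (auto simp: eventually_at intro!: exI[of _ 1])
  moreover have "((\<lambda>z. c * z ^ k) \<longlongrightarrow> c * 0 ^ k) (at 0)" by (intro tendsto_intros)
  ultimately have "((\<lambda>z. N 1 z) \<longlongrightarrow> c * 0 ^ k) (at 0)" by (rule Lim_transform_eventually[rotated])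
  moreover have "((\<lambda>z. N 1 z) \<longlongrightarrow> N 1 0) (at 0)" using cont by (simp add: isCont_def)
  ultimately have "N 1 0 = c * 0 ^ k" using tendsto_unique[of "at (0::complex)"] by auto
  then show ?thesis using that[of 1 0] k by simp
qed

text \<open>Weak Bezout: the norm of \<open>Q\<close> in \<open>C[x,z][y]/(P)\<close> is a binary form of degree 9; at one of its
  zeros multiplication by \<open>Q\<close> is singular, so \<open>P\<close> and \<open>Q\<close> have a common root \<open>y\<close>.\<close>

lemma common_zero_monic:
  assumes c: "p (0,3,0) = 1"
  obtains x where "x \<noteq> 0" "cubic_fun p x = 0" "cubic_fun h x = 0"
proof -
  define d where "d = h (0,3,0)"
  \<comment> \<open>The form \<open>p\<close> is read as the monic cubic
    \<open>y^3 + A y^2 + B y + C\<close> over the polynomials in \<open>x\<close> and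
    \<open>z\<close>.\<close>
  define A B C where "A x z = p (1,2,0) * x + p (0,2,1) * z"
    and "B x z = p (2,1,0) * (x * x) + p (1,1,1) * (x * z) + p (0,1,2) * (z * z)"
    and "C x z = p (3,0,0) * (x * x * x) + p (2,0,1) * (x * x * z) + p (1,0,2) * (x * z * z) + p (0,0,3) * (z * z * z)"
    for x z :: complex
  \<comment> \<open>The remainder \<open>h - d p\<close>, of degree at most 2 in
    \<open>y\<close>.\<close>
  define r2 r1 r0 where "r2 x z = h (1,2,0) * x + h (0,2,1) * z - d * A x z"
    and "r1 x z = h (2,1,0) * (x * x) + h (1,1,1) * (x * z) + h (0,1,2) * (z * z) - d * B x z"
    and "r0 x z = h (3,0,0) * (x * x * x) + h (2,0,1) * (x * x * z) + h (1,0,2) * (x * z * z) + h (0,0,3) * (z * z * z) - d * C x z"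
    for x z :: complex
  \<comment> \<open>The remainder of \<open>y r\<close> modulo \<open>p\<close>; in the same way
    \<open>t\<close> is that of \<open>y^2 r\<close>. So the columns of \<open>M\<close> describe
    multiplication by \<open>r\<close>, and the degrees in \<open>x\<close> and \<open>z\<close> of
    the three factors of each term of the determinant add up to 9.\<close>
  define s0 s1 s2 where "s0 x z = - (r2 x z * C x z)" and "s1 x z = r0 x z - r2 x z * B x z"
    and "s2 x z = r1 x z - r2 x z * A x z" for x z :: complex
  define t0 t1 t2 where "t0 x z = - (s2 x z * C x z)" and "t1 x z = s0 x z - s2 x z * B x z"
    and "t2 x z = s1 x z - s2 x z * A x z" for x z :: complex
  define M :: "complex \<Rightarrow> complex \<Rightarrow> complex^3^3" where
    "M x z = vector [vec3 (r0 x z) (s0 x z) (t0 x z), vec3 (r1 x z) (s1 x z) (t1 x z), vec3 (r2 x z) (s2 x z) (t2 x z)]" for x z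
  define N where "N x z = r0 x z * s1 x z * t2 x z + s0 x z * t1 x z * r2 x z + t0 x z * r1 x z * s2 x z
      - r0 x z * t1 x z * s2 x z - s0 x z * r1 x z * t2 x z - t0 x z * s1 x z * r2 x z" for x z
  have detM: "det (M x z) = N x z" for x z by (simp add: det_3 M_def N_def)
  have hom: "N (t * x) (t * z) = t ^ 9 * N x z" for t x z
  proof -
    have 1: "A (t*x) (t*z) = t * A x z" "B (t*x) (t*z) = t^2 * B x z" "C (t*x) (t*z) = t^3 * C x z"
      by (simp_all add: A_def B_def C_def algebra_simps power2_eq_square power3_eq_cube)
    have 2: "r2 (t*x) (t*z) = t * r2 x z" "r1 (t*x) (t*z) = t^2 * r1 x z" "r0 (t*x) (t*z) = t^3 * r0 x z"
      unfolding r0_def r1_def r2_def 1 by (simp_all add: algebra_simps power2_eq_square power3_eq_cube)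
    have 3: "s2 (t*x) (t*z) = t^2 * s2 x z" "s1 (t*x) (t*z) = t^3 * s1 x z" "s0 (t*x) (t*z) = t^4 * s0 x z"
      unfolding s0_def s1_def s2_def 1 2 by (simp_all add: algebra_simps eval_nat_numeral)
    have 4: "t2 (t*x) (t*z) = t^3 * t2 x z" "t1 (t*x) (t*z) = t^4 * t1 x z" "t0 (t*x) (t*z) = t^5 * t0 x z"
      unfolding t0_def t1_def t2_def 1 2 3 by (simp_all add: algebra_simps eval_nat_numeral)
    show ?thesis unfolding N_def 2 3 4 by (simp add: algebra_simps eval_nat_numeral)
  qed
  have pol: "polynomial_fun (\<lambda>x. N x 1)"
    unfolding N_def t0_def t1_def t2_def s0_def s1_def s2_def r0_def r1_def r2_def A_def B_def C_def
    by (intro polynomial_fun_intros)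
  have "continuous_on UNIV (\<lambda>z. N 1 z)"
    unfolding N_def t0_def t1_def t2_def s0_def s1_def s2_def r0_def r1_def r2_def A_def B_def C_def
    by (intro continuous_intros)
  then have cont: "isCont (\<lambda>z. N 1 z) 0" by (simp add: continuous_on_eq_continuous_at)
  obtain x z where xz: "(x, z) \<noteq> (0, 0)" "N x z = 0" by (rule binary_form_has_zero[OF hom _ pol cont]) auto
  \<comment> \<open>A kernel vector is a nonzero polynomial \<open>Up\<close> of degree at most 2
    whose product with \<open>Rp\<close> is divisible by \<open>Pp\<close>.\<close>
  obtain u where u: "u \<noteq> 0" "M x z *v u = 0"
    by (rule exists_kernel_vector[of "M x z"]) (use xz detM in auto)
  have row: "r0 x z * u$1 + s0 x z * u$2 + t0 x z * u$3 = 0" "r1 x z * u$1 + s1 x z * u$2 + t1 x z * u$3 = 0"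
     "r2 x z * u$1 + s2 x z * u$2 + t2 x z * u$3 = 0"
    using u(2) by (simp_all add: vec3_eq_iff mat3_vec M_def)
  define Pp Rp Up where "Pp = [:C x z, B x z, A x z, 1:]" and "Rp = [:r0 x z, r1 x z, r2 x z:]" and "Up = [:u$1, u$2, u$3:]"
  have "Rp * Up = Pp * [:u$2 * r2 x z + u$3 * s2 x z, u$3 * r2 x z:]"
  proof -
    have c: "r0 x z * u$1 = C x z * (u$2 * r2 x z + u$3 * s2 x z)"
      "r0 x z * u$2 + r1 x z * u$1 = B x z * (u$2 * r2 x z + u$3 * s2 x z) + C x z * (u$3 * r2 x z)"
      "r0 x z * u$3 + r1 x z * u$2 + r2 x z * u$1 = A x z * (u$2 * r2 x z + u$3 * s2 x z) + B x z * (u$3 * r2 x z)"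
      using row unfolding t0_def t1_def t2_def s0_def s1_def s2_def by Groebner_Basis.algebra+
    have "Rp * Up = [:r0 x z * u$1, r0 x z * u$2 + r1 x z * u$1, r0 x z * u$3 + r1 x z * u$2 + r2 x z * u$1,
        r1 x z * u$3 + r2 x z * u$2, r2 x z * u$3:]"
      by (simp add: Rp_def Up_def algebra_simps)
    also have "\<dots> = Pp * [:u$2 * r2 x z + u$3 * s2 x z, u$3 * r2 x z:]"
      unfolding c by (simp add: Pp_def s2_def algebra_simps)
    finally show ?thesis .
  qed
  then have "Pp dvd Rp * Up" by (rule dvdI)
  moreover have "Up \<noteq> 0" using u(1) by (simp add: Up_def vec3_eq_iff)
  moreover have "degree Up < degree Pp"
  proof -
    have "degree Pp = 3" by (simp add: Pp_def)
    moreover have "degree Up \<le> 2" unfolding Up_def by (intro degree_pCons_le[THEN order_trans]) auto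
    ultimately show ?thesis by simp
  qed
  ultimately obtain y where y: "poly Pp y = 0" "poly Rp y = 0" using common_root_of_dvd by blast
  let ?v = "vec3 x y z"
  have "cubic_fun p ?v = poly Pp y"
    by (simp add: cubic_fun_explicit Pp_def A_def B_def C_def c algebra_simps power2_eq_square power3_eq_cube)
  moreover have "cubic_fun h ?v = poly Rp y + d * poly Pp y"
    by (simp add: cubic_fun_explicit Pp_def Rp_def A_def B_def C_def r0_def r1_def r2_def d_def algebra_simps power2_eq_square power3_eq_cube)
  moreover have "?v \<noteq> 0" using xz(1) by (auto simp: vec3_eq_iff)
  ultimately show ?thesis using that[of ?v] y by simp
qed

definition column_matrix :: "complex^3 \<Rightarrow> complex^3 \<Rightarrow> complex^3 \<Rightarrow> complex^3^3" where
  "column_matrix u v w = vector [vec3 (u$1) (v$1) (w$1), vec3 (u$2) (v$2) (w$2), vec3 (u$3) (v$3) (w$3)]"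

lemma column_matrix_vec: "(column_matrix u v w *v x) = x$1 *s u + x$2 *s v + x$3 *s w"
  by (simp add: vec3_eq_iff mat3_vec column_matrix_def mult.commute)

lemma det_column_matrix: "det (column_matrix u v w) =
   (u$2 * v$3 - u$3 * v$2) * w$1 + (u$3 * v$1 - u$1 * v$3) * w$2 + (u$1 * v$2 - u$2 * v$1) * w$3"
  by (simp add: det_3 column_matrix_def algebra_simps)

lemma complete_to_basis:
  assumes p: "p \<noteq> 0" and ind: "\<forall>c. v \<noteq> c *s p"
  obtains w where "invertible (column_matrix v p w)"
proof -
  have "v$2 * p$3 - v$3 * p$2 \<noteq> 0 \<or> v$3 * p$1 - v$1 * p$3 \<noteq> 0 \<or> v$1 * p$2 - v$2 * p$1 \<noteq> 0"
  proof (rule ccontr)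
    assume "\<not> ?thesis"
    then have e: "v$2 * p$3 = v$3 * p$2" "v$3 * p$1 = v$1 * p$3" "v$1 * p$2 = v$2 * p$1" by auto
    consider "p$1 \<noteq> 0" | "p$2 \<noteq> 0" | "p$3 \<noteq> 0" using p by (auto simp: vec3_eq_iff)
    then show False
    proof cases
      case 1 then have "v = (v$1 / p$1) *s p" using e by (simp add: vec3_eq_iff field_simps)
      then show False using ind by blast
    next
      case 2 then have "v = (v$2 / p$2) *s p" using e by (simp add: vec3_eq_iff field_simps)
      then show False using ind by blast
    next
      case 3 then have "v = (v$3 / p$3) *s p" using e by (simp add: vec3_eq_iff field_simps)
      then show False using ind by blast
    qed
  qed
  then show ?thesis
    using that[of "vec3 1 0 0"] that[of "vec3 0 1 0"] that[of "vec3 0 0 1"]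
    by (auto simp: invertible_det_nz det_column_matrix)
qed

lemma complete_to_basis1:
  assumes p: "p \<noteq> (0 :: complex^3)"
  obtains v w where "invertible (column_matrix v p w)"
proof -
  have "\<exists>v. \<forall>c. v \<noteq> c *s p"
  proof (cases "p$1 = 0")
    case True
    then show ?thesis by (intro exI[of _ "vec3 1 0 0"]) (simp add: vec3_eq_iff)
  next
    case False
    then show ?thesis by (intro exI[of _ "vec3 0 1 1"]) (auto simp: vec3_eq_iff)
  qed
  then show ?thesis using complete_to_basis[OF p] that by blast
qed

text \<open>Moving a point with \<open>P e\<close> nonzero to \<open>(0, 1, 0)\<close> and rescaling
  makes the first cubic monic in \<open>y\<close>.\<close>

lemma common_zero:
  assumes P: "is_cubic P" "P e \<noteq> 0" and Q: "is_cubic Q"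
  obtains x where "x \<noteq> 0" "P x = 0" "Q x = 0"
proof -
  have "cubic_fun (cubic_coeffs P) 0 = 0" by (simp add: cubic_fun_explicit)
  then have "P 0 = 0" unfolding cubic_fun_cubic_coeffs[OF P(1)] .
  then have "e \<noteq> 0" using P(2) by auto
  then obtain v w where inv: "invertible (column_matrix v e w)" by (rule complete_to_basis1)
  let ?A = "column_matrix v e w"
  let ?P = "\<lambda>x. (1 / P e) * P (?A *v x)" and ?Q = "\<lambda>x. Q (?A *v x)"
  have P': "is_cubic ?P" by (intro is_cubic_scale is_cubic_compose P)
  have Q': "is_cubic ?Q" by (intro is_cubic_compose Q)
  have "?A *v vec3 0 1 0 = e" by (simp add: column_matrix_vec)
  then have "cubic_coeffs ?P (0,3,0) = 1" using P(2) by (simp add: cubic_coeffs_def)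
  then obtain x where x: "x \<noteq> 0" "cubic_fun (cubic_coeffs ?P) x = 0" "cubic_fun (cubic_coeffs ?Q) x = 0"
    by (rule common_zero_monic)
  have "?A *v x \<noteq> 0" using inv x(1) by (metis invertible_left_inverse matrix_left_invertible_ker)
  then show ?thesis using that[of "?A *v x"] x(2,3) P(2) unfolding cubic_fun_cubic_coeffs[OF P'] cubic_fun_cubic_coeffs[OF Q'] by simp
qed

section \<open>Existence of a flex and reduction to normal form\<close>

definition hessian :: "(nat \<times> nat \<times> nat \<Rightarrow> complex) \<Rightarrow> complex^3 \<Rightarrow> complex^3^3" where
  "hessian f x = (
    let a = 6 * f (3,0,0) * x$1 + 2 * f (2,1,0) * x$2 + 2 * f (2,0,1) * x$3;
        b = 2 * f (2,1,0) * x$1 + 2 * f (1,2,0) * x$2 + f (1,1,1) * x$3;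
        c = 2 * f (2,0,1) * x$1 + f (1,1,1) * x$2 + 2 * f (1,0,2) * x$3;
        d = 2 * f (1,2,0) * x$1 + 6 * f (0,3,0) * x$2 + 2 * f (0,2,1) * x$3;
        e = f (1,1,1) * x$1 + 2 * f (0,2,1) * x$2 + 2 * f (0,1,2) * x$3;
        g = 2 * f (1,0,2) * x$1 + 2 * f (0,1,2) * x$2 + 6 * f (0,0,3) * x$3
    in vector [vec3 a b c, vec3 b d e, vec3 c e g])"

lemma is_cubic_det_hessian: "is_cubic (\<lambda>x. det (hessian f x))"
proof -
  have neg: "is_cubic P \<Longrightarrow> is_cubic (\<lambda>x. - P x)" for P using is_cubic_scale[of P "-1"] by simp
  have sub: "is_cubic P \<Longrightarrow> is_cubic Q \<Longrightarrow> is_cubic (\<lambda>x. P x - Q x)" for P Q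
    using is_cubic_add[of P "\<lambda>x. - Q x"] neg by simp
  show ?thesis unfolding det_3 hessian_def Let_def vector_3 by (intro is_cubic_add sub is_cubic_product)
qed

text \<open>Euler's relation for the quadratic partial derivatives, evaluated at \<open>x\<close>
  and polarised in \<open>v\<close>; the factor 2 is their degree.\<close>

lemma cubic_deriv_hessian:
  "2 * cubic_deriv (cubic_fun f) x v = (\<Sum>i\<in>UNIV. v$i * (hessian f x *v x)$i)"
  "2 * cubic_deriv (cubic_fun f) v x = (\<Sum>i\<in>UNIV. v$i * (hessian f x *v v)$i)"
  by (simp_all add: cubic_deriv_partial dx_cubic_def dy_cubic_def dz_cubic_def cubic_monomials_explicit sum_3 mat3_vec
      hessian_def Let_def algebra_simps power2_eq_square)

lemma hessian_symmetric: "(\<Sum>i\<in>UNIV. v$i * (hessian f x *v w)$i) = (\<Sum>i\<in>UNIV. w$i * (hessian f x *v v)$i)"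
  by (simp add: sum_3 mat3_vec hessian_def Let_def algebra_simps)

text \<open>A common zero \<open>x\<close> of the cubic and its Hessian determinant is a flex, and a
  kernel vector of the Hessian at \<open>x\<close> spans the tangent together with \<open>x\<close>.
  Were the kernel vector a multiple of \<open>x\<close>, Euler's relation would make
  \<open>x\<close> singular.\<close>

lemma flex_pair_exists:
  assumes P: "is_cubic P" and sm: "cubic_smooth P"
  obtains p v where "flex_pair P p v"
proof -
  define f where "f = cubic_coeffs P"
  have Pf: "P = cubic_fun f" unfolding f_def cubic_fun_cubic_coeffs[OF P] ..
  have "\<exists>e. P e \<noteq> 0"
  proof (rule ccontr)
    assume "\<not> ?thesis"
    then have "cubic_deriv P x v = 0" for x v by (simp add: cubic_deriv_def)
    moreover have "vec3 1 0 0 \<noteq> 0" by (simp add: vec3_eq_iff)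
    ultimately show False using sm unfolding cubic_smooth_def by blast
  qed
  then obtain x where x: "x \<noteq> 0" "P x = 0" "det (hessian f x) = 0"
    using common_zero[OF P _ is_cubic_det_hessian] by blast
  obtain v where v: "v \<noteq> 0" "hessian f x *v v = 0" using exists_kernel_vector[OF x(3)] by blast
  have "2 * cubic_deriv P x v = 0" unfolding Pf cubic_deriv_hessian(1) hessian_symmetric[of v] v(2) by simp
  moreover have "2 * cubic_deriv P v x = 0" unfolding Pf cubic_deriv_hessian(2)[of f v x] v(2) by simp
  moreover have "v \<noteq> c *s x" for c
  proof
    assume vc: "v = c *s x"
    then have "c \<noteq> 0" using v(1) by auto
    have "c *s (hessian f x *v x) = 0" using v(2) vc by (simp add: vector_scalar_commute)
    then have h: "hessian f x *v x = 0" using \<open>c \<noteq> 0\<close> by simp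
    have "2 * cubic_deriv P x w = 0" for w unfolding Pf cubic_deriv_hessian(1) h by simp
    then show False using sm x(1) by (auto simp: cubic_smooth_def)
  qed
  ultimately show ?thesis using that[of x v] x by (simp add: flex_pair_def)
qed

lemma cube_root_exists: "\<exists>r. r ^ 3 = (c :: complex)"
  using nth_root_exists[of 3 c] by auto

lemma weier_normal_form_at_infinity:
  assumes f: "f (0,3,0) = 0" "f (1,2,0) = 0" "f (2,1,0) = 0" and f2: "f (0,2,1) \<noteq> 0" and f3: "f (3,0,0) \<noteq> 0"
  obtains B a b where "invertible B" "\<And>x. cubic_fun f (B *v x) = weier a b x"
proof -
  \<comment> \<open>The numbers \<open>u\<close> and \<open>w\<close> complete the square in
    \<open>y\<close>.\<close>
  define k c u w where "k = f (0,2,1)" "c = f (3,0,0)" "u = f (1,1,1) / (2 * k)" "w = f (0,1,2) / (2 * k)"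
  note defs = this
  define G2 G1 G0 where "G2 = f (2,0,1) - k * u^2" "G1 = f (1,0,2) - 2 * k * u * w" "G0 = f (0,0,3) - k * w^2"
  note G = this
  have k: "k \<noteq> 0" and c: "c \<noteq> 0" using f2 f3 by (simp_all add: defs)
  have F: "cubic_fun f x = k * x$3 * (x$2 + u * x$1 + w * x$3)^2 + c * x$1^3 + G2 * x$1^2 * x$3 + G1 * x$1 * x$3^2 + G0 * x$3^3" for x
  proof -
    have 1: "f (1,1,1) = 2 * k * u" "f (0,1,2) = 2 * k * w" using k by (simp_all add: defs)
    have 2: "f (2,0,1) = G2 + k * u^2" "f (1,0,2) = G1 + 2 * k * u * w" "f (0,0,3) = G0 + k * w^2" by (simp_all add: G)
    show ?thesis unfolding cubic_fun_explicit f 1 2 defs(1,2)[symmetric]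
      by (simp add: algebra_simps power2_eq_square power3_eq_cube)
  qed
  \<comment> \<open>Rescaling \<open>x\<close> by \<open>r\<close> and \<open>y\<close> by
    \<open>t\<close> brings the coefficients of \<open>x^3\<close> and \<open>y^2 z\<close> to -1
    and 1.\<close>
  obtain r where r: "r ^ 3 = - 1 / c" using cube_root_exists by blast
  define t where "t = csqrt (1 / k)"
  have t: "k * t^2 = 1" using k by (simp add: t_def)
  have cr: "c * r^3 = -1" using r c by simp
  have r0: "r \<noteq> 0" using cr by auto
  have t0: "t \<noteq> 0" using t by auto
  \<comment> \<open>The translation in \<open>x\<close> that removes the term
    \<open>x^2 z\<close>.\<close>
  define s where "s = - G2 / (3 * c)"
  have s: "3 * c * s = - G2" using c by (simp add: s_def)
  define B :: "complex^3^3" where "B = vector [vec3 r 0 s, vec3 (- u * r) t (- u * s - w), vec3 0 0 1]"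
  have "det B = r * t" by (simp add: B_def det_3)
  then have inv: "invertible B" using r0 t0 by (simp add: invertible_det_nz)
  define e1 e0 where "e1 = 3 * c * r * s^2 + 2 * G2 * r * s + G1 * r" and "e0 = c * s^3 + G2 * s^2 + G1 * s + G0"
  have "cubic_fun f (B *v x) = weier (- e1 / 3) (- e0 / 2) x" for x
  proof -
    have Bx: "(B *v x)$1 = r * x$1 + s * x$3" "(B *v x)$3 = x$3" "(B *v x)$2 + u * (B *v x)$1 + w * (B *v x)$3 = t * x$2"
      by (simp_all add: B_def mat3_vec algebra_simps)
    have "cubic_fun f (B *v x) = k * x$3 * (t * x$2)^2 + c * (r * x$1 + s * x$3)^3 + G2 * (r * x$1 + s * x$3)^2 * x$3
       + G1 * (r * x$1 + s * x$3) * x$3^2 + G0 * x$3^3"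
      unfolding F unfolding Bx(3) unfolding Bx(1,2) ..
    also have "\<dots> = (k * t^2) * x$2^2 * x$3 + (c * r^3) * x$1^3 + (3 * c * s + G2) * r^2 * x$1^2 * x$3 + e1 * x$1 * x$3^2 + e0 * x$3^3"
      by (simp add: e1_def e0_def algebra_simps power2_eq_square power3_eq_cube)
    also have "\<dots> = weier (- e1 / 3) (- e0 / 2) x" unfolding t cr s by (simp add: weier_def)
    finally show ?thesis .
  qed
  then show ?thesis using that inv by blast
qed

text \<open>Placing a flex at \<open>(0, 1, 0)\<close> and a point of its tangent at
  \<open>(1, 0, 0)\<close> removes three monomials; smoothness keeps the two coefficients by which
  the normalisation divides from vanishing.\<close>

theorem weier_normal_form:
  assumes P: "is_cubic P" and sm: "cubic_smooth P"
  obtains g a b where "invertible g" "a^3 + b^2 \<noteq> 0" "\<And>x. P x = weier a b (g *v x)"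
proof -
  obtain p v where pv: "flex_pair P p v" using flex_pair_exists[OF P sm] .
  then obtain w where inv: "invertible (column_matrix v p w)" using complete_to_basis by (auto simp: flex_pair_def)
  let ?A = "column_matrix v p w"
  let ?Q = "\<lambda>x. P (?A *v x)"
  define f where "f = cubic_coeffs ?Q"
  have Qf: "cubic_fun f = ?Q" unfolding f_def by (rule cubic_fun_cubic_coeffs[OF is_cubic_compose[OF P]])
  have smQ: "cubic_smooth (cubic_fun f)" unfolding Qf by (rule cubic_smooth_compose[OF sm inv])
  have A: "?A *v vec3 1 0 0 = v" "?A *v vec3 0 1 0 = p" by (simp_all add: column_matrix_vec)
  have D: "cubic_deriv (cubic_fun f) x y = cubic_deriv P (?A *v x) (?A *v y)" for x y
    unfolding Qf by (rule cubic_deriv_compose)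
  note partial = cubic_deriv_partial dx_cubic_def dy_cubic_def dz_cubic_def cubic_monomials_explicit
  have f030: "f (0,3,0) = 0"
  proof -
    have "cubic_fun f (vec3 0 1 0) = 0" unfolding Qf A using pv by (simp add: flex_pair_def)
    then show ?thesis by (simp add: cubic_fun_explicit)
  qed
  have f120: "f (1,2,0) = 0"
  proof -
    have "cubic_deriv (cubic_fun f) (vec3 0 1 0) (vec3 1 0 0) = 0" unfolding D A using pv by (simp add: flex_pair_def)
    then show ?thesis by (simp add: partial)
  qed
  have f210: "f (2,1,0) = 0"
  proof -
    have "cubic_deriv (cubic_fun f) (vec3 1 0 0) (vec3 0 1 0) = 0" unfolding D A using pv by (simp add: flex_pair_def)
    then show ?thesis by (simp add: partial)
  qed
  have f021: "f (0,2,1) \<noteq> 0"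
  proof
    assume "f (0,2,1) = 0"
    then have "cubic_deriv (cubic_fun f) (vec3 0 1 0) y = 0" for y by (simp add: partial f030 f120[simplified])
    moreover have "vec3 0 1 0 \<noteq> 0" by (simp add: vec3_eq_iff)
    ultimately show False using smQ unfolding cubic_smooth_def by blast
  qed
  have f300: "f (3,0,0) \<noteq> 0"
  proof
    assume f300: "f (3,0,0) = 0"
    \<comment> \<open>Without the term \<open>x^3\<close> the line \<open>z = 0\<close> would be a
      component, and a point \<open>(1, y, 0)\<close> where it meets the residual conic would be
      singular.\<close>
    have "degree [:f (2,0,1), f (1,1,1), f (0,2,1):] > 0" using f021 by simp
    then obtain y where y: "poly [:f (2,0,1), f (1,1,1), f (0,2,1):] y = 0" using alg_closed_imp_poly_has_root by blast
    then have y': "f (2,0,1) + f (1,1,1) * y + f (0,2,1) * y^2 = 0" by (simp add: algebra_simps power2_eq_square)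
    have "cubic_deriv (cubic_fun f) (vec3 1 y 0) z = z$3 * (f (2,0,1) + f (1,1,1) * y + f (0,2,1) * y^2)" for z
      by (simp add: partial f030 f120[simplified] f210[simplified] f300 algebra_simps)
    then have "cubic_deriv (cubic_fun f) (vec3 1 y 0) z = 0" for z unfolding y' by simp
    moreover have "vec3 1 y 0 \<noteq> 0" by (simp add: vec3_eq_iff)
    ultimately show False using smQ unfolding cubic_smooth_def by blast
  qed
  obtain B a b where B: "invertible B" "\<And>x. cubic_fun f (B *v x) = weier a b x"
    using weier_normal_form_at_infinity[OF f030 f120 f210 f021 f300] by blast
  have "cubic_smooth (\<lambda>x. cubic_fun f (B *v x))" by (rule cubic_smooth_compose[OF smQ B(1)])
  then have ab: "a^3 + b^2 \<noteq> 0" unfolding B(2) by (simp add: cubic_smooth_weier)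
  obtain C where C: "(?A ** B) ** C = mat 1" "C ** (?A ** B) = mat 1"
    using invertible_mult[OF inv B(1)] by (auto simp: invertible_def)
  have "P x = weier a b (C *v x)" for x
  proof -
    have "weier a b (C *v x) = P ((?A ** B) *v (C *v x))" unfolding B(2)[symmetric] Qf by (simp only: matrix_vector_mul_assoc matrix_mul_assoc)
    then show ?thesis using C by (simp add: matrix_vector_mul_assoc matrix_mul_assoc)
  qed
  moreover have "invertible C" using C by (auto simp: invertible_def)
  ultimately show ?thesis using that ab by blast
qed

text \<open>If neither parameter vanishes, \<open>b' / b\<close> determines
  \<open>1 / \<beta>^2\<close> up to a cube root of unity, and equality of the invariants makes the
  remaining factor of \<open>a'\<close> a cube root of unity.\<close>

lemma weier_parameters_equivalent:
  assumes d: "a^3 + b^2 \<noteq> (0::complex)" "a'^3 + b'^2 \<noteq> 0" and j: "a^3 * b'^2 = a'^3 * b^2"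
  obtains \<alpha> \<beta> where "\<alpha>^3 = 1" "\<beta> \<noteq> 0" "a' = a * \<alpha> / \<beta>^4" "b' = b / \<beta>^6"
proof -
  \<comment> \<open>Here \<gamma> stands for \<open>1 / \<beta>^2\<close>. For \<open>b = 0\<close>
    it comes from a square root of \<open>a' / a\<close>, otherwise from a cube root of
    \<open>b' / b\<close>.\<close>
  have "\<exists>\<alpha> \<gamma>. \<alpha>^3 = 1 \<and> \<gamma> \<noteq> 0 \<and> a' = a * \<alpha> * \<gamma>^2 \<and> b' = b * \<gamma>^3"
  proof (cases "b = 0")
    case True
    then have "a \<noteq> 0" using d by auto
    then have b': "b' = 0" using j True by simp
    then have "a' \<noteq> 0" using d by auto
    then show ?thesis using True b' \<open>a \<noteq> 0\<close> by (intro exI[of _ 1] exI[of _ "csqrt (a' / a)"]) auto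
  next
    case False
    have b': "b' \<noteq> 0"
    proof
      assume "b' = 0"
      then show False using j False d by auto
    qed
    obtain \<gamma> where \<gamma>: "\<gamma>^3 = b' / b" using cube_root_exists by blast
    then have \<gamma>0: "\<gamma> \<noteq> 0" using False b' by auto
    show ?thesis
    proof (cases "a = 0")
      case True
      then have "a' = 0" using j False by simp
      then show ?thesis using True \<gamma> \<gamma>0 False by (intro exI[of _ 1] exI[of _ \<gamma>]) auto
    next
      case a: False
      define \<alpha> where "\<alpha> = a' / (a * \<gamma>^2)"
      have "\<gamma>^6 = (b' / b)^2" unfolding \<gamma>[symmetric] by (simp flip: power_mult)
      then have g: "\<gamma>^6 * b^2 = b'^2" using False by (simp add: power_divide)
      have "a'^3 * b^2 = (a^3 * \<gamma>^6) * b^2" unfolding j[symmetric] g[symmetric] by simp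
      then have "a'^3 = a^3 * \<gamma>^6" using False by simp
      then have "\<alpha>^3 = 1"
        using a \<gamma>0 by (simp add: \<alpha>_def power_divide power_mult_distrib flip: power_mult)
      then show ?thesis using a \<gamma> \<gamma>0 False by (intro exI[of _ \<alpha>] exI[of _ \<gamma>]) (auto simp: \<alpha>_def)
    qed
  qed
  then obtain \<alpha> \<gamma> where 1: "\<alpha>^3 = 1" "\<gamma> \<noteq> 0" "a' = a * \<alpha> * \<gamma>^2" "b' = b * \<gamma>^3" by blast
  define \<beta> where "\<beta> = csqrt (1 / \<gamma>)"
  have \<beta>: "\<beta>^2 = 1 / \<gamma>" by (simp add: \<beta>_def)
  have \<beta>0: "\<beta> \<noteq> 0" using \<beta> 1(2) by auto
  have "\<beta>^4 = (1 / \<gamma>)^2" "\<beta>^6 = (1 / \<gamma>)^3" unfolding \<beta>[symmetric] by (simp_all flip: power_mult)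
  then show ?thesis using that[of \<alpha> \<beta>, OF _ \<beta>0] 1 by (auto simp: power_divide)
qed

lemma weier_parameters_invariant:
  assumes "\<alpha>^3 = 1" "\<beta> \<noteq> (0::complex)" "a' = a * \<alpha> / \<beta>^4" "b' = b / \<beta>^6"
  shows "a^3 * b'^2 = a'^3 * b^2"
  using assms by (simp add: power_divide power_mult_distrib flip: power_mult)

section \<open>The rational homology of \<open>SL\<^sub>3\<close> and \<open>GL\<^sub>3\<close>\<close>

text \<open>Relations of the target lift only up to an element of the kernel. That element is
  torsion, and commutativity lets its exponent be distributed over the product.\<close>

lemma rational_iso_rank_one_back:
  assumes f: "rational_iso A B f" and A: "comm_group A" and B: "group B" "rank_one_group B"
  shows "rank_one_group A"
proof -
  interpret A: comm_group A by (rule A)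
  interpret f: group_hom A B f using assms A.is_group by (simp add: group_hom_def group_hom_axioms_def rational_iso_def)
  obtain g where g: "g \<in> carrier B" "\<And>n::nat. n > 0 \<Longrightarrow> g [^]\<^bsub>B\<^esub> n \<noteq> \<one>\<^bsub>B\<^esub>"
    and gen: "\<And>x. x \<in> carrier B \<Longrightarrow> \<exists>n>0. \<exists>m::int. x [^]\<^bsub>B\<^esub> (n::nat) = g [^]\<^bsub>B\<^esub> m"
    using B unfolding rank_one_group_def by blast
  obtain k :: nat and h where h: "k > 0" "h \<in> carrier A" "f h = g [^]\<^bsub>B\<^esub> k" using f g(1) unfolding rational_iso_def by blast
  show ?thesis unfolding rank_one_group_def
  proof (intro bexI[of _ h] conjI ballI allI impI)
    fix n :: nat assume n: "n > 0"
    show "h [^]\<^bsub>A\<^esub> n \<noteq> \<one>\<^bsub>A\<^esub>"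
    proof
      assume "h [^]\<^bsub>A\<^esub> n = \<one>\<^bsub>A\<^esub>"
      then have "f (h [^]\<^bsub>A\<^esub> n) = \<one>\<^bsub>B\<^esub>" by simp
      then have "g [^]\<^bsub>B\<^esub> (k * n) = \<one>\<^bsub>B\<^esub>" using h g(1) by (simp add: f.hom_nat_pow f.H.nat_pow_pow)
      then show False using g(2)[of "k * n"] h(1) n by simp
    qed
  next
    fix x assume x: "x \<in> carrier A"
    obtain n :: nat and m :: int where n: "n > 0" "f x [^]\<^bsub>B\<^esub> n = g [^]\<^bsub>B\<^esub> m" using gen[OF f.hom_closed[OF x]] by blast
    \<comment> \<open>The exponents are matched so that \<open>y\<close> lies in the kernel of
      \<open>f\<close>, whose value at \<open>h\<close> is only the \<open>k\<close>-th power of the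
      generator \<open>g\<close>.\<close>
    define y where "y = x [^]\<^bsub>A\<^esub> (n * k) \<otimes>\<^bsub>A\<^esub> inv\<^bsub>A\<^esub> (h [^]\<^bsub>A\<^esub> m)"
    have yA: "y \<in> carrier A" using x h by (simp add: y_def)
    have "f (x [^]\<^bsub>A\<^esub> (n * k)) = (f x [^]\<^bsub>B\<^esub> n) [^]\<^bsub>B\<^esub> k" using x by (simp add: f.hom_nat_pow f.H.nat_pow_pow)
    also have "\<dots> = g [^]\<^bsub>B\<^esub> (m * int k)" unfolding n(2) using g(1) by (simp flip: int_pow_int add: f.H.int_pow_pow)
    also have "\<dots> = f (h [^]\<^bsub>A\<^esub> m)"
      using h g(1) by (simp add: f.hom_int_pow f.H.int_pow_pow mult.commute flip: int_pow_int)
    finally have "f y = \<one>\<^bsub>B\<^esub>" using x h by (simp add: y_def)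
    then obtain l :: nat where l: "l > 0" "y [^]\<^bsub>A\<^esub> l = \<one>\<^bsub>A\<^esub>" using f yA unfolding rational_iso_def by blast
    have c: "x [^]\<^bsub>A\<^esub> (n * k) \<in> carrier A" "h [^]\<^bsub>A\<^esub> m \<in> carrier A" using x h by auto
    have "(x [^]\<^bsub>A\<^esub> (n * k)) [^]\<^bsub>A\<^esub> l \<otimes>\<^bsub>A\<^esub> inv\<^bsub>A\<^esub> ((h [^]\<^bsub>A\<^esub> m) [^]\<^bsub>A\<^esub> l) = \<one>\<^bsub>A\<^esub>"
      using l(2) c unfolding y_def by (simp add: A.nat_pow_distrib A.nat_pow_inv)
    then have "(x [^]\<^bsub>A\<^esub> (n * k)) [^]\<^bsub>A\<^esub> l = (h [^]\<^bsub>A\<^esub> m) [^]\<^bsub>A\<^esub> l"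
      using c A.inv_solve_right'[of "\<one>\<^bsub>A\<^esub>"] by simp
    also have "(x [^]\<^bsub>A\<^esub> (n * k)) [^]\<^bsub>A\<^esub> l = x [^]\<^bsub>A\<^esub> (n * k * l)" using x by (simp add: A.nat_pow_pow)
    also have "(h [^]\<^bsub>A\<^esub> m) [^]\<^bsub>A\<^esub> l = h [^]\<^bsub>A\<^esub> (m * int l)" using h(2) by (simp flip: int_pow_int add: A.int_pow_pow)
    finally show "\<exists>n>0. \<exists>m::int. x [^]\<^bsub>A\<^esub> (n::nat) = h [^]\<^bsub>A\<^esub> m"
      using n(1) h(1) l(1) by (intro exI[of _ "n * k * l"]) auto
  qed (use h in auto)
qed

section \<open>Suspension and the homology of pairs of known rank\<close>

lemma homotopic_with_linear_pair:
  fixes f g :: "'a::topological_space \<Rightarrow> 'b::real_normed_vector"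
  assumes f: "continuous_on A f" and g: "continuous_on A g"
    and B: "\<And>x t. x \<in> A \<Longrightarrow> 0 \<le> t \<Longrightarrow> t \<le> 1 \<Longrightarrow> (1 - t) *\<^sub>R f x + t *\<^sub>R g x \<in> B"
    and T: "\<And>x t. x \<in> S \<Longrightarrow> 0 \<le> t \<Longrightarrow> t \<le> 1 \<Longrightarrow> (1 - t) *\<^sub>R f x + t *\<^sub>R g x \<in> T"
  shows "homotopic_with (\<lambda>h. h \<in> S \<rightarrow> T) (top_of_set A) (top_of_set B) f g"
  unfolding homotopic_with_def
proof (intro exI[of _ "\<lambda>(t, x). (1 - t) *\<^sub>R f x + t *\<^sub>R g x"] conjI ballI allI)
  have "continuous_on ({0..1} \<times> A) (\<lambda>y. (1 - fst y) *\<^sub>R f (snd y) + fst y *\<^sub>R g (snd y))"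
    by (intro continuous_intros continuous_on_compose2[OF f] continuous_on_compose2[OF g]) auto
  then show "continuous_map (prod_topology (top_of_set {0..1}) (top_of_set A)) (top_of_set B) (\<lambda>(t, x). (1 - t) *\<^sub>R f x + t *\<^sub>R g x)"
    using B by (auto simp: case_prod_unfold continuous_map_in_subtopology simp flip: subtopology_Times)
qed (use T in auto)

lemma homotopic_with_True: "homotopic_with (\<lambda>h. h \<in> {} \<rightarrow> {}) X Y f g \<Longrightarrow> homotopic_with (\<lambda>_. True) X Y f g"
  by (erule homotopic_with_mono) simp

lemma relative_homology_iso_homeomorphic:
  fixes f :: "'a::topological_space \<Rightarrow> 'b::topological_space"
  assumes "continuous_on A f" "f ` A \<subseteq> B" "continuous_on B g" "g ` B \<subseteq> A"
    "\<And>x. x \<in> A \<Longrightarrow> g (f x) = x" "\<And>y. y \<in> B \<Longrightarrow> f (g y) = y"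
    "f ` S \<subseteq> T" "g ` T \<subseteq> S"
  shows "relative_homology_group p (top_of_set A) S \<cong> relative_homology_group p (top_of_set B) T"
proof -
  have "homeomorphic_maps (top_of_set A) (top_of_set B) f g"
    using assms by (auto simp: homeomorphic_maps_def continuous_map_in_subtopology)
  then have "group_isomorphisms (relative_homology_group p (top_of_set A) S) (relative_homology_group p (top_of_set B) T)
     (hom_induced p (top_of_set A) S (top_of_set B) T f) (hom_induced p (top_of_set B) T (top_of_set A) S g)"
    by (rule homeomorphic_maps_relative_homology_group_isomorphisms) (use assms in auto)
  then show ?thesis unfolding is_iso_def using group_isomorphisms_imp_iso by blast
qed

lemma trivial_kernel_image_iso:
  assumes hom: "h \<in> hom A B" and grp: "group A" "group B"
    and ker: "kernel A B h = {\<one>\<^bsub>A\<^esub>}" and im: "h ` carrier A = carrier B"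
  shows "h \<in> iso A B"
proof -
  interpret group_hom A B h using assms by (simp add: group_hom_def group_hom_axioms_def)
  show ?thesis using hom inj_iff_trivial_ker ker im by (simp add: iso_def bij_betw_def)
qed

text \<open>The product retracts onto \<open>N\<close> by moving the real coordinate to -1, which
  keeps \<open>N\<close> inside itself, so the groups of the pair with \<open>N\<close> vanish and
  the triple lowers the degree by one. Excision then leaves \<open>P\<close> relative to the product
  of the line with \<open>B\<close>, and \<open>P\<close> retracts onto the level 1, a copy of
  \<open>A\<close>.\<close>

theorem suspension_iso:
  fixes A B :: "'a::real_normed_vector set"
  assumes B: "openin (top_of_set A) B"
  shows "relative_homology_group (p + 1) (top_of_set ((UNIV::real set) \<times> A)) {(t, a). a \<in> A \<and> (t \<noteq> 0 \<or> a \<in> B)}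
    \<cong> relative_homology_group p (top_of_set A) B"
proof -
  define T where "T = (UNIV::real set) \<times> A"
  define N P T' where "N = {(t, a). a \<in> A \<and> ((t::real) < 0 \<or> a \<in> B)}" and "P = {(t, a). a \<in> A \<and> ((t::real) > 0 \<or> a \<in> B)}"
    and "T' = {(t, a). a \<in> A \<and> ((t::real) \<noteq> 0 \<or> a \<in> B)}"
  let ?X = "top_of_set T"
  have sub: "N \<subseteq> T'" "P \<subseteq> T'" "T' \<subseteq> T" "N \<subseteq> T" "P \<subseteq> T" by (auto simp: T_def N_def P_def T'_def)
  have PN: "N \<union> P = T'" "N \<inter> P = UNIV \<times> B" using openin_imp_subset[OF B] by (auto simp: N_def P_def T'_def)
  obtain W where W: "open W" "B = A \<inter> W" using B by (auto simp: openin_open)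
  have oN: "openin ?X N"
  proof -
    have "N = T \<inter> (({..<0} \<times> UNIV) \<union> (UNIV \<times> W))" unfolding N_def T_def W(2) by auto
    moreover have "open (({..<0::real} \<times> (UNIV::'a set)) \<union> (UNIV \<times> W))" using W(1) by (intro open_Un open_Times) auto
    ultimately show ?thesis by (simp add: openin_open_Int)
  qed
  have oP: "openin ?X P"
  proof -
    have "P = T \<inter> (({0<..} \<times> UNIV) \<union> (UNIV \<times> W))" unfolding P_def T_def W(2) by auto
    moreover have "open (({0::real<..} \<times> (UNIV::'a set)) \<union> (UNIV \<times> W))" using W(1) by (intro open_Un open_Times) auto
    ultimately show ?thesis by (simp add: openin_open_Int)
  qed
  have linN: "(1 - t) * (-1) + t * x < 0" if "0 \<le> t" "t \<le> 1" "x < 0" for t x :: real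
    using that by (cases "t = 0") (auto simp: mult_less_0_iff add_nonpos_neg intro: add_nonpos_neg)
  have triv: "trivial_group (relative_homology_group q ?X N)" for q
  proof (rule trivial_relative_homology_group_gen)
    let ?f = "\<lambda>x :: real \<times> 'a. (-1, snd x)"
    have subN: "subtopology ?X N = top_of_set N" using sub by (simp add: subtopology_subtopology Int_absorb1)
    have cf: "continuous_on S ?f" for S by (intro continuous_intros)
    show "continuous_map ?X (subtopology ?X N) ?f"
      unfolding subN using cf by (auto simp: continuous_map_in_subtopology T_def N_def)
    show "homotopic_with (\<lambda>_. True) ?X ?X ?f id"
      by (rule homotopic_with_True, rule homotopic_with_linear_pair[OF cf]) (auto simp: T_def algebra_simps simp flip: scaleR_add_left)
    show "homotopic_with (\<lambda>_. True) (subtopology ?X N) (subtopology ?X N) ?f id"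
      unfolding subN
      by (rule homotopic_with_True, rule homotopic_with_linear_pair[OF cf])
         (use linN in \<open>auto simp: N_def simp flip: scaleR_add_left\<close>)
  qed
  have one: "carrier (relative_homology_group q ?X N) = {\<one>\<^bsub>relative_homology_group q ?X N\<^esub>}" for q
    using triv by (simp add: trivial_group_def)
  have NT: "N \<subseteq> T'" by (rule sub)
  \<comment> \<open>In the sequence of the triple both neighbouring groups are those of
    \<open>?X\<close> relative to \<open>N\<close>, which are trivial.\<close>
  have "hom_relboundary (p+1) ?X T' N \<in> iso (relative_homology_group (p+1) ?X T') (relative_homology_group (p+1-1) (subtopology ?X T') N)"
  proof (rule trivial_kernel_image_iso)
    show "hom_relboundary (p+1) ?X T' N \<in> hom (relative_homology_group (p+1) ?X T') (relative_homology_group (p+1-1) (subtopology ?X T') N)"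
      by (rule group_homomorphism_hom_relboundary)
    interpret g: group_hom "relative_homology_group (p+1) ?X N" "relative_homology_group (p+1) ?X T'" "hom_induced (p+1) ?X N ?X T' id"
      by (simp add: group_hom_def group_hom_axioms_def)
    show "kernel (relative_homology_group (p+1) ?X T') (relative_homology_group (p+1-1) (subtopology ?X T') N) (hom_relboundary (p+1) ?X T' N)
       = {\<one>\<^bsub>relative_homology_group (p+1) ?X T'\<^esub>}"
      using homology_exactness_triple_1[OF NT, of "p+1" ?X] one[of "p+1"] g.hom_one by simp
    have "hom_induced (p+1-1) (subtopology ?X T') N ?X N id x = \<one>\<^bsub>relative_homology_group (p+1-1) ?X N\<^esub>" for x
      using hom_induced_carrier[of "p+1-1" "subtopology ?X T'" N ?X N id x] one by blast
    then have "kernel (relative_homology_group (p+1-1) (subtopology ?X T') N) (relative_homology_group (p+1-1) ?X N)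
       (hom_induced (p+1-1) (subtopology ?X T') N ?X N id) = carrier (relative_homology_group (p+1-1) (subtopology ?X T') N)"
      by (auto simp: kernel_def)
    then show "hom_relboundary (p+1) ?X T' N ` carrier (relative_homology_group (p+1) ?X T') = carrier (relative_homology_group (p+1-1) (subtopology ?X T') N)"
      using homology_exactness_triple_2[OF NT, of "p+1" ?X] by simp
  qed auto
  then have 1: "relative_homology_group (p+1) ?X T' \<cong> relative_homology_group p (subtopology ?X T') N"
    by (auto simp: is_iso_def)
  have subT': "subtopology ?X T' = top_of_set T'" using sub by (simp add: subtopology_subtopology Int_absorb1)
  have 2: "relative_homology_group p (top_of_set P) (N \<inter> P) \<cong> relative_homology_group p (top_of_set T') N"
  proof -
    have "openin (top_of_set T') N" "openin (top_of_set T') P"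
      using oN oP sub openin_subset_trans by blast+
    from open_cover_excision[OF this, of p] show ?thesis
      using PN sub by (auto simp: is_iso_def subtopology_subtopology Int_absorb1)
  qed
  have linP: "(1 - t) * 1 + t * x > 0" if "0 \<le> t" "t \<le> 1" "x > 0" for t x :: real
    using that by (cases "t = 1") (auto intro: add_pos_nonneg)
  have 3: "relative_homology_group p (top_of_set P) (N \<inter> P) \<cong> relative_homology_group p (top_of_set A) B"
    unfolding is_iso_def
  proof -
    have "hom_induced p (top_of_set P) (N \<inter> P) (top_of_set A) B snd \<in> iso (relative_homology_group p (top_of_set P) (N \<inter> P)) (relative_homology_group p (top_of_set A) B)"
    proof (rule homotopy_equivalence_relative_homology_group_isomorphism)
      show "continuous_map (top_of_set P) (top_of_set A) snd"
        by (auto simp: continuous_map_in_subtopology P_def intro: continuous_intros)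
      show "continuous_map (top_of_set A) (top_of_set P) (Pair 1)"
        by (auto simp: continuous_map_in_subtopology P_def intro!: continuous_intros)
      show "homotopic_with (\<lambda>h. h \<in> N \<inter> P \<rightarrow> N \<inter> P) (top_of_set P) (top_of_set P) (Pair 1 \<circ> snd) id"
        by (rule homotopic_with_linear_pair)
           (use linP in \<open>auto simp: N_def P_def o_def intro!: continuous_intros simp flip: scaleR_add_left\<close>)
      show "homotopic_with (\<lambda>k. k \<in> B \<rightarrow> B) (top_of_set A) (top_of_set A) (snd \<circ> Pair 1) id"
        by (rule homotopic_with_linear_pair) (auto simp: o_def simp flip: scaleR_add_left)
    qed (auto simp: PN)
    then show "iso (relative_homology_group p (top_of_set P) (N \<inter> P)) (relative_homology_group p (top_of_set A) B) \<noteq> {}" by blast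
  qed
  have "relative_homology_group (p+1) ?X T' \<cong> relative_homology_group p (top_of_set A) B"
    using 1 2 3 iso_trans group.iso_sym[OF group_relative_homology_group 2] unfolding subT' by blast
  then show ?thesis by (simp add: T_def T'_def)
qed

lemma suspension_open:
  assumes "openin (top_of_set A) B"
  shows "openin (top_of_set ((UNIV::'c::real_normed_vector set) \<times> A)) {(t, a). a \<in> A \<and> (t \<noteq> 0 \<or> a \<in> B)}"
proof -
  obtain W where W: "open W" "B = A \<inter> W" using assms by (auto simp: openin_open)
  have "{(t, a). a \<in> A \<and> (t \<noteq> 0 \<or> a \<in> B)} = ((UNIV::'c set) \<times> A) \<inter> ((- {0}) \<times> UNIV \<union> UNIV \<times> W)"
    unfolding W(2) by auto
  moreover have "open ((- {0::'c}) \<times> UNIV \<union> UNIV \<times> W)" using W(1) by (intro open_Un open_Times) auto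
  ultimately show ?thesis by (simp add: openin_open_Int)
qed

theorem complex_suspension_iso:
  fixes A B :: "'a::real_normed_vector set"
  assumes B: "openin (top_of_set A) B"
  shows "relative_homology_group p (top_of_set ((UNIV::complex set) \<times> A)) {(z, a). a \<in> A \<and> (z \<noteq> 0 \<or> a \<in> B)}
    \<cong> relative_homology_group (p - 2) (top_of_set A) B"
proof -
  let ?B = "{(t, a). a \<in> A \<and> ((t::real) \<noteq> 0 \<or> a \<in> B)}"
  let ?BB = "{(t, x). x \<in> UNIV \<times> A \<and> ((t::real) \<noteq> 0 \<or> x \<in> ?B)}"
  have "relative_homology_group p (top_of_set ((UNIV::complex set) \<times> A)) {(z, a). a \<in> A \<and> (z \<noteq> 0 \<or> a \<in> B)}
    \<cong> relative_homology_group p (top_of_set ((UNIV::real set) \<times> (UNIV::real set) \<times> A)) ?BB"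
    by (rule relative_homology_iso_homeomorphic[where f = "\<lambda>(z, a). (Re z, Im z, a)" and g = "\<lambda>(s, t, a). (Complex s t, a)"])
       (auto simp: case_prod_unfold complex_eq_iff Complex_eq intro!: continuous_intros)
  moreover have "relative_homology_group (p - 1 + 1) (top_of_set ((UNIV::real set) \<times> (UNIV::real set) \<times> A)) ?BB
    \<cong> relative_homology_group (p - 1) (top_of_set ((UNIV::real set) \<times> A)) ?B"
    by (rule suspension_iso[OF suspension_open[OF B]])
  moreover have "relative_homology_group (p - 2 + 1) (top_of_set ((UNIV::real set) \<times> A)) ?B
    \<cong> relative_homology_group (p - 2) (top_of_set A) B"
    by (rule suspension_iso[OF B])
  ultimately show ?thesis by (simp) (meson iso_trans)
qed

lemma torsion_trivial_exact_middle:
  assumes ex: "kernel B C g = f ` carrier A" and hom: "f \<in> hom A B" "g \<in> hom B C"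
    and grp: "group A" "group B" "group C" and "torsion_group A" "torsion_group C"
  shows "torsion_group B"
  unfolding torsion_group_def
proof
  interpret f: group_hom A B f using assms by (simp add: group_hom_def group_hom_axioms_def)
  interpret g: group_hom B C g using assms by (simp add: group_hom_def group_hom_axioms_def)
  fix x assume x: "x \<in> carrier B"
  obtain n :: nat where n: "n > 0" "g x [^]\<^bsub>C\<^esub> n = \<one>\<^bsub>C\<^esub>"
    using assms(8) g.hom_closed[OF x] unfolding torsion_group_def by blast
  then have "x [^]\<^bsub>B\<^esub> n \<in> kernel B C g" using x by (simp add: kernel_def g.hom_nat_pow)
  then obtain a where a: "a \<in> carrier A" "f a = x [^]\<^bsub>B\<^esub> n" unfolding ex by (auto elim!: imageE)
  obtain m :: nat where m: "m > 0" "a [^]\<^bsub>A\<^esub> m = \<one>\<^bsub>A\<^esub>" using assms(7) a unfolding torsion_group_def by blast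
  have "f (a [^]\<^bsub>A\<^esub> m) = \<one>\<^bsub>B\<^esub>" using m(2) by simp
  then have "(x [^]\<^bsub>B\<^esub> n) [^]\<^bsub>B\<^esub> m = \<one>\<^bsub>B\<^esub>" using a by (simp add: f.hom_nat_pow)
  then have "x [^]\<^bsub>B\<^esub> (n * m) = \<one>\<^bsub>B\<^esub>" using x by (simp add: f.H.nat_pow_pow)
  then show "\<exists>n>0. x [^]\<^bsub>B\<^esub> (n::nat) = \<one>\<^bsub>B\<^esub>" using n(1) m(1) by (intro exI[of _ "n * m"]) simp
qed

lemma hom_boundary_hom':
  "hom_boundary (p + 1) X S \<in> hom (relative_homology_group (p + 1) X S) (homology_group p (subtopology X S))"
  using hom_hom_boundary[of "p+1" X S] by simp

lemma torsion_homology_middle: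
  assumes "torsion_group (homology_group p (subtopology X S))" "torsion_group (relative_homology_group p X S)"
  shows "torsion_group (homology_group p X)"
  by (rule torsion_trivial_exact_middle[OF homology_exact_3]) (use assms in auto)

lemma torsion_homology_subspace:
  assumes "torsion_group (relative_homology_group (p+1) X S)" "torsion_group (homology_group p X)"
  shows "torsion_group (homology_group p (subtopology X S))"
  by (rule torsion_trivial_exact_middle[OF homology_exact_2 hom_boundary_hom']) (use assms in auto)

lemma rational_iso_boundary:
  assumes X: "torsion_group (homology_group p X)"
    and surj: "\<And>c. c \<in> carrier (homology_group (p+1) X) \<Longrightarrow> \<exists>n>0. hom_induced (p+1) X {} X S id c [^]\<^bsub>relative_homology_group (p+1) X S\<^esub> (n::nat) = \<one>\<^bsub>relative_homology_group (p+1) X S\<^esub>"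
  shows "rational_iso (relative_homology_group (p+1) X S) (homology_group p (subtopology X S)) (hom_boundary (p+1) X S)"
proof (rule exact_rational_iso)
  show "kernel (relative_homology_group (p + 1) X S) (homology_group p (subtopology X S)) (hom_boundary (p + 1) X S) =
     hom_induced (p+1) X {} X S id ` carrier (homology_group (p+1) X)"
    using homology_exact_1[of "p+1" X S] by simp
  show "kernel (homology_group p (subtopology X S)) (homology_group p X) (hom_induced p (subtopology X S) {} X {} id)
    = hom_boundary (p+1) X S ` carrier (relative_homology_group (p+1) X S)" by (rule homology_exact_2)
  show "\<exists>n>0. hom_induced p (subtopology X S) {} X {} id c [^]\<^bsub>homology_group p X\<^esub> (n::nat) = \<one>\<^bsub>homology_group p X\<^esub>" for c
    using X hom_induced_carrier[of p "subtopology X S" "{}" X "{}" id c] unfolding torsion_group_def by blast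
qed (auto simp: hom_boundary_hom' surj)

lemma rational_iso_projection:
  assumes "torsion_group (homology_group p (subtopology X S))" "torsion_group (homology_group (p-1) (subtopology X S))"
  shows "rational_iso (homology_group p X) (relative_homology_group p X S) (hom_induced p X {} X S id)"
proof (rule exact_rational_iso[OF homology_exact_3 homology_exact_1])
  show "\<exists>n>0. hom_induced p (subtopology X S) {} X {} id a [^]\<^bsub>homology_group p X\<^esub> (n::nat) = \<one>\<^bsub>homology_group p X\<^esub>"
    if a: "a \<in> carrier (homology_group p (subtopology X S))" for a
    by (rule torsion_group_image[OF assms(1) _ _ _ a]) auto
  show "\<exists>n>0. hom_boundary p X S c [^]\<^bsub>homology_group (p-1) (subtopology X S)\<^esub> (n::nat) = \<one>\<^bsub>homology_group (p-1) (subtopology X S)\<^esub>" for c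
    using assms(2) hom_boundary_carrier[of p X S c] unfolding torsion_group_def by blast
qed auto

text \<open>The rational Poincare series has coefficient 1 in the degrees of \<open>K\<close> and 0
  elsewhere. All spaces below have Betti numbers 0 or 1, so a set of degrees records it
  completely.\<close>

definition has_rational_cells :: "'a topology \<Rightarrow> int set \<Rightarrow> bool" where
  "has_rational_cells X K \<longleftrightarrow> (\<forall>p\<in>K. rank_one_group (homology_group p X)) \<and> (\<forall>p. p \<notin> K \<longrightarrow> torsion_group (homology_group p X))"

lemma has_rational_cells_iso:
  assumes "has_rational_cells X K" "\<And>p. homology_group p X \<cong> homology_group p Y"
  shows "has_rational_cells Y K"
  using assms rank_one_group_iso[OF assms(2)] torsion_group_iso[OF assms(2)] unfolding has_rational_cells_def by auto

lemma has_rational_cells_homotopy: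
  "has_rational_cells X K \<Longrightarrow> X homotopy_equivalent_space Y \<Longrightarrow> has_rational_cells Y K"
  by (erule has_rational_cells_iso) (rule homotopy_equivalent_space_imp_isomorphic_homology_groups)

lemma has_rational_cells_contractible:
  assumes "contractible_space X" "topspace X \<noteq> {}"
  shows "has_rational_cells X {0}"
proof -
  obtain a where a: "a \<in> topspace X" and "X homotopy_equivalent_space subtopology X {a}"
    using assms contractible_eq_homotopy_equivalent_singleton_subtopology[of X] by (metis topspace_discrete_topology)
  then have iso: "homology_group p X \<cong> homology_group p (subtopology X {a})" for p
    using homotopy_equivalent_space_imp_isomorphic_homology_groups by blast
  have triv: "torsion_group (homology_group p X)" if "p \<noteq> 0" for p
  proof -
    have "trivial_group (homology_group p (subtopology X {a}))"
      by (rule homology_dimension_axiom[OF _ that]) (use a in auto)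
    then show ?thesis using iso torsion_group_iso torsion_group_trivial by (metis group_relative_homology_group)
  qed
  have "path_connected_space X" using assms(1) contractible_imp_path_connected_space by blast
  then have "homology_group 0 X \<cong> integer_group" using isomorphic_integer_zeroth_homology_group assms(2) by blast
  then have "rank_one_group (homology_group 0 X)"
    using rank_one_group_iso rank_one_integer_group group_integer_group group_relative_homology_group by blast
  then show ?thesis using triv by (auto simp: has_rational_cells_def)
qed

text \<open>The effect of a circle factor. The relative groups are those of \<open>E\<close> shifted
  by two. The section at the point 1 makes the inclusion surjective on homology, so the sequence of
  the pair splits. As \<open>K\<close> has no two consecutive degrees, no rank exceeds one.\<close>

lemma has_rational_cells_punctured_product:
  fixes E :: "'a::real_normed_vector set"
  assumes E: "has_rational_cells (top_of_set E) K" and K: "\<And>p. p \<in> K \<Longrightarrow> p + 1 \<notin> K"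
  shows "has_rational_cells (top_of_set ((- {0::complex}) \<times> E)) (K \<union> {p + 1 | p. p \<in> K})"
proof -
  let ?X = "top_of_set ((UNIV::complex set) \<times> E)" and ?S = "(- {0::complex}) \<times> E"
  have S: "subtopology ?X ?S = top_of_set ?S" by (simp add: subtopology_subtopology Int_absorb1 Sigma_mono)
  have rel: "relative_homology_group p ?X ?S \<cong> homology_group (p - 2) (top_of_set E)" for p
  proof -
    have "?S = {(z, a). a \<in> E \<and> (z \<noteq> 0 \<or> a \<in> {})}" by auto
    then show ?thesis using complex_suspension_iso[of E "{}" p] by simp
  qed
  have X: "has_rational_cells ?X K"
  proof (rule has_rational_cells_homotopy[OF E])
    show "top_of_set E homotopy_equivalent_space ?X"
      unfolding homotopy_equivalent_space_def
    proof (intro exI conjI)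
      show "continuous_map (top_of_set E) ?X (Pair 0)"
        by (auto simp: continuous_map_in_subtopology intro!: continuous_intros)
      show "continuous_map ?X (top_of_set E) snd"
        by (auto simp: continuous_map_in_subtopology intro!: continuous_intros)
      show "homotopic_with (\<lambda>_. True) (top_of_set E) (top_of_set E) (snd \<circ> Pair 0) id"
        by (rule homotopic_with_True, rule homotopic_with_linear_pair) (auto simp: o_def simp flip: scaleR_add_left)
      show "homotopic_with (\<lambda>_. True) ?X ?X (Pair 0 \<circ> snd) id"
        by (rule homotopic_with_True, rule homotopic_with_linear_pair)
           (auto simp: o_def intro!: continuous_intros simp flip: scaleR_add_left)
    qed
  qed
  \<comment> \<open>A class is moved into the punctured product by replacing the first coordinate by
    1, which is homotopic to the identity in the full product.\<close>
  have surj: "\<exists>a\<in>carrier (homology_group p (top_of_set ?S)). hom_induced p (top_of_set ?S) {} ?X {} id a = c"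
    if c: "c \<in> carrier (homology_group p ?X)" for p c
  proof -
    let ?s = "\<lambda>x :: complex \<times> 'a. (1::complex, snd x)"
    have s: "continuous_map ?X (top_of_set ?S) ?s"
      by (auto simp: continuous_map_in_subtopology intro!: continuous_intros)
    have i: "continuous_map (top_of_set ?S) ?X id" by (auto simp: continuous_map_in_subtopology)
    have "homotopic_with (\<lambda>_. True) ?X ?X (id \<circ> ?s) id"
      by (rule homotopic_with_True, rule homotopic_with_linear_pair)
         (auto simp: o_def intro!: continuous_intros simp flip: scaleR_add_left)
    then have "hom_induced p ?X {} ?X {} (id \<circ> ?s) c = c"
      using homology_homotopy_empty hom_induced_id[OF c] by metis
    then have "hom_induced p (top_of_set ?S) {} ?X {} id (hom_induced p ?X {} (top_of_set ?S) {} ?s c) = c"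
      using hom_induced_compose'[OF s _ i, of "{}" "{}" "{}" p c] by simp
    then show ?thesis using hom_induced_carrier by blast
  qed
  have proj0: "hom_induced p ?X {} ?X ?S id c = \<one>\<^bsub>relative_homology_group p ?X ?S\<^esub>"
    if c: "c \<in> carrier (homology_group p ?X)" for p c
  proof -
    obtain a where "a \<in> carrier (homology_group p (top_of_set ?S))" "hom_induced p (top_of_set ?S) {} ?X {} id a = c"
      using surj[OF c] by blast
    then have "c \<in> kernel (homology_group p ?X) (relative_homology_group p ?X ?S) (hom_induced p ?X {} ?X ?S id)"
      unfolding homology_exact_3 S by blast
    then show ?thesis by (simp add: kernel_def)
  qed
  have relK: "torsion_group (relative_homology_group p ?X ?S)" if "p - 2 \<notin> K" for p
    using E that torsion_group_iso[OF rel] by (simp add: has_rational_cells_def)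
  show ?thesis
    unfolding has_rational_cells_def
  proof (intro conjI ballI allI impI)
    fix p assume "p \<in> K \<union> {p + 1 | p. p \<in> K}"
    then consider "p \<in> K" | "p - 1 \<in> K" by force
    then show "rank_one_group (homology_group p (top_of_set ?S))"
    proof cases
      case 1
      have "rational_iso (homology_group p (top_of_set ?S)) (homology_group p ?X) (hom_induced p (top_of_set ?S) {} ?X {} id)"
      proof -
        have ker: "\<exists>n>0. x [^]\<^bsub>homology_group p (top_of_set ?S)\<^esub> (n::nat) = \<one>\<^bsub>homology_group p (top_of_set ?S)\<^esub>"
          if x: "x \<in> carrier (homology_group p (top_of_set ?S))" "hom_induced p (top_of_set ?S) {} ?X {} id x = \<one>\<^bsub>homology_group p ?X\<^esub>" for x
        proof -
          have "x \<in> hom_boundary (p+1) ?X ?S ` carrier (relative_homology_group (p+1) ?X ?S)"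
            using x homology_exact_2[of p ?X ?S] unfolding S by (auto simp: kernel_def)
          then obtain y where y: "y \<in> carrier (relative_homology_group (p+1) ?X ?S)" "x = hom_boundary (p+1) ?X ?S y" by blast
          \<comment> \<open>The relative group in degree \<open>p + 1\<close> is that of
            \<open>E\<close> in degree \<open>p - 1\<close>, a neighbour of \<open>p\<close> and so
            not in \<open>K\<close>.\<close>
          have "p + 1 - 2 \<notin> K" using K[of "p-1"] 1 by auto
          then show ?thesis unfolding y(2)
            using torsion_group_image[OF relK hom_boundary_hom' _ _ y(1)] unfolding S by simp
        qed
        have cok: "\<exists>n>0. \<exists>x\<in>carrier (homology_group p (top_of_set ?S)). hom_induced p (top_of_set ?S) {} ?X {} id x = y [^]\<^bsub>homology_group p ?X\<^esub> (n::nat)"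
          if y: "y \<in> carrier (homology_group p ?X)" for y
        proof -
          interpret group "homology_group p ?X" by simp
          have "y [^]\<^bsub>homology_group p ?X\<^esub> (1::nat) = y" using y by simp
          then show ?thesis using surj[OF y] by (metis zero_less_one)
        qed
        show ?thesis unfolding rational_iso_def using ker cok by simp
      qed
      then obtain f where "rational_iso (homology_group p (top_of_set ?S)) (homology_group p ?X) f" by blast
      then show ?thesis
        using X 1 rational_iso_rank_one_back[OF _ abelian_relative_homology_group group_relative_homology_group]
        unfolding has_rational_cells_def by blast
    next
      case 2
      have "p \<notin> K" using K[OF 2] by simp
      then have t: "torsion_group (homology_group p ?X)" using X by (simp add: has_rational_cells_def)
      have "rational_iso (relative_homology_group (p+1) ?X ?S) (homology_group p (subtopology ?X ?S)) (hom_boundary (p+1) ?X ?S)"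
      proof (rule rational_iso_boundary[OF t])
        interpret R: group "relative_homology_group (p+1) ?X ?S" by simp
        show "\<exists>n>0. hom_induced (p+1) ?X {} ?X ?S id c [^]\<^bsub>relative_homology_group (p+1) ?X ?S\<^esub> (n::nat) = \<one>\<^bsub>relative_homology_group (p+1) ?X ?S\<^esub>"
          if "c \<in> carrier (homology_group (p+1) ?X)" for c
          by (rule exI[of _ "1::nat"]) (simp add: proj0[OF that])
      qed
      moreover have "rank_one_group (relative_homology_group (p+1) ?X ?S)"
        using rank_one_group_iso[OF rel[of "p+1"]] E 2 by (simp add: has_rational_cells_def)
      ultimately show ?thesis using rational_iso_rank_one S by (metis group_relative_homology_group)
    qed
  next
    fix p assume p: "p \<notin> K \<union> {p + 1 | p. p \<in> K}"
    then have "p \<notin> K" "p + 1 - 2 \<notin> K" by force+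
    then have "torsion_group (homology_group p (subtopology ?X ?S))"
      using X relK torsion_homology_subspace[of p ?X ?S] unfolding has_rational_cells_def by blast
    then show "torsion_group (homology_group p (top_of_set ?S))" by (simp only: S)
  qed
qed

text \<open>The degree condition makes the projection to the relative groups vanish modulo torsion
  and prevents a class of \<open>X\<close> and a boundary from meeting in one degree, so the ranks
  simply add up.\<close>

lemma has_rational_cells_subspace:
  assumes X: "has_rational_cells X K"
    and L: "\<And>p. p \<in> L \<Longrightarrow> rank_one_group (relative_homology_group p X S)"
      "\<And>p. p \<notin> L \<Longrightarrow> torsion_group (relative_homology_group p X S)"
    and KL: "\<And>p. p \<in> K \<Longrightarrow> p \<notin> L \<and> p + 1 \<notin> L"
  shows "has_rational_cells (subtopology X S) (K \<union> {p. p + 1 \<in> L})"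
proof -
  have 1: "rank_one_group (homology_group p (subtopology X S))" if p: "p \<in> K" for p
  proof -
    have "rational_iso (homology_group p (subtopology X S)) (homology_group p X) (hom_induced p (subtopology X S) {} X {} id)"
      by (rule torsion_imp_rational_iso_inclusion) (use L KL[OF p] in auto)
    then show ?thesis
      using rational_iso_rank_one_back[OF _ abelian_relative_homology_group group_relative_homology_group] X p
      unfolding has_rational_cells_def by blast
  qed
  have 2: "rank_one_group (homology_group p (subtopology X S))" if p: "p + 1 \<in> L" for p
  proof -
    have nK: "p \<notin> K" "p + 1 \<notin> K" using p KL by blast+
    then have t: "torsion_group (homology_group p X)" "torsion_group (homology_group (p + 1) X)"
      using X by (auto simp: has_rational_cells_def)
    have "rational_iso (relative_homology_group (p+1) X S) (homology_group p (subtopology X S)) (hom_boundary (p+1) X S)"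
    proof (rule rational_iso_boundary[OF t(1)])
      show "\<exists>n>0. hom_induced (p+1) X {} X S id c [^]\<^bsub>relative_homology_group (p+1) X S\<^esub> (n::nat) = \<one>\<^bsub>relative_homology_group (p+1) X S\<^esub>"
        if "c \<in> carrier (homology_group (p+1) X)" for c
        by (rule torsion_group_image[OF t(2) _ _ _ that]) auto
    qed
    then show ?thesis using rational_iso_rank_one L(1)[OF p] by (metis group_relative_homology_group)
  qed
  have 3: "torsion_group (homology_group p (subtopology X S))" if "p \<notin> K" "p + 1 \<notin> L" for p
    by (rule torsion_homology_subspace) (use X L that in \<open>auto simp: has_rational_cells_def\<close>)
  show ?thesis using 1 2 3 by (auto simp: has_rational_cells_def)
qed

text \<open>The condition \<open>p + 1 \<notin> L\<close> makes the boundary map vanish modulo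
  torsion; \<open>p \<notin> L\<close> keeps the ranks at most one.\<close>

lemma has_rational_cells_ambient:
  assumes S: "has_rational_cells (subtopology X S) K"
    and L: "\<And>p. p \<in> L \<Longrightarrow> rank_one_group (relative_homology_group p X S)"
      "\<And>p. p \<notin> L \<Longrightarrow> torsion_group (relative_homology_group p X S)"
    and KL: "\<And>p. p \<in> K \<Longrightarrow> p \<notin> L \<and> p + 1 \<notin> L"
  shows "has_rational_cells X (K \<union> L)"
proof -
  have 1: "rank_one_group (homology_group p X)" if p: "p \<in> K" for p
  proof -
    have "rational_iso (homology_group p (subtopology X S)) (homology_group p X) (hom_induced p (subtopology X S) {} X {} id)"
      by (rule torsion_imp_rational_iso_inclusion) (use L KL[OF p] in auto)
    then show ?thesis
      using rational_iso_rank_one[OF _ group_relative_homology_group group_relative_homology_group] S p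
      unfolding has_rational_cells_def by blast
  qed
  have 2: "rank_one_group (homology_group p X)" if p: "p \<in> L" for p
  proof -
    have nK: "p \<notin> K" "p - 1 \<notin> K" using p KL[of p] KL[of "p - 1"] by auto
    then have "rational_iso (homology_group p X) (relative_homology_group p X S) (hom_induced p X {} X S id)"
      by (intro rational_iso_projection) (use S in \<open>auto simp: has_rational_cells_def\<close>)
    then show ?thesis
      using rational_iso_rank_one_back[OF _ abelian_relative_homology_group group_relative_homology_group] L(1)[OF p] by blast
  qed
  have 3: "torsion_group (homology_group p X)" if "p \<notin> K" "p \<notin> L" for p
    by (rule torsion_homology_middle[of p X S]) (use S L that in \<open>auto simp: has_rational_cells_def\<close>)
  show ?thesis using 1 2 3 by (auto simp: has_rational_cells_def)
qed

lemma has_rational_cells_homeomorphic: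
  fixes f :: "'a::topological_space \<Rightarrow> 'b::topological_space"
  assumes "has_rational_cells (top_of_set A) K" "continuous_on A f" "f ` A \<subseteq> B" "continuous_on B g" "g ` B \<subseteq> A"
    "\<And>x. x \<in> A \<Longrightarrow> g (f x) = x" "\<And>y. y \<in> B \<Longrightarrow> f (g y) = y"
  shows "has_rational_cells (top_of_set B) K"
  by (rule has_rational_cells_iso[OF assms(1)], rule relative_homology_iso_homeomorphic[OF assms(2-7)]) auto

lemma deformation_homotopy_equivalent:
  fixes f :: "'a::real_normed_vector \<Rightarrow> 'b::topological_space"
  assumes f: "continuous_on A f" "f ` A \<subseteq> B" and g: "continuous_on B g" "g ` B \<subseteq> A"
    and fg: "\<And>y. y \<in> B \<Longrightarrow> f (g y) = y"
    and lin: "\<And>x t. x \<in> A \<Longrightarrow> 0 \<le> t \<Longrightarrow> t \<le> 1 \<Longrightarrow> (1 - t) *\<^sub>R x + t *\<^sub>R g (f x) \<in> A"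
  shows "top_of_set A homotopy_equivalent_space top_of_set B"
  unfolding homotopy_equivalent_space_def
proof (intro exI conjI)
  show "continuous_map (top_of_set A) (top_of_set B) f" "continuous_map (top_of_set B) (top_of_set A) g"
    using f g by (auto simp: continuous_map_in_subtopology)
  have gf: "continuous_on A (\<lambda>x. g (f x))" using continuous_on_compose2[OF g(1) f] .
  have "homotopic_with (\<lambda>_. True) (top_of_set A) (top_of_set A) (\<lambda>x. x) (\<lambda>x. g (f x))"
    by (rule homotopic_with_True, rule homotopic_with_linear_pair[OF continuous_on_id gf]) (use lin in auto)
  then show "homotopic_with (\<lambda>_. True) (top_of_set A) (top_of_set A) (g \<circ> f) id"
    by (simp add: homotopic_with_sym o_def id_def)
  show "homotopic_with (\<lambda>_. True) (top_of_set B) (top_of_set B) (f \<circ> g) id"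
  proof (rule homotopic_with_equal)
    show "continuous_map (top_of_set B) (top_of_set B) (f \<circ> g)"
      using f g fg continuous_on_compose2[OF f(1) g] by (auto simp: continuous_map_in_subtopology o_def)
  qed (use fg in auto)
qed

section \<open>Frames in complex three-space\<close>

text \<open>Homotopy equivalent to the 3-sphere. The free third coordinate will hold the component
  of the second vector of a frame along the first.\<close>

definition fst2_nonzero :: "(complex \<times> complex \<times> complex) set" where
  "fst2_nonzero = {(x, y, z). x \<noteq> 0 \<or> y \<noteq> 0}"

lemma has_rational_cells_UNIV: "has_rational_cells (top_of_set (UNIV :: ('a::real_normed_vector) set)) {0}"
  using convex_imp_contractible[OF convex_UNIV] contractible_space_top_of_set[of "UNIV :: 'a set"]
  by (intro has_rational_cells_contractible) auto

lemma has_rational_cells_fst2_nonzero: "has_rational_cells (top_of_set fst2_nonzero) {0, 3}"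
proof -
  let ?X = "top_of_set (UNIV :: (complex \<times> complex \<times> complex) set)"
  have rel: "relative_homology_group p ?X fst2_nonzero \<cong> homology_group (p - 4) (top_of_set (UNIV :: complex set))" for p
  proof -
    have "relative_homology_group p (top_of_set ((UNIV::complex set) \<times> (UNIV::complex set) \<times> (UNIV::complex set)))
        {(z, a). a \<in> UNIV \<times> UNIV \<and> (z \<noteq> 0 \<or> a \<in> {(t, a). a \<in> UNIV \<and> (t \<noteq> 0 \<or> a \<in> {})})}
      \<cong> relative_homology_group (p - 2) (top_of_set ((UNIV::complex set) \<times> (UNIV::complex set))) {(t, a). a \<in> UNIV \<and> (t \<noteq> 0 \<or> a \<in> {})}"
      by (rule complex_suspension_iso[OF suspension_open]) simp
    moreover have "relative_homology_group (p - 2) (top_of_set ((UNIV::complex set) \<times> (UNIV::complex set))) {(t, a). a \<in> UNIV \<and> (t \<noteq> 0 \<or> a \<in> {})}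
       \<cong> homology_group (p - 2 - 2) (top_of_set (UNIV :: complex set))"
      by (rule complex_suspension_iso) simp
    moreover have "{(z, a). a \<in> UNIV \<times> UNIV \<and> (z \<noteq> 0 \<or> a \<in> {(t, a). a \<in> UNIV \<and> (t \<noteq> 0 \<or> a \<in> {})})} = fst2_nonzero"
      by (auto simp: fst2_nonzero_def)
    ultimately show ?thesis by (auto intro: iso_trans)
  qed
  have "has_rational_cells (subtopology ?X fst2_nonzero) ({0} \<union> {p. p + 1 \<in> {4}})"
  proof (rule has_rational_cells_subspace[OF has_rational_cells_UNIV])
    show "rank_one_group (relative_homology_group p ?X fst2_nonzero)" if "p \<in> {4}" for p
      using has_rational_cells_UNIV[where 'a=complex] that rank_one_group_iso[OF rel[of p]] by (auto simp: has_rational_cells_def)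
    show "torsion_group (relative_homology_group p ?X fst2_nonzero)" if "p \<notin> {4}" for p
      using has_rational_cells_UNIV[where 'a=complex] that torsion_group_iso[OF rel[of p]] by (auto simp: has_rational_cells_def)
  qed auto
  moreover have "{0} \<union> {p. p + 1 \<in> {4}} = {0, 3::int}" by auto
  ultimately show ?thesis by (simp add: subtopology_subtopology)
qed

lemma continuous_on_vec3:
  fixes a b c :: "'a::topological_space \<Rightarrow> 'b::{zero, topological_space}"
  assumes "continuous_on S a" "continuous_on S b" "continuous_on S c"
  shows "continuous_on S (\<lambda>x. vector [a x, b x, c x] :: 'b^3)"
proof -
  have "continuous_on S (\<lambda>x. (vector [a x, b x, c x] :: 'b^3) $ i)" for i
    using assms exhaust_3[of i] by auto
  then have "continuous_on S (\<lambda>x. \<chi> i. (vector [a x, b x, c x] :: 'b^3) $ i)" by (rule continuous_on_vec_lambda)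
  then show ?thesis by simp
qed

definition cross3c :: "complex^3 \<Rightarrow> complex^3 \<Rightarrow> complex^3" where
  "cross3c v w = vec3 (v$2 * w$3 - v$3 * w$2) (v$3 * w$1 - v$1 * w$3) (v$1 * w$2 - v$2 * w$1)"

text \<open>The linearly independent pairs; by orthonormalisation a model, up to homotopy, of the
  Stiefel manifold that is \<open>SU(3)\<close>.\<close>

definition two_frames :: "((complex^3) \<times> (complex^3)) set" where
  "two_frames = {(v, w). cross3c v w \<noteq> 0}"

lemma norm_complex3_squared: "complex_of_real ((norm (v::complex^3))\<^sup>2) = v$1 * cnj (v$1) + v$2 * cnj (v$2) + v$3 * cnj (v$3)"
proof -
  have "(norm v)\<^sup>2 = (\<Sum>i\<in>UNIV. (norm (v$i))\<^sup>2)" by (simp add: norm_vec_def L2_set_def sum_nonneg)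
  then show ?thesis by (simp only: sum_3 complex_norm_square of_real_add)
qed

lemma norm_plus_third_eq_0_iff:
  fixes v :: "complex^3"
  shows "norm v + v$3 = 0 \<longleftrightarrow> v$1 = 0 \<and> v$2 = 0 \<and> Im (v$3) = 0 \<and> Re (v$3) \<le> 0"
proof
  assume a: "norm v + v$3 = 0"
  then have 1: "v$3 = - of_real (norm v)" by (simp add: add_eq_0_iff2)
  then have "v$3 * cnj (v$3) = of_real ((norm v)\<^sup>2)" by (simp add: power2_eq_square)
  then have "v$1 * cnj (v$1) + v$2 * cnj (v$2) = 0" using norm_complex3_squared[of v] by simp
  then have "complex_of_real ((norm (v$1))\<^sup>2 + (norm (v$2))\<^sup>2) = 0" by (simp only: complex_norm_square of_real_add)
  then have "(norm (v$1))\<^sup>2 + (norm (v$2))\<^sup>2 = 0" by (simp only: of_real_eq_0_iff)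
  then show "v$1 = 0 \<and> v$2 = 0 \<and> Im (v$3) = 0 \<and> Re (v$3) \<le> 0"
    using 1 by (simp add: sum_power2_eq_zero_iff)
next
  assume a: "v$1 = 0 \<and> v$2 = 0 \<and> Im (v$3) = 0 \<and> Re (v$3) \<le> 0"
  have "(norm v)\<^sup>2 = (\<Sum>i\<in>UNIV. (norm (v$i))\<^sup>2)" by (simp add: norm_vec_def L2_set_def sum_nonneg)
  then have "(norm v)\<^sup>2 = (norm (v$3))\<^sup>2" using a by (simp add: sum_3)
  then have "norm v = norm (v$3)" by simp
  also have "\<dots> = - Re (v$3)" using a by (simp add: cmod_def)
  finally show "norm v + v$3 = 0" using a by (simp add: complex_eq_iff)
qed

lemma cross3c_eq_0_iff: "cross3c v w = 0 \<longleftrightarrow> v$2 * w$3 = v$3 * w$2 \<and> v$3 * w$1 = v$1 * w$3 \<and> v$1 * w$2 = v$2 * w$1"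
  by (simp add: cross3c_def vec3_eq_iff)

lemma cross3c_eq_0E:
  assumes "cross3c v w = 0" "v \<noteq> 0"
  obtains c where "w = c *s v"
proof -
  have c: "v$2 * w$3 = v$3 * w$2" "v$3 * w$1 = v$1 * w$3" "v$1 * w$2 = v$2 * w$1"
    using assms(1) by (auto simp: cross3c_eq_0_iff)
  consider "v$1 \<noteq> 0" | "v$2 \<noteq> 0" | "v$3 \<noteq> 0" using assms(2) by (auto simp: vec3_eq_iff)
  then show ?thesis
  proof cases
    case 1
    have "w = (w$1 / v$1) *s v" using 1 c by (simp add: vec3_eq_iff field_simps)
    then show ?thesis by (rule that)
  next
    case 2
    have "w = (w$2 / v$2) *s v" using 2 c by (simp add: vec3_eq_iff field_simps)
    then show ?thesis by (rule that)
  next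
    case 3
    have "w = (w$3 / v$3) *s v" using 3 c by (simp add: vec3_eq_iff field_simps)
    then show ?thesis by (rule that)
  qed
qed

lemma cross3c_0 [simp]: "cross3c 0 w = 0" by (simp add: cross3c_eq_0_iff)

text \<open>Away from the ray \<open>v = (0, 0, v\<^sub>3)\<close>, \<open>v\<^sub>3 \<le> 0\<close>, the vectors
  \<open>e\<^sub>1 - cnj v\<^sub>1 / (|v| + cnj v\<^sub>3) e\<^sub>3\<close>, \<open>e\<^sub>2 - cnj v\<^sub>2 / (|v| + cnj v\<^sub>3) e\<^sub>3\<close> and \<open>v\<close> form a basis,
  which trivialises the bundle of second vectors of a frame.\<close>

lemma has_rational_cells_frames_off_ray:
  "has_rational_cells (top_of_set {x \<in> two_frames. norm (fst x) + fst x $ 3 \<noteq> 0}) {0, 3}"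
proof -
  let ?V = "{v :: complex^3. norm v + v$3 \<noteq> 0}"
  let ?r = "\<lambda>v :: complex^3. complex_of_real (norm v)"
  \<comment> \<open>The coefficient of \<open>v\<close> in the expansion of \<open>w\<close>:
    pairing with \<open>(cnj v1, cnj v2, |v| + cnj v3)\<close> annihilates the other two basis
    vectors and sends \<open>v\<close> to \<open>|v| (|v| + v3)\<close>.\<close>
  let ?z = "\<lambda>v w :: complex^3. (w$3 * (?r v + cnj (v$3)) + cnj (v$1) * w$1 + cnj (v$2) * w$2) / (?r v * (?r v + v$3))"
  \<comment> \<open>The complement of the ray is starlike about \<open>(0, 0, 1)\<close>.\<close>
  have "top_of_set (?V \<times> fst2_nonzero) homotopy_equivalent_space top_of_set fst2_nonzero"
  proof (rule deformation_homotopy_equivalent[where f = snd and g = "\<lambda>y. (vec3 0 0 1, y)"])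
    fix x :: "(complex^3) \<times> complex \<times> complex \<times> complex" and t :: real
    assume x: "x \<in> ?V \<times> fst2_nonzero" and t: "0 \<le> t" "t \<le> 1"
    let ?v = "(1 - t) *\<^sub>R fst x + t *\<^sub>R vec3 0 0 1"
    have "norm ?v + ?v $ 3 \<noteq> 0"
    proof
      assume "norm ?v + ?v $ 3 = 0"
      then have h: "(1 - t) *\<^sub>R fst x $ 1 = 0" "(1 - t) *\<^sub>R fst x $ 2 = 0" "(1 - t) * Im (fst x $ 3) = 0" "(1 - t) * Re (fst x $ 3) + t \<le> 0"
        unfolding norm_plus_third_eq_0_iff by auto
      have t1: "t \<noteq> 1" using h(4) by auto
      moreover have "Re (fst x $ 3) \<le> 0"
      proof (rule ccontr)
        assume "\<not> Re (fst x $ 3) \<le> 0"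
        then have "(1 - t) * Re (fst x $ 3) > 0" using t t1 by simp
        then show False using h(4) t by linarith
      qed
      ultimately have "norm (fst x) + fst x $ 3 = 0" using h unfolding norm_plus_third_eq_0_iff by auto
      then show False using x by auto
    qed
    then show "(1 - t) *\<^sub>R x + t *\<^sub>R (vec3 0 0 1, snd x) \<in> ?V \<times> fst2_nonzero"
      using x by (cases x) (auto simp del: vector_add_component simp flip: scaleR_add_left)
  next
    show "(\<lambda>y. (vec3 0 0 1, y)) ` fst2_nonzero \<subseteq> ?V \<times> fst2_nonzero"
      by (auto simp: norm_plus_third_eq_0_iff)
  qed (auto intro!: continuous_intros)
  then have 1: "has_rational_cells (top_of_set (?V \<times> fst2_nonzero)) {0, 3}"
    using has_rational_cells_homotopy[OF has_rational_cells_fst2_nonzero] homotopy_equivalent_space_sym by blast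
  have nz: "?r v \<noteq> 0" "?r v + v$3 \<noteq> 0" "?r v + cnj (v$3) \<noteq> 0" if "norm v + v$3 \<noteq> 0" for v :: "complex^3"
  proof -
    show "?r v \<noteq> 0" using that by auto
    show "?r v + v$3 \<noteq> 0" using that .
    have "cnj (?r v + v$3) \<noteq> 0" using that by (simp only: complex_cnj_zero_iff not_False_eq_True)
    then show "?r v + cnj (v$3) \<noteq> 0" by simp
  qed
  have rr: "?r v * ?r v = v$1 * cnj (v$1) + v$2 * cnj (v$2) + v$3 * cnj (v$3)" for v :: "complex^3"
    using norm_complex3_squared[of v] by (simp add: power2_eq_square)
  show ?thesis
  proof (rule has_rational_cells_homeomorphic[OF 1, where
      f = "\<lambda>x. (fst x, vec3 (fst (snd x) + snd (snd (snd x)) * fst x $ 1) (fst (snd (snd x)) + snd (snd (snd x)) * fst x $ 2)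
         (snd (snd (snd x)) * fst x $ 3 - (cnj (fst x $ 1) * fst (snd x) + cnj (fst x $ 2) * fst (snd (snd x))) / (?r (fst x) + cnj (fst x $ 3))))" and
      g = "\<lambda>x. (fst x, (snd x $ 1 - ?z (fst x) (snd x) * fst x $ 1, snd x $ 2 - ?z (fst x) (snd x) * fst x $ 2, ?z (fst x) (snd x)))"], goal_cases)
    case 1
    then show ?case using nz by (auto intro!: continuous_intros continuous_on_vec3)
  next
    case 2
    have "(v, vec3 (p + s * v$1) (q + s * v$2) (s * v$3 - (cnj (v$1) * p + cnj (v$2) * q) / (?r v + cnj (v$3)))) \<in> two_frames"
      (is "(_, ?w) \<in> _") if v: "norm v + v$3 \<noteq> 0" and pq: "p \<noteq> 0 \<or> q \<noteq> 0" for v :: "complex^3" and p q s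
    proof -
      have v0: "v \<noteq> 0" using nz[OF v] by auto
      have "cross3c v ?w \<noteq> 0"
      proof
        assume "cross3c v ?w = 0"
        then obtain c where c: "?w = c *s v" using v0 by (rule cross3c_eq_0E)
        have "?w $ i = c * v $ i" for i using c by simp
        from this[of 1] this[of 2] this[of 3] have e: "p + s * v$1 = c * v$1" "q + s * v$2 = c * v$2"
            "s * v$3 - (cnj (v$1) * p + cnj (v$2) * q) / (?r v + cnj (v$3)) = c * v$3"
          by simp_all
        have e1: "p = (c - s) * v$1" "q = (c - s) * v$2" using e(1,2) by (auto simp: algebra_simps)
        have "s * v$3 * (?r v + cnj (v$3)) - (cnj (v$1) * p + cnj (v$2) * q) = c * v$3 * (?r v + cnj (v$3))"
          using e(3) nz(3)[OF v] by (simp add: divide_simps split: if_splits)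
        then have "(c - s) * (?r v * (?r v + v$3)) = 0" using rr[of v] unfolding e1 by Groebner_Basis.algebra
        then have "c - s = 0" using nz[OF v] by simp
        then show False using e1 pq by simp
      qed
      then show ?thesis by (simp add: two_frames_def)
    qed
    then have "(fst x, vec3 (fst (snd x) + snd (snd (snd x)) * fst x $ 1) (fst (snd (snd x)) + snd (snd (snd x)) * fst x $ 2)
         (snd (snd (snd x)) * fst x $ 3 - (cnj (fst x $ 1) * fst (snd x) + cnj (fst x $ 2) * fst (snd (snd x))) / (?r (fst x) + cnj (fst x $ 3))))
       \<in> {x \<in> two_frames. norm (fst x) + fst x $ 3 \<noteq> 0}" if "x \<in> ?V \<times> fst2_nonzero" for x
      using that unfolding fst2_nonzero_def by (cases x) simp
    then show ?case by blast
  next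
    case 3
    then show ?case using nz by (auto intro!: continuous_intros)
  next
    case 4
    have "(fst x, (snd x $ 1 - ?z (fst x) (snd x) * fst x $ 1, snd x $ 2 - ?z (fst x) (snd x) * fst x $ 2, ?z (fst x) (snd x))) \<in> ?V \<times> fst2_nonzero"
      if xx: "x \<in> {x \<in> two_frames. norm (fst x) + fst x $ 3 \<noteq> 0}" for x
    proof -
      obtain v w where x: "x = (v, w)" by (cases x)
      have v: "norm v + v$3 \<noteq> 0" and c: "cross3c v w \<noteq> 0" using xx by (auto simp: x two_frames_def)
      define z where "z = ?z v w"
      have z: "z * (?r v * (?r v + v$3)) = w$3 * (?r v + cnj (v$3)) + cnj (v$1) * w$1 + cnj (v$2) * w$2"
        using nz[OF v] by (simp add: z_def)
      have "w$1 - z * v$1 \<noteq> 0 \<or> w$2 - z * v$2 \<noteq> 0"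
      proof (rule ccontr)
        assume "\<not> ?thesis"
        then have h: "w$1 = z * v$1" "w$2 = z * v$2" by auto
        have "(w$3 - z * v$3) * (?r v + cnj (v$3)) = 0" using z rr[of v] unfolding h by Groebner_Basis.algebra
        then have "w$3 = z * v$3" using nz[OF v] by simp
        then show False using c h by (simp add: cross3c_eq_0_iff)
      qed
      then show ?thesis using v by (simp add: fst2_nonzero_def x flip: z_def)
    qed
    then show ?case by blast
  next
    case (5 x)
    obtain v p q s where x: "x = (v, p, q, s)" by (cases x) auto
    have v: "norm v + v$3 \<noteq> 0" using 5 by (auto simp: x)
    let ?w = "vec3 (p + s * v$1) (q + s * v$2) (s * v$3 - (cnj (v$1) * p + cnj (v$2) * q) / (?r v + cnj (v$3)))"
    have "u * (?r v + cnj (v$3)) + cnj (v$1) * (p + s * v$1) + cnj (v$2) * (q + s * v$2) = s * (?r v * (?r v + v$3))"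
      if "u * (?r v + cnj (v$3)) = s * v$3 * (?r v + cnj (v$3)) - (cnj (v$1) * p + cnj (v$2) * q)" for u
      using that rr[of v] by Groebner_Basis.algebra
    moreover have "(s * v$3 - (cnj (v$1) * p + cnj (v$2) * q) / (?r v + cnj (v$3))) * (?r v + cnj (v$3)) = s * v$3 * (?r v + cnj (v$3)) - (cnj (v$1) * p + cnj (v$2) * q)"
      using nz[OF v] by (simp add: field_simps)
    ultimately have "?w$3 * (?r v + cnj (v$3)) + cnj (v$1) * ?w$1 + cnj (v$2) * ?w$2 = s * (?r v * (?r v + v$3))"
      by simp
    then have "?z v ?w = s" using nz[OF v] by simp
    then show ?case by (simp only: x fst_conv snd_conv) simp
  next
    case (6 y)
    obtain v w where y: "y = (v, w)" by (cases y)
    have v: "norm v + v$3 \<noteq> 0" using 6 by (auto simp: y)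
    define z where "z = ?z v w"
    have z: "z * (?r v * (?r v + v$3)) = w$3 * (?r v + cnj (v$3)) + cnj (v$1) * w$1 + cnj (v$2) * w$2"
      using nz[OF v] by (simp add: z_def)
    have "(w$3 - z * v$3) * (?r v + cnj (v$3)) = - (cnj (v$1) * (w$1 - z * v$1) + cnj (v$2) * (w$2 - z * v$2))"
      using z rr[of v] by Groebner_Basis.algebra
    then have "z * v$3 - (cnj (v$1) * (w$1 - z * v$1) + cnj (v$2) * (w$2 - z * v$2)) / (?r v + cnj (v$3)) = w$3"
      using nz[OF v] by (simp add: field_simps) 
    then show ?case by (simp add: y vec3_eq_iff flip: z_def)
  qed
qed

lemma continuous_on_cross3c [continuous_intros]:
  "continuous_on S f \<Longrightarrow> continuous_on S g \<Longrightarrow> continuous_on S (\<lambda>x. cross3c (f x) (g x))"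
  unfolding cross3c_def by (intro continuous_intros continuous_on_vec3)

text \<open>The ray is closed of real codimension five, and near it the vectors \<open>e1\<close>,
  \<open>e2\<close>, \<open>v\<close> trivialise the second vectors. So the relative groups are
  those of the fibre, in degrees 0 and 3, shifted by five; they do not interact with the degrees 0
  and 3 off the ray.\<close>

lemma has_rational_cells_two_frames: "has_rational_cells (top_of_set two_frames) {0, 3, 5, 8}"
proof -
  let ?X = "top_of_set two_frames"
  let ?M = "{x \<in> two_frames. norm (fst x) + fst x $ 3 \<noteq> 0}" and ?P = "{x \<in> two_frames. Re (fst x $ 3) < 0}"
  let ?A = "{s::real. s < 0} \<times> fst2_nonzero"
  have v0: "v \<noteq> 0" if "(v, w) \<in> two_frames" for v w using that by (auto simp: two_frames_def)
  have M: "openin ?X ?M"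
  proof -
    have "open {x :: (complex^3) \<times> (complex^3). norm (fst x) + fst x $ 3 \<noteq> 0}"
      by (intro open_Collect_neq continuous_intros)
    then show ?thesis by (auto simp: openin_open Collect_conj_eq)
  qed
  have P: "openin ?X ?P"
  proof -
    have "open {x :: (complex^3) \<times> (complex^3). Re (fst x $ 3) < 0}"
      by (intro open_Collect_less continuous_intros)
    then show ?thesis by (auto simp: openin_open Collect_conj_eq)
  qed
  have cover: "?M \<union> ?P = topspace ?X"
  proof -
    have "x \<in> ?M \<union> ?P" if "x \<in> two_frames" for x
    proof -
      obtain v w where x: "x = (v, w)" by (cases x)
      show ?thesis
      proof (cases "norm v + v$3 = 0")
        case True
        then have "v$3 = - of_real (norm v)" by (simp add: add_eq_0_iff2)
        then show ?thesis using v0 that by (simp add: x)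
      qed (use that in \<open>simp add: x\<close>)
    qed
    then show ?thesis by auto
  qed
  have subP: "subtopology ?X ?P = top_of_set ?P" by (simp add: subtopology_subtopology Int_absorb1 Collect_restrict)
  have subM: "subtopology ?X ?M = top_of_set ?M" by (simp add: subtopology_subtopology Int_absorb1 Collect_restrict)
  have "top_of_set ?A homotopy_equivalent_space top_of_set fst2_nonzero"
  proof (rule deformation_homotopy_equivalent[where f = snd and g = "\<lambda>y. (-1, y)"])
    fix x :: "real \<times> complex \<times> complex \<times> complex" and t :: real
    assume x: "x \<in> ?A" and t: "0 \<le> t" "t \<le> 1"
    have "(1 - t) * fst x - t < 0"
    proof (cases "t = 0")
      case False
      have "(1 - t) * fst x \<le> 0" using x t by (intro mult_nonneg_nonpos) auto
      then show ?thesis using t False by linarith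
    qed (use x in auto)
    then show "(1 - t) *\<^sub>R x + t *\<^sub>R (-1, snd x) \<in> ?A"
      using x by (cases x) (simp flip: scaleR_add_left)
  qed (auto intro!: continuous_intros)
  then have A: "has_rational_cells (top_of_set ?A) {0, 3}"
    using has_rational_cells_homotopy[OF has_rational_cells_fst2_nonzero] homotopy_equivalent_space_sym by blast
  let ?S1 = "{(t::real, a). a \<in> ?A \<and> (t \<noteq> 0 \<or> a \<in> {})}"
  let ?S2 = "{(t::complex, a). a \<in> UNIV \<times> ?A \<and> (t \<noteq> 0 \<or> a \<in> ?S1)}"
  let ?S3 = "{(t::complex, a). a \<in> UNIV \<times> UNIV \<times> ?A \<and> (t \<noteq> 0 \<or> a \<in> ?S2)}"
  let ?T = "(UNIV :: complex set) \<times> (UNIV :: complex set) \<times> (UNIV :: real set) \<times> ?A"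
  \<comment> \<open>The ray is cut out by \<open>v1 = 0\<close>, \<open>v2 = 0\<close> and
    \<open>Im v3 = 0\<close>: two complex suspensions and a real one shift the degree by 2 + 2 +
    1.\<close>
  have T: "relative_homology_group p (top_of_set ?T) ?S3 \<cong> homology_group (p - 5) (top_of_set ?A)" for p
  proof -
    have 1: "relative_homology_group p (top_of_set ?T) ?S3 \<cong> relative_homology_group (p - 2) (top_of_set ((UNIV :: complex set) \<times> (UNIV :: real set) \<times> ?A)) ?S2"
      by (intro complex_suspension_iso suspension_open) simp
    have 2: "relative_homology_group (p - 2) (top_of_set ((UNIV :: complex set) \<times> (UNIV :: real set) \<times> ?A)) ?S2
      \<cong> relative_homology_group (p - 2 - 2) (top_of_set ((UNIV :: real set) \<times> ?A)) ?S1"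
      by (intro complex_suspension_iso suspension_open) simp
    have "relative_homology_group (p - 5 + 1) (top_of_set ((UNIV :: real set) \<times> ?A)) ?S1 \<cong> relative_homology_group (p - 5) (top_of_set ?A) {}"
      by (intro suspension_iso) simp
    moreover have "p - 5 + 1 = p - 2 - 2" by simp
    ultimately have "relative_homology_group (p - 2 - 2) (top_of_set ((UNIV :: real set) \<times> ?A)) ?S1 \<cong> relative_homology_group (p - 5) (top_of_set ?A) {}"
      by (simp only:)
    from iso_trans[OF 1 iso_trans[OF 2 this]] show ?thesis .
  qed
  have fP: "(vec3 a b (Complex s t), vec3 (x + z * a) (y + z * b) (z * Complex s t)) \<in> ?P"
    if "s < 0" "x \<noteq> 0 \<or> y \<noteq> 0" for a b s t x y z
  proof -
    let ?c = "Complex s t"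
    have c: "?c \<noteq> 0" using that(1) by (simp add: complex_eq_iff)
    have "?c * (y + z * b) = ?c * y + b * (z * ?c)" "?c * (x + z * a) = ?c * x + a * (z * ?c)" by (simp_all add: algebra_simps)
    then have "(b * (z * ?c) = ?c * (y + z * b) \<longleftrightarrow> y = 0) \<and> (?c * (x + z * a) = a * (z * ?c) \<longleftrightarrow> x = 0)"
      using c by auto
    then have "cross3c (vec3 a b ?c) (vec3 (x + z * a) (y + z * b) (z * ?c)) \<noteq> 0"
      using that(2) unfolding cross3c_eq_0_iff vector_3 by blast
    then show ?thesis using that(1) by (simp add: two_frames_def)
  qed
  have gP: "w$1 - w$3 / v$3 * v$1 \<noteq> 0 \<or> w$2 - w$3 / v$3 * v$2 \<noteq> 0"
    if "cross3c v w \<noteq> 0" "Re (v$3) < 0" for v w :: "complex^3"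
  proof (rule ccontr)
    assume h: "\<not> ?thesis"
    define c where "c = w$3 / v$3"
    have "v$3 \<noteq> 0" using that(2) by auto
    then have "w$3 = c * v$3" by (simp add: c_def)
    moreover have "w$1 = c * v$1" "w$2 = c * v$2" using h by (auto simp: c_def)
    ultimately have "cross3c v w = 0" by (simp add: cross3c_eq_0_iff)
    then show False using that(1) by blast
  qed
  \<comment> \<open>The coordinates are \<open>v1\<close>, \<open>v2\<close>, \<open>Im v3\<close>,
    \<open>Re v3\<close>, the first two entries of \<open>w\<close> minus its multiple of
    \<open>v\<close>, and the factor \<open>w3 / v3\<close> of that multiple.\<close>
  have "relative_homology_group p (top_of_set ?T) ?S3 \<cong> relative_homology_group p (top_of_set ?P) (?M \<inter> ?P)" for p
  proof (rule relative_homology_iso_homeomorphic[where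
      f = "\<lambda>x. (vec3 (fst x) (fst (snd x)) (Complex (fst (snd (snd (snd x)))) (fst (snd (snd x)))),
         vec3 (fst (snd (snd (snd (snd x)))) + snd (snd (snd (snd (snd (snd x))))) * fst x)
           (fst (snd (snd (snd (snd (snd x))))) + snd (snd (snd (snd (snd (snd x))))) * fst (snd x))
           (snd (snd (snd (snd (snd (snd x))))) * (Complex (fst (snd (snd (snd x)))) (fst (snd (snd x))))))" and
      g = "\<lambda>x. (fst x $ 1, fst x $ 2, Im (fst x $ 3), Re (fst x $ 3),
          snd x $ 1 - snd x $ 3 / fst x $ 3 * fst x $ 1, snd x $ 2 - snd x $ 3 / fst x $ 3 * fst x $ 2, snd x $ 3 / fst x $ 3)"], goal_cases)
    case 1
    show ?case unfolding Complex_eq by (intro continuous_intros continuous_on_vec3)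
  next
    case 2
    show ?case using fP unfolding fst2_nonzero_def by auto
  next
    case 3
    show ?case by (intro continuous_intros) auto
  next
    case 4
    show ?case using gP unfolding fst2_nonzero_def two_frames_def by auto
  next
    case (5 x)
    obtain a b t s p q r where x: "x = (a, b, t, s, p, q, r)" by (cases x) auto
    have "Complex s t \<noteq> 0" using 5 by (auto simp: x complex_eq_iff)
    then show ?case by (simp add: x)
  next
    case (6 y)
    obtain v w where y: "y = (v, w)" by (cases y)
    have "v$3 \<noteq> 0" using 6 by (auto simp: y)
    then show ?case by (simp add: y vec3_eq_iff)
  next
    case 7
    have "(vec3 a b (Complex s t), vec3 (x + z * a) (y + z * b) (z * Complex s t)) \<in> ?M \<inter> ?P"
      if "s < 0" "x \<noteq> 0 \<or> y \<noteq> 0" "a \<noteq> 0 \<or> b \<noteq> 0 \<or> t \<noteq> 0" for a b s t x y z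
      using fP[OF that(1,2)] that(3) by (auto simp: norm_plus_third_eq_0_iff)
    note 7 = this
    show ?case
    proof (rule image_subsetI)
      fix x assume x: "x \<in> ?S3"
      obtain a b t s p q r where xeq: "x = (a, b, t, s, p, q, r)" by (cases x) auto
      have "s < 0" "p \<noteq> 0 \<or> q \<noteq> 0" "a \<noteq> 0 \<or> b \<noteq> 0 \<or> t \<noteq> 0"
        using x unfolding xeq fst2_nonzero_def by auto
      from 7[OF this] show "(vec3 (fst x) (fst (snd x)) (Complex (fst (snd (snd (snd x)))) (fst (snd (snd x)))),
         vec3 (fst (snd (snd (snd (snd x)))) + snd (snd (snd (snd (snd (snd x))))) * fst x)
           (fst (snd (snd (snd (snd (snd x))))) + snd (snd (snd (snd (snd (snd x))))) * fst (snd x))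
           (snd (snd (snd (snd (snd (snd x))))) * (Complex (fst (snd (snd (snd x)))) (fst (snd (snd x)))))) \<in> ?M \<inter> ?P"
        unfolding xeq fst_conv snd_conv .
    qed
  next
    case 8
    show ?case
    proof (rule image_subsetI)
      fix y assume y: "y \<in> ?M \<inter> ?P"
      obtain v w where yeq: "y = (v, w)" by (cases y)
      have h: "cross3c v w \<noteq> 0" "Re (v$3) < 0" "norm v + v$3 \<noteq> 0" using y by (auto simp: yeq two_frames_def)
      have "v$1 \<noteq> 0 \<or> v$2 \<noteq> 0 \<or> Im (v$3) \<noteq> 0" using h(2,3) unfolding norm_plus_third_eq_0_iff by auto
      then show "(fst y $ 1, fst y $ 2, Im (fst y $ 3), Re (fst y $ 3), snd y $ 1 - snd y $ 3 / fst y $ 3 * fst y $ 1,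
          snd y $ 2 - snd y $ 3 / fst y $ 3 * fst y $ 2, snd y $ 3 / fst y $ 3) \<in> ?S3"
        using gP[OF h(1,2)] h(2) unfolding fst2_nonzero_def yeq fst_conv snd_conv by blast
    qed
  qed
  note TP = this
  have PX: "relative_homology_group p (top_of_set ?P) (?M \<inter> ?P) \<cong> relative_homology_group p ?X ?M" for p
    using open_cover_excision[OF M P cover, of p] unfolding subP by (auto simp: is_iso_def)
  have rel: "homology_group (p - 5) (top_of_set ?A) \<cong> relative_homology_group p ?X ?M" for p
    by (rule iso_trans[OF group.iso_sym[OF group_relative_homology_group T] iso_trans[OF TP PX]])
  note ranks = rank_one_group_iso[OF rel group_relative_homology_group group_relative_homology_group]
    torsion_group_iso[OF rel group_relative_homology_group group_relative_homology_group]
  have "has_rational_cells ?X ({0, 3} \<union> {5, 8})"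
  proof (rule has_rational_cells_ambient[where S = ?M])
    show "has_rational_cells (subtopology ?X ?M) {0, 3}" unfolding subM by (rule has_rational_cells_frames_off_ray)
    show "rank_one_group (relative_homology_group p ?X ?M)" if "p \<in> {5, 8}" for p
    proof -
      have "p - 5 \<in> {0, 3}" using that by auto
      then show ?thesis using A ranks(1)[of p] unfolding has_rational_cells_def by blast
    qed
    show "torsion_group (relative_homology_group p ?X ?M)" if "p \<notin> {5, 8}" for p
    proof -
      have "p - 5 \<notin> {0, 3}" using that by auto
      then show ?thesis using A ranks(2)[of p] unfolding has_rational_cells_def by blast
    qed
  qed auto
  then show ?thesis by (simp add: insert_commute)
qed

lemma det_cross3c: "det (g :: complex^3^3) = g$3$1 * cross3c (g$1) (g$2) $ 1 + g$3$2 * cross3c (g$1) (g$2) $ 2 + g$3$3 * cross3c (g$1) (g$2) $ 3"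
  by (simp add: det_3 cross3c_def algebra_simps)

text \<open>For two given independent rows and a given determinant, the admissible third rows form
  an affine space, which contracts linearly onto one chosen row.\<close>

lemma matrices_homotopy_equivalent_frames:
  fixes K :: "complex set"
  assumes K: "0 \<notin> K"
  shows "top_of_set {g :: complex^3^3. det g \<in> K} homotopy_equivalent_space top_of_set (K \<times> two_frames)"
proof -
  \<comment> \<open>The multiple of the conjugated cross product that gives the prescribed
    determinant.\<close>
  let ?u = "\<lambda>x :: complex \<times> (complex^3) \<times> (complex^3). \<chi> i. fst x * cnj (cross3c (fst (snd x)) (snd (snd x)) $ i) / of_real ((norm (cross3c (fst (snd x)) (snd (snd x))))\<^sup>2)"
  let ?g = "\<lambda>x. vector [fst (snd x), snd (snd x), ?u x] :: complex^3^3"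
  have c: "continuous_on (K \<times> two_frames) ?u"
    by (intro continuous_on_vec_lambda continuous_intros) (auto simp: two_frames_def)
  have det: "det (?g (d, v, w)) = d" if "(v, w) \<in> two_frames" for d v w
  proof -
    let ?c = "cross3c v w"
    have n: "complex_of_real ((norm ?c)\<^sup>2) \<noteq> 0" using that by (simp add: two_frames_def)
    have "det (?g (d, v, w)) = d * (?c$1 * cnj (?c$1) + ?c$2 * cnj (?c$2) + ?c$3 * cnj (?c$3)) / of_real ((norm ?c)\<^sup>2)"
      unfolding det_cross3c by (simp add: field_simps add_divide_distrib)
    then show ?thesis using n unfolding norm_complex3_squared[symmetric] by simp
  qed
  show ?thesis
  proof (rule deformation_homotopy_equivalent[where f = "\<lambda>g. (det g, g$1, g$2)" and g = ?g], goal_cases)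
    case 1 show ?case unfolding det_3 by (intro continuous_intros)
  next
    case 2 show ?case using K by (force simp: det_cross3c two_frames_def)
  next
    case 3
    show ?case by (rule continuous_on_vec3[OF _ _ c]) (intro continuous_intros)+
  next
    case 4 show ?case using det by auto
  next
    case (5 y)
    then show ?case using det by (cases y) auto
  next
    case (6 x t)
    let ?x = "?g (det x, x$1, x$2)"
    have fr: "(x$1, x$2) \<in> two_frames" using 6(1) K by (force simp: det_cross3c two_frames_def)
    let ?y = "(1 - t) *\<^sub>R x + t *\<^sub>R ?x"
    \<comment> \<open>Only the third row varies, and the determinant is linear in it.\<close>
    have "det ((1 - t) *\<^sub>R a + t *\<^sub>R b) = (1 - t) *\<^sub>R det a + t *\<^sub>R det b"
      if ab: "a $ 1 = b $ 1" "a $ 2 = b $ 2" for a b :: "complex^3^3"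
    proof -
      define y where "y = (1 - t) *\<^sub>R a + t *\<^sub>R b"
      have y: "y $ 1 = b $ 1" "y $ 2 = b $ 2" "y $ 3 $ j = (1 - t) *\<^sub>R a $ 3 $ j + t *\<^sub>R b $ 3 $ j" for j
        using ab by (simp_all add: y_def flip: scaleR_add_left)
      show ?thesis unfolding y_def[symmetric] det_cross3c y ab by (simp add: algebra_simps)
    qed
    from this[of x ?x] have "det ?y = (1 - t) *\<^sub>R det x + t *\<^sub>R det ?x" by simp
    also have "\<dots> = det x" unfolding det[OF fr] by (simp flip: scaleR_add_left)
    finally show ?case using 6(1) by simp
  qed
qed

lemma has_rational_cells_SL3: "has_rational_cells (top_of_set {g :: complex^3^3. det g = 1}) {0, 3, 5, 8}"
proof -
  have "has_rational_cells (top_of_set ({1::complex} \<times> two_frames)) {0, 3, 5, 8}"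
    by (rule has_rational_cells_homeomorphic[OF has_rational_cells_two_frames, of "Pair 1" _ snd]) (auto intro!: continuous_intros)
  from has_rational_cells_homotopy[OF this] show ?thesis
    using matrices_homotopy_equivalent_frames[of "{1}"] homotopy_equivalent_space_sym by auto
qed

lemma has_rational_cells_GL3: "has_rational_cells (top_of_set {g :: complex^3^3. det g \<noteq> 0}) {0, 1, 3, 4, 5, 6, 8, 9}"
proof -
  have "has_rational_cells (top_of_set ((- {0::complex}) \<times> two_frames)) ({0, 3, 5, 8} \<union> {p + 1 | p. p \<in> {0, 3, 5, 8}})"
    by (rule has_rational_cells_punctured_product[OF has_rational_cells_two_frames]) auto
  moreover have "{0, 3, 5, 8} \<union> {p + 1 | p. p \<in> {0, 3, 5, 8}} = {0, 1, 3, 4, 5, 6, 8, 9 :: int}" by auto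
  ultimately have "has_rational_cells (top_of_set ((- {0::complex}) \<times> two_frames)) {0, 1, 3, 4, 5, 6, 8, 9}" by simp
  from has_rational_cells_homotopy[OF this] show ?thesis
    using matrices_homotopy_equivalent_frames[of "- {0}"] homotopy_equivalent_space_sym by auto
qed

section \<open>Slices in the space of Weierstrass cubics\<close>

lemma mat_mult_nth: "((mat t :: complex^3^3) ** A) $ i $ j = t * A $ i $ j"
  by (simp add: matrix_matrix_mult_def mat_def if_distrib[of "\<lambda>x. x * _"] sum.delta cong: if_cong)

lemma mat_mult_vec: "(mat t :: complex^3^3) *v x = t *s x"
  by (simp add: vec_eq_iff matrix_vector_mult_def mat_def if_distrib[of "\<lambda>x. x * _"] sum.delta cong: if_cong)

lemma mat_mult_commute: "(mat t :: complex^3^3) ** A = A ** mat t"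
  by (simp add: vec_eq_iff matrix_matrix_mult_def mat_def if_distrib[of "\<lambda>x. x * _"] if_distrib[of "\<lambda>x. _ * x"] sum.delta mult.commute cong: if_cong)

lemma mat_mult_mat: "(mat s :: complex^3^3) ** mat t = mat (s * t)"
  by (simp add: vec_eq_iff mat_mult_nth) (simp add: mat_def)

lemma det_mat3: "det (mat t :: complex^3^3) = t^3"
  by (simp add: det_3 mat_def power3_eq_cube)

lemma continuous_on_matrix_mult:
  fixes f g :: "'a::topological_space \<Rightarrow> complex^3^3"
  assumes "continuous_on S f" "continuous_on S g"
  shows "continuous_on S (\<lambda>x. f x ** g x)"
  unfolding matrix_matrix_mult_def by (intro continuous_on_vec_lambda continuous_intros assms)

lemma continuous_on_mat:
  assumes "continuous_on S f" shows "continuous_on S (\<lambda>x. mat (f x) :: complex^3^3)"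
proof -
  have "continuous_on S (\<lambda>x. if i = j then f x else 0)" for i j :: 3
    using assms by (cases "i = j") auto
  then show ?thesis unfolding mat_def by (intro continuous_on_vec_lambda)
qed

lemma continuous_on_det3:
  fixes f :: "'a::topological_space \<Rightarrow> complex^3^3"
  assumes "continuous_on S f" shows "continuous_on S (\<lambda>x. det (f x))"
  unfolding det_3 by (intro continuous_intros assms)

text \<open>The adjugate formula, whose columns are cross products of rows; it makes the continuity
  of inversion visible.\<close>

definition minv3 :: "complex^3^3 \<Rightarrow> complex^3^3" where
  "minv3 g = (\<chi> i j. (if j = 1 then cross3c (g$2) (g$3) $ i else if j = 2 then cross3c (g$3) (g$1) $ i else cross3c (g$1) (g$2) $ i) / det g)"

lemma minv3:
  assumes "det g \<noteq> 0"
  shows "g ** minv3 g = mat 1" "minv3 g ** g = mat 1"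
proof -
  have "(g ** minv3 g) $ i $ j = (mat 1 :: complex^3^3) $ i $ j" for i j
  proof -
    have "(g ** minv3 g) $ i $ j * det g = (mat 1 :: complex^3^3) $ i $ j * det g"
      using assms exhaust_3[of i] exhaust_3[of j]
      by (auto simp: minv3_def matrix_matrix_mult_def sum_3 mat_def cross3c_def add_divide_distrib[symmetric] diff_divide_distrib[symmetric])
         (simp_all add: det_3 algebra_simps)
    then show ?thesis using assms by simp
  qed
  then show 1: "g ** minv3 g = mat 1" by (simp add: vec_eq_iff)
  then show "minv3 g ** g = mat 1" by (simp add: matrix_left_right_inverse)
qed

lemma det_minv3: "det g \<noteq> 0 \<Longrightarrow> det (minv3 g) = 1 / det g"
  using det_mul[of g "minv3 g"] by (simp add: minv3 field_simps)

lemma continuous_on_minv3: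
  assumes "continuous_on S f" "\<And>x. x \<in> S \<Longrightarrow> det (f x) \<noteq> 0"
  shows "continuous_on S (\<lambda>x. minv3 (f x))"
proof -
  have "continuous_on S (\<lambda>x. (if j = 1 then cross3c (f x$2) (f x$3) $ i else if j = 2 then cross3c (f x$3) (f x$1) $ i else cross3c (f x$1) (f x$2) $ i))" for i j :: 3
    using assms(1) by (cases "j = 1"; cases "j = 2") (auto intro!: continuous_intros)
  then show ?thesis unfolding minv3_def using assms
    by (intro continuous_on_vec_lambda continuous_on_divide continuous_on_det3) auto
qed

lemma weier_scale: "weier a b (mat t *v x) = t^3 * weier a b x"
  by (simp add: weier_def mat_mult_vec power2_eq_square power3_eq_cube algebra_simps)

lemma weier_proportional:
  assumes "\<And>x. weier a b x = k * weier a' b' x"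
  shows "k = 1" "a = a'" "b = b'"
proof -
  show k: "k = 1" using assms[of "vec3 0 1 1"] assms[of "vec3 0 1 (-1)"] assms[of "vec3 1 0 0"] by (simp add: weier_def)
  show b: "b = b'" using assms[of "vec3 0 0 1"] by (simp add: weier_def k)
  show "a = a'" using assms[of "vec3 1 0 1"] by (simp add: weier_def k b)
qed

lemma det_diag_matrix: "\<beta> \<noteq> 0 \<Longrightarrow> det (diag_matrix \<alpha> \<beta>) = \<alpha> / \<beta>"
  by (simp add: det_3 diag_matrix_def power2_eq_square)

lemma det_swap_matrix:
  assumes "a^3 + b^2 \<noteq> 0" "q \<in> flexes a b"
  shows "det (swap_matrix a b q) = (if q = None then 1 else -1)"
  using assms affine_flex_slope(1)[OF assms(1)] by (auto simp: flexes_def swap_matrix_def det_flex_swap)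

text \<open>A root bound: for \<open>|x| > 1\<close> the quartic gives
  \<open>|x|^2 <= 14 A + 3 A^2\<close>, where 14 is the sum of its coefficients 6 and 8. It
  separates the flex at infinity from the others uniformly while the curve varies in a bounded
  family.\<close>

lemma affine_flexes_bounded:
  assumes "a^3 + b^2 \<noteq> 0" "norm a \<le> A" "norm b \<le> A" "(x, y) \<in> affine_flexes a b"
  shows "norm y \<le> (14 * A + 3 * A^2 + 1)^3 + 3 * A * (14 * A + 3 * A^2 + 1) + 2 * A + 1"
proof -
  let ?R = "14 * A + 3 * A^2 + 1"
  have A0: "A \<ge> 0" using assms(2) norm_ge_zero order_trans by blast
  have q: "x^4 = - (6 * a * x^2) - 8 * b * x + 3 * a^2" "y^2 = x^3 + 3 * a * x + 2 * b"
    using assms(4) by (auto simp: affine_flexes_def algebra_simps)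
  have x: "norm x \<le> ?R"
  proof (cases "norm x \<le> 1")
    case True
    then show ?thesis using A0 by (smt (verit) zero_le_power2)
  next
    case False
    let ?n = "norm x"
    have n1: "1 \<le> ?n" "?n \<le> ?n^2" "1 \<le> ?n^2"
      using False mult_mono[of 1 ?n 1 ?n] mult_left_mono[of 1 ?n ?n] by (auto simp: power2_eq_square)
    have "?n^4 = norm (x^4)" by (simp add: norm_power)
    also have "\<dots> \<le> norm (6 * a * x^2) + norm (8 * b * x) + norm (3 * a^2)"
      unfolding q(1) by (smt (verit) norm_minus_cancel norm_triangle_ineq norm_triangle_ineq4)
    also have "\<dots> = 6 * norm a * ?n^2 + 8 * norm b * ?n + 3 * (norm a)^2" by (simp add: norm_mult norm_power)
    also have "\<dots> \<le> 6 * A * ?n^2 + 8 * A * ?n^2 + 3 * A^2 * ?n^2"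
    proof (intro add_mono)
      show "6 * norm a * ?n^2 \<le> 6 * A * ?n^2" using assms(2) by (intro mult_right_mono) auto
      show "8 * norm b * ?n \<le> 8 * A * ?n^2" using assms(3) n1 A0 by (intro mult_mono) auto
      have "3 * (norm a)^2 \<le> 3 * A^2" using assms(2) by (simp add: power_mono)
      also have "\<dots> \<le> 3 * A^2 * ?n^2" using n1(3) A0 by (simp add: mult_le_cancel_left1)
      finally show "3 * (norm a)^2 \<le> 3 * A^2 * ?n^2" .
    qed
    also have "\<dots> = (14 * A + 3 * A^2) * ?n^2" by (simp add: algebra_simps)
    finally have "?n^2 * ?n^2 \<le> (14 * A + 3 * A^2) * ?n^2" unfolding power_add[symmetric] by simp
    from mult_right_le_imp_le[OF this] have "?n^2 \<le> 14 * A + 3 * A^2" using n1(3) by linarith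
    then show ?thesis using n1 by linarith
  qed
  have R1: "?R \<ge> 1" using A0 by simp
  have "(norm y)^2 = norm (y^2)" by (simp add: norm_power)
  also have "\<dots> \<le> norm (x^3) + norm (3 * a * x) + norm (2 * b)"
    unfolding q(2) by (smt (verit) norm_triangle_ineq)
  also have "\<dots> = (norm x)^3 + 3 * norm a * norm x + 2 * norm b" by (simp add: norm_mult norm_power)
  also have "\<dots> \<le> ?R^3 + 3 * A * ?R + 2 * A"
    using x assms(2,3) A0 by (intro add_mono power_mono mult_mono) auto
  finally have y2: "(norm y)^2 \<le> ?R^3 + 3 * A * ?R + 2 * A" .
  have "norm y \<le> (norm y)^2 + 1"
  proof (cases "norm y \<le> 1")
    case True then show ?thesis by (smt (verit) zero_le_power2)
  next
    case False
    then have "norm y * 1 \<le> norm y * norm y" by (intro mult_left_mono) auto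
    then show ?thesis by (simp add: power2_eq_square)
  qed
  then show ?thesis using y2 by linarith
qed

text \<open>\<open>E\<close> consists of the diagonal equivalences that keep a member of the slice inside the slice. That it
  does not depend on the member is what makes the number of sheets below constant.\<close>

locale weier_slice =
  fixes S :: "complex set" and ca cb :: "complex \<Rightarrow> complex" and E :: "(complex \<times> complex) set" and s1 :: complex
  assumes open_S: "open S" and s1: "s1 \<in> S"
    and star: "\<And>s t. s \<in> S \<Longrightarrow> 0 \<le> t \<Longrightarrow> t \<le> 1 \<Longrightarrow> (1 - t) *\<^sub>R s + t *\<^sub>R s1 \<in> S"
    and cont: "continuous_on S ca" "continuous_on S cb"
    and inj: "\<And>s s'. s \<in> S \<Longrightarrow> s' \<in> S \<Longrightarrow> ca s = ca s' \<Longrightarrow> cb s = cb s' \<Longrightarrow> s = s'"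
    and disc: "\<And>s. s \<in> S \<Longrightarrow> ca s ^ 3 + cb s ^ 2 \<noteq> 0"
    and finite_E: "finite E" and E_sub: "\<And>\<alpha> \<beta>. (\<alpha>, \<beta>) \<in> E \<Longrightarrow> \<alpha>^3 = 1 \<and> \<beta> \<noteq> 0"
    and E_iff: "\<And>s \<alpha> \<beta>. s \<in> S \<Longrightarrow> \<alpha>^3 = 1 \<Longrightarrow> \<beta> \<noteq> 0 \<Longrightarrow>
      (\<exists>s'\<in>S. ca s' = ca s * \<alpha> / \<beta>^4 \<and> cb s' = cb s / \<beta>^6) \<longleftrightarrow> (\<alpha>, \<beta>) \<in> E"
begin

lemma equivalence_decomposition:
  assumes "s \<in> S" "s' \<in> S" "det h \<noteq> 0" "k \<noteq> 0"
    and eq: "\<And>x. weier (ca s) (cb s) (h *v x) = k * weier (ca s') (cb s') x"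
  obtains q \<alpha> \<beta> t where "q \<in> flexes (ca s) (cb s)" "(\<alpha>, \<beta>) \<in> E" "t^3 = k"
    "h = mat t ** (swap_matrix (ca s) (cb s) q ** diag_matrix \<alpha> \<beta>)"
    "ca s' = ca s * \<alpha> / \<beta>^4" "cb s' = cb s / \<beta>^6"
proof -
  obtain t where t: "t^3 = k" using cube_root_exists by blast
  have t0: "t \<noteq> 0" using t assms(4) by auto
  let ?h = "mat (1 / t) ** h"
  have "weier (ca s) (cb s) (?h *v x) = weier (ca s') (cb s') x" for x
    unfolding matrix_vector_mul_assoc[symmetric] weier_scale eq t[symmetric] using t0 by (simp add: power_divide)
  moreover have "invertible ?h" unfolding invertible_det_nz det_mul det_mat3 using t0 assms(3) by simp
  ultimately obtain q \<alpha> \<beta> where q: "q \<in> flexes (ca s) (cb s)" "\<alpha>^3 = 1" "\<beta> \<noteq> 0" "ca s' = ca s * \<alpha> / \<beta>^4"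
      "cb s' = cb s / \<beta>^6" "?h = swap_matrix (ca s) (cb s) q ** diag_matrix \<alpha> \<beta>"
    using weier_equivalences[OF disc[OF assms(1)]] by blast
  have "(\<alpha>, \<beta>) \<in> E" using E_iff[OF assms(1) q(2,3)] q(4,5) assms(2) by blast
  moreover have "mat t ** ?h = h" unfolding matrix_mul_assoc mat_mult_mat using t0 by simp
  ultimately show ?thesis using that q t by metis
qed

text \<open>Equivalences near the identity cannot move the flex at infinity, because the other
  flexes stay bounded. What remains is a scalar times a diagonal matrix from the finite set
  \<open>E\<close>. The alternative \<open>k = 1\<close> or \<open>det h = 1\<close> serves both
  groups and leaves only finitely many scalars, so a small neighbourhood contains just the
  identity.\<close>

lemma rigid:
  assumes s0: "s0 \<in> S"
  obtains \<epsilon> where "\<epsilon> > 0" "\<And>s s' h k. s \<in> S \<Longrightarrow> s' \<in> S \<Longrightarrow> dist s s0 < \<epsilon> \<Longrightarrow> dist h (mat 1) < \<epsilon> \<Longrightarrow> det h \<noteq> 0 \<Longrightarrow> k \<noteq> 0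
     \<Longrightarrow> k = 1 \<or> det h = 1 \<Longrightarrow> (\<And>x. weier (ca s) (cb s) (h *v x) = k * weier (ca s') (cb s') x) \<Longrightarrow> h = mat 1 \<and> s = s'"
proof -
  define A where "A = norm (ca s0) + norm (cb s0) + 1"
  obtain \<epsilon>1 where \<epsilon>1: "\<epsilon>1 > 0" "\<And>s. s \<in> S \<Longrightarrow> dist s s0 < \<epsilon>1 \<Longrightarrow> dist (ca s) (ca s0) < 1"
    using cont(1) s0 unfolding continuous_on_iff by (metis zero_less_one)
  obtain \<epsilon>2 where \<epsilon>2: "\<epsilon>2 > 0" "\<And>s. s \<in> S \<Longrightarrow> dist s s0 < \<epsilon>2 \<Longrightarrow> dist (cb s) (cb s0) < 1"
    using cont(2) s0 unfolding continuous_on_iff by (metis zero_less_one)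
  define B where "B = (14 * A + 3 * A^2 + 1)^3 + 3 * A * (14 * A + 3 * A^2 + 1) + 2 * A + 1"
  have A0: "A \<ge> 0" by (simp add: A_def)
  have B0: "B \<ge> 0" unfolding B_def using A0 by (intro add_nonneg_nonneg mult_nonneg_nonneg zero_le_power) auto
  \<comment> \<open>A gap around 1 in the finite set of ratios \<open>\<alpha> / \<beta>\<close>,
    which are visible in \<open>h\<close> as the quotient of its first two diagonal entries;
    \<open>\<delta>2\<close> is the gap around 1 among the cube roots of unity.\<close>
  obtain \<delta>1 where \<delta>1: "\<delta>1 > 0" "\<And>\<alpha> \<beta>. (\<alpha>, \<beta>) \<in> E \<Longrightarrow> \<alpha> / \<beta> \<noteq> 1 \<Longrightarrow> \<delta>1 \<le> dist 1 (\<alpha> / \<beta>)"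
    using finite_set_avoid[of "(\<lambda>(\<alpha>, \<beta>). \<alpha> / \<beta>) ` E" 1] finite_E by fastforce
  obtain \<delta>2 where \<delta>2: "\<delta>2 > 0" "\<And>z::complex. z^3 = 1 \<Longrightarrow> z \<noteq> 1 \<Longrightarrow> \<delta>2 \<le> dist 1 z"
    using finite_set_avoid[of "{z::complex. z^3 = 1}" 1] finite_nth_roots[of 3 1] by auto
  \<comment> \<open>The bounds 1/2 and \<open>1 / (2 * (B + 1))\<close> contradict a moved flex,
    \<open>\<delta>1 / 4\<close> forces the ratio to be 1, and \<open>\<delta>2\<close> forces the
    last cube root of unity to be 1.\<close>
  define \<epsilon> where "\<epsilon> = Min {\<epsilon>1, \<epsilon>2, 1/2, 1 / (2 * (B + 1)), \<delta>1 / 4, \<delta>2}"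
  have \<epsilon>: "\<epsilon> > 0" "\<epsilon> \<le> \<epsilon>1" "\<epsilon> \<le> \<epsilon>2" "\<epsilon> \<le> 1/2" "\<epsilon> \<le> 1 / (2 * (B + 1))" "\<epsilon> \<le> \<delta>1 / 4" "\<epsilon> \<le> \<delta>2"
    using \<epsilon>1 \<epsilon>2 \<delta>1 \<delta>2 B0 by (auto simp: \<epsilon>_def)
  show ?thesis
  proof (rule that[OF \<epsilon>(1)])
    fix s s' h k
    assume s: "s \<in> S" "s' \<in> S" and ds: "dist s s0 < \<epsilon>" and dh: "dist h (mat 1) < \<epsilon>" and h0: "det h \<noteq> 0" and k0: "k \<noteq> 0"
      and k: "k = 1 \<or> det h = 1" and eq: "\<And>x. weier (ca s) (cb s) (h *v x) = k * weier (ca s') (cb s') x"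
    obtain q \<alpha> \<beta> t where d: "q \<in> flexes (ca s) (cb s)" "(\<alpha>, \<beta>) \<in> E" "t^3 = k"
       "h = mat t ** (swap_matrix (ca s) (cb s) q ** diag_matrix \<alpha> \<beta>)"
       "ca s' = ca s * \<alpha> / \<beta>^4" "cb s' = cb s / \<beta>^6"
      using equivalence_decomposition[OF s h0 k0 eq] by blast
    have t0: "t \<noteq> 0" using d(3) k0 by auto
    have \<alpha>\<beta>: "\<alpha>^3 = 1" "\<beta> \<noteq> 0" using E_sub d(2) by auto
    have entry: "dist (h $ i $ j) ((mat 1 :: complex^3^3) $ i $ j) < \<epsilon>" for i j
      using dh dist_vec_nth_le[of "h $ i" j "mat 1 $ i"] dist_vec_nth_le[of h i "mat 1"] by linarith
    have h22: "dist (h$2$2) 1 < \<epsilon>" and h32: "norm (h$3$2) < \<epsilon>" and h11: "dist (h$1$1) 1 < \<epsilon>"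
      using entry[of 2 2] entry[of 3 2] entry[of 1 1] by (simp_all add: mat_def dist_norm)
    have n22: "norm (h$2$2) > 1/2"
    proof -
      have "norm (1::complex) \<le> norm (h$2$2) + dist (h$2$2) 1" by (metis add.commute dist_commute dist_norm norm_triangle_sub)
      then show ?thesis using h22 \<epsilon>(4) by simp
    qed
    have col: "h *v vec3 0 1 0 = t *s (case q of None \<Rightarrow> vec3 0 \<beta> 0 | Some (x, y) \<Rightarrow> (\<beta> / (2 * y)) *s vec3 x y 1)"
      unfolding d(4) matrix_vector_mul_assoc[symmetric] mat_mult_vec
      by (simp only: matrix_vector_mul_assoc swap_diag_column[OF disc[OF s(1)] d(1)])
    have "q = None"
    proof (rule ccontr)
      assume "q \<noteq> None"
      then obtain x y where q: "q = Some (x, y)" "(x, y) \<in> affine_flexes (ca s) (cb s)"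
        using d(1) by (auto simp: flexes_def)
      \<comment> \<open>The second column is a multiple of \<open>(x, y, 1)\<close>; its middle
        entry is near 1 and its last near 0, so \<open>y\<close> would be large.\<close>
      have "h$2$2 = y * h$3$2"
        using arg_cong[OF col, of "\<lambda>v. v$2"] arg_cong[OF col, of "\<lambda>v. v$3"] by (simp add: q(1) mat3_vec)
      moreover have "norm y \<le> B" unfolding B_def
      proof (rule affine_flexes_bounded[OF disc[OF s(1)] _ _ q(2)])
        have "norm (ca s) \<le> norm (ca s0) + dist (ca s) (ca s0)" by (metis dist_norm norm_triangle_sub)
        then show "norm (ca s) \<le> A" using \<epsilon>1(2)[OF s(1)] ds \<epsilon>(2) by (simp add: A_def) (smt (verit) norm_ge_zero)
        have "norm (cb s) \<le> norm (cb s0) + dist (cb s) (cb s0)" by (metis dist_norm norm_triangle_sub)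
        then show "norm (cb s) \<le> A" using \<epsilon>2(2)[OF s(1)] ds \<epsilon>(3) by (simp add: A_def) (smt (verit) norm_ge_zero)
      qed
      ultimately have "1/2 < B * \<epsilon>" using n22 h32 B0 by (smt (verit) mult_mono norm_ge_zero norm_mult)
      also have "\<dots> \<le> B * (1 / (2 * (B + 1)))" using \<epsilon>(5) B0 by (rule mult_left_mono)
      also have "\<dots> \<le> 1/2" using B0 by (simp add: field_simps)
      finally show False by simp
    qed
    then have hd: "h = mat t ** diag_matrix \<alpha> \<beta>" using d(4) by (simp add: swap_matrix_def)
    have hn: "h$1$1 = t * \<alpha>" "h$2$2 = t * \<beta>" by (simp_all add: hd mat_mult_nth diag_matrix_def)
    have \<alpha>\<beta>1: "\<alpha> / \<beta> = 1"
    proof (rule ccontr)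
      assume "\<alpha> / \<beta> \<noteq> 1"
      then have "\<delta>1 \<le> norm (1 - \<alpha> / \<beta>)" using \<delta>1(2) d(2) by (simp add: dist_norm)
      also have "1 - \<alpha> / \<beta> = (h$2$2 - h$1$1) / h$2$2" unfolding hn using t0 \<alpha>\<beta> by (simp add: field_simps)
      also have "norm \<dots> = norm (h$2$2 - h$1$1) / norm (h$2$2)" by (simp add: norm_divide)
      also have "\<dots> < (2 * \<epsilon>) / (1/2)"
      proof (rule frac_less)
        have "dist (h$2$2) (h$1$1) < 2 * \<epsilon>" using h22 h11 by (smt (verit) dist_commute dist_triangle)
        then show "norm (h$2$2 - h$1$1) < 2 * \<epsilon>" by (simp add: dist_norm)
      qed (use n22 \<epsilon> in auto)
      finally show False using \<epsilon>(6) by simp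
    qed
    then have ab: "\<alpha> = \<beta>" using \<alpha>\<beta> by simp
    then have b3: "\<beta>^3 = 1" using \<alpha>\<beta> by simp
    have b46: "\<beta>^4 = \<beta>" "\<beta>^6 = 1" using b3 by (simp_all add: eval_nat_numeral)
    have "ca s' = ca s" "cb s' = cb s" using d(5,6) ab b46 \<alpha>\<beta>(2) by auto
    then have ss: "s = s'" using inj s by metis
    \<comment> \<open>Since \<open>\<alpha> = \<beta>\<close>, the determinant equals
      \<open>k\<close>, so both alternatives give the same conclusion.\<close>
    have "det h = t^3" unfolding hd det_mul det_mat3 det_diag_matrix[OF \<alpha>\<beta>(2)] \<alpha>\<beta>1 by simp
    then have "t^3 = 1" using k d(3) by auto
    then have "(t * \<beta>)^3 = 1" using b3 by (simp add: power_mult_distrib)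
    moreover have "dist 1 (t * \<beta>) < \<delta>2" using h22 \<epsilon>(7) by (simp add: hn dist_commute)
    ultimately have tb: "t * \<beta> = 1" using \<delta>2(2) by fastforce
    have "1 / \<beta>^2 = \<beta>" using b3 \<alpha>\<beta>(2) by (simp add: field_simps power2_eq_square power3_eq_cube)
    then have "h $ i $ j = (mat 1 :: complex^3^3) $ i $ j" for i j
      using exhaust_3[of i] exhaust_3[of j] tb unfolding hd mat_mult_nth ab unfolding diag_matrix_def mat_def by (elim disjE) simp_all
    then show "h = mat 1 \<and> s = s'" using ss by (simp add: vec_eq_iff)
  qed
qed

end

lemma is_cubic_weier_compose: "is_cubic (\<lambda>x. weier a b (g *v x))"
  by (rule is_cubic_compose[OF is_cubic_weier])

lemma cubic_coeffs_eq_scale_iff: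
  assumes "is_cubic P" "is_cubic Q"
  shows "cubic_coeffs P = (\<lambda>m. k * cubic_coeffs Q m) \<longleftrightarrow> (\<forall>x. P x = k * Q x)"
proof
  assume "cubic_coeffs P = (\<lambda>m. k * cubic_coeffs Q m)"
  then have "cubic_fun (cubic_coeffs P) x = k * cubic_fun (cubic_coeffs Q) x" for x by (simp add: cubic_fun_scale)
  then show "\<forall>x. P x = k * Q x" using assms by (simp add: cubic_fun_cubic_coeffs)
next
  assume "\<forall>x. P x = k * Q x"
  then have "P = (\<lambda>x. k * Q x)" by auto
  then show "cubic_coeffs P = (\<lambda>m. k * cubic_coeffs Q m)" by (auto simp: cubic_coeffs_scale)
qed

lemma topspace_U32: "topspace U32 = Pi32 - Sigma32" by (simp add: U32_def)

lemma cubic_coeffs_weier_smooth: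
  assumes "a^3 + b^2 \<noteq> 0" "det g \<noteq> 0"
  shows "cubic_coeffs (\<lambda>x. weier a b (g *v x)) \<in> Pi32 - Sigma32"
  unfolding nonsingular_iff_cubic_smooth cubic_fun_cubic_coeffs[OF is_cubic_weier_compose]
  using cubic_smooth_compose[of "weier a b" g] assms by (simp add: cubic_smooth_weier invertible_det_nz)

lemma continuous_on_cubic_coeffs:
  assumes "\<And>x. continuous_on A (\<lambda>y. P y x)"
  shows "continuous_on A (\<lambda>y. cubic_coeffs (P y) m)"
proof -
  have if_const: "continuous_on A (\<lambda>y. if c then f y else g y)"
    if "continuous_on A f" "continuous_on A g" for c and f g :: "_ \<Rightarrow> complex"
    using that by (cases c) auto
  show ?thesis unfolding cubic_coeffs_def
    by (intro if_const continuous_on_add continuous_on_diff continuous_on_divide continuous_on_const assms ballI) simp_all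
qed

context weier_slice
begin

definition slice_cubic :: "(complex^3^3) \<times> complex \<Rightarrow> nat \<times> nat \<times> nat \<Rightarrow> complex" where
  "slice_cubic = (\<lambda>(g, s). cubic_coeffs (\<lambda>x. weier (ca s) (cb s) (g *v x)))"

lemma slice_cubic_smooth: "det g \<noteq> 0 \<Longrightarrow> s \<in> S \<Longrightarrow> slice_cubic (g, s) \<in> Pi32 - Sigma32"
  by (simp only: slice_cubic_def case_prod_conv cubic_coeffs_weier_smooth disc not_False_eq_True)

lemma slice_cubic_eq_iff:
  "slice_cubic (g, s) = (\<lambda>m. k * slice_cubic (g', s') m) \<longleftrightarrow> (\<forall>x. weier (ca s) (cb s) (g *v x) = k * weier (ca s') (cb s') (g' *v x))"
  unfolding slice_cubic_def case_prod_conv by (rule cubic_coeffs_eq_scale_iff[OF is_cubic_weier_compose is_cubic_weier_compose])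

lemma continuous_on_slice_cubic: "continuous_on (UNIV \<times> S) slice_cubic"
proof -
  have w: "continuous_on (UNIV \<times> S) (\<lambda>y. weier (ca (snd y)) (cb (snd y)) (fst y *v x))" for x :: "complex^3"
    unfolding weier_def mat3_vec
    by (intro continuous_intros continuous_on_compose2[OF cont(1)] continuous_on_compose2[OF cont(2)]) auto
  have "continuous_on (UNIV \<times> S) (\<lambda>y. slice_cubic y m)" for m
  proof -
    have "continuous_on (UNIV \<times> S) (\<lambda>y. cubic_coeffs (\<lambda>x. weier (ca (snd y)) (cb (snd y)) (fst y *v x)) m)"
      by (rule continuous_on_cubic_coeffs[OF w])
    then show ?thesis by (simp add: slice_cubic_def case_prod_unfold)
  qed
  then show ?thesis by (rule continuous_on_coordinatewise_then_product)
qed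

text \<open>Two points with proportional cubics differ by the equivalence
  \<open>g ** minv3 g'\<close>, which is near the identity when both matrices are near
  \<open>g0\<close>.\<close>

lemma locally_rigid:
  assumes g0: "det g0 \<noteq> 0" and s0: "s0 \<in> S"
  shows "\<exists>W. open W \<and> (g0, s0) \<in> W \<and> W \<subseteq> {g. det g \<noteq> 0} \<times> S \<and>
    (\<forall>g s g' s' k. (g, s) \<in> W \<longrightarrow> (g', s') \<in> W \<longrightarrow> k \<noteq> 0 \<longrightarrow> k = 1 \<or> det g = det g' \<longrightarrow>
       slice_cubic (g, s) = (\<lambda>m. k * slice_cubic (g', s') m) \<longrightarrow> g = g' \<and> s = s')"
proof -
  obtain \<epsilon> where \<epsilon>: "\<epsilon> > 0" and rig: "\<And>s s' h k. s \<in> S \<Longrightarrow> s' \<in> S \<Longrightarrow> dist s s0 < \<epsilon> \<Longrightarrow> dist h (mat 1) < \<epsilon> \<Longrightarrow> det h \<noteq> 0 \<Longrightarrow> k \<noteq> 0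
     \<Longrightarrow> k = 1 \<or> det h = 1 \<Longrightarrow> (\<And>x. weier (ca s) (cb s) (h *v x) = k * weier (ca s') (cb s') x) \<Longrightarrow> h = mat 1 \<and> s = s'"
    using rigid[OF s0] by blast
  define P where "P = {x :: (complex^3^3) \<times> (complex^3^3). det (fst x) \<noteq> 0} \<inter> {x. det (snd x) \<noteq> 0}"
  have oP: "open P" unfolding P_def by (intro open_Int open_Collect_neq continuous_on_det3 continuous_intros)
  have "continuous_on P (\<lambda>x. fst x ** minv3 (snd x))"
    by (intro continuous_on_matrix_mult continuous_on_minv3 continuous_intros) (auto simp: P_def)
  then have "open (P \<inter> (\<lambda>x. fst x ** minv3 (snd x)) -` ball (mat 1) \<epsilon>)"
    by (rule continuous_open_preimage[OF _ oP open_ball])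
  moreover have "(g0, g0) \<in> P \<inter> (\<lambda>x. fst x ** minv3 (snd x)) -` ball (mat 1) \<epsilon>"
    using g0 \<epsilon> by (simp add: P_def minv3)
  ultimately obtain A B where "open A" "open B" "(g0, g0) \<in> A \<times> B"
    "A \<times> B \<subseteq> P \<inter> (\<lambda>x. fst x ** minv3 (snd x)) -` ball (mat 1) \<epsilon>"
    by (rule open_prod_elim)
  then have AB: "open A" "open B" "g0 \<in> A" "g0 \<in> B" "A \<times> B \<subseteq> P \<inter> (\<lambda>x. fst x ** minv3 (snd x)) -` ball (mat 1) \<epsilon>"
    by simp_all
  show ?thesis
  proof (intro exI[of _ "(A \<inter> B) \<times> (ball s0 \<epsilon> \<inter> S)"] conjI allI impI)
    show "open ((A \<inter> B) \<times> (ball s0 \<epsilon> \<inter> S))" using AB open_S by (intro open_Times open_Int) auto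
    show "(g0, s0) \<in> (A \<inter> B) \<times> (ball s0 \<epsilon> \<inter> S)" using AB s0 \<epsilon> by simp
    have AB0: "det g \<noteq> 0" "det g' \<noteq> 0" "dist (g ** minv3 g') (mat 1) < \<epsilon>" if "g \<in> A" "g' \<in> B" for g g'
    proof -
      have "(g, g') \<in> P \<inter> (\<lambda>x. fst x ** minv3 (snd x)) -` ball (mat 1) \<epsilon>" using AB(5) that by blast
      then show "det g \<noteq> 0" "det g' \<noteq> 0" "dist (g ** minv3 g') (mat 1) < \<epsilon>" by (auto simp: P_def dist_commute)
    qed
    show "(A \<inter> B) \<times> (ball s0 \<epsilon> \<inter> S) \<subseteq> {g. det g \<noteq> 0} \<times> S" using AB0(1) by auto
    fix g s g' s' k
    assume gs: "(g, s) \<in> (A \<inter> B) \<times> (ball s0 \<epsilon> \<inter> S)" "(g', s') \<in> (A \<inter> B) \<times> (ball s0 \<epsilon> \<inter> S)"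
      and k: "k \<noteq> 0" "k = 1 \<or> det g = det g'" and eq: "slice_cubic (g, s) = (\<lambda>m. k * slice_cubic (g', s') m)"
    have d: "det g \<noteq> 0" "det g' \<noteq> 0" and ds: "dist (g ** minv3 g') (mat 1) < \<epsilon>" using AB0[of g g'] gs by auto
    have "det (g ** minv3 g') = det g / det g'" using d by (simp add: det_mul det_minv3)
    then have dh: "det (g ** minv3 g') \<noteq> 0" "k = 1 \<or> det (g ** minv3 g') = 1" using k(2) d by auto
    have "weier (ca s) (cb s) ((g ** minv3 g') *v x) = k * weier (ca s') (cb s') x" for x
    proof -
      have "weier (ca s) (cb s) (g *v (minv3 g' *v x)) = k * weier (ca s') (cb s') (g' *v (minv3 g' *v x))"
        using eq unfolding slice_cubic_eq_iff by blast
      then show ?thesis by (simp add: matrix_vector_mul_assoc minv3[OF d(2)])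
    qed
    then have "g ** minv3 g' = mat 1 \<and> s = s'"
      using rig[of s s' "g ** minv3 g'" k] gs ds dh k(1) by (auto simp: dist_commute)
    moreover have "g = (g ** minv3 g') ** g'" by (simp add: matrix_mul_assoc[symmetric] minv3[OF d(2)])
    ultimately show "g = g'" "s = s'" by simp_all
  qed
qed

text \<open>Source and target both have complex dimension ten, nine for the matrices and one for the
  slice. So invariance of domain turns local injectivity into openness.\<close>

theorem open_map_slice_cubic:
  assumes W: "open W" "W \<subseteq> {g. det g \<noteq> 0} \<times> S"
  shows "openin U32 (slice_cubic ` W)"
proof -
  \<comment> \<open>The ten coefficients are arranged as a matrix and a number, so that the
    composite maps between subsets of one Euclidean space.\<close>
  define \<Lambda> :: "(nat \<times> nat \<times> nat \<Rightarrow> complex) \<Rightarrow> (complex^3^3) \<times> complex" where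
    "\<Lambda> f = (vector [vec3 (f (3,0,0)) (f (0,3,0)) (f (0,0,3)), vec3 (f (2,1,0)) (f (2,0,1)) (f (1,2,0)), vec3 (f (0,2,1)) (f (1,0,2)) (f (0,1,2))], f (1,1,1))" for f
  have coord: "continuous_on A (\<lambda>f :: nat \<times> nat \<times> nat \<Rightarrow> complex. f m)" for m A
    by (rule continuous_on_subset[OF continuous_on_product_coordinates]) simp
  have cL: "continuous_on A \<Lambda>" for A
    unfolding \<Lambda>_def by (intro continuous_intros continuous_on_vec3 coord)
  have iL: "f = f'" if "\<Lambda> f = \<Lambda> f'" "f \<in> Pi32" "f' \<in> Pi32" for f f'
  proof
    fix m
    have "fst (\<Lambda> f) $ i $ j = fst (\<Lambda> f') $ i $ j" for i j using that by simp
    note e = this[of 1 1] this[of 1 2] this[of 1 3] this[of 2 1] this[of 2 2] this[of 2 3] this[of 3 1] this[of 3 2] this[of 3 3]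
    have "snd (\<Lambda> f) = snd (\<Lambda> f')" using that by simp
    with e have "f (3,0,0) = f' (3,0,0)" "f (0,3,0) = f' (0,3,0)" "f (0,0,3) = f' (0,0,3)" "f (2,1,0) = f' (2,1,0)"
      "f (2,0,1) = f' (2,0,1)" "f (1,2,0) = f' (1,2,0)" "f (0,2,1) = f' (0,2,1)" "f (1,0,2) = f' (1,0,2)"
      "f (0,1,2) = f' (0,1,2)" "f (1,1,1) = f' (1,1,1)"
      unfolding \<Lambda>_def fst_conv snd_conv vector_3 by blast+
    then have "\<forall>m\<in>cubic_monomials. f m = f' m" unfolding cubic_monomials_explicit ball_simps by blast
    then show "f m = f' m" using that(2,3) unfolding Pi32_def mem_Collect_eq by metis
  qed
  have "openin U32 (slice_cubic ` W')" if W': "open W'" "W' \<subseteq> W" "inj_on slice_cubic W'" for W'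
  proof -
    have sm: "slice_cubic y \<in> Pi32 - Sigma32" if "y \<in> W'" for y
    proof -
      have "y \<in> {g. det g \<noteq> 0} \<times> S" using that W'(2) W(2) by blast
      then show ?thesis using slice_cubic_smooth by (cases y) simp
    qed
    have "open ((\<lambda>y. \<Lambda> (slice_cubic y)) ` W')"
    proof (rule invariance_of_domain[OF _ W'(1)])
      have "continuous_on W' slice_cubic"
        by (rule continuous_on_subset[OF continuous_on_slice_cubic]) (use W W' in auto)
      then show "continuous_on W' (\<lambda>y. \<Lambda> (slice_cubic y))" using continuous_on_compose2[OF cL[of UNIV]] by blast
      show "inj_on (\<lambda>y. \<Lambda> (slice_cubic y)) W'"
        using W'(3) iL sm unfolding inj_on_def by blast
    qed
    then have "open (\<Lambda> -` ((\<lambda>y. \<Lambda> (slice_cubic y)) ` W'))" by (rule open_vimage) (rule cL)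
    moreover have "slice_cubic ` W' = (Pi32 - Sigma32) \<inter> \<Lambda> -` ((\<lambda>y. \<Lambda> (slice_cubic y)) ` W')"
      using sm iL by blast
    ultimately show ?thesis unfolding U32_def by (simp add: openin_open_Int)
  qed
  note loc = this
  have "\<exists>W'. open W' \<and> W' \<subseteq> W \<and> y \<in> W' \<and> inj_on slice_cubic W'" if y: "y \<in> W" for y
  proof -
    obtain g0 s0 where y0: "y = (g0, s0)" by (cases y)
    have g0: "det g0 \<noteq> 0" "s0 \<in> S" using y W(2) y0 by auto
    obtain V where V: "open V" "(g0, s0) \<in> V" and V1: "\<forall>g s g' s' k. (g, s) \<in> V \<longrightarrow> (g', s') \<in> V \<longrightarrow> k \<noteq> 0 \<longrightarrow> k = 1 \<or> det g = det g' \<longrightarrow>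
       slice_cubic (g, s) = (\<lambda>m. k * slice_cubic (g', s') m) \<longrightarrow> g = g' \<and> s = s'"
      using locally_rigid[OF g0] by blast
    have "inj_on slice_cubic (V \<inter> W)"
    proof (rule inj_onI)
      fix z z' assume z: "z \<in> V \<inter> W" "z' \<in> V \<inter> W" "slice_cubic z = slice_cubic z'"
      obtain g s g' s' where zz: "z = (g, s)" "z' = (g', s')" by (cases z, cases z') auto
      have "g = g' \<and> s = s'" by (rule V1[rule_format, where k = 1]) (use z zz in auto)
      then show "z = z'" using zz by simp
    qed
    then show ?thesis using V(1,2) W(1) y y0 by (intro exI[of _ "V \<inter> W"]) auto
  qed
  then obtain N where N: "\<And>y. y \<in> W \<Longrightarrow> open (N y) \<and> N y \<subseteq> W \<and> y \<in> N y \<and> inj_on slice_cubic (N y)" by metis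
  have "slice_cubic ` W = (\<Union>y\<in>W. slice_cubic ` N y)" using N by blast
  moreover have "openin U32 (\<Union>y\<in>W. slice_cubic ` N y)" using N loc by (intro openin_clauses(3)) blast
  ultimately show ?thesis by simp
qed

end

section \<open>The finite covers defined by slices\<close>

text \<open>The instances are \<open>U32\<close> with \<open>K = {1}\<close>, \<open>D = - {0}\<close> (the group \<open>GL\<^sub>3\<close>) and \<open>N32\<close> with
  \<open>K = - {0}\<close>, \<open>D = {1}\<close> (the group \<open>SL\<^sub>3\<close>).\<close>

locale cubic_quotient =
  fixes X :: "'x topology" and \<pi> :: "(nat \<times> nat \<times> nat \<Rightarrow> complex) \<Rightarrow> 'x" and K D :: "complex set"
  assumes mode: "K = {1} \<and> D = - {0} \<or> K = - {0} \<and> D = {1}"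
    and continuous_quot: "continuous_map U32 X \<pi>"
    and open_quot: "\<And>V. openin U32 V \<Longrightarrow> openin X (\<pi> ` V)"
    and quot_onto: "\<pi> ` (Pi32 - Sigma32) = topspace X"
    and quot_eq_iff: "\<And>f f'. f \<in> Pi32 - Sigma32 \<Longrightarrow> f' \<in> Pi32 - Sigma32 \<Longrightarrow> \<pi> f = \<pi> f' \<longleftrightarrow> (\<exists>k\<in>K. f = (\<lambda>m. k * f' m))"
begin

abbreviation "linear_group \<equiv> {g :: complex^3^3. det g \<in> D}"

lemma K_nonzero: "k \<in> K \<Longrightarrow> k \<noteq> 0" and D_nonzero: "d \<in> D \<Longrightarrow> d \<noteq> 0"
  and one_K: "1 \<in> K" and one_D: "1 \<in> D"
  and K_mult: "k \<in> K \<Longrightarrow> k' \<in> K \<Longrightarrow> k * k' \<in> K" and D_mult: "d \<in> D \<Longrightarrow> d' \<in> D \<Longrightarrow> d * d' \<in> D"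
  and K_divide: "k \<in> K \<Longrightarrow> k' \<in> K \<Longrightarrow> k / k' \<in> K" and D_divide: "d \<in> D \<Longrightarrow> d' \<in> D \<Longrightarrow> d / d' \<in> D"
  and KD: "k \<in> K \<Longrightarrow> k \<in> D \<Longrightarrow> k = 1"
  using mode by auto

text \<open>A flex swap has determinant -1; multiplied by the scalar \<sigma>, which is its own
  cube, it gets the determinant \<open>- \<sigma>\<close>. This is admissible with \<sigma> equal to
  1 for \<open>GL\<^sub>3\<close> and -1 for \<open>SL\<^sub>3\<close>.\<close>

lemma obtain_sign:
  obtains \<sigma> :: complex where "\<sigma> * \<sigma> = 1" "\<sigma> \<in> K" "- \<sigma> \<in> D"
  using mode that[of 1] that[of "-1"] by auto

text \<open>For \<open>GL\<^sub>3\<close> a constant scalar works. For \<open>SL\<^sub>3\<close> the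
  scalar must be a cube root of the determinant, and the logarithm gives the continuous branch
  through \<open>\<mu>0\<close>.\<close>

lemma scalar_section:
  assumes "\<mu>0^3 \<in> K" "d0 / \<mu>0^3 \<in> D"
  obtains N \<mu> where "open N" "d0 \<in> N" "continuous_on N \<mu>" "\<mu> d0 = \<mu>0" "\<And>d. d \<in> N \<Longrightarrow> \<mu> d \<noteq> 0 \<and> \<mu> d ^ 3 \<in> K \<and> d / \<mu> d ^ 3 \<in> D"
proof -
  have \<mu>0: "\<mu>0 \<noteq> 0" using K_nonzero[OF assms(1)] by auto
  have d0: "d0 \<noteq> 0" using D_nonzero[OF assms(2)] by auto
  from mode show ?thesis
  proof
    assume m: "K = {1} \<and> D = - {0}"
    show ?thesis
      by (rule that[of "- {0}" "\<lambda>_. \<mu>0"]) (use m assms \<mu>0 d0 in auto)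
  next
    assume m: "K = - {0} \<and> D = {1}"
    define N where "N = {d. d / d0 \<in> - \<real>\<^sub>\<le>\<^sub>0}"
    define \<mu> where "\<mu> d = \<mu>0 * exp (Ln (d / d0) / 3)" for d
    show ?thesis
    proof (rule that[of N \<mu>])
      have "open ((\<lambda>d. d / d0) -` (- \<real>\<^sub>\<le>\<^sub>0))"
        by (rule open_vimage) (use d0 in \<open>auto intro!: continuous_intros\<close>)
      then show "open N" by (simp add: N_def vimage_def)
      show "d0 \<in> N" using d0 by (simp add: N_def complex_nonpos_Reals_iff)
      show "continuous_on N \<mu>" unfolding \<mu>_def N_def using d0 by (auto intro!: continuous_intros)
      show "\<mu> d0 = \<mu>0" using d0 by (simp add: \<mu>_def)
      fix d assume d: "d \<in> N"
      have dd: "d / d0 \<noteq> 0" using d by (auto simp: N_def)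
      have "exp (Ln (d / d0) / 3) ^ 3 = exp (3 * (Ln (d / d0) / 3))" by (metis exp_of_nat_mult of_nat_numeral)
      then have "\<mu> d ^ 3 = \<mu>0^3 * (d / d0)" using dd by (simp add: \<mu>_def power_mult_distrib)
      moreover have "\<mu>0^3 = d0" using assms(2) m \<mu>0 by simp
      ultimately have "\<mu> d ^ 3 = d" using d0 by simp
      then show "\<mu> d \<noteq> 0 \<and> \<mu> d ^ 3 \<in> K \<and> d / \<mu> d ^ 3 \<in> D" using m dd by auto
    qed
  qed
qed

lemma scalar_exists:
  assumes "d \<noteq> 0" obtains \<mu> where "\<mu> \<noteq> 0" "\<mu>^3 \<in> K" "d / \<mu>^3 \<in> D"
proof -
  obtain r where r: "r^3 = d" using cube_root_exists by blast
  then show ?thesis using mode that[of 1] that[of r] assms by auto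
qed

end

locale cubic_cover = cubic_quotient X \<pi> K D + weier_slice S ca cb E s1
  for X :: "'x topology" and \<pi> K D S ca cb E s1
begin

abbreviation "cover_space \<equiv> linear_group \<times> S"
abbreviation "slice_proj y \<equiv> \<pi> (slice_cubic y)"

lemma total_nonzero: "(g, s) \<in> cover_space \<Longrightarrow> det g \<noteq> 0 \<and> s \<in> S"
  using D_nonzero by auto

lemma slice_cubic_total: "y \<in> cover_space \<Longrightarrow> slice_cubic y \<in> Pi32 - Sigma32"
  using slice_cubic_smooth total_nonzero by (cases y) blast

lemma proj_eq_iff:
  assumes "(g, s) \<in> {g. det g \<noteq> 0} \<times> S" "(g', s') \<in> {g. det g \<noteq> 0} \<times> S"
  shows "slice_proj (g, s) = slice_proj (g', s') \<longleftrightarrow> (\<exists>k\<in>K. \<forall>x. weier (ca s) (cb s) (g *v x) = k * weier (ca s') (cb s') (g' *v x))"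
  unfolding slice_cubic_eq_iff[symmetric] using assms by (intro quot_eq_iff slice_cubic_smooth) auto

lemma continuous_on_slice_total: "continuous_map (top_of_set cover_space) U32 slice_cubic"
  unfolding U32_def continuous_map_in_subtopology
proof
  show "continuous_map (top_of_set cover_space) euclidean slice_cubic"
    unfolding continuous_map_iff_continuous by (rule continuous_on_subset[OF continuous_on_slice_cubic]) auto
  show "slice_cubic \<in> topspace (top_of_set cover_space) \<rightarrow> Pi32 - Sigma32" using slice_cubic_total by auto
qed

lemma continuous_proj: "continuous_map (top_of_set cover_space) X (\<lambda>y. slice_proj y)"
  using continuous_map_compose[OF continuous_on_slice_total continuous_quot] by (simp add: o_def)

text \<open>The saturation of an open subset of the total space under the scalars is open in
  \<open>GL\<^sub>3 \<times> S\<close>, where \<open>slice_cubic\<close> is open by invariance of domain.\<close>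

lemma open_proj:
  assumes W: "openin (top_of_set cover_space) W"
  shows "openin X ((\<lambda>y. slice_proj y) ` W)"
proof -
  obtain O' where O': "open O'" "W = cover_space \<inter> O'" using W by (auto simp: openin_open)
  define W1 where "W1 = {(h, s) | h s. \<exists>\<mu>. \<mu> \<noteq> 0 \<and> \<mu>^3 \<in> K \<and> (mat (1 / \<mu>) ** h, s) \<in> W}"
  have W1: "W1 \<subseteq> {g. det g \<noteq> 0} \<times> S"
  proof -
    have "det h \<noteq> 0 \<and> s \<in> S" if "(mat (1 / \<mu>) ** h, s) \<in> W" for h s \<mu>
      using total_nonzero[of "mat (1 / \<mu>) ** h" s] that O'(2) by (auto simp: det_mul)
    then show ?thesis by (auto simp: W1_def)
  qed
  have "open W1"
  proof (rule openI)
    fix y assume "y \<in> W1"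
    then obtain h0 s0 \<mu>0 where y: "y = (h0, s0)" and \<mu>0: "\<mu>0 \<noteq> 0" "\<mu>0^3 \<in> K" "(mat (1 / \<mu>0) ** h0, s0) \<in> W"
      by (auto simp: W1_def)
    have "det (mat (1 / \<mu>0) ** h0) \<in> D" and s0: "s0 \<in> S" using \<mu>0(3) O'(2) by auto
    then have "det h0 / \<mu>0^3 \<in> D" by (simp add: det_mul det_mat3 power_divide)
    from scalar_section[OF \<mu>0(2) this] obtain N \<mu> where N: "open N" "det h0 \<in> N" "continuous_on N \<mu>" "\<mu> (det h0) = \<mu>0"
      "\<And>d. d \<in> N \<Longrightarrow> \<mu> d \<noteq> 0 \<and> \<mu> d ^ 3 \<in> K \<and> d / \<mu> d ^ 3 \<in> D" by blast
    \<comment> \<open>A neighbourhood in which the continuous choice of scalar brings each matrix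
      back into the linear group; its part mapped into \<open>O'\<close> lies in
      \<open>W1\<close>.\<close>
    define V0 where "V0 = (\<lambda>y :: (complex^3^3) \<times> complex. det (fst y)) -` N \<inter> UNIV \<times> S"
    have oV0: "open V0" unfolding V0_def
      by (intro open_Int open_vimage N(1) open_Times open_S open_UNIV continuous_on_det3 continuous_intros)
    have c: "continuous_on V0 (\<lambda>y. (mat (1 / \<mu> (det (fst y))) ** fst y, snd y))"
      by (intro continuous_intros continuous_on_matrix_mult continuous_on_mat continuous_on_compose2[OF N(3)] continuous_on_det3)
         (use N(5) in \<open>auto simp: V0_def\<close>)
    have "open (V0 \<inter> (\<lambda>y. (mat (1 / \<mu> (det (fst y))) ** fst y, snd y)) -` O')"
      by (rule continuous_open_preimage[OF c oV0 O'(1)])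
    moreover have "y \<in> V0 \<inter> (\<lambda>y. (mat (1 / \<mu> (det (fst y))) ** fst y, snd y)) -` O'"
      using N(2,4) s0 \<mu>0(3) O'(2) by (simp add: y V0_def)
    moreover have "V0 \<inter> (\<lambda>y. (mat (1 / \<mu> (det (fst y))) ** fst y, snd y)) -` O' \<subseteq> W1"
    proof
      fix z assume z: "z \<in> V0 \<inter> (\<lambda>y. (mat (1 / \<mu> (det (fst y))) ** fst y, snd y)) -` O'"
      obtain h s where hs: "z = (h, s)" by (cases z)
      have dN: "det h \<in> N" "s \<in> S" "(mat (1 / \<mu> (det h)) ** h, s) \<in> O'" using z by (auto simp: hs V0_def)
      have "det (mat (1 / \<mu> (det h)) ** h) \<in> D" using N(5)[OF dN(1)] by (simp add: det_mul det_mat3 power_divide)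
      then have "(mat (1 / \<mu> (det h)) ** h, s) \<in> W" using dN O'(2) by simp
      then show "z \<in> W1" using N(5)[OF dN(1)] unfolding W1_def hs by blast
    qed
    ultimately show "\<exists>e>0. ball y e \<subseteq> W1" by (meson open_contains_ball_eq subset_trans)
  qed
  from open_quot[OF open_map_slice_cubic[OF this W1]]
  have "openin X (\<pi> ` slice_cubic ` W1)" .
  moreover have "\<pi> ` slice_cubic ` W1 = (\<lambda>y. slice_proj y) ` W"
  proof
    show "\<pi> ` slice_cubic ` W1 \<subseteq> (\<lambda>y. slice_proj y) ` W"
    proof -
      have "slice_proj (h, s) = slice_proj (mat (1 / \<mu>) ** h, s)" if m: "\<mu> \<noteq> 0" "\<mu>^3 \<in> K" "(mat (1 / \<mu>) ** h, s) \<in> W" for h s \<mu>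
      proof -
        have "(h, s) \<in> W1" using m by (auto simp: W1_def)
        moreover have "det (mat (1 / \<mu>) ** h) \<noteq> 0" using total_nonzero m(3) O'(2) by blast
        moreover have "weier (ca s) (cb s) (h *v x) = \<mu>^3 * weier (ca s) (cb s) ((mat (1 / \<mu>) ** h) *v x)" for x
          unfolding matrix_vector_mul_assoc[symmetric] weier_scale using m(1) by (simp add: power_divide)
        ultimately show ?thesis using W1 m(2) by (subst proj_eq_iff) auto
      qed
      then show ?thesis unfolding W1_def by blast
    qed
    have "y \<in> W1" if "y \<in> W" for y
      using that one_K unfolding W1_def by (cases y) (auto intro!: exI[of _ 1])
    then show "(\<lambda>y. slice_proj y) ` W \<subseteq> \<pi> ` slice_cubic ` W1" by blast
  qed
  ultimately show ?thesis by simp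
qed

lemma locally_injective_proj:
  assumes y: "y \<in> cover_space"
  shows "\<exists>W. openin (top_of_set cover_space) W \<and> y \<in> W \<and> inj_on (\<lambda>y. slice_proj y) W"
proof -
  obtain g0 s0 where y0: "y = (g0, s0)" by (cases y)
  have g0: "det g0 \<noteq> 0" "s0 \<in> S" using y total_nonzero y0 by auto
  obtain V where V: "open V" "(g0, s0) \<in> V" and V1: "\<forall>g s g' s' k. (g, s) \<in> V \<longrightarrow> (g', s') \<in> V \<longrightarrow> k \<noteq> 0 \<longrightarrow> k = 1 \<or> det g = det g' \<longrightarrow>
       slice_cubic (g, s) = (\<lambda>m. k * slice_cubic (g', s') m) \<longrightarrow> g = g' \<and> s = s'"
    using locally_rigid[OF g0] by blast
  have "inj_on (\<lambda>y. slice_proj y) (cover_space \<inter> V)"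
  proof (rule inj_onI)
    fix z z' assume z: "z \<in> cover_space \<inter> V" "z' \<in> cover_space \<inter> V" "slice_proj z = slice_proj z'"
    obtain g s g' s' where zz: "z = (g, s)" "z' = (g', s')" by (cases z, cases z') auto
    obtain k where k: "k \<in> K" "slice_cubic z = (\<lambda>m. k * slice_cubic z' m)"
      using quot_eq_iff slice_cubic_total z by blast
    have "k = 1 \<or> det g = det g'" using mode k(1) z(1,2) by (auto simp: zz)
    then have "g = g' \<and> s = s'" using V1[rule_format, of g s g' s' k] K_nonzero k z(1,2) by (auto simp: zz)
    then show "z = z'" by (simp add: zz)
  qed
  then show ?thesis using V y y0 by (intro exI[of _ "cover_space \<inter> V"]) (auto simp: openin_open_Int)
qed

section \<open>Counting the sheets\<close>

text \<open>The members of \<open>stabiliser s\<close> that fix the flex at infinity. They are the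
  same for all \<open>s\<close>, because \<open>E\<close> is.\<close>

definition twists :: "(complex^3^3) set" where
  "twists = {mat t ** diag_matrix \<alpha> \<beta> | t \<alpha> \<beta>. (\<alpha>, \<beta>) \<in> E \<and> t^3 \<in> K \<and> t^3 * (\<alpha> / \<beta>) \<in> D}"

lemma one_E: "(1, 1) \<in> E"
  using E_iff[OF s1, of 1 1] s1 by auto

lemma finite_twists: "finite twists"
proof -
  have "finite {t. t^3 \<in> K \<and> t^3 * (\<alpha> / \<beta>) \<in> D}" for \<alpha> \<beta>
  proof (cases "\<exists>t0. t0^3 \<in> K \<and> t0^3 * (\<alpha> / \<beta>) \<in> D")
    case True
    then obtain t0 where t0: "t0^3 \<in> K" "t0^3 * (\<alpha> / \<beta>) \<in> D" by blast
    have "{t. t^3 \<in> K \<and> t^3 * (\<alpha> / \<beta>) \<in> D} \<subseteq> {t. t^3 = t0^3}"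
    proof safe
      fix t assume t: "t^3 \<in> K" "t^3 * (\<alpha> / \<beta>) \<in> D"
      have nz: "\<alpha> / \<beta> \<noteq> 0" "t0^3 \<noteq> 0" using t0 D_nonzero K_nonzero by fastforce+
      \<comment> \<open>The cubes of two admissible scalars have a quotient in both \<open>K\<close>
        and \<open>D\<close>, hence 1.\<close>
      have "t^3 / t0^3 \<in> K" using K_divide t t0 by blast
      moreover have "t^3 / t0^3 \<in> D" using D_divide[OF t(2) t0(2)] nz by simp
      ultimately have "t^3 / t0^3 = 1" using KD by blast
      then show "t^3 = t0^3" using nz by simp
    qed
    then show ?thesis using finite_nth_roots[of 3 "t0^3"] finite_subset by auto
  next
    case False
    then have "{t. t^3 \<in> K \<and> t^3 * (\<alpha> / \<beta>) \<in> D} = {}" by blast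
    then show ?thesis by (simp only: finite.emptyI)
  qed
  then have "finite (SIGMA x:E. {t. t^3 \<in> K \<and> t^3 * (fst x / snd x) \<in> D})" using finite_E by auto
  moreover have "twists = (\<lambda>((\<alpha>, \<beta>), t). mat t ** diag_matrix \<alpha> \<beta>) ` (SIGMA x:E. {t. t^3 \<in> K \<and> t^3 * (fst x / snd x) \<in> D})"
    by (force simp: twists_def image_iff)
  ultimately show ?thesis by simp
qed

lemma card_twists: "card twists > 0"
proof -
  have "mat 1 ** diag_matrix 1 1 \<in> twists"
    unfolding twists_def using one_E one_K one_D by (intro CollectI exI[of _ 1]) auto
  then show ?thesis using finite_twists card_gt_0_iff by blast
qed

text \<open>Its members may move along the slice, from \<open>s\<close> to \<open>s'\<close>. The
  set parametrises the fibre of the projection, and includes the true stabiliser as the case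
  \<open>s' = s\<close>.\<close>

definition stabiliser :: "complex \<Rightarrow> (complex^3^3) set" where
  "stabiliser s = {h. det h \<in> D \<and> (\<exists>s'\<in>S. \<exists>k\<in>K. \<forall>x. weier (ca s) (cb s) (h *v x) = k * weier (ca s') (cb s') x)}"

text \<open>Each member is uniquely a flex swap, with its determinant corrected by a scalar, times a
  twist. So the count is the same for every slice parameter, whatever automorphisms the curve
  has.\<close>

lemma card_stabiliser:
  assumes s: "s \<in> S"
  shows "finite (stabiliser s)" "card (stabiliser s) = 9 * card twists"
proof -
  obtain \<sigma> where \<sigma>: "\<sigma> * \<sigma> = 1" "\<sigma> \<in> K" "- \<sigma> \<in> D" by (rule obtain_sign)
  have \<sigma>0: "\<sigma> \<noteq> 0" using K_nonzero \<sigma>(2) by blast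
  have \<sigma>3: "\<sigma>^3 = \<sigma>" using \<sigma>(1) by (simp add: power3_eq_cube)
  let ?sw = "swap_matrix (ca s) (cb s)" and ?F = "flexes (ca s) (cb s)"
  \<comment> \<open>The sign that corrects the determinant of a proper swap; the flex at infinity
    needs none.\<close>
  define c where "c q = (if q = None then 1 else \<sigma>)" for q :: "(complex \<times> complex) option"
  define f where "f = (\<lambda>(q, m :: complex^3^3). mat (c q) ** ?sw q ** m)"
  have cc: "c q * c q = 1" "c q \<in> K" "c q \<noteq> 0" "c q ^ 3 = c q" for q using \<sigma> \<sigma>0 \<sigma>3 one_K by (auto simp: c_def)
  have cdet: "c q * det (?sw q) \<in> D" if "q \<in> ?F" for q
    using \<sigma> one_D det_swap_matrix[OF disc[OF s] that] by (auto simp: c_def)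
  note flex = weier_swap_matrix[OF disc[OF s]]
  have inj: "inj_on f (?F \<times> twists)"
  proof (rule inj_onI, clarify)
    fix q m q' m' assume q: "q \<in> ?F" "q' \<in> ?F" and m: "m \<in> twists" "m' \<in> twists" and eq: "f (q, m) = f (q', m')"
    obtain t \<alpha> \<beta> where m1: "m = mat t ** diag_matrix \<alpha> \<beta>" "(\<alpha>, \<beta>) \<in> E" "t^3 \<in> K" using m(1) by (auto simp: twists_def)
    obtain t' \<alpha>' \<beta>' where m2: "m' = mat t' ** diag_matrix \<alpha>' \<beta>'" "(\<alpha>', \<beta>') \<in> E" "t'^3 \<in> K" using m(2) by (auto simp: twists_def)
    have nz: "t \<noteq> 0" "t' \<noteq> 0" "\<beta> \<noteq> 0" "\<beta>' \<noteq> 0" using m1 m2 K_nonzero E_sub by fastforce+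
    \<comment> \<open>The second column is a multiple of the flex named by \<open>q\<close>, so it
      determines \<open>q\<close>.\<close>
    have col: "f (q, mat t ** diag_matrix \<alpha> \<beta>) *v vec3 0 1 0 = (c q * t) *s (case q of None \<Rightarrow> vec3 0 \<beta> 0 | Some (x, y) \<Rightarrow> (\<beta> / (2 * y)) *s vec3 x y 1)"
      if q: "q \<in> ?F" for q t \<alpha> \<beta>
    proof -
      have "f (q, mat t ** diag_matrix \<alpha> \<beta>) = mat (c q) ** (?sw q ** mat t) ** diag_matrix \<alpha> \<beta>"
        by (simp add: f_def matrix_mul_assoc)
      also have "\<dots> = mat (c q * t) ** (?sw q ** diag_matrix \<alpha> \<beta>)"
        unfolding mat_mult_commute[symmetric] by (simp add: matrix_mul_assoc mat_mult_mat)
      finally have "f (q, mat t ** diag_matrix \<alpha> \<beta>) = mat (c q * t) ** (?sw q ** diag_matrix \<alpha> \<beta>)" .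
      then have "f (q, mat t ** diag_matrix \<alpha> \<beta>) *v vec3 0 1 0 = (c q * t) *s ((?sw q ** diag_matrix \<alpha> \<beta>) *v vec3 0 1 0)"
        by (simp only: mat_mult_vec matrix_vector_mul_assoc[symmetric])
      then show ?thesis unfolding swap_diag_column[OF disc[OF s] q] .
    qed
    have y0: "snd p \<noteq> 0" if "Some p \<in> ?F" for p
      using affine_flex_slope(1)[OF disc[OF s]] that by (cases p) (auto simp: flexes_def)
    have e: "(c q * t) *s (case q of None \<Rightarrow> vec3 0 \<beta> 0 | Some (x, y) \<Rightarrow> (\<beta> / (2 * y)) *s vec3 x y 1)
       = (c q' * t') *s (case q' of None \<Rightarrow> vec3 0 \<beta>' 0 | Some (x, y) \<Rightarrow> (\<beta>' / (2 * y)) *s vec3 x y 1)"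
      using eq col[OF q(1), of t \<alpha> \<beta>] col[OF q(2), of t' \<alpha>' \<beta>'] unfolding m1(1) m2(1) by simp
    have qq: "q = q'"
    proof (cases q)
      case None
      show ?thesis
      proof (cases q')
        case (Some p)
        then show ?thesis using arg_cong[OF e, of "\<lambda>v. v$3"] None y0[of p] q(2) nz cc(3) by (cases p) auto
      qed (simp add: None)
    next
      case (Some p)
      show ?thesis
      proof (cases q')
        case None
        then show ?thesis using arg_cong[OF e, of "\<lambda>v. v$3"] Some y0[of p] q(1) nz cc(3) by (cases p) auto
      next
        case S': (Some p')
        obtain x y x' y' where p: "p = (x, y)" "p' = (x', y')" by (cases p, cases p') auto
        have y: "y \<noteq> 0" "y' \<noteq> 0" using y0[of p] y0[of p'] q by (simp_all add: Some S' p)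
        define u u' where "u = c q * t * (\<beta> / (2 * y))" and "u' = c q' * t' * (\<beta>' / (2 * y'))"
        have "u *s vec3 x y 1 = u' *s vec3 x' y' 1" using e by (simp add: Some S' p u_def u'_def)
        then have "(u *s vec3 x y 1) $ i = (u' *s vec3 x' y' 1) $ i" for i by simp
        from this[of 1] this[of 2] this[of 3] have "u * x = u' * x'" "u * y = u' * y'" "u = u'" by simp_all
        moreover have "u \<noteq> 0" using nz cc(3) y by (simp add: u_def)
        ultimately show ?thesis by (simp add: Some S' p)
      qed
    qed
    \<comment> \<open>The left factor cancels because the swap and the scalar \<open>c q\<close>
      both square to 1.\<close>
    have inv: "(mat (c q) ** ?sw q) ** f (q, m) = m" for m
    proof -
      have "(mat (c q) ** ?sw q) ** f (q, m) = mat (c q) ** (?sw q ** mat (c q)) ** ?sw q ** m"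
        by (simp add: f_def matrix_mul_assoc)
      also have "\<dots> = mat (c q * c q) ** (?sw q ** ?sw q) ** m"
        unfolding mat_mult_commute[symmetric] by (simp add: matrix_mul_assoc mat_mult_mat)
      also have "\<dots> = m" unfolding cc(1) flex(2)[OF q(1)] by simp
      finally show ?thesis .
    qed
    have "m = (mat (c q) ** ?sw q) ** f (q, m)" by (rule inv[symmetric])
    also have "\<dots> = (mat (c q) ** ?sw q) ** f (q, m')" using eq by (simp only: qq)
    also have "\<dots> = m'" by (rule inv)
    finally show "q = q' \<and> m = m'" using qq by blast
  qed
  have im: "stabiliser s = f ` (?F \<times> twists)"
  proof
    show "stabiliser s \<subseteq> f ` (?F \<times> twists)"
    proof
      fix h assume "h \<in> stabiliser s"
      then obtain s' k where h: "det h \<in> D" "s' \<in> S" "k \<in> K" "\<And>x. weier (ca s) (cb s) (h *v x) = k * weier (ca s') (cb s') x"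
        unfolding stabiliser_def by blast
      obtain q \<alpha> \<beta> t where d: "q \<in> ?F" "(\<alpha>, \<beta>) \<in> E" "t^3 = k" "h = mat t ** (?sw q ** diag_matrix \<alpha> \<beta>)"
          "ca s' = ca s * \<alpha> / \<beta>^4" "cb s' = cb s / \<beta>^6"
        by (rule equivalence_decomposition[OF s h(2) D_nonzero[OF h(1)] K_nonzero[OF h(3)] h(4)])
      have \<beta>: "\<beta> \<noteq> 0" using E_sub d(2) by blast
      have dh: "det h = t^3 * (det (?sw q) * (\<alpha> / \<beta>))" unfolding d(4) det_mul det_mat3 det_diag_matrix[OF \<beta>] by simp
      define m where "m = mat (c q * t) ** diag_matrix \<alpha> \<beta>"
      have "f (q, m) = mat (c q) ** (?sw q ** mat (c q * t)) ** diag_matrix \<alpha> \<beta>"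
        by (simp add: f_def m_def matrix_mul_assoc)
      also have "\<dots> = mat (c q * (c q * t)) ** (?sw q ** diag_matrix \<alpha> \<beta>)"
        unfolding mat_mult_commute[symmetric] by (simp add: matrix_mul_assoc mat_mult_mat)
      also have "c q * (c q * t) = t" using cc(1)[of q] by (simp add: mult.assoc[symmetric])
      finally have "f (q, m) = h" by (simp add: d(4))
      moreover have "m \<in> twists"
      proof -
        have 1: "(c q * t)^3 = c q * k" using cc(4) d(3) by (simp add: power_mult_distrib)
        have "det (?sw q) * det (?sw q) = 1" using det_swap_matrix[OF disc[OF s] d(1)] by simp
        moreover have "(c q * det (?sw q)) * det h = (det (?sw q) * det (?sw q)) * ((c q * k) * (\<alpha> / \<beta>))"
          unfolding dh d(3) by (simp only: mult_ac)
        ultimately have "(c q * t)^3 * (\<alpha> / \<beta>) = (c q * det (?sw q)) * det h" unfolding 1 by simp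
        then have "(c q * t)^3 * (\<alpha> / \<beta>) \<in> D" using D_mult[OF cdet[OF d(1)] h(1)] by simp
        moreover have "(c q * t)^3 \<in> K" unfolding 1 by (rule K_mult[OF cc(2) h(3)])
        ultimately show ?thesis unfolding twists_def m_def using d(2) by blast
      qed
      ultimately show "h \<in> f ` (?F \<times> twists)" using d(1) by (intro image_eqI[of _ _ "(q, m)"]) simp_all
    qed
    show "f ` (?F \<times> twists) \<subseteq> stabiliser s"
    proof clarify
      fix q m assume q: "q \<in> ?F" and m: "m \<in> twists"
      obtain t \<alpha> \<beta> where m1: "m = mat t ** diag_matrix \<alpha> \<beta>" "(\<alpha>, \<beta>) \<in> E" "t^3 \<in> K" "t^3 * (\<alpha> / \<beta>) \<in> D" using m by (auto simp: twists_def)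
      have \<alpha>\<beta>: "\<alpha>^3 = 1" "\<beta> \<noteq> 0" using E_sub m1(2) by auto
      obtain s' where s': "s' \<in> S" "ca s' = ca s * \<alpha> / \<beta>^4" "cb s' = cb s / \<beta>^6" using E_iff[OF s \<alpha>\<beta>] m1(2) by blast
      have "det (f (q, m)) = (c q * det (?sw q)) * (t^3 * (\<alpha> / \<beta>))"
        unfolding f_def m1(1) case_prod_conv det_mul det_mat3 det_diag_matrix[OF \<alpha>\<beta>(2)] cc(4) by (simp add: mult.assoc)
      then have "det (f (q, m)) \<in> D" using D_mult[OF cdet[OF q] m1(4)] by simp
      moreover have "weier (ca s) (cb s) (f (q, m) *v x) = (c q * t^3) * weier (ca s') (cb s') x" for x
        unfolding f_def m1(1) case_prod_conv matrix_vector_mul_assoc[symmetric] weier_scale flex(1)[OF q] weier_diag_matrix[OF \<alpha>\<beta>] s'(2,3) cc(4)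
        by (simp add: mult.assoc)
      ultimately show "f (q, m) \<in> stabiliser s" unfolding stabiliser_def using s'(1) K_mult[OF cc(2) m1(3)] by blast
    qed
  qed
  show "finite (stabiliser s)" unfolding im using card_flexes(1)[OF disc[OF s]] finite_twists by simp
  show "card (stabiliser s) = 9 * card twists"
    unfolding im card_image[OF inj] card_cartesian_product card_flexes(2)[OF disc[OF s]] by simp
qed

text \<open>The comparison matrix determines \<open>g\<close>, and then \<open>s\<close>, because
  proportional Weierstrass cubics have equal parameters and these determine \<open>s\<close> in the
  slice.\<close>

lemma fibre_bij:
  assumes y0: "(g0, s0) \<in> cover_space"
  shows "bij_betw (\<lambda>(g, s). g0 ** minv3 g) {y \<in> cover_space. slice_proj y = slice_proj (g0, s0)} (stabiliser s0)"
proof -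
  have g0: "det g0 \<noteq> 0" "det g0 \<in> D" "s0 \<in> S" using total_nonzero y0 by auto
  have eqv: "\<exists>k\<in>K. \<forall>x. weier (ca s0) (cb s0) ((g0 ** minv3 g) *v x) = k * weier (ca s) (cb s) x"
    if gs: "(g, s) \<in> cover_space" "slice_proj (g, s) = slice_proj (g0, s0)" for g s
  proof -
    have dg: "det g \<noteq> 0" "s \<in> S" using total_nonzero gs(1) by auto
    obtain k where k: "k \<in> K" "\<And>x. weier (ca s0) (cb s0) (g0 *v x) = k * weier (ca s) (cb s) (g *v x)"
      using gs(2)[symmetric] dg g0 by (subst (asm) proj_eq_iff) auto
    have "weier (ca s0) (cb s0) ((g0 ** minv3 g) *v x) = k * weier (ca s) (cb s) x" for x
      using k(2)[of "minv3 g *v x"] by (simp add: matrix_vector_mul_assoc minv3[OF dg(1)])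
    then show ?thesis using k(1) by blast
  qed
  show ?thesis
  proof (rule bij_betwI')
    fix y y' assume y: "y \<in> {y \<in> cover_space. slice_proj y = slice_proj (g0, s0)}" "y' \<in> {y \<in> cover_space. slice_proj y = slice_proj (g0, s0)}"
    obtain g s g' s' where gs: "y = (g, s)" "y' = (g', s')" by (cases y, cases y') auto
    have t: "(g, s) \<in> cover_space" "slice_proj (g, s) = slice_proj (g0, s0)" "(g', s') \<in> cover_space" "slice_proj (g', s') = slice_proj (g0, s0)" using y gs by auto
    have d: "det g \<noteq> 0" "det g' \<noteq> 0" "s \<in> S" "s' \<in> S" using t total_nonzero by auto
    show "((case y of (g, s) \<Rightarrow> g0 ** minv3 g) = (case y' of (g, s) \<Rightarrow> g0 ** minv3 g)) = (y = y')"
    proof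
      assume "(case y of (g, s) \<Rightarrow> g0 ** minv3 g) = (case y' of (g, s) \<Rightarrow> g0 ** minv3 g)"
      then have e: "g0 ** minv3 g = g0 ** minv3 g'" by (simp add: gs)
      have "minv3 g0 ** (g0 ** minv3 g) = minv3 g0 ** (g0 ** minv3 g')" using e by simp
      then have mi: "minv3 g = minv3 g'" by (simp add: matrix_mul_assoc minv3[OF g0(1)])
      have "g = g ** (minv3 g' ** g')" by (simp add: minv3[OF d(2)])
      also have "\<dots> = (g ** minv3 g) ** g'" unfolding mi by (simp add: matrix_mul_assoc)
      finally have gg: "g = g'" by (simp add: minv3[OF d(1)])
      obtain k where k: "k \<in> K" "\<And>x. weier (ca s0) (cb s0) ((g0 ** minv3 g) *v x) = k * weier (ca s) (cb s) x" using eqv[OF t(1,2)] by blast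
      obtain k' where k': "k' \<in> K" "\<And>x. weier (ca s0) (cb s0) ((g0 ** minv3 g) *v x) = k' * weier (ca s') (cb s') x" using eqv[OF t(3,4)] unfolding gg by blast
      have "weier (ca s) (cb s) x = (k' / k) * weier (ca s') (cb s') x" for x
        using k(2)[of x] k'(2)[of x] K_nonzero[OF k(1)] by (simp add: field_simps)
      from weier_proportional(2,3)[OF this] have "s = s'" using inj d(3,4) by blast
      then show "y = y'" using gg by (simp add: gs)
    qed simp
  next
    fix y assume y: "y \<in> {y \<in> cover_space. slice_proj y = slice_proj (g0, s0)}"
    obtain g s where gs: "y = (g, s)" by (cases y)
    have t: "(g, s) \<in> cover_space" "slice_proj (g, s) = slice_proj (g0, s0)" using y gs by auto
    have dg: "det g \<noteq> 0" "det g \<in> D" "s \<in> S" using t(1) total_nonzero by auto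
    have "det (g0 ** minv3 g) = det g0 / det g" using dg by (simp add: det_mul det_minv3)
    then show "(case y of (g, s) \<Rightarrow> g0 ** minv3 g) \<in> stabiliser s0"
      unfolding stabiliser_def gs using eqv[OF t] dg(3) D_divide[OF g0(2) dg(2)] by auto
  next
    fix h assume "h \<in> stabiliser s0"
    then obtain s k where h: "det h \<in> D" "s \<in> S" "k \<in> K" "\<And>x. weier (ca s0) (cb s0) (h *v x) = k * weier (ca s) (cb s) x"
      by (auto simp: stabiliser_def)
    have dh: "det h \<noteq> 0" using D_nonzero h(1) by blast
    define g where "g = minv3 h ** g0"
    have hg: "h ** g = g0" by (simp add: g_def matrix_mul_assoc minv3[OF dh])
    have dg: "det g = det g0 / det h" using dh by (simp add: g_def det_mul det_minv3)
    have gD: "(g, s) \<in> cover_space" using D_divide[OF g0(2) h(1)] h(2) by (simp add: dg)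
    have dg0: "det g \<noteq> 0" using total_nonzero gD by blast
    have "weier (ca s0) (cb s0) (g0 *v x) = k * weier (ca s) (cb s) (g *v x)" for x
      using h(4)[of "g *v x"] by (simp add: matrix_vector_mul_assoc hg)
    then have "slice_proj (g0, s0) = slice_proj (g, s)" using h(2,3) g0 dg0 by (subst proj_eq_iff) auto
    moreover have "g0 ** minv3 g = h" unfolding hg[symmetric] matrix_mul_assoc[symmetric] by (simp add: minv3[OF dg0])
    ultimately show "\<exists>y\<in>{y \<in> cover_space. slice_proj y = slice_proj (g0, s0)}. h = (case y of (g, s) \<Rightarrow> g0 ** minv3 g)"
      using gD by (intro bexI[of _ "(g, s)"]) auto
  qed
qed

lemma card_fibre:
  assumes "x \<in> (\<lambda>y. slice_proj y) ` cover_space"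
  shows "finite {y \<in> cover_space. slice_proj y = x}" "card {y \<in> cover_space. slice_proj y = x} = 9 * card twists"
proof -
  obtain g0 s0 where y0: "(g0, s0) \<in> cover_space" "x = slice_proj (g0, s0)" using assms by auto
  have s0: "s0 \<in> S" using y0(1) by simp
  show "finite {y \<in> cover_space. slice_proj y = x}" "card {y \<in> cover_space. slice_proj y = x} = 9 * card twists"
    using card_stabiliser[OF s0] bij_betw_same_card[OF fibre_bij[OF y0(1)]] bij_betw_finite[OF fibre_bij[OF y0(1)]]
    unfolding y0(2) by auto
qed

lemma lifts_simplices_proj:
  "lifts_simplices (9 * card twists) (top_of_set cover_space) (\<lambda>y. slice_proj y) (subtopology X ((\<lambda>y. slice_proj y) ` cover_space))"
proof (rule evenly_covers_imp_lifts_simplices)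
  have sub: "topspace (subtopology X ((\<lambda>y. slice_proj y) ` cover_space)) = (\<lambda>y. slice_proj y) ` cover_space"
    using continuous_map_image_subset_topspace[OF continuous_proj] by auto
  show "9 * card twists > 0" using card_twists by simp
  show "evenly_covers (9 * card twists) cover_space (\<lambda>y. slice_proj y) (subtopology X ((\<lambda>y. slice_proj y) ` cover_space))"
  proof (rule open_map_imp_evenly_covers)
    show "continuous_map (top_of_set cover_space) (subtopology X ((\<lambda>y. slice_proj y) ` cover_space)) (\<lambda>y. slice_proj y)"
      unfolding continuous_map_in_subtopology using continuous_proj by auto
    show "openin (subtopology X ((\<lambda>y. slice_proj y) ` cover_space)) ((\<lambda>y. slice_proj y) ` W)" if "openin (top_of_set cover_space) W" for W
    proof -
      have "W \<subseteq> cover_space" using openin_imp_subset[OF that] .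
      then have "(\<lambda>y. slice_proj y) ` W \<subseteq> (\<lambda>y. slice_proj y) ` cover_space" by (rule image_mono)
      then have "(\<lambda>y. slice_proj y) ` W = (\<lambda>y. slice_proj y) ` W \<inter> (\<lambda>y. slice_proj y) ` cover_space" by blast
      then show ?thesis using open_proj[OF that] unfolding openin_subtopology by blast
    qed
    show "\<exists>W. openin (top_of_set cover_space) W \<and> y \<in> W \<and> inj_on (\<lambda>y. slice_proj y) W" if "y \<in> cover_space" for y
      by (rule locally_injective_proj[OF that])
    show "finite {y \<in> cover_space. slice_proj y = x} \<and> card {y \<in> cover_space. slice_proj y = x} = 9 * card twists"
      if "x \<in> topspace (subtopology X ((\<lambda>y. slice_proj y) ` cover_space))" for x
      using card_fibre that unfolding sub by blast
  qed (use card_twists in simp)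
qed

end

section \<open>Gluing the slices\<close>

text \<open>On the complex line through \<open>u\<close> and the identity the determinant is a
  nonzero polynomial, and the complement of its finitely many zeros in the plane is path
  connected.\<close>

lemma path_connected_GL3: "path_connected {g :: complex^3^3. det g \<noteq> 0}"
proof -
  have "path_component {g :: complex^3^3. det g \<noteq> 0} u (mat 1)" if u: "det u \<noteq> 0" for u :: "complex^3^3"
  proof -
    \<comment> \<open>The line as a matrix of polynomials, so that its determinant is itself a
      polynomial.\<close>
    define A :: "(complex poly)^3^3" where "A = (\<chi> i j. [:u $ i $ j, mat 1 $ i $ j - u $ i $ j:])"
    have A: "poly (det A) z = det ((mat (1 - z) ** u) + mat z)" for z
      unfolding det_3 A_def by (simp add: mat_mult_nth) (simp add: mat_def algebra_simps)
    have "poly (det A) 0 = det u" unfolding A by simp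
    then have "det A \<noteq> 0" using u by auto
    then have "finite {z. poly (det A) z = 0}" by (rule poly_roots_finite)
    then have "path_connected (- {z. poly (det A) z = 0})"
      by (intro path_connected_complement_countable countable_finite) simp_all
    moreover have "0 \<in> - {z. poly (det A) z = 0}" "1 \<in> - {z. poly (det A) z = 0}"
      using u by (simp_all add: A)
    ultimately obtain p where p: "path p" "path_image p \<subseteq> - {z. poly (det A) z = 0}" "pathstart p = 0" "pathfinish p = 1"
      unfolding path_connected_def by blast
    define f where "f = (\<lambda>z :: complex. (mat (1 - z) ** u) + mat z)"
    have cf: "continuous_on B f" for B
      unfolding f_def by (intro continuous_intros continuous_on_matrix_mult continuous_on_mat)
    have "path (f \<circ> p)" using p(1) cf by (rule path_continuous_image)
    moreover have "path_image (f \<circ> p) \<subseteq> {g. det g \<noteq> 0}"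
      unfolding path_image_compose using p(2) by (auto simp: f_def A)
    moreover have "pathstart (f \<circ> p) = u" "pathfinish (f \<circ> p) = mat 1"
      using p(3,4) by (simp_all add: pathstart_compose pathfinish_compose f_def)
    ultimately show ?thesis unfolding path_component_def by blast
  qed
  note to_one = this
  show ?thesis unfolding path_connected_component
  proof (intro ballI)
    fix u v :: "complex^3^3" assume uv: "u \<in> {g. det g \<noteq> 0}" "v \<in> {g. det g \<noteq> 0}"
    show "path_component {g. det g \<noteq> 0} u v"
      by (rule path_component_trans[OF to_one path_component_sym[OF to_one]]) (use uv in auto)
  qed
qed

lemma path_connected_SL3: "path_connected {g :: complex^3^3. det g = 1}"
proof -
  \<comment> \<open>Dividing the first row by the determinant retracts the invertible matrices onto
    those of determinant 1.\<close>
  define f where "f = (\<lambda>g :: complex^3^3. vector [(1 / det g) *s g $ 1, g $ 2, g $ 3] :: complex^3^3)"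
  have "continuous_on {g :: complex^3^3. det g \<noteq> 0} f"
  proof -
    have "continuous_on {g :: complex^3^3. det g \<noteq> 0} (\<lambda>g. (1 / det g) *s g $ 1)"
      unfolding vector_scalar_mult_def
      by (intro continuous_on_vec_lambda continuous_intros continuous_on_det3) auto
    then show ?thesis unfolding f_def by (intro continuous_on_vec3 continuous_intros)
  qed
  from path_connected_continuous_image[OF this path_connected_GL3]
  have "path_connected (f ` {g. det g \<noteq> 0})" .
  moreover have "f ` {g. det g \<noteq> 0} = {g. det g = 1}"
  proof
    have "det (vector [c *s g $ 1, g $ 2, g $ 3]) = c * det g" for c and g :: "complex^3^3"
      by (simp add: det_3 algebra_simps)
    then have "det (f g) = 1" if "det g \<noteq> 0" for g using that by (simp add: f_def)
    then show "f ` {g. det g \<noteq> 0} \<subseteq> {g. det g = 1}" by auto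
    have "f g = g" if "det g = 1" for g
    proof -
      have "f g $ i = g $ i" for i using exhaust_3[of i] that by (auto simp: f_def)
      then show ?thesis by (simp add: vec_eq_iff)
    qed
    then show "{g. det g = 1} \<subseteq> f ` {g. det g \<noteq> 0}" by (intro subsetI, rule_tac x = x in image_eqI) simp_all
  qed
  ultimately show ?thesis by simp
qed

lemma (in cubic_quotient) path_connected_linear_group: "path_connected linear_group"
proof -
  have "linear_group = {g. det g \<noteq> 0} \<or> linear_group = {g. det g = 1}" using mode by auto
  then show ?thesis using path_connected_GL3 path_connected_SL3 by auto
qed

context cubic_cover
begin

lemma path_connected_cover_space: "path_connected cover_space"
proof -
  have "closed_segment s1 s \<subseteq> S" if "s \<in> S" for s
  proof
    fix x assume "x \<in> closed_segment s1 s"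
    then obtain u where u: "0 \<le> u" "u \<le> 1" "x = (1 - u) *\<^sub>R s1 + u *\<^sub>R s" unfolding closed_segment_def by blast
    have "(1 - (1 - u)) *\<^sub>R s + (1 - u) *\<^sub>R s1 \<in> S" by (rule star[OF that]) (use u in auto)
    then show "x \<in> S" by (simp add: u(3) add.commute)
  qed
  then have "path_connected S" using s1 by (intro starlike_imp_path_connected) (auto simp: starlike_def)
  then show ?thesis using path_connected_linear_group by (rule path_connected_Times[rotated])
qed

text \<open>The lifts of the orbit map are indexed by the fibre through the identity: a point
  \<open>(u, s)\<close> gives the lift that sends \<open>g\<close> to \<open>(u ** g, s)\<close>.
  They are compatible because the group multiplies on the right, while equivalences of cubics act on
  the left.\<close>

theorem rational_iso_orbit_map:
  "rational_iso (homology_group p (top_of_set linear_group)) (homology_group p (subtopology X ((\<lambda>y. slice_proj y) ` cover_space)))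
     (hom_induced p (top_of_set linear_group) {} (subtopology X ((\<lambda>y. slice_proj y) ` cover_space)) {} (\<lambda>g. slice_proj (g, s1)))"
proof (rule rational_iso_of_homotopic_lifts[OF lifts_simplices_proj,
    where I = "{y \<in> cover_space. slice_proj y = slice_proj (mat 1, s1)}" and l = "\<lambda>y g. (fst y ** g, snd y)" and m = "\<lambda>g. (g, s1)" and r = fst])
  let ?I = "{y \<in> cover_space. slice_proj y = slice_proj (mat 1, s1)}"
  let ?G = "top_of_set linear_group" and ?Y = "top_of_set cover_space"
  have 1: "(mat 1, s1) \<in> cover_space" using one_D s1 by simp
  show "9 * card twists > 0" using card_twists by simp
  show "finite ?I" "card ?I = 9 * card twists" using card_fibre[of "slice_proj (mat 1, s1)"] 1 by blast+
  have dl: "(u ** g, s) \<in> cover_space" if "(u, s) \<in> cover_space" "g \<in> linear_group" for u g s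
    using that D_mult by (auto simp: det_mul)
  show "continuous_map ?G ?Y (\<lambda>g. (fst y ** g, snd y))" if "y \<in> ?I" for y
    unfolding continuous_map_in_subtopology continuous_map_iff_continuous using that dl
    by (cases y) (auto intro!: continuous_intros continuous_on_matrix_mult)
  show "slice_proj (fst y ** g, snd y) = slice_proj (g, s1)" if y: "y \<in> ?I" and g: "g \<in> topspace ?G" for y g
  proof -
    obtain u s where us: "y = (u, s)" by (cases y)
    have u: "(u, s) \<in> cover_space" "slice_proj (u, s) = slice_proj (mat 1, s1)" using y us by auto
    have nz: "det u \<noteq> 0" "s \<in> S" "det g \<noteq> 0" using total_nonzero u(1) g D_nonzero by auto
    obtain k where k: "k \<in> K" "\<And>x. weier (ca s) (cb s) (u *v x) = k * weier (ca s1) (cb s1) (mat 1 *v x)"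
      using u(2) nz s1 by (subst (asm) proj_eq_iff) auto
    have "weier (ca s) (cb s) ((u ** g) *v x) = k * weier (ca s1) (cb s1) (g *v x)" for x
      using k(2)[of "g *v x"] by (simp add: matrix_vector_mul_assoc)
    then show ?thesis using k(1) nz s1 by (simp add: us) (subst proj_eq_iff, auto simp: det_mul)
  qed
  show "y = y'" if y: "y \<in> ?I" "y' \<in> ?I" and g: "g \<in> topspace ?G" and eq: "(fst y ** g, snd y) = (fst y' ** g, snd y')" for y y' g
  proof -
    have dg: "det g \<noteq> 0" using g D_nonzero by auto
    have "fst y = (fst y ** g) ** minv3 g" by (simp add: matrix_mul_assoc[symmetric] minv3[OF dg])
    also have "\<dots> = fst y'" using eq by (simp add: matrix_mul_assoc[symmetric] minv3[OF dg])
    finally show ?thesis using eq by (simp add: prod_eq_iff)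
  qed
  have m: "continuous_map ?G ?Y (\<lambda>g. (g, s1))"
    unfolding continuous_map_in_subtopology continuous_map_iff_continuous using s1
    by (auto intro!: continuous_intros)
  show "continuous_map ?G ?Y (\<lambda>g. (g, s1))" by (rule m)
  have pr: "continuous_map ?Y (subtopology X ((\<lambda>y. slice_proj y) ` cover_space)) (\<lambda>y. slice_proj y)"
    unfolding continuous_map_in_subtopology using continuous_proj by auto
  show "continuous_map ?G (subtopology X ((\<lambda>y. slice_proj y) ` cover_space)) (\<lambda>g. slice_proj (g, s1))"
    using continuous_map_compose[OF m pr] by (simp add: o_def)
  \<comment> \<open>A path in the cover space from \<open>y\<close> to the identity point,
    multiplied by \<open>g\<close> on the right, joins the two lifts.\<close>
  show "homotopic_with (\<lambda>_. True) ?G ?Y (\<lambda>g. (fst y ** g, snd y)) (\<lambda>g. (g, s1))" if y: "y \<in> ?I" for y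
  proof -
    obtain p where p: "path p" "path_image p \<subseteq> cover_space" "pathstart p = y" "pathfinish p = (mat 1, s1)"
      using path_connected_cover_space y 1 unfolding path_connected_def by blast
    have pc: "continuous_on {0..1} p" using p(1) by (simp add: path_def)
    have pi: "p t \<in> cover_space" if "t \<in> {0..1}" for t using p(2) that by (auto simp: path_image_def)
    have "continuous_on ({0..1} \<times> linear_group) (\<lambda>x. (fst (p (fst x)) ** snd x, snd (p (fst x))))"
      by (intro continuous_intros continuous_on_matrix_mult continuous_on_compose2[OF pc]) auto
    moreover have "(fst (p t) ** g, snd (p t)) \<in> cover_space" if "t \<in> {0..1}" "g \<in> linear_group" for t g
      using dl[of "fst (p t)" "snd (p t)" g] pi[OF that(1)] that(2) by simp
    ultimately have "continuous_map (prod_topology (top_of_set {0..1}) ?G) ?Y (\<lambda>x. (fst (p (fst x)) ** snd x, snd (p (fst x))))"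
      by (auto simp: continuous_map_in_subtopology simp flip: subtopology_Times)
    then show ?thesis
      unfolding homotopic_with_def using p(3,4)
      by (intro exI[of _ "\<lambda>x. (fst (p (fst x)) ** snd x, snd (p (fst x)))"]) (auto simp: pathstart_def pathfinish_def)
  qed
  show "continuous_map ?Y ?G fst"
    unfolding continuous_map_in_subtopology continuous_map_iff_continuous by (auto intro: continuous_intros)
  show "homotopic_with (\<lambda>_. True) ?Y ?Y ((\<lambda>g. (g, s1)) \<circ> fst) id"
  proof (rule homotopic_with_symD, rule homotopic_with_True, rule homotopic_with_linear_pair)
    show "(1 - t) *\<^sub>R id y + t *\<^sub>R ((\<lambda>g. (g, s1)) \<circ> fst) y \<in> cover_space" if "y \<in> cover_space" "0 \<le> t" "t \<le> 1" for y t
    proof -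
      obtain g s where y: "y = (g, s)" by (cases y)
      have "(1 - t) *\<^sub>R g + t *\<^sub>R g = g" by (simp flip: scaleR_add_left)
      then show ?thesis using that star[of s t] by (simp add: y)
    qed
  qed (auto simp: o_def id_def intro!: continuous_intros)
qed simp_all

end

section \<open>Regions of cubics with prescribed j-invariant\<close>

context cubic_quotient
begin

text \<open>Up to normalisation \<open>a\<^sup>3 / (a\<^sup>3 + b\<^sup>2)\<close> is the j-invariant.\<close>

definition modular_region :: "complex set \<Rightarrow> 'x set" where
  "modular_region J = \<pi> ` {cubic_coeffs (\<lambda>x. weier a b (g *v x)) | g a b. det g \<noteq> 0 \<and> a^3 + b^2 \<noteq> 0 \<and> a^3 / (a^3 + b^2) \<in> J}"

lemma modular_region_UNIV: "modular_region UNIV = topspace X"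
proof -
  have "f \<in> {cubic_coeffs (\<lambda>x. weier a b (g *v x)) | g a b. det g \<noteq> 0 \<and> a^3 + b^2 \<noteq> 0 \<and> a^3 / (a^3 + b^2) \<in> UNIV}"
    if f: "f \<in> Pi32 - Sigma32" for f
  proof -
    have "is_cubic (cubic_fun f)" "cubic_smooth (cubic_fun f)" using f nonsingular_iff_cubic_smooth is_cubic_cubic_fun by auto
    then obtain g a b where g: "invertible g" "a^3 + b^2 \<noteq> 0" "\<And>x. cubic_fun f x = weier a b (g *v x)"
      by (rule weier_normal_form) blast
    have "cubic_coeffs (cubic_fun f) = f" using f by (intro cubic_coeffs_cubic_fun) auto
    moreover have "cubic_fun f = (\<lambda>x. weier a b (g *v x))" using g(3) by auto
    ultimately have "f = cubic_coeffs (\<lambda>x. weier a b (g *v x))" by simp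
    then show ?thesis using g(1,2) unfolding invertible_det_nz by blast
  qed
  moreover have "cubic_coeffs (\<lambda>x. weier a b (g *v x)) \<in> Pi32 - Sigma32" if "det g \<noteq> 0" "a^3 + b^2 \<noteq> 0" for g a b
    using that(2,1) by (rule cubic_coeffs_weier_smooth)
  ultimately have "{cubic_coeffs (\<lambda>x. weier a b (g *v x)) | g a b. det g \<noteq> 0 \<and> a^3 + b^2 \<noteq> 0 \<and> a^3 / (a^3 + b^2) \<in> UNIV} = Pi32 - Sigma32"
    by blast
  then show ?thesis unfolding modular_region_def quot_onto[symmetric] by simp
qed

lemma modular_region_Un: "modular_region (J \<union> J') = modular_region J \<union> modular_region J'"
  unfolding modular_region_def image_Un[symmetric] by (rule arg_cong[of _ _ "image \<pi>"]) blast

text \<open>Depends on the invariance of j: two Weierstrass presentations of one point are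
  equivalent after a cube root of the scalar is absorbed into the matrix.\<close>

lemma modular_region_Int: "modular_region J \<inter> modular_region J' = modular_region (J \<inter> J')"
proof
  show "modular_region (J \<inter> J') \<subseteq> modular_region J \<inter> modular_region J'" unfolding modular_region_def by blast
  show "modular_region J \<inter> modular_region J' \<subseteq> modular_region (J \<inter> J')"
  proof
    fix x assume "x \<in> modular_region J \<inter> modular_region J'"
    then obtain g a b g' a' b' where h: "det g \<noteq> 0" "a^3 + b^2 \<noteq> 0" "a^3 / (a^3 + b^2) \<in> J" "x = \<pi> (cubic_coeffs (\<lambda>x. weier a b (g *v x)))"
        and h': "det g' \<noteq> 0" "a'^3 + b'^2 \<noteq> 0" "a'^3 / (a'^3 + b'^2) \<in> J'" "x = \<pi> (cubic_coeffs (\<lambda>x. weier a' b' (g' *v x)))"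
      unfolding modular_region_def by blast
    have "\<pi> (cubic_coeffs (\<lambda>x. weier a b (g *v x))) = \<pi> (cubic_coeffs (\<lambda>x. weier a' b' (g' *v x)))" using h(4) h'(4) by simp
    then obtain k where "k \<in> K" "cubic_coeffs (\<lambda>x. weier a b (g *v x)) = (\<lambda>m. k * cubic_coeffs (\<lambda>x. weier a' b' (g' *v x)) m)"
      using quot_eq_iff[OF cubic_coeffs_weier_smooth[OF h(2,1)] cubic_coeffs_weier_smooth[OF h'(2,1)]] by blast
    then have k: "k \<noteq> 0" "\<And>x. weier a b (g *v x) = k * weier a' b' (g' *v x)"
      using K_nonzero unfolding cubic_coeffs_eq_scale_iff[OF is_cubic_weier_compose is_cubic_weier_compose] by auto
    obtain t where t: "t^3 = k" using cube_root_exists by blast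
    have t0: "t \<noteq> 0" using t k(1) by auto
    let ?h = "mat (1 / t) ** (g ** minv3 g')"
    have "weier a b (?h *v x) = weier a' b' x" for x
      unfolding matrix_vector_mul_assoc[symmetric] weier_scale k(2) t[symmetric]
      using t0 by (simp add: matrix_vector_mul_assoc minv3[OF h'(1)] power_divide)
    moreover have "invertible ?h" using t0 h(1) h'(1) by (simp add: invertible_det_nz det_mul det_mat3 det_minv3)
    ultimately obtain \<alpha> \<beta> where ab: "\<alpha>^3 = 1" "\<beta> \<noteq> 0" "a' = a * \<alpha> / \<beta>^4" "b' = b / \<beta>^6"
      using weier_equivalences[OF h(2)] by blast
    have "a^3 * b'^2 = a'^3 * b^2" using ab by (rule weier_parameters_invariant)
    then have "a^3 / (a^3 + b^2) = a'^3 / (a'^3 + b'^2)" using h(2) h'(2) by (simp add: frac_eq_eq algebra_simps)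
    then have "a^3 / (a^3 + b^2) \<in> J \<inter> J'" using h(3) h'(3) by simp
    then show "x \<in> modular_region (J \<inter> J')" using h(1,2,4) unfolding modular_region_def by blast
  qed
qed

end

text \<open>Weierstrass cubics with equal j are diagonally equivalent, so each cubic of the region
  is equivalent to a slice member; a scalar then brings the matrix into the linear group without
  leaving the class.\<close>

lemma (in cubic_cover) image_cover_space:
  assumes J: "(\<lambda>s. ca s ^ 3 / (ca s ^ 3 + cb s ^ 2)) ` S = J"
  shows "(\<lambda>y. slice_proj y) ` cover_space = modular_region J"
proof
  show "(\<lambda>y. slice_proj y) ` cover_space \<subseteq> modular_region J"
  proof clarify
    fix g :: "complex^3^3" and s assume gs: "det g \<in> D" "s \<in> S"
    have "ca s ^ 3 / (ca s ^ 3 + cb s ^ 2) \<in> J" using J gs(2) by blast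
    then show "slice_proj (g, s) \<in> modular_region J"
      unfolding modular_region_def slice_cubic_def case_prod_conv using D_nonzero[OF gs(1)] disc[OF gs(2)] by blast
  qed
  show "modular_region J \<subseteq> (\<lambda>y. slice_proj y) ` cover_space"
  proof
    fix x assume "x \<in> modular_region J"
    then obtain g a b where h: "det g \<noteq> 0" "a^3 + b^2 \<noteq> 0" "a^3 / (a^3 + b^2) \<in> J" "x = \<pi> (cubic_coeffs (\<lambda>x. weier a b (g *v x)))"
      unfolding modular_region_def by blast
    obtain s where s: "s \<in> S" "a^3 / (a^3 + b^2) = ca s ^ 3 / (ca s ^ 3 + cb s ^ 2)" using h(3) J by blast
    have "ca s ^ 3 * b^2 = a^3 * cb s ^ 2" using s(2) h(2) disc[OF s(1)] by (simp add: frac_eq_eq algebra_simps)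
    then obtain \<alpha> \<beta> where ab: "\<alpha>^3 = 1" "\<beta> \<noteq> 0" "a = ca s * \<alpha> / \<beta>^4" "b = cb s / \<beta>^6"
      by (rule weier_parameters_equivalent[OF disc[OF s(1)] h(2)])
    let ?h = "diag_matrix \<alpha> \<beta> ** g"
    have \<alpha>0: "\<alpha> \<noteq> 0" using ab(1) by auto
    have dh: "det ?h \<noteq> 0" using h(1) ab(2) \<alpha>0 by (simp add: det_mul det_diag_matrix)
    obtain \<mu> where \<mu>: "\<mu> \<noteq> 0" "\<mu>^3 \<in> K" "det ?h / \<mu>^3 \<in> D" using dh by (rule scalar_exists)
    have "weier a b (g *v x) = \<mu>^3 * weier (ca s) (cb s) ((mat (1 / \<mu>) ** ?h) *v x)" for x
      unfolding matrix_vector_mul_assoc[symmetric] weier_scale weier_diag_matrix[OF ab(1,2)] ab(3,4)[symmetric]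
      using \<mu>(1) by (simp add: power_divide)
    then have "cubic_coeffs (\<lambda>x. weier a b (g *v x)) = (\<lambda>m. \<mu>^3 * slice_cubic (mat (1 / \<mu>) ** ?h, s) m)"
      unfolding slice_cubic_def case_prod_conv cubic_coeffs_eq_scale_iff[OF is_cubic_weier_compose is_cubic_weier_compose] by blast
    moreover have in_cs: "(mat (1 / \<mu>) ** ?h, s) \<in> cover_space"
      using \<mu>(3) s(1) unfolding det_mul[of "mat (1 / \<mu>)"] by (simp add: det_mul[of "mat (1 / \<mu>)"] det_mat3 power_divide)
    ultimately have "x = slice_proj (mat (1 / \<mu>) ** ?h, s)"
      unfolding h(4) using quot_eq_iff[OF cubic_coeffs_weier_smooth[OF h(2,1)] slice_cubic_total[OF in_cs]] \<mu>(2) by blast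
    then show "x \<in> (\<lambda>y. slice_proj y) ` cover_space" using in_cs by blast
  qed
qed

section \<open>Three slices covering all nonsingular cubics\<close>

text \<open>For \<open>z = a^3 / b^2\<close> the invariant is \<open>z / (z + 1)\<close>. This
  Moebius map pulls the half-plane back to a disc whose boundary circle passes through -1, the
  preimage of infinity.\<close>

lemma modular_disc1:
  assumes "z \<noteq> -1"
  shows "Re (z / (z + 1)) < 2/3 \<longleftrightarrow> norm (z - 1/2) < 3/2"
proof -
  define x y where "x = Re z" and "y = Im z"
  have "x + 1 \<noteq> 0 \<or> y \<noteq> 0" using assms by (auto simp: x_def y_def complex_eq_iff)
  then have d: "(x + 1)^2 + y^2 > 0" by (simp add: sum_power2_gt_zero_iff)
  have "Re (z / (z + 1)) = (x * (x + 1) + y * y) / ((x + 1)^2 + y^2)"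
    by (simp add: Re_divide x_def y_def)
  then have "Re (z / (z + 1)) < 2/3 \<longleftrightarrow> x * (x + 1) + y * y < 2/3 * ((x + 1)^2 + y^2)"
    by (simp only: pos_divide_less_eq[OF d])
  also have "\<dots> \<longleftrightarrow> x^2 - x + y^2 < 2" by (auto simp: power2_eq_square algebra_simps)
  also have "\<dots> \<longleftrightarrow> (x - 1/2)^2 + y^2 < (3/2)^2" by (auto simp: power2_eq_square algebra_simps)
  also have "(x - 1/2)^2 + y^2 = (norm (z - 1/2))^2" by (simp add: cmod_power2 x_def y_def)
  finally have *: "Re (z / (z + 1)) < 2/3 \<longleftrightarrow> (norm (z - 1/2))^2 < (3/2)^2" .
  have "(3/2)^2 \<le> (norm (z - 1/2))^2 \<longleftrightarrow> 3/2 \<le> norm (z - 1/2)" by (rule power_mono_iff) auto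
  then show ?thesis using * by linarith
qed

text \<open>With \<open>z = b^2 / a^3\<close> the invariant is one minus the previous expression,
  and the bounds 1/3 and 2/3 are exchanged; so the disc is the same.\<close>

lemma modular_disc2:
  assumes "z \<noteq> -1"
  shows "Re (1 / (1 + z)) > 1/3 \<longleftrightarrow> norm (z - 1/2) < 3/2"
proof -
  have "z + 1 \<noteq> 0" using assms by (simp add: eq_neg_iff_add_eq_0)
  then have "1 / (1 + z) = 1 - z / (z + 1)" by (simp add: field_simps)
  then have "Re (1 / (1 + z)) = 1 - Re (z / (z + 1))" by simp
  then show ?thesis using modular_disc1[OF assms] by linarith
qed

text \<open>The disc is convex and contains 0. It is applied to the cube or square of a slice
  parameter, which makes the slices starlike.\<close>

lemma disc_star:
  fixes z :: complex
  assumes z: "norm (z - 1/2) < 3/2" and r: "0 \<le> r" "r \<le> 1"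
  shows "norm (of_real r * z - 1/2) < 3/2"
proof -
  have "of_real r * z - 1/2 = of_real r * (z - 1/2) - of_real ((1 - r) / 2)" by (simp add: field_simps)
  then have "norm (of_real r * z - 1/2) \<le> norm (of_real r * (z - 1/2)) + norm (complex_of_real ((1 - r) / 2))"
    by (metis norm_triangle_ineq4)
  also have "\<dots> = r * norm (z - 1/2) + (1 - r) / 2" using r by (simp only: norm_mult norm_of_real) simp
  finally have 1: "norm (of_real r * z - 1/2) \<le> r * norm (z - 1/2) + (1 - r) / 2" .
  show ?thesis
  proof (cases "r = 0")
    case False
    then have "r * norm (z - 1/2) < r * (3/2)" using z r by simp
    moreover have "(1 - r) / 2 \<le> (1 - r) * (3/2)" using r by simp
    moreover have "r * (3/2) + (1 - r) * (3/2) = 3/2" by (simp add: field_simps)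
    ultimately show ?thesis using 1 by linarith
  qed (use 1 in simp)
qed

lemma disc_not_minus_one: "norm (z - 1/2) < 3/2 \<Longrightarrow> z \<noteq> (-1 :: complex)"
proof
  assume a: "norm (z - 1/2) < 3/2" "z = -1"
  have "norm (z - 1/2) = norm (- (3/2) :: complex)" unfolding a(2) by simp
  also have "\<dots> = 3/2" unfolding norm_minus_cancel by simp
  finally show False using a(1) by simp
qed

lemma powers_of_roots:
  fixes \<alpha> \<beta> :: complex
  shows "\<beta>^6 = 1 \<Longrightarrow> \<beta>^12 = 1" "\<alpha>^3 = 1 \<Longrightarrow> \<alpha> = \<beta>^4 \<Longrightarrow> \<beta>^12 = 1"
proof -
  have 1: "\<beta>^12 = (\<beta>^6)^2" and 2: "\<beta>^12 = (\<beta>^4)^3" by (simp_all flip: power_mult)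
  show "\<beta>^12 = 1" if "\<beta>^6 = 1" unfolding 1 that by simp
  show "\<beta>^12 = 1" if "\<alpha>^3 = 1" "\<alpha> = \<beta>^4" using that(1) unfolding 2 that(2) .
qed

lemma finite_root_pairs: "m > 0 \<Longrightarrow> n > 0 \<Longrightarrow> finite {(\<alpha>, \<beta>). \<alpha>^m = (1::complex) \<and> \<beta>^n = (1::complex) \<and> P \<alpha> \<beta>}"
  by (rule finite_subset[of _ "{\<alpha>. \<alpha>^m = 1} \<times> {\<beta>. \<beta>^n = 1}"]) auto

text \<open>The disc in \<open>a^3 / b^2\<close>, pulled back to the parameter \<open>a\<close> with
  \<open>b = 1\<close>; \<open>slice_a1\<close> uses the parameter \<open>b\<close> with
  \<open>a = 1\<close>, and \<open>slice_strip\<close> uses j itself.\<close>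

definition slice_b1 :: "complex set" where "slice_b1 = {s. norm (s^3 - 1/2) < 3/2}"
definition slice_a1 :: "complex set" where "slice_a1 = {s. norm (s^2 - 1/2) < 3/2}"
definition slice_strip :: "complex set" where "slice_strip = {j. 1/3 < Re j \<and> Re j < 2/3}"
text \<open>The parameter \<open>a\<close> for \<open>b = 1\<close>: the principal cube root of
  \<open>j / (1 - j)\<close>, continuous because this quotient avoids the closed negative axis on
  the strip.\<close>

definition strip_root :: "complex \<Rightarrow> complex" where "strip_root j = exp (Ln (j / (1 - j)) / 3)"

text \<open>Keeping \<open>b = 1\<close> means \<open>\<beta>^6 = 1\<close>; then \<open>s\<close>
  is only multiplied by a cube root of unity, under which the slice is invariant.\<close>

lemma weier_slice_b1:
  "weier_slice slice_b1 (\<lambda>s. s) (\<lambda>_. 1) {(\<alpha>, \<beta>). \<alpha>^3 = 1 \<and> \<beta>^6 = 1 \<and> True} 0"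
proof
  show "open slice_b1" unfolding slice_b1_def by (intro open_Collect_less continuous_intros)
  show "(0::complex) \<in> slice_b1" by (simp add: slice_b1_def)
  show "(1 - t) *\<^sub>R s + t *\<^sub>R 0 \<in> slice_b1" if "s \<in> slice_b1" "0 \<le> t" "t \<le> 1" for s t
  proof -
    have "((1 - t) *\<^sub>R s)^3 = of_real ((1 - t)^3) * s^3" by (simp add: scaleR_conv_of_real power_mult_distrib)
    moreover have "norm (of_real ((1 - t)^3) * s^3 - 1/2) < 3/2"
      using that by (intro disc_star power_le_one zero_le_power) (auto simp: slice_b1_def)
    ultimately show ?thesis by (simp add: slice_b1_def)
  qed
  show "s^3 + 1^2 \<noteq> 0" if "s \<in> slice_b1" for s :: complex
    using disc_not_minus_one[of "s^3"] that by (auto simp: slice_b1_def eq_neg_iff_add_eq_0)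
  show "finite {(\<alpha>, \<beta>). \<alpha>^3 = (1::complex) \<and> \<beta>^6 = (1::complex) \<and> True}" by (rule finite_root_pairs) auto
  show "\<alpha>^3 = 1 \<and> \<beta> \<noteq> 0" if "(\<alpha>, \<beta>) \<in> {(\<alpha>, \<beta>). \<alpha>^3 = (1::complex) \<and> \<beta>^6 = (1::complex) \<and> True}" for \<alpha> \<beta>
    using that by auto
  show "(\<exists>s'\<in>slice_b1. s' = s * \<alpha> / \<beta>^4 \<and> 1 = 1 / \<beta>^6) \<longleftrightarrow> (\<alpha>, \<beta>) \<in> {(\<alpha>, \<beta>). \<alpha>^3 = 1 \<and> \<beta>^6 = 1 \<and> True}"
    if s: "s \<in> slice_b1" and a: "\<alpha>^3 = 1" "\<beta> \<noteq> 0" for s \<alpha> \<beta>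
  proof
    assume "\<exists>s'\<in>slice_b1. s' = s * \<alpha> / \<beta>^4 \<and> 1 = 1 / \<beta>^6"
    then show "(\<alpha>, \<beta>) \<in> {(\<alpha>, \<beta>). \<alpha>^3 = 1 \<and> \<beta>^6 = 1 \<and> True}" using a by (auto simp: field_simps)
  next
    assume "(\<alpha>, \<beta>) \<in> {(\<alpha>, \<beta>). \<alpha>^3 = 1 \<and> \<beta>^6 = 1 \<and> True}"
    then have b: "\<beta>^6 = 1" by simp
    have "(s * \<alpha> / \<beta>^4)^3 = s^3"
      using a(1) powers_of_roots(1)[OF b] by (simp add: power_divide power_mult_distrib flip: power_mult)
    then show "\<exists>s'\<in>slice_b1. s' = s * \<alpha> / \<beta>^4 \<and> 1 = 1 / \<beta>^6" using s b by (simp add: slice_b1_def)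
  qed
qed (auto intro!: continuous_intros)

text \<open>Keeping \<open>a = 1\<close> forces \<open>\<alpha> = \<beta>^4\<close>, hence
  \<open>\<beta>^12 = 1\<close>; then \<open>s\<close> changes at most its sign, which the slice
  admits.\<close>

lemma weier_slice_a1:
  "weier_slice slice_a1 (\<lambda>_. 1) (\<lambda>s. s) {(\<alpha>, \<beta>). \<alpha>^3 = 1 \<and> \<beta>^12 = 1 \<and> \<alpha> = \<beta>^4} 0"
proof
  show "open slice_a1" unfolding slice_a1_def by (intro open_Collect_less continuous_intros)
  show "(0::complex) \<in> slice_a1" by (simp add: slice_a1_def)
  show "(1 - t) *\<^sub>R s + t *\<^sub>R 0 \<in> slice_a1" if "s \<in> slice_a1" "0 \<le> t" "t \<le> 1" for s t
  proof -
    have "((1 - t) *\<^sub>R s)^2 = of_real ((1 - t)^2) * s^2" by (simp add: scaleR_conv_of_real power_mult_distrib)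
    moreover have "norm (of_real ((1 - t)^2) * s^2 - 1/2) < 3/2"
      using that by (intro disc_star power_le_one zero_le_power) (auto simp: slice_a1_def)
    ultimately show ?thesis by (simp add: slice_a1_def)
  qed
  show "1^3 + s^2 \<noteq> 0" if "s \<in> slice_a1" for s :: complex
    using disc_not_minus_one[of "s^2"] that by (auto simp: slice_a1_def eq_neg_iff_add_eq_0 add.commute)
  show "finite {(\<alpha>, \<beta>). \<alpha>^3 = (1::complex) \<and> \<beta>^12 = (1::complex) \<and> \<alpha> = \<beta>^4}" by (rule finite_root_pairs) auto
  show "\<alpha>^3 = 1 \<and> \<beta> \<noteq> 0" if "(\<alpha>, \<beta>) \<in> {(\<alpha>, \<beta>). \<alpha>^3 = (1::complex) \<and> \<beta>^12 = (1::complex) \<and> \<alpha> = \<beta>^4}" for \<alpha> \<beta>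
    using that by auto
  show "(\<exists>s'\<in>slice_a1. 1 = 1 * \<alpha> / \<beta>^4 \<and> s' = s / \<beta>^6) \<longleftrightarrow> (\<alpha>, \<beta>) \<in> {(\<alpha>, \<beta>). \<alpha>^3 = 1 \<and> \<beta>^12 = 1 \<and> \<alpha> = \<beta>^4}"
    if s: "s \<in> slice_a1" and a: "\<alpha>^3 = 1" "\<beta> \<noteq> 0" for s \<alpha> \<beta>
  proof
    assume "\<exists>s'\<in>slice_a1. 1 = 1 * \<alpha> / \<beta>^4 \<and> s' = s / \<beta>^6"
    then have "\<alpha> = \<beta>^4" using a by (auto simp: field_simps)
    then show "(\<alpha>, \<beta>) \<in> {(\<alpha>, \<beta>). \<alpha>^3 = 1 \<and> \<beta>^12 = 1 \<and> \<alpha> = \<beta>^4}" using a powers_of_roots(2)[OF a(1)] by blast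
  next
    assume "(\<alpha>, \<beta>) \<in> {(\<alpha>, \<beta>). \<alpha>^3 = 1 \<and> \<beta>^12 = 1 \<and> \<alpha> = \<beta>^4}"
    then have b: "\<beta>^12 = 1" "\<alpha> = \<beta>^4" by auto
    have "(s / \<beta>^6)^2 = s^2" using b(1) by (simp add: power_divide flip: power_mult)
    then show "\<exists>s'\<in>slice_a1. 1 = 1 * \<alpha> / \<beta>^4 \<and> s' = s / \<beta>^6" using s b a by (simp add: slice_a1_def)
  qed
qed (auto intro!: continuous_intros)

lemma strip_quotient:
  assumes "j \<in> slice_strip"
  shows "1 - j \<noteq> 0" "j \<noteq> 0" "j / (1 - j) \<notin> \<real>\<^sub>\<le>\<^sub>0"
proof -
  show j: "1 - j \<noteq> 0" "j \<noteq> 0" using assms by (auto simp: slice_strip_def)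
  show "j / (1 - j) \<notin> \<real>\<^sub>\<le>\<^sub>0"
  proof
    assume "j / (1 - j) \<in> \<real>\<^sub>\<le>\<^sub>0"
    then obtain x where x: "x \<le> 0" "j / (1 - j) = of_real x" by (auto elim: nonpos_Reals_cases)
    then have "j = of_real x * (1 - j)" using j by (simp add: field_simps)
    then have "Re j = Re (of_real x * (1 - j))" by (rule arg_cong)
    also have "\<dots> = x * (1 - Re j)" by simp
    finally have "Re j = x * (1 - Re j)" .
    moreover have "x * (1 - Re j) \<le> 0" using x(1) assms by (intro mult_nonpos_nonneg) (auto simp: slice_strip_def)
    ultimately show False using assms by (simp add: slice_strip_def)
  qed
qed

lemma strip_root_cubed: "j \<in> slice_strip \<Longrightarrow> strip_root j ^ 3 = j / (1 - j)"
proof -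
  assume j: "j \<in> slice_strip"
  have "exp (Ln (j / (1 - j)) / 3) ^ 3 = exp (3 * (Ln (j / (1 - j)) / 3))" by (metis exp_of_nat_mult of_nat_numeral)
  then show ?thesis using strip_quotient[OF j] by (simp add: strip_root_def)
qed

lemma strip_root_inj: "j \<in> slice_strip \<Longrightarrow> j' \<in> slice_strip \<Longrightarrow> strip_root j ^ 3 = strip_root j' ^ 3 \<Longrightarrow> j = j'"
  using strip_quotient[of j] strip_quotient[of j'] by (auto simp: strip_root_cubed field_simps)

text \<open>Since j is the parameter, an equivalence within the slice cannot move it, so only
  diagonal automorphisms of a curve with nonzero \<open>a\<close> and \<open>b\<close>
  remain.\<close>

lemma weier_slice_strip:
  "weier_slice slice_strip strip_root (\<lambda>_. 1) {(\<alpha>, \<beta>). \<alpha>^3 = 1 \<and> \<beta>^6 = 1 \<and> \<alpha> = \<beta>^4} (1/2)"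
proof
  have "slice_strip = {j. 1/3 < Re j} \<inter> {j. Re j < 2/3}" by (auto simp: slice_strip_def)
  moreover have "open ({j. 1/3 < Re j} \<inter> {j. Re j < 2/3})" by (intro open_Int open_Collect_less continuous_intros)
  ultimately show "open slice_strip" by simp
  show "(1/2::complex) \<in> slice_strip" by (simp add: slice_strip_def)
  show "(1 - t) *\<^sub>R s + t *\<^sub>R (1/2) \<in> slice_strip" if "s \<in> slice_strip" "0 \<le> t" "t \<le> 1" for s t
  proof -
    have "convex slice_strip"
    proof -
      have strip: "slice_strip = {j. Re j > 1/3} \<inter> {j. Re j < 2/3}" by (auto simp: slice_strip_def)
      show ?thesis unfolding strip by (intro convex_Int convex_halfspace_Re_gt convex_halfspace_Re_lt)
    qed
    moreover have "(1/2::complex) \<in> slice_strip" by (simp add: slice_strip_def)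
    ultimately show ?thesis using that by (intro convexD) auto
  qed
  show "continuous_on slice_strip strip_root"
    unfolding strip_root_def by (intro continuous_intros) (use strip_quotient in auto)
  show "s = s'" if "s \<in> slice_strip" "s' \<in> slice_strip" "strip_root s = strip_root s'" for s s'
    using strip_root_inj[OF that(1,2)] that(3) by simp
  show "strip_root s ^ 3 + 1^2 \<noteq> 0" if "s \<in> slice_strip" for s
    using strip_quotient(1)[OF that] by (simp add: strip_root_cubed[OF that] field_simps)
  show "finite {(\<alpha>, \<beta>). \<alpha>^3 = (1::complex) \<and> \<beta>^6 = (1::complex) \<and> \<alpha> = \<beta>^4}" by (rule finite_root_pairs) auto
  show "\<alpha>^3 = 1 \<and> \<beta> \<noteq> 0" if "(\<alpha>, \<beta>) \<in> {(\<alpha>, \<beta>). \<alpha>^3 = (1::complex) \<and> \<beta>^6 = (1::complex) \<and> \<alpha> = \<beta>^4}" for \<alpha> \<beta>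
    using that by auto
  show "(\<exists>s'\<in>slice_strip. strip_root s' = strip_root s * \<alpha> / \<beta>^4 \<and> 1 = 1 / \<beta>^6) \<longleftrightarrow> (\<alpha>, \<beta>) \<in> {(\<alpha>, \<beta>). \<alpha>^3 = 1 \<and> \<beta>^6 = 1 \<and> \<alpha> = \<beta>^4}"
    if s: "s \<in> slice_strip" and a: "\<alpha>^3 = 1" "\<beta> \<noteq> 0" for s \<alpha> \<beta>
  proof
    assume "\<exists>s'\<in>slice_strip. strip_root s' = strip_root s * \<alpha> / \<beta>^4 \<and> 1 = 1 / \<beta>^6"
    then obtain s' where s': "s' \<in> slice_strip" "strip_root s' = strip_root s * \<alpha> / \<beta>^4" and b: "\<beta>^6 = 1"
      using a by (auto simp: field_simps)
    have "strip_root s' ^ 3 = strip_root s ^ 3"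
      unfolding s'(2) using a(1) powers_of_roots(1)[OF b] by (simp add: power_divide power_mult_distrib flip: power_mult)
    then have "s' = s" by (rule strip_root_inj[OF s'(1) s])
    moreover have "strip_root s \<noteq> 0" by (simp add: strip_root_def)
    ultimately have "\<alpha> = \<beta>^4" using s'(2) a by (simp add: field_simps)
    then show "(\<alpha>, \<beta>) \<in> {(\<alpha>, \<beta>). \<alpha>^3 = 1 \<and> \<beta>^6 = 1 \<and> \<alpha> = \<beta>^4}" using a b by blast
  next
    assume "(\<alpha>, \<beta>) \<in> {(\<alpha>, \<beta>). \<alpha>^3 = 1 \<and> \<beta>^6 = 1 \<and> \<alpha> = \<beta>^4}"
    then show "\<exists>s'\<in>slice_strip. strip_root s' = strip_root s * \<alpha> / \<beta>^4 \<and> 1 = 1 / \<beta>^6" using s a by (intro bexI[of _ s]) auto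
  qed
qed (auto intro!: continuous_intros)

lemma modular_range_b1: "(\<lambda>s. s^3 / (s^3 + 1^2)) ` slice_b1 = {j :: complex. Re j < 2/3}"
proof
  show "(\<lambda>s. s^3 / (s^3 + 1^2)) ` slice_b1 \<subseteq> {j :: complex. Re j < 2/3}"
    using modular_disc1 disc_not_minus_one unfolding slice_b1_def by auto
  show "{j :: complex. Re j < 2/3} \<subseteq> (\<lambda>s. s^3 / (s^3 + 1^2)) ` slice_b1"
  proof
    fix j :: complex assume j: "j \<in> {j. Re j < 2/3}"
    then have j1: "1 - j \<noteq> 0" by auto
    obtain s where s: "s^3 = j / (1 - j)" using cube_root_exists by blast
    have 1: "s^3 + 1 = 1 / (1 - j)" unfolding s using j1 by (simp add: field_simps)
    then have "s^3 + 1 \<noteq> 0" using j1 by simp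
    then have "s^3 \<noteq> -1" by (simp add: eq_neg_iff_add_eq_0)
    moreover have jj: "s^3 / (s^3 + 1) = j" unfolding 1 unfolding s using j1 by simp
    ultimately have "s \<in> slice_b1" using modular_disc1[of "s^3"] j by (simp add: slice_b1_def)
    then show "j \<in> (\<lambda>s. s^3 / (s^3 + 1^2)) ` slice_b1" using jj by force
  qed
qed

lemma modular_range_a1: "(\<lambda>s. 1^3 / (1^3 + s^2)) ` slice_a1 = {j :: complex. Re j > 1/3}"
proof
  show "(\<lambda>s. 1^3 / (1^3 + s^2)) ` slice_a1 \<subseteq> {j :: complex. Re j > 1/3}"
    using modular_disc2 disc_not_minus_one unfolding slice_a1_def by auto
  show "{j :: complex. Re j > 1/3} \<subseteq> (\<lambda>s. 1^3 / (1^3 + s^2)) ` slice_a1"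
  proof
    fix j :: complex assume j: "j \<in> {j. Re j > 1/3}"
    then have j0: "j \<noteq> 0" by auto
    define s where "s = csqrt (1 / j - 1)"
    have s: "s^2 = 1 / j - 1" by (simp add: s_def)
    have 1: "1 + s^2 = 1 / j" unfolding s by simp
    then have "s^2 + 1 \<noteq> 0" using j0 by (simp add: add.commute)
    then have "s^2 \<noteq> -1" by (simp add: eq_neg_iff_add_eq_0)
    moreover have jj: "1 / (1 + s^2) = j" unfolding 1 by simp
    ultimately have "s \<in> slice_a1" using modular_disc2[of "s^2"] j by (simp add: slice_a1_def)
    then show "j \<in> (\<lambda>s. 1^3 / (1^3 + s^2)) ` slice_a1" using jj by force
  qed
qed

lemma modular_range_strip: "(\<lambda>s. strip_root s ^ 3 / (strip_root s ^ 3 + 1^2)) ` slice_strip = slice_strip"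
proof -
  have "strip_root s ^ 3 / (strip_root s ^ 3 + 1^2) = s" if "s \<in> slice_strip" for s
  proof -
    have "strip_root s ^ 3 + 1^2 = 1 / (1 - s)" using strip_quotient(1)[OF that] by (simp add: strip_root_cubed[OF that] field_simps)
    then show ?thesis using strip_quotient(1)[OF that] by (simp add: strip_root_cubed[OF that])
  qed
  then show ?thesis by simp
qed

theorem (in cubic_quotient) rational_iso_linear_group:
  "\<exists>f. rational_iso (homology_group p (top_of_set linear_group)) (homology_group p X) f"
proof -
  interpret b1: cubic_cover X \<pi> K D slice_b1 "\<lambda>s. s" "\<lambda>_. 1" "{(\<alpha>, \<beta>). \<alpha>^3 = 1 \<and> \<beta>^6 = 1 \<and> True}" 0
    by (intro cubic_cover.intro cubic_quotient_axioms weier_slice_b1)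
  interpret a1: cubic_cover X \<pi> K D slice_a1 "\<lambda>_. 1" "\<lambda>s. s" "{(\<alpha>, \<beta>). \<alpha>^3 = 1 \<and> \<beta>^12 = 1 \<and> \<alpha> = \<beta>^4}" 0
    by (intro cubic_cover.intro cubic_quotient_axioms weier_slice_a1)
  interpret st: cubic_cover X \<pi> K D slice_strip strip_root "\<lambda>_. 1" "{(\<alpha>, \<beta>). \<alpha>^3 = 1 \<and> \<beta>^6 = 1 \<and> \<alpha> = \<beta>^4}" "1/2"
    by (intro cubic_cover.intro cubic_quotient_axioms weier_slice_strip)
  let ?G = "top_of_set linear_group"
  let ?U = "modular_region {j. Re j < 2/3}" and ?V = "modular_region {j. Re j > 1/3}"
  have U: "(\<lambda>y. b1.slice_proj y) ` b1.cover_space = ?U" by (rule b1.image_cover_space[OF modular_range_b1])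
  have V: "(\<lambda>y. a1.slice_proj y) ` a1.cover_space = ?V" by (rule a1.image_cover_space[OF modular_range_a1])
  have "slice_strip = {j. Re j < 2/3} \<inter> {j. Re j > 1/3}" by (auto simp: slice_strip_def)
  then have UV: "(\<lambda>y. st.slice_proj y) ` st.cover_space = ?U \<inter> ?V"
    unfolding modular_region_Int using st.image_cover_space[OF modular_range_strip] by simp
  have cont: "continuous_map ?G (subtopology X ((\<lambda>y. \<psi> y) ` (linear_group \<times> S))) (\<lambda>g. \<psi> (g, s1))"
    if "continuous_map (top_of_set (linear_group \<times> S)) X (\<lambda>y. \<psi> y)" "s1 \<in> S" for \<psi> and S :: "complex set" and s1
  proof -
    have m: "continuous_map ?G (top_of_set (linear_group \<times> S)) (\<lambda>g. (g, s1))"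
      unfolding continuous_map_in_subtopology continuous_map_iff_continuous using that(2) by (auto intro!: continuous_intros)
    have "continuous_map (top_of_set (linear_group \<times> S)) (subtopology X ((\<lambda>y. \<psi> y) ` (linear_group \<times> S))) \<psi>"
      unfolding continuous_map_in_subtopology using that(1) by auto
    from continuous_map_compose[OF m this] show ?thesis by (simp add: o_def)
  qed
  have "rational_iso (homology_group p ?G) (homology_group p X) (hom_induced p ?G {} X {} (\<lambda>g. b1.slice_proj (g, 0)))"
  proof (rule rational_iso_open_cover[where v = "\<lambda>g. a1.slice_proj (g, 0)" and w = "\<lambda>g. st.slice_proj (g, 1/2)"])
    show "openin X ?U" unfolding U[symmetric] by (rule b1.open_proj) simp
    show "openin X ?V" unfolding V[symmetric] by (rule a1.open_proj) simp
    have "{j. Re j < 2/3} \<union> {j. Re j > 1/3} = UNIV" by auto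
    then show "?U \<union> ?V = topspace X" unfolding modular_region_Un[symmetric] using modular_region_UNIV by simp
    show "rational_iso (homology_group p ?G) (homology_group p (subtopology X ?U)) (hom_induced p ?G {} (subtopology X ?U) {} (\<lambda>g. b1.slice_proj (g, 0)))" for p
      using b1.rational_iso_orbit_map[of p] unfolding U .
    show "rational_iso (homology_group p ?G) (homology_group p (subtopology X ?V)) (hom_induced p ?G {} (subtopology X ?V) {} (\<lambda>g. a1.slice_proj (g, 0)))" for p
      using a1.rational_iso_orbit_map[of p] unfolding V .
    show "rational_iso (homology_group p ?G) (homology_group p (subtopology X (?U \<inter> ?V))) (hom_induced p ?G {} (subtopology X (?U \<inter> ?V)) {} (\<lambda>g. st.slice_proj (g, 1/2)))" for p
      using st.rational_iso_orbit_map[of p] unfolding UV .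
    show "continuous_map ?G (subtopology X ?U) (\<lambda>g. b1.slice_proj (g, 0))"
      using cont[OF b1.continuous_proj b1.s1] unfolding U .
    show "continuous_map ?G (subtopology X (?U \<inter> ?V)) (\<lambda>g. st.slice_proj (g, 1/2))"
      using cont[OF st.continuous_proj st.s1] unfolding UV .
    \<comment> \<open>The real segment from 1 to 0 lies in the slice \<open>a = 1\<close>; the orbit
      map slides along it.\<close>
    have a: "complex_of_real (1 - t) \<in> slice_a1" if "t \<in> {0..1}" for t
    proof -
      have "norm (complex_of_real ((1 - t)^2) * 1 - 1/2) < 3/2"
        using that by (intro disc_star power_le_one zero_le_power) auto
      then show ?thesis by (simp add: slice_a1_def)
    qed
    \<comment> \<open>At \<open>j = 1/2\<close> the root is 1, so the base cubic has
      \<open>a = b = 1\<close> and belongs to both slices.\<close>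
    have eq: "st.slice_proj (g, 1/2) = a1.slice_proj (g, 1)" for g
      by (simp add: st.slice_cubic_def a1.slice_cubic_def strip_root_def)
    have path: "continuous_map (prod_topology (top_of_set {0..1}) ?G) (top_of_set a1.cover_space) (\<lambda>x. (snd x, complex_of_real (1 - fst x)))"
      using a by (auto simp: continuous_map_in_subtopology simp flip: subtopology_Times intro!: continuous_intros)
    have "continuous_map (top_of_set a1.cover_space) (subtopology X ?V) (\<lambda>y. a1.slice_proj y)"
      unfolding V[symmetric] continuous_map_in_subtopology using a1.continuous_proj by auto
    from continuous_map_compose[OF path this]
    have "continuous_map (prod_topology (top_of_set {0..1}) ?G) (subtopology X ?V) (\<lambda>x. a1.slice_proj (snd x, complex_of_real (1 - fst x)))"
      unfolding o_def .
    then show "homotopic_with (\<lambda>_. True) ?G (subtopology X ?V) (\<lambda>g. st.slice_proj (g, 1/2)) (\<lambda>g. a1.slice_proj (g, 0))"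
      unfolding homotopic_with_def eq
      by (intro exI[of _ "\<lambda>x. a1.slice_proj (snd x, complex_of_real (1 - fst x))"]) simp
  qed
  then show ?thesis by blast
qed

section \<open>The projectivised space as a quotient, and the conclusion\<close>

lemma openin_quotient_topology:
  "openin (quotient_topology X q) V \<longleftrightarrow> V \<subseteq> q ` topspace X \<and> openin X {x \<in> topspace X. q x \<in> V}"
proof -
  have "istopology (\<lambda>V. V \<subseteq> q ` topspace X \<and> openin X {x \<in> topspace X. q x \<in> V})"
    unfolding istopology_def
  proof (intro conjI allI impI)
    fix S T assume "S \<subseteq> q ` topspace X \<and> openin X {x \<in> topspace X. q x \<in> S}" "T \<subseteq> q ` topspace X \<and> openin X {x \<in> topspace X. q x \<in> T}"
    moreover have "{x \<in> topspace X. q x \<in> S \<inter> T} = {x \<in> topspace X. q x \<in> S} \<inter> {x \<in> topspace X. q x \<in> T}" by auto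
    ultimately show "S \<inter> T \<subseteq> q ` topspace X" "openin X {x \<in> topspace X. q x \<in> S \<inter> T}" by auto
  next
    fix \<K> assume k: "\<forall>K\<in>\<K>. K \<subseteq> q ` topspace X \<and> openin X {x \<in> topspace X. q x \<in> K}"
    have "{x \<in> topspace X. q x \<in> \<Union>\<K>} = (\<Union>K\<in>\<K>. {x \<in> topspace X. q x \<in> K})" by auto
    moreover have "openin X (\<Union>K\<in>\<K>. {x \<in> topspace X. q x \<in> K})" by (rule openin_Union) (use k in blast)
    ultimately show "openin X {x \<in> topspace X. q x \<in> \<Union>\<K>}" by simp
    show "\<Union>\<K> \<subseteq> q ` topspace X" using k by blast
  qed
  then show ?thesis by (simp add: quotient_topology_def)
qed

lemma topspace_quotient_topology: "topspace (quotient_topology X q) = q ` topspace X"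
proof
  show "topspace (quotient_topology X q) \<subseteq> q ` topspace X"
    using openin_topspace[of "quotient_topology X q"] unfolding openin_quotient_topology by blast
  have "{x \<in> topspace X. q x \<in> q ` topspace X} = topspace X" by blast
  then have "openin (quotient_topology X q) (q ` topspace X)" unfolding openin_quotient_topology by simp
  then show "q ` topspace X \<subseteq> topspace (quotient_topology X q)" by (rule openin_subset)
qed

lemma nonsingular_scale:
  assumes "f \<in> Pi32 - Sigma32" "c \<noteq> 0"
  shows "(\<lambda>m. c * f m) \<in> Pi32 - Sigma32"
proof -
  have "cubic_fun (\<lambda>m. c * f m) = (\<lambda>x. c * cubic_fun f x)" by (simp add: cubic_fun_scale fun_eq_iff)
  moreover have "cubic_deriv (\<lambda>x. c * cubic_fun f x) x v = c * cubic_deriv (cubic_fun f) x v" for x v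
    by (simp add: cubic_deriv_def algebra_simps diff_divide_distrib)
  ultimately have "cubic_smooth (cubic_fun (\<lambda>m. c * f m))"
    using assms unfolding nonsingular_iff_cubic_smooth by (simp add: cubic_smooth_def)
  moreover have "(\<lambda>m. c * f m) \<in> Pi32" using assms(1) by (simp add: Pi32_def)
  ultimately show ?thesis unfolding nonsingular_iff_cubic_smooth by blast
qed

lemma proj_class_eq_iff: "proj_class f = proj_class f' \<longleftrightarrow> (\<exists>k\<in>- {0}. f = (\<lambda>m. k * f' m))"
proof
  assume "proj_class f = proj_class f'"
  moreover have "f \<in> proj_class f" unfolding proj_class_def by (intro CollectI exI[of _ 1]) simp
  ultimately have "f \<in> proj_class f'" by simp
  then show "\<exists>k\<in>- {0}. f = (\<lambda>m. k * f' m)" unfolding proj_class_def by blast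
next
  assume "\<exists>k\<in>- {0}. f = (\<lambda>m. k * f' m)"
  then obtain k where k: "k \<noteq> 0" "f = (\<lambda>m. k * f' m)" by auto
  show "proj_class f = proj_class f'"
  proof (intro equalityI subsetI)
    fix g assume "g \<in> proj_class f"
    then obtain l where "l \<noteq> 0" "g = (\<lambda>m. l * f m)" unfolding proj_class_def by blast
    then show "g \<in> proj_class f'"
      unfolding proj_class_def k(2) using k(1) by (intro CollectI exI[of _ "l * k"]) (simp add: mult.assoc)
  next
    fix g assume "g \<in> proj_class f'"
    then obtain l where "l \<noteq> 0" "g = (\<lambda>m. l * f' m)" unfolding proj_class_def by blast
    then show "g \<in> proj_class f"
      unfolding proj_class_def k(2) using k(1) by (intro CollectI exI[of _ "l / k"]) simp
  qed
qed

lemma continuous_map_scale: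
  assumes "c \<noteq> 0" shows "continuous_map U32 U32 (\<lambda>f m. c * f m)"
  unfolding U32_def continuous_map_in_subtopology
proof
  have "continuous_on (Pi32 - Sigma32) (\<lambda>f :: nat \<times> nat \<times> nat \<Rightarrow> complex. \<lambda>m. c * f m)"
    by (intro continuous_on_coordinatewise_then_product continuous_intros continuous_on_subset[OF continuous_on_product_coordinates]) simp
  then show "continuous_map (top_of_set (Pi32 - Sigma32)) euclidean (\<lambda>f m. c * f m)" by simp
  show "(\<lambda>f m. c * f m) \<in> topspace (top_of_set (Pi32 - Sigma32)) \<rightarrow> Pi32 - Sigma32"
    using nonsingular_scale[OF _ assms] by auto
qed

lemma cubic_quotient_U32: "cubic_quotient U32 (\<lambda>f. f) {1} (- {0})"
  by unfold_locales (auto simp: topspace_U32)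

lemma cubic_quotient_N32: "cubic_quotient N32 proj_class (- {0}) {1}"
proof
  have open_class: "openin N32 V \<longleftrightarrow> V \<subseteq> proj_class ` (Pi32 - Sigma32) \<and> openin U32 {f \<in> Pi32 - Sigma32. proj_class f \<in> V}" for V
    unfolding N32_def openin_quotient_topology topspace_U32 ..
  have top: "topspace N32 = proj_class ` (Pi32 - Sigma32)"
    unfolding N32_def topspace_quotient_topology topspace_U32 ..
  show "proj_class ` (Pi32 - Sigma32) = topspace N32" by (simp add: top)
  show "continuous_map U32 N32 proj_class"
    unfolding continuous_map_def using open_class by (auto simp: top topspace_U32)
  show "openin N32 (proj_class ` V)" if V: "openin U32 V" for V
  proof -
    have sub: "V \<subseteq> Pi32 - Sigma32" using openin_subset[OF V] by (simp add: topspace_U32)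
    \<comment> \<open>The saturation of an open set is the union of its preimages under all nonzero
      scalings, each of which is continuous; this gives the openness of the quotient map.\<close>
    have preimage: "{f \<in> Pi32 - Sigma32. proj_class f \<in> proj_class ` V} = (\<Union>k\<in>- {0}. {f \<in> topspace U32. (\<lambda>m. k * f m) \<in> V})"
    proof (intro equalityI subsetI)
      fix f assume "f \<in> {f \<in> Pi32 - Sigma32. proj_class f \<in> proj_class ` V}"
      then obtain f' where f: "f \<in> Pi32 - Sigma32" "f' \<in> V" "proj_class f' = proj_class f" by auto
      then obtain k where "k \<in> - {0}" "f' = (\<lambda>m. k * f m)" unfolding proj_class_eq_iff by blast
      then show "f \<in> (\<Union>k\<in>- {0}. {f \<in> topspace U32. (\<lambda>m. k * f m) \<in> V})" using f by (auto simp: topspace_U32)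
    next
      fix f assume "f \<in> (\<Union>k\<in>- {0}. {f \<in> topspace U32. (\<lambda>m. k * f m) \<in> V})"
      then obtain k where k: "k \<in> - {0}" "f \<in> Pi32 - Sigma32" "(\<lambda>m. k * f m) \<in> V" by (auto simp: topspace_U32)
      have "proj_class (\<lambda>m. k * f m) = proj_class f" unfolding proj_class_eq_iff using k(1) by blast
      then have "proj_class f \<in> proj_class ` V" using k(3) by (metis imageI)
      then show "f \<in> {f \<in> Pi32 - Sigma32. proj_class f \<in> proj_class ` V}" using k(2) by blast
    qed
    have "openin U32 W" if WW: "W \<in> (\<lambda>k. {f \<in> topspace U32. (\<lambda>m. k * f m) \<in> V}) ` (- {0})" for W
    proof -
      obtain k where k: "k \<noteq> 0" and W: "W = {f \<in> topspace U32. (\<lambda>m. k * f m) \<in> V}" using WW by auto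
      show ?thesis unfolding W by (rule openin_continuous_map_preimage[OF continuous_map_scale[OF k] V])
    qed
    then have union: "openin U32 (\<Union>k\<in>- {0}. {f \<in> topspace U32. (\<lambda>m. k * f m) \<in> V})" by (rule openin_Union)
    show ?thesis unfolding open_class preimage by (rule conjI[OF image_mono[OF sub] union])
  qed
  show "- {0} = {1} \<and> {1} = - {0::complex} \<or> - {0} = - {0::complex} \<and> {1} = {1::complex}" by simp
  show "proj_class f = proj_class f' \<longleftrightarrow> (\<exists>k\<in>- {0}. f = (\<lambda>m. k * f' m))" for f f' by (rule proj_class_eq_iff)
qed

lemma has_rational_cells_transfer:
  assumes X: "has_rational_cells X L" and iso: "\<And>p. \<exists>f. rational_iso (homology_group p X) (homology_group p Y) f"
  shows "has_rational_cells Y L"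
proof -
  have "(rank_one_group (homology_group p X) \<longrightarrow> rank_one_group (homology_group p Y)) \<and>
    (torsion_group (homology_group p X) \<longrightarrow> torsion_group (homology_group p Y))" for p
  proof -
    obtain f where f: "rational_iso (homology_group p X) (homology_group p Y) f" using iso by blast
    note grp = group_relative_homology_group[of p X "{}"] group_relative_homology_group[of p Y "{}"]
    show ?thesis using rational_iso_rank_one[OF f grp] rational_iso_torsion[OF f grp] by blast
  qed
  then show ?thesis using X unfolding has_rational_cells_def by blast
qed

lemma has_rational_cells_cohomology:
  assumes "has_rational_cells X L"
  shows "(int i \<in> L \<longrightarrow> cohom_is_R i X) \<and> (int i \<notin> L \<longrightarrow> cohom_trivial i X)"
  using assms rank_one_homology_imp_cohom_is_R torsion_homology_imp_cohom_trivial unfolding has_rational_cells_def by blast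

theorem theorem1:
  shows "(\<forall>i. (i \<in> {0, 1, 3, 4, 5, 6, 8, 9} \<longrightarrow> cohom_is_R i U32) \<and>
              (i \<notin> {0, 1, 3, 4, 5, 6, 8, 9} \<longrightarrow> cohom_trivial i U32)) \<and>
         (\<forall>i. (i \<in> {0, 3, 5, 8} \<longrightarrow> cohom_is_R i N32) \<and>
              (i \<notin> {0, 3, 5, 8} \<longrightarrow> cohom_trivial i N32))"
proof -
  interpret U: cubic_quotient U32 "\<lambda>f. f" "{1}" "- {0}" by (rule cubic_quotient_U32)
  interpret N: cubic_quotient N32 proj_class "- {0}" "{1}" by (rule cubic_quotient_N32)
  have "{g :: complex^3^3. det g \<in> - {0}} = {g. det g \<noteq> 0}" "{g :: complex^3^3. det g \<in> {1}} = {g. det g = 1}" by auto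
  note groups = this
  have U: "has_rational_cells U32 {0, 1, 3, 4, 5, 6, 8, 9}"
    by (rule has_rational_cells_transfer[OF has_rational_cells_GL3 U.rational_iso_linear_group[unfolded groups]])
  have N: "has_rational_cells N32 {0, 3, 5, 8}"
    by (rule has_rational_cells_transfer[OF has_rational_cells_SL3 N.rational_iso_linear_group[unfolded groups]])
  show ?thesis
  proof (intro conjI allI)
    fix i :: nat
    have "int i \<in> {0, 1, 3, 4, 5, 6, 8, 9} \<longleftrightarrow> i \<in> {0, 1, 3, 4, 5, 6, 8, 9}" "int i \<in> {0, 3, 5, 8} \<longleftrightarrow> i \<in> {0, 3, 5, 8}" by auto
    note groups = has_rational_cells_cohomology[OF U, of i, unfolded this] has_rational_cells_cohomology[OF N, of i, unfolded this]
    show "i \<in> {0, 1, 3, 4, 5, 6, 8, 9} \<longrightarrow> cohom_is_R i U32" by (rule groups(1)[THEN conjunct1])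
    show "i \<notin> {0, 1, 3, 4, 5, 6, 8, 9} \<longrightarrow> cohom_trivial i U32" by (rule groups(1)[THEN conjunct2])
    show "i \<in> {0, 3, 5, 8} \<longrightarrow> cohom_is_R i N32" by (rule groups(2)[THEN conjunct1])
    show "i \<notin> {0, 3, 5, 8} \<longrightarrow> cohom_trivial i N32" by (rule groups(2)[THEN conjunct2])
  qed
qed

end
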